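(* Suppose that $m=-(k+\tfrac12)$ for $k\in\mathbb{Z}_{\ge0}$. Let $K\subset\mathbb{C}\setminus\partial E^\infty$ be bounded away from $\partial E^\infty$, i.e., $\mathrm{dist}(K,\partial E^\infty)>0$. Then $$\frac{1}{u_n(ny;m)}=\frac{1}{\mathrm{i}\,p^\infty(y)}+\mathcal{O}(n^{-1}),\quad n\to+\infty,\quad y\in K,$$ where $p^\infty(y)$ denotes the meromorphic continuation of $p(y)$ from a neighborhood of $y=\infty$ to the maximal domain $\mathbb{C}\setminus\partial E^\infty$ as a non-vanishing function whose only singularity is a simple pole at the origin $y=0$, and the error estimate is uniform for $y\in K$. Likewise, if $m=k+\tfrac12$ for $k\in\mathbb{Z}_{\ge0}$ and $K\subset\mathbb{C}\setminus\partial E^0$ is bounded away from $\partial E^0$, then $$u_n(ny;m)=\mathrm{i}\,p^0(y)+\mathcal{O}(n^{-1}),\quad n\to+\infty,\quad y\in K,$$ where $p^0(y)$ denotes the analytic continuation of $p(y)$ from a neighborhood of $y=\infty$ to the maximal domain $\mathbb{C}\setminus\partial E^0$ as a function whose only zero is simple and lies at the origin, and the error estimate is uniform for $y\in K$.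
   Context: For $n\in\mathbb{Z}$ and $m\in\mathbb{C}$, $u_n(x;m)$ denotes the unique rational solution $u(x)$ of $$u''=\frac{(u')^2}{u}-\frac{u'}{x}+\frac{4\Theta_0u^2+4(1-\Theta_\infty)}{x}+4u^3-\frac4u,\qquad \Theta_0=n+m,\quad \Theta_\infty=m-n+1,$$ that tends to $1$ as $x\to\infty$. $p(y):=\frac{\mathrm{i}}{2y}-\mathrm{i}\sqrt{\frac{1}{4y^2}+1}$, where the square root equals $1$ at $y=\infty$ and is analytic except on the segment $I$ of the imaginary axis joining $y=\pm\frac12\mathrm{i}$. $V(\lambda;y):=-\log(\lambda)-\mathrm{i}y(\lambda-\lambda^{-1})$; its real part is single-valued. The set of $y\in\mathbb{C}\setminus I$ where $\mathrm{Re}(V(p(y);y))=0$ is the union of four analytic arcs: the two rays of the imaginary axis joining $\pm\frac12\mathrm{i}$ to $\pm\mathrm{i}\infty$, an arc in the right half-plane joining $\frac12\mathrm{i}$ to $-\frac12\mathrm{i}$, and the reflection of the latter in the imaginary axis. The closures (including the endpoints $\pm\frac12\mathrm{i}$) of the last two arcs are the "eyebrows": $\partial E^\infty$ is the one in the right half-plane and $\partial E^0$ is the one in the left half-plane. Together they bound the compact simply-connected "eye" $E\ni0$. *)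

theory Defs
  imports "HOL-Complex_Analysis.Complex_Analysis"
begin

text \<open>Writing a rational function in lowest terms makes its value \<open>0\<close> at its poles, because
  \<open>x / 0 = 0\<close>. Hence \<open>f x \<noteq> 0\<close> says that \<open>x\<close> is neither a zero nor a pole of \<open>f\<close>, and
  \<open>1 / f x = 0\<close> is the correct value of the reciprocal at a pole of \<open>f\<close>.\<close>

definition rational_function :: "(complex \<Rightarrow> complex) \<Rightarrow> bool" where
  "rational_function f \<longleftrightarrow>
     (\<exists>P Q. Q \<noteq> 0 \<and> coprime P Q \<and> f = (\<lambda>x. poly P x / poly Q x))"

definition painleve_III :: "complex \<Rightarrow> complex \<Rightarrow> (complex \<Rightarrow> complex) \<Rightarrow> complex \<Rightarrow> bool" where
  "painleve_III t0 tinf u x \<longleftrightarrow>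
     deriv (deriv u) x =
       (deriv u x)\<^sup>2 / u x - deriv u x / x
       + (4 * t0 * (u x)\<^sup>2 + 4 * (1 - tinf)) / x + 4 * (u x) ^ 3 - 4 / u x"

definition rational_solution :: "int \<Rightarrow> complex \<Rightarrow> (complex \<Rightarrow> complex) \<Rightarrow> bool" where
  "rational_solution n m u \<longleftrightarrow>
     rational_function u \<and>
     (\<forall>x. x \<noteq> 0 \<and> u x \<noteq> 0 \<longrightarrow> painleve_III (of_int n + m) (m - of_int n + 1) u x) \<and>
     (u \<longlongrightarrow> 1) at_infinity"

definition u_rat :: "int \<Rightarrow> complex \<Rightarrow> complex \<Rightarrow> complex" where
  "u_rat n m = (THE u. rational_solution n m u)"

definition I_seg :: "complex set" where
  "I_seg = closed_segment (- \<i> / 2) (\<i> / 2)"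

text \<open>The principal square root has the required branch: \<open>1 / (4 * y\<^sup>2) + 1\<close> is a
  nonpositive real number exactly for nonzero \<open>y\<close> in \<open>I_seg\<close>.\<close>

definition p_fun :: "complex \<Rightarrow> complex" where
  "p_fun y = \<i> / (2 * y) - \<i> * csqrt (1 / (4 * y\<^sup>2) + 1)"

text \<open>Only the real part is used below, so the choice of the branch of the logarithm
  is immaterial.\<close>

definition V_fun :: "complex \<Rightarrow> complex \<Rightarrow> complex" where
  "V_fun l y = - Ln l - \<i> * y * (l - inverse l)"

definition zero_level :: "complex set" where
  "zero_level = {y. y \<notin> I_seg \<and> Re (V_fun (p_fun y) y) = 0}"

text \<open>The zero level consists of two rays on the imaginary axis, one arc in the open right
  half-plane and one arc in the open left half-plane; the closures add the
  endpoints \<open>\<plusminus> \<i> / 2\<close>.\<close>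

definition eyebrow_inf :: "complex set" where
  "eyebrow_inf = closure (zero_level \<inter> {y. Re y > 0})"

definition eyebrow_zero :: "complex set" where
  "eyebrow_zero = closure (zero_level \<inter> {y. Re y < 0})"

text \<open>The value \<open>0\<close> on the eyebrow only makes the continuation unique as a total
  function. The value \<open>0\<close> at the pole of \<open>p_inf\<close> makes \<open>1 / (\<i> * p_inf 0)\<close> equal to \<open>0\<close>,
  as it should be.\<close>

definition p_inf :: "complex \<Rightarrow> complex" where
  "p_inf = (THE f.
     f holomorphic_on (- eyebrow_inf - {0}) \<and>
     (\<forall>\<^sub>F y in at_infinity. f y = p_fun y) \<and>
     (\<forall>y \<in> - eyebrow_inf - {0}. f y \<noteq> 0) \<and>
     is_pole f 0 \<and> zorder f 0 = - 1 \<and>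
     f 0 = 0 \<and> (\<forall>y \<in> eyebrow_inf. f y = 0))"

definition p_zero :: "complex \<Rightarrow> complex" where
  "p_zero = (THE f.
     f holomorphic_on (- eyebrow_zero) \<and>
     (\<forall>\<^sub>F y in at_infinity. f y = p_fun y) \<and>
     (\<forall>y \<in> - eyebrow_zero. f y = 0 \<longleftrightarrow> y = 0) \<and>
     zorder f 0 = 1 \<and>
     (\<forall>y \<in> eyebrow_zero. f y = 0))"

definition bounded_away :: "complex set \<Rightarrow> complex set \<Rightarrow> bool" where
  "bounded_away K B \<longleftrightarrow> (\<exists>d>0. \<forall>y\<in>K. \<forall>z\<in>B. d \<le> dist y z)"

end

theory Submission
  imports Defs
begin

text \<open>Everything reduces to the second estimate. The map \<open>u(x) \<mapsto> 1 / u(-x)\<close>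
  exchanges the parameters \<open>m\<close> and \<open>-m\<close> (lemma
  \<open>rational_solution_reflect\<close>), the two eyebrows are exchanged by \<open>y
  \<mapsto> -y\<close>, and \<open>p_inf y = -i / w_lim (-y)\<close>, where \<open>w_lim = i
  p_zero\<close> (lemmas \<open>p_inf_eq\<close>, \<open>p_zero_eq\<close>). Since rational
  solutions that tend to \<open>1\<close> are unique (\<open>rational_solution_unique\<close>),
  it is enough to exhibit, for each large \<open>n\<close>, one rational solution with the
  claimed behaviour.

  The limit \<open>w_lim\<close> is a branch of the algebraic function defined by \<open>y w^2 +
  w = y\<close>. Its two values are \<open>w\<close> and \<open>-1/w\<close>, and the eyebrow is
  the place where a solution switches from one to the other. The function \<open>level\<close>
  is continuous on the plane, even and strictly increasing in \<open>|Re y|\<close>; its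
  logarithm is \<open>- Re V(p(y);y)\<close> on the right half-plane, and the eyebrow in the
  left half-plane is its level curve \<open>level = 1\<close> there.

  For \<open>m = 1/2\<close> the rational solution is a quotient of consecutive reverse Bessel
  polynomials, and \<open>U(y) = u(n y)\<close> satisfies the Riccati equation \<open>U' = 2 n
  (U - w) (U + 1/w)\<close>. On the right half-plane \<open>Re U > 0\<close>, by a continued
  fraction. The Schwarz-Pick inequality bounds \<open>|U'|\<close> by \<open>Re U / Re
  y\<close>, and the factor \<open>U + 1/w\<close> on the other side cancels \<open>Re
  U\<close>, so \<open>|U - w| \<le> 1 / (2 n Re y)\<close> (lemma
  \<open>halfplane_riccati\<close>). No asymptotic expansion enters. The same method applies to
  the solution \<open>psi\<close> of the Bessel equation that is recessive at the origin; its
  logarithmic derivative is close to the other equilibrium. The values in the left half-plane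
  are then Moebius images of the values in the right half-plane, with the ratio \<open>R = psi /
  phi\<close> as the coefficient: \<open>U(-t) = (J R - U) / (1 + R)\<close>. Because \<open>R'
  / R = 2 n (U + J)\<close> is known, \<open>|R|\<close> is comparable to \<open>level^(2
  n)\<close> (lemma \<open>bessel_R_two_sided\<close>), which is exponentially small inside the
  eyebrow and exponentially large outside: this is why the eyebrow is the curve of
  discontinuity. What remains are the neighbourhoods of the imaginary axis. On the rays, a
  barrier argument carries the estimate from the right to the left
  (\<open>strip_estimate\<close>); on the segment between the corners the maximum principle does
  (\<open>bessel_near_segment\<close>).

  The step from \<open>m\<close> to \<open>m + 1\<close> is the Baecklund transformation
  \<open>v = (1 - Y) / (u (1 + Y))\<close>, where \<open>Y\<close> is built from
  \<open>u\<close> and \<open>u'\<close> and satisfies \<open>Y' = 2 (u + 1/u) Y + 2 (u -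
  1/u)\<close>. After scaling by \<open>n\<close> the derivative of \<open>Y\<close> is bounded
  by Cauchy's estimate, so the equation forces \<open>Y = (1 - w^2) / (1 + w^2) +
  O(1/n)\<close>, and this value gives \<open>v = w + O(1/n)\<close>: the limit does not change
  with \<open>m\<close> (lemma \<open>asymptotics_at_step\<close>). The formula for
  \<open>v\<close> degenerates at the zero \<open>y = 0\<close> of \<open>w\<close>; there
  \<open>v\<close> is controlled by the maximum principle on a small disc, after checking that
  it has no pole in it (lemma \<open>disc_extension\<close>).\<close>

section \<open>Estimates for holomorphic functions along paths and on discs\<close>

lemma DERIV_norm_comp:
  fixes g :: "complex \<Rightarrow> complex" and \<gamma> :: "real \<Rightarrow> complex"
  assumes g: "(g has_field_derivative D) (at (\<gamma> s))"
    and \<gamma>: "(\<gamma> has_vector_derivative v) (at s)" and nz: "g (\<gamma> s) \<noteq> 0"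
  shows "((\<lambda>s. norm (g (\<gamma> s))) has_real_derivative norm (g (\<gamma> s)) * Re (D * v / g (\<gamma> s))) (at s)"
proof -
  have 1: "((g \<circ> \<gamma>) has_vector_derivative v * D) (at s)"
    by (rule field_vector_diff_chain_at[OF \<gamma> g])
  then have 2: "((g \<circ> \<gamma>) has_derivative (\<lambda>h. h *\<^sub>R (v * D))) (at s)"
    by (simp add: has_vector_derivative_def)
  have 3: "((\<lambda>s. norm ((g \<circ> \<gamma>) s)) has_derivative (\<lambda>h. inner (h *\<^sub>R (v * D)) (sgn ((g \<circ> \<gamma>) s)))) (at s)"
    using has_derivative_compose[OF 2 has_derivative_norm] nz by simp
  have 4: "inner (h *\<^sub>R (v * D)) (sgn ((g \<circ> \<gamma>) s)) = (norm (g (\<gamma> s)) * Re (D * v / g (\<gamma> s))) * h" for h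
  proof -
    define w where "w = g (\<gamma> s)"
    have w: "w \<noteq> 0" using nz by (simp add: w_def)
    have "Re (D * v / w) = Re (D * v * cnj w) / (norm w)\<^sup>2"
      by (subst complex_div_cnj) (simp flip: of_real_power)
    moreover have "inner (v * D) (sgn w) = inner (v * D) w / norm w"
      by (simp add: sgn_div_norm divide_inverse mult.commute)
    moreover have "inner (v * D) w = Re (D * v * cnj w)"
      by (simp add: inner_complex_def algebra_simps)
    ultimately show ?thesis using w unfolding o_def w_def[symmetric]
      by (simp add: power2_eq_square mult.commute)
  qed
  show ?thesis
    using 3 unfolding has_field_derivative_def o_def 4[unfolded o_def] .
qed

lemma DERIV_ln_norm_comp:
  fixes g :: "complex \<Rightarrow> complex" and \<gamma> :: "real \<Rightarrow> complex"
  assumes g: "(g has_field_derivative D) (at (\<gamma> s))"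
    and \<gamma>: "(\<gamma> has_vector_derivative v) (at s)" and nz: "g (\<gamma> s) \<noteq> 0"
  shows "((\<lambda>s. ln (norm (g (\<gamma> s)))) has_real_derivative Re (D * v / g (\<gamma> s))) (at s)"
  using DERIV_chain2[OF DERIV_ln DERIV_norm_comp[OF assms]] nz by (simp add: field_simps)

text \<open>Integrating the logarithmic derivative along a segment controls the growth of the modulus;
  applied with the end points exchanged it also gives a lower bound.\<close>

lemma norm_le_exp_log_deriv_bound:
  fixes g :: "complex \<Rightarrow> complex"
  assumes der: "\<And>z. z \<in> closed_segment a b \<Longrightarrow> (g has_field_derivative g' z) (at z)"
    and nz: "\<And>z. z \<in> closed_segment a b \<Longrightarrow> g z \<noteq> 0"
    and bd: "\<And>z. z \<in> closed_segment a b \<Longrightarrow> norm (g' z / g z) \<le> B"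
  shows "norm (g b) \<le> norm (g a) * exp (B * norm (b - a))"
proof -
  define \<gamma> where "\<gamma> s = a + of_real s * (b - a)" for s :: real
  have seg: "\<gamma> s \<in> closed_segment a b" if "0 \<le> s" "s \<le> 1" for s
    unfolding closed_segment_def \<gamma>_def using that
    by (auto intro!: exI[of _ s] simp: algebra_simps scaleR_conv_of_real)
  have d\<gamma>: "(\<gamma> has_vector_derivative (b - a)) (at s)" for s
    unfolding \<gamma>_def by (auto intro!: derivative_eq_intros simp: scaleR_conv_of_real)
  define l where "l s = ln (norm (g (\<gamma> s)))" for s
  have dl: "(l has_real_derivative Re (g' (\<gamma> s) * (b - a) / g (\<gamma> s))) (at s)" if "0 \<le> s" "s \<le> 1" for s
    unfolding l_def by (rule DERIV_ln_norm_comp[OF der[OF seg[OF that]] d\<gamma> nz[OF seg[OF that]]])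
  obtain x where x: "0 < x" "x < 1" "l 1 - l 0 = (1 - 0) * Re (g' (\<gamma> x) * (b - a) / g (\<gamma> x))"
    using MVT2[of 0 1 l "\<lambda>s. Re (g' (\<gamma> s) * (b - a) / g (\<gamma> s))"] dl by auto
  have "l 1 - l 0 \<le> norm (g' (\<gamma> x) / g (\<gamma> x) * (b - a))"
    unfolding x(3) using complex_Re_le_cmod by (simp add: mult.commute)
  also have "\<dots> \<le> B * norm (b - a)"
    unfolding norm_mult by (intro mult_right_mono bd seg) (use x in auto)
  finally have "l 1 \<le> l 0 + B * norm (b - a)" by simp
  moreover have "g a \<noteq> 0" "g b \<noteq> 0" using nz[of a] nz[of b] by auto
  ultimately have "exp (ln (norm (g b))) \<le> exp (ln (norm (g a)) + B * norm (b - a))"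
    unfolding l_def \<gamma>_def exp_le_cancel_iff by simp
  then show ?thesis using \<open>g a \<noteq> 0\<close> \<open>g b \<noteq> 0\<close> by (simp add: exp_add)
qed

lemma norm_horizontally_increasing:
  fixes g :: "complex \<Rightarrow> complex"
  assumes ab: "a < b"
    and der: "\<And>s. a < s \<Longrightarrow> s < b \<Longrightarrow> (g has_field_derivative g' (Complex s t)) (at (Complex s t))"
    and nz: "\<And>s. a < s \<Longrightarrow> s < b \<Longrightarrow> g (Complex s t) \<noteq> 0"
    and pos: "\<And>s. a < s \<Longrightarrow> s < b \<Longrightarrow> Re (g' (Complex s t) / g (Complex s t)) > 0"
    and cont: "continuous_on {a..b} (\<lambda>s. norm (g (Complex s t)))"
  shows "norm (g (Complex a t)) < norm (g (Complex b t))"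
proof (rule DERIV_pos_imp_increasing_open[OF ab _ cont])
  fix s assume s: "a < s" "s < b"
  have eq: "Complex s t = of_real s + \<i> * of_real t" for s by (simp add: complex_eq_iff)
  have "((\<lambda>s. Complex s t) has_vector_derivative 1) (at s)"
    unfolding eq by (auto intro!: derivative_eq_intros)
  from DERIV_norm_comp[OF der[OF s] this nz[OF s]] pos[OF s] nz[OF s]
  show "\<exists>y. ((\<lambda>s. norm (g (Complex s t))) has_real_derivative y) (at s) \<and> 0 < y"
    by (intro exI conjI) (assumption, simp)
qed

text \<open>The Cayley transforms that send \<open>a\<close> and \<open>f a\<close> to the origin turn
  \<open>f\<close> into a self-map of the disc, to which Schwarz's lemma applies.\<close>

lemma halfplane_Schwarz_Pick:
  assumes holf: "f holomorphic_on {z. 0 < Re z}"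
    and pos: "\<And>z. 0 < Re z \<Longrightarrow> 0 < Re (f z)" and a: "0 < Re a"
  shows "norm (deriv f a) \<le> Re (f a) / Re a"
proof -
  define \<phi> where "\<phi> z = (a + cnj a * z) / (1 - z)" for z
  define g where "g z = (f (\<phi> z) - f a) / (f (\<phi> z) + cnj (f a))" for z
  have \<phi>pos: "0 < Re (\<phi> z)" if "z \<in> ball 0 1" for z
  proof -
    have z: "norm z < 1" using that by simp
    then have "z \<noteq> 1" by auto
    have "Re (\<phi> z) = Re ((a + cnj a * z) * cnj (1 - z)) / (norm (1 - z))\<^sup>2"
      unfolding \<phi>_def by (subst complex_div_cnj) (simp flip: of_real_power del: complex_cnj_diff)
    also have "Re ((a + cnj a * z) * cnj (1 - z)) = Re a * (1 - (norm z)\<^sup>2)"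
      unfolding cmod_power2 by (simp add: power2_eq_square algebra_simps)
    finally show ?thesis using a z \<open>z \<noteq> 1\<close> by (simp add: power_less_one_iff abs_square_less_1)
  qed
  have hol\<phi>: "\<phi> holomorphic_on ball 0 1" unfolding \<phi>_def
    by (intro holomorphic_intros) auto
  have holf\<phi>: "(\<lambda>z. f (\<phi> z)) holomorphic_on ball 0 1"
    using holomorphic_on_compose_gen[OF hol\<phi> holf] \<phi>pos by (force simp: o_def)
  have fa: "0 < Re (f a)" using pos a by simp
  have den: "f (\<phi> z) + cnj (f a) \<noteq> 0" if "z \<in> ball 0 1" for z
    using pos[OF \<phi>pos[OF that]] fa by (auto simp: complex_eq_iff)
  have holg: "g holomorphic_on ball 0 1" unfolding g_def
    by (intro holomorphic_intros holf\<phi> den) 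
  have lt: "norm (g z) < 1" if "norm z < 1" for z
  proof -
    have z: "z \<in> ball 0 1" using that by simp
    define w where "w = f (\<phi> z)"
    have w: "0 < Re w" using pos[OF \<phi>pos[OF z]] by (simp add: w_def)
    have "(norm (w + cnj (f a)))\<^sup>2 - (norm (w - f a))\<^sup>2 = 4 * Re w * Re (f a)"
      unfolding cmod_power2 by (simp add: power2_eq_square algebra_simps)
    then have "(norm (w - f a))\<^sup>2 < (norm (w + cnj (f a)))\<^sup>2"
      using w fa by (smt (verit) mult_pos_pos)
    then have "norm (w - f a) < norm (w + cnj (f a))"
      by (rule power2_less_imp_less) simp
    then show ?thesis using den[OF z] by (simp add: g_def w_def norm_divide)
  qed
  have \<phi>0: "\<phi> 0 = a" by (simp add: \<phi>_def)
  have "g 0 = 0" by (simp add: g_def \<phi>0)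
  from Schwarz_Lemma(2)[OF holg this lt, of 0] have 1: "norm (deriv g 0) \<le> 1" by simp
  have "open {z. 0 < Re z}" by (simp add: open_halfspace_Re_gt)
  then have df: "(f has_field_derivative deriv f a) (at a)"
    using holf a by (simp add: holomorphic_derivI)
  have d\<phi>: "(\<phi> has_field_derivative (cnj a + a)) (at 0)"
    unfolding \<phi>_def by (auto intro!: derivative_eq_intros)
  have df\<phi>: "((\<lambda>z. f (\<phi> z)) has_field_derivative deriv f a * (cnj a + a)) (at 0)"
    using DERIV_chain2[of f "deriv f a" \<phi> 0 "cnj a + a" UNIV] df d\<phi> \<phi>0 by simp
  have nz: "f a + cnj (f a) \<noteq> 0" using fa by (auto simp: complex_eq_iff)
  have "(g has_field_derivative (deriv f a * (cnj a + a)) / (f a + cnj (f a))) (at 0)"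
  proof -
    have 1: "((\<lambda>z. f (\<phi> z) - f a) has_field_derivative deriv f a * (cnj a + a)) (at 0)"
      using DERIV_diff[OF df\<phi> DERIV_const[of "f a"]] by simp
    have 2: "((\<lambda>z. f (\<phi> z) + cnj (f a)) has_field_derivative deriv f a * (cnj a + a)) (at 0)"
      using DERIV_add[OF df\<phi> DERIV_const[of "cnj (f a)"]] by simp
    show ?thesis unfolding g_def
      using DERIV_divide[OF 1 2] nz by (simp add: \<phi>0)
  qed
  then have "deriv g 0 = (deriv f a * (cnj a + a)) / (f a + cnj (f a))" by (rule DERIV_imp_deriv)
  moreover have "cnj a + a = of_real (2 * Re a)" "f a + cnj (f a) = of_real (2 * Re (f a))"
    by (auto simp: complex_eq_iff)
  ultimately have "norm (deriv g 0) = norm (deriv f a) * (2 * Re a) / (2 * Re (f a))"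
    using a fa by (simp add: norm_mult norm_divide)
  with 1 show ?thesis using a fa by (simp add: field_simps)
qed

text \<open>A bound that blows up like \<open>1 / |Re y|\<close> near the imaginary axis suffices to
  control a holomorphic function across the axis: the factor \<open>(y - c)^2 + r^2\<close> has
  modulus \<open>2 r |Re y|\<close> on the circle and so cancels the blow-up, and it is bounded
  below on the smaller disc.\<close>

lemma disc_max_crossing_axis:
  assumes hol: "f holomorphic_on T" and T: "open T" "cball c r \<subseteq> T" and r: "r > 0" and c: "Re c = 0"
    and bd: "\<And>y. norm (y - c) = r \<Longrightarrow> Re y \<noteq> 0 \<Longrightarrow> norm (f y) * \<bar>Re y\<bar> \<le> M"
    and y: "norm (y - c) \<le> r / 2"
  shows "norm (f y) \<le> 3 * M / r"
proof -
  define g where "g y = f y * ((y - c)\<^sup>2 + of_real r ^ 2)" for y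
  have M: "M \<ge> 0"
  proof -
    have "norm (f (c + of_real r)) * \<bar>Re (c + of_real r)\<bar> \<le> M"
      by (rule bd) (use r c in auto)
    then show ?thesis using r c by (smt (verit) mult_nonneg_nonneg norm_ge_zero abs_ge_zero)
  qed
  have holg: "g holomorphic_on T" unfolding g_def by (intro holomorphic_intros hol)
  have contg: "continuous_on T g" by (rule holomorphic_on_imp_continuous_on[OF holg])
  have gy: "norm (g y) \<le> 2 * r * M"
  proof (rule maximum_modulus_frontier[of g "cball c r"])
    show "g holomorphic_on interior (cball c r)"
      using holomorphic_on_subset[OF holg] T(2) interior_subset by blast
    show "continuous_on (closure (cball c r)) g"
      using continuous_on_subset[OF contg T(2)] by simp
    show "y \<in> cball c r" using y r by (simp add: dist_norm norm_minus_commute)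
    fix z assume "z \<in> frontier (cball c r)"
    then have z: "norm (z - c) = r" by (auto simp: dist_norm norm_minus_commute)
    (* On the circle r^2 is the product of z - c and its conjugate, so a factor z - c splits off. *)
    have "(of_real r :: complex) ^ 2 = (z - c) * cnj (z - c)"
      using z complex_norm_square[of "z - c"] by simp
    then have "(z - c)\<^sup>2 + of_real r ^ 2 = (z - c) * ((z - c) + cnj (z - c))"
      by (simp add: power2_eq_square algebra_simps)
    also have "\<dots> = (z - c) * of_real (2 * Re z)" using c by (simp add: complex_eq_iff)
    finally have eq: "norm (g z) = norm (f z) * (r * (2 * \<bar>Re z\<bar>))"
      unfolding g_def using z by (simp add: norm_mult abs_mult)
    show "norm (g z) \<le> 2 * r * M"
    proof (cases "Re z = 0")
      case False
      from bd[OF z this] have "2 * r * (norm (f z) * \<bar>Re z\<bar>) \<le> 2 * r * M"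
        using r by (intro mult_left_mono) auto
      then show ?thesis unfolding eq by (simp add: mult_ac)
    qed (use eq r M in simp)
  qed auto
  have "3 / 4 * r\<^sup>2 \<le> norm ((y - c)\<^sup>2 + of_real r ^ 2)"
  proof -
    have "norm (of_real r ^ 2 :: complex) \<le> norm ((y - c)\<^sup>2 + of_real r ^ 2) + norm ((y - c)\<^sup>2)"
      by (metis add_diff_cancel_left' norm_triangle_ineq4)
    moreover have "norm ((y - c)\<^sup>2) \<le> (r/2)\<^sup>2" unfolding norm_power
      using y by (intro power_mono) auto
    moreover have "norm (of_real r ^ 2 :: complex) = r\<^sup>2" using r by (simp add: norm_power)
    moreover have "(r/2)\<^sup>2 = r\<^sup>2 / 4" by (simp add: power2_eq_square)
    ultimately show ?thesis by linarith
  qed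
  then have "norm (f y) * (3 / 4 * r\<^sup>2) \<le> norm (g y)"
    unfolding g_def norm_mult by (rule mult_left_mono) auto
  with gy have "norm (f y) * (3 / 4 * r\<^sup>2) \<le> 2 * r * M" by linarith
  then have "norm (f y) * r \<le> 8 / 3 * M" using r by (simp add: power2_eq_square field_simps)
  then have "norm (f y) * r \<le> 3 * M" using M by linarith
  then show ?thesis using r by (simp add: field_simps)
qed

text \<open>A function that can cross the level \<open>0\<close> only downwards never reaches it from
  below: look at the first point where it would.\<close>

lemma barrier:
  fixes F :: "real \<Rightarrow> real"
  assumes cont: "continuous_on {a..b} F" and Fa: "F a < 0"
    and der: "\<And>s. a \<le> s \<Longrightarrow> s \<le> b \<Longrightarrow> F s = 0 \<Longrightarrow> \<exists>D<0. (F has_real_derivative D) (at s)"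
    and s: "s \<in> {a..b}"
  shows "F s < 0"
proof (rule ccontr)
  assume neg: "\<not> F s < 0"
  define S where "S = {x \<in> {a..b}. F x \<in> {0..}}"
  have cl: "closed S"
  proof -
    have "S = {a..b} \<inter> F -` {0..}" unfolding S_def by blast
    then show ?thesis using continuous_closed_preimage[OF cont, of "{0..}"] by simp
  qed
  have sS: "s \<in> S" using neg s by (auto simp: S_def)
  have bdd: "bdd_below S" unfolding S_def by (auto intro: bdd_belowI[of _ a])
  have I: "Inf S \<in> S" using closed_contains_Inf[OF _ bdd cl] sS by blast
  define x where "x = Inf S"
  have x: "a \<le> x" "x \<le> b" "F x \<ge> 0" using I by (auto simp: S_def x_def)
  have below: "F y < 0" if "a \<le> y" "y < x" for y
  proof (rule ccontr)
    assume "\<not> F y < 0" then have "y \<in> S" using that x by (auto simp: S_def)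
    then have "x \<le> y" unfolding x_def by (rule cInf_lower[OF _ bdd])
    then show False using that by simp
  qed
  have "a < x" using x Fa by (cases "a = x") auto
  have "F x = 0"
  proof (rule ccontr)
    assume "F x \<noteq> 0" then have "F x > 0" using x by simp
    have "continuous_on {a..x} F" by (rule continuous_on_subset[OF cont]) (use x in auto)
    from IVT'[of F a 0 x, OF _ _ _ this] Fa \<open>F x > 0\<close> x obtain y where "a \<le> y" "y \<le> x" "F y = 0" by auto
    then show False using below[of y] \<open>F x \<noteq> 0\<close> by (cases "y = x") auto
  qed
  from der[OF x(1,2) this] obtain D where "D < 0" "(F has_real_derivative D) (at x)" by auto
  from DERIV_neg_dec_left[OF this(2,1)] obtain d where d: "d > 0" "\<And>h. h > 0 \<Longrightarrow> h < d \<Longrightarrow> F x < F (x - h)" by auto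
  define h where "h = min (d/2) (x - a)"
  have "h > 0" "h < d" using d \<open>a < x\<close> by (auto simp: h_def)
  moreover have "a \<le> x - h" "x - h < x" using \<open>h > 0\<close> by (auto simp: h_def)
  ultimately show False using d(2)[of h] below[of "x - h"] \<open>F x = 0\<close> by auto
qed

section \<open>The two branches and the level function\<close>

text \<open>The equation \<open>y w^2 + w = y\<close> has the roots \<open>(- 1 \<plusminus> sqrt (1 + 4
  y^2)) / (2 y)\<close>. Two determinations are needed. The outer one, \<open>w_out = i
  p_fun\<close>, is analytic off the segment \<open>I_seg\<close> and tends to \<open>1\<close>
  at infinity; the inner one, \<open>w_in\<close>, is analytic off the two imaginary rays and
  vanishes at the origin. They agree on the right half-plane, and on the left half-plane
  \<open>w_out\<close> equals \<open>-1 / w_in\<close>.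

  The modulus of \<open>exp_minus_V\<close> is \<open>exp (- Re V(p(y);y))\<close>. On the right
  half-plane it is \<open>level\<close>, which is written in terms of the inner branch in order
  to be even and continuous on the whole plane.\<close>

definition root_out :: "complex \<Rightarrow> complex" where "root_out y = csqrt (1 / (4 * y\<^sup>2) + 1)"
definition w_out :: "complex \<Rightarrow> complex" where "w_out y = root_out y - 1 / (2 * y)"
definition root_in :: "complex \<Rightarrow> complex" where "root_in y = csqrt (1 + 4 * y\<^sup>2)"
definition w_in :: "complex \<Rightarrow> complex" where "w_in y = 2 * y / (1 + root_in y)"
definition level :: "complex \<Rightarrow> real" where "level y = norm (w_in y) * exp (Re (root_in y))"
definition exp_minus_V :: "complex \<Rightarrow> complex" where "exp_minus_V y = w_out y * exp (2 * y * root_out y)"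
definition w_lim :: "complex \<Rightarrow> complex" where
  "w_lim y = (if y \<in> eyebrow_zero then 0 else if Re y > 0 \<or> level y < 1 then w_in y else w_out y)"

lemma I_seg_iff: "y \<in> I_seg \<longleftrightarrow> Re y = 0 \<and> \<bar>Im y\<bar> \<le> 1/2"
proof
  assume "y \<in> I_seg"
  then obtain u where u: "0 \<le> u" "u \<le> 1" and yu: "y = (1 - u) *\<^sub>R (- \<i> / 2) + u *\<^sub>R (\<i> / 2)"
    unfolding I_seg_def closed_segment_def by blast
  have "Re y = 0" "Im y = u - 1/2" unfolding yu by (simp_all add: field_simps)
  then show "Re y = 0 \<and> \<bar>Im y\<bar> \<le> 1/2" using \<open>0 \<le> u\<close> \<open>u \<le> 1\<close> by linarith
next
  assume a: "Re y = 0 \<and> \<bar>Im y\<bar> \<le> 1/2"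
  show "y \<in> I_seg" unfolding I_seg_def closed_segment_def
    using a by (auto intro!: exI[of _ "Im y + 1/2"] simp: complex_eq_iff field_simps abs_le_iff)
qed

lemma nonzero_off_I_seg: "y \<notin> I_seg \<Longrightarrow> y \<noteq> 0"
  by (auto simp: I_seg_iff)

lemma slit_off_I_seg:
  assumes "y \<notin> I_seg" shows "1 / (4 * y\<^sup>2) + 1 \<notin> \<real>\<^sub>\<le>\<^sub>0"
proof
  assume "1 / (4 * y\<^sup>2) + 1 \<in> \<real>\<^sub>\<le>\<^sub>0"
  then obtain a where a: "a \<le> 0" "1 / (4 * y\<^sup>2) + 1 = of_real a" by (auto elim: nonpos_Reals_cases)
  have y0: "y \<noteq> 0" using nonzero_off_I_seg[OF assms] .
  have "1 = 4 * y\<^sup>2 * of_real (a - 1)" using a(2) y0 by (simp add: field_simps)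
  then have e: "y\<^sup>2 = of_real (1 / (4 * (a - 1)))" using a(1)
    by (simp add: field_simps)
  then have 1: "Re y * Im y = 0" and 2: "(Re y)\<^sup>2 - (Im y)\<^sup>2 = 1 / (4 * (a - 1))"
    by (auto simp: complex_eq_iff power2_eq_square)
  have neg: "1 / (4 * (a - 1)) < 0" "1 / (4 * (a - 1)) \<ge> - 1/4" using a(1) by (auto simp: field_simps)
  have "Re y = 0" using 1 2 neg(1) zero_le_power2[of "Re y"] by (cases "Im y = 0") (simp, simp)
  moreover from this 2 neg(2) have "(Im y)\<^sup>2 \<le> (1/2)\<^sup>2" by (simp add: power2_eq_square)
  then have "\<bar>Im y\<bar> \<le> 1/2" using abs_le_square_iff[of "Im y" "1/2"] by simp
  ultimately show False using assms by (simp add: I_seg_iff)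
qed

lemma root_out_sq: "(root_out y)\<^sup>2 = 1 / (4 * y\<^sup>2) + 1" by (simp add: root_out_def)

lemma Re_root_out_pos: "y \<notin> I_seg \<Longrightarrow> 0 < Re (root_out y)"
  using slit_off_I_seg[of y] csqrt_principal[of "1 / (4 * y\<^sup>2) + 1"] unfolding root_out_def
  by (metis Re_csqrt complex_nonpos_Reals_iff csqrt_principal power2_csqrt Im_power2 Re_power2
      less_eq_real_def mult_zero_left mult_zero_right power2_eq_square zero_le_power2 diff_ge_0_iff_ge
      diff_0 neg_le_0_iff_le mult.commute)

lemma root_out_minus: "root_out (- y) = root_out y" by (simp add: root_out_def)

lemma w_out_quadratic: assumes "y \<noteq> 0" shows "y * (w_out y)\<^sup>2 + w_out y = y"
proof -
  have "y * (w_out y)\<^sup>2 + w_out y = y * (root_out y)\<^sup>2 - 1 / (4 * y)"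
    using assms unfolding w_out_def by (simp add: power2_eq_square field_simps)
  also have "\<dots> = y" using assms unfolding root_out_sq by (simp add: power2_eq_square field_simps)
  finally show ?thesis .
qed

lemma w_out_times: assumes "y \<noteq> 0" shows "w_out y * (root_out y + 1 / (2 * y)) = 1"
proof -
  have "w_out y * (root_out y + 1 / (2 * y)) = (root_out y)\<^sup>2 - 1 / (4 * y\<^sup>2)"
    using assms unfolding w_out_def by (simp add: power2_eq_square field_simps)
  then show ?thesis by (simp add: root_out_sq)
qed

lemma w_out_nonzero: "y \<noteq> 0 \<Longrightarrow> w_out y \<noteq> 0" using w_out_times by fastforce

lemma inverse_w_out: "y \<noteq> 0 \<Longrightarrow> 1 / w_out y = root_out y + 1 / (2 * y)"
  using w_out_times[of y] w_out_nonzero[of y] by (simp add: field_simps)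

lemma w_out_plus_inverse: "y \<noteq> 0 \<Longrightarrow> w_out y + 1 / w_out y = 2 * root_out y"
  by (simp add: inverse_w_out) (simp add: w_out_def)

lemma w_out_minus: "y \<noteq> 0 \<Longrightarrow> w_out (- y) = 1 / w_out y"
  by (simp add: inverse_w_out) (simp add: w_out_def root_out_minus)

lemma Re_w_out_pos: assumes "y \<notin> I_seg" shows "0 < Re (w_out y)"
proof -
  have y: "y \<noteq> 0" using nonzero_off_I_seg assms by auto
  define w where "w = w_out y"
  have w: "w \<noteq> 0" using w_out_nonzero y by (simp add: w_def)
  have "Re (w + 1 / w) = Re w * (1 + 1 / (norm w)\<^sup>2)"
    by (simp add: Re_divide cmod_power2 algebra_simps)
  moreover have "Re (w + 1 / w) > 0" using w_out_plus_inverse[OF y] Re_root_out_pos[OF assms] by (simp add: w_def)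
  moreover have "1 + 1 / (norm w)\<^sup>2 > 0" by (simp add: add_pos_nonneg)
  ultimately show ?thesis unfolding w_def[symmetric] by (simp add: zero_less_mult_iff)
qed

lemma DERIV_root_out: assumes "y \<notin> I_seg"
  shows "(root_out has_field_derivative (- 1 / (4 * y^3 * root_out y))) (at y)"
proof -
  have y: "y \<noteq> 0" using nonzero_off_I_seg assms by auto
  have 1: "((\<lambda>y. 1 / (4 * y\<^sup>2) + 1) has_field_derivative (- 1 / (2 * y^3))) (at y)"
    using y by (auto intro!: derivative_eq_intros simp: field_simps power2_eq_square power3_eq_cube)
  show ?thesis unfolding root_out_def[abs_def]
    using has_field_derivative_csqrt'[OF 1 slit_off_I_seg[OF assms]]
    by (simp add: mult.assoc)
qed

lemma DERIV_w_out: assumes "y \<notin> I_seg"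
  shows "(w_out has_field_derivative (w_out y / (2 * root_out y * y\<^sup>2))) (at y)"
proof -
  have y: "y \<noteq> 0" using nonzero_off_I_seg assms by auto
  have q: "root_out y \<noteq> 0" using Re_root_out_pos[OF assms] by auto
  have 1: "((\<lambda>y. 1 / (2 * y)) has_field_derivative (- 1 / (2 * y^2))) (at y)"
    using y by (auto intro!: derivative_eq_intros simp: field_simps power2_eq_square)
  have "- 1 / (4 * y^3 * root_out y) - (- 1 / (2 * y^2)) = w_out y / (2 * root_out y * y\<^sup>2)"
    unfolding w_out_def using y q by (simp add: field_simps power2_eq_square power3_eq_cube)
  then show ?thesis using DERIV_diff[OF DERIV_root_out[OF assms] 1] unfolding w_out_def[abs_def] by simp
qed

lemma holomorphic_w_out: "w_out holomorphic_on - I_seg"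
  by (rule holomorphic_onI) (use DERIV_w_out in \<open>auto simp: field_differentiable_def intro: has_field_derivative_at_within\<close>)

text \<open>The logarithmic derivative of \<open>exp_minus_V\<close> is \<open>2 root_out = w +
  1/w\<close>; this is what links the level function to the Riccati equation of the Bessel
  quotient.\<close>

lemma DERIV_exp_minus_V: assumes "y \<notin> I_seg"
  shows "(exp_minus_V has_field_derivative (exp_minus_V y * (2 * root_out y))) (at y)"
proof -
  have y: "y \<noteq> 0" using nonzero_off_I_seg assms by auto
  have q: "root_out y \<noteq> 0" using Re_root_out_pos[OF assms] by auto
  have 1: "((\<lambda>y. exp (2 * y * root_out y)) has_field_derivative
     exp (2 * y * root_out y) * (2 * root_out y + 2 * y * (- 1 / (4 * y^3 * root_out y)))) (at y)"
    by (rule DERIV_root_out[OF assms] derivative_eq_intros refl)+ simp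
  have "(exp_minus_V has_field_derivative w_out y / (2 * root_out y * y\<^sup>2) * exp (2 * y * root_out y) + 
     exp (2 * y * root_out y) * (2 * root_out y + 2 * y * (- 1 / (4 * y^3 * root_out y))) * w_out y) (at y)"
    unfolding exp_minus_V_def[abs_def] by (rule DERIV_mult[OF DERIV_w_out[OF assms] 1])
  moreover have "w_out y / (2 * root_out y * y\<^sup>2) * exp (2 * y * root_out y) + 
     exp (2 * y * root_out y) * (2 * root_out y + 2 * y * (- 1 / (4 * y^3 * root_out y))) * w_out y = exp_minus_V y * (2 * root_out y)"
    unfolding exp_minus_V_def using y q by (simp add: field_simps power2_eq_square power3_eq_cube)
  ultimately show ?thesis by simp
qed

lemma exp_minus_V_nonzero: "y \<noteq> 0 \<Longrightarrow> exp_minus_V y \<noteq> 0" by (simp add: exp_minus_V_def w_out_nonzero)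

lemma root_in_sq: "(root_in y)\<^sup>2 = 1 + 4 * y\<^sup>2" by (simp add: root_in_def)
lemma Re_root_in: "0 \<le> Re (root_in y)" by (simp only: root_in_def Re_csqrt)
lemma one_plus_root_in: "1 + root_in y \<noteq> 0" using Re_root_in[of y] by (auto simp: complex_eq_iff)
lemma root_in_minus: "root_in (- y) = root_in y" by (simp add: root_in_def)
lemma w_in_minus: "w_in (- y) = - w_in y" by (simp add: w_in_def root_in_minus)
lemma w_in_eq_0_iff: "w_in y = 0 \<longleftrightarrow> y = 0" using one_plus_root_in[of y] by (auto simp: w_in_def)
lemma level_minus: "level (- y) = level y" by (simp add: level_def w_in_minus root_in_minus)

lemma w_in_quadratic: "y * (w_in y)\<^sup>2 + w_in y = y"
proof -
  have "y * (w_in y)\<^sup>2 + w_in y = y * (4 * y\<^sup>2 + 2 * (1 + root_in y)) / (1 + root_in y)\<^sup>2"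
  proof -
    define T where "T = 1 + root_in y"
    have "T \<noteq> 0" using one_plus_root_in[of y] by (simp add: T_def)
    then show ?thesis unfolding w_in_def T_def[symmetric] by (simp add: power2_eq_square field_simps)
  qed
  also have "4 * y\<^sup>2 + 2 * (1 + root_in y) = (1 + root_in y)\<^sup>2"
    using root_in_sq[of y] by (simp add: power2_eq_square algebra_simps)
  finally show ?thesis using one_plus_root_in[of y] by simp
qed

text \<open>Since the real part of \<open>root_in\<close> is nonnegative, \<open>1 + root_in\<close>
  dominates the square root of \<open>1 + |root_in|^2\<close>, hence \<open>2 |y|\<close>.\<close>

lemma norm_w_in_le: "norm (w_in y) \<le> 1"
proof -
  have "(norm (2 * y))\<^sup>2 = norm ((root_in y)\<^sup>2 - 1)"
    by (simp add: root_in_sq norm_mult norm_power power_mult_distrib)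
  also have "\<dots> \<le> (norm (root_in y))\<^sup>2 + 1" using norm_triangle_ineq4[of "(root_in y)\<^sup>2" 1] by (simp add: norm_power)
  also have "\<dots> \<le> (norm (1 + root_in y))\<^sup>2"
    using Re_root_in[of y] unfolding cmod_power2 by (simp add: power2_eq_square algebra_simps)
  finally have "norm (2 * y) \<le> norm (1 + root_in y)" by (rule power2_le_imp_le) simp
  then show ?thesis unfolding w_in_def norm_divide using one_plus_root_in[of y] by simp
qed

lemma root_in_eq: assumes "Re y > 0" shows "root_in y = 2 * y * root_out y"
  unfolding root_in_def
proof (rule csqrt_unique)
  have y: "y \<noteq> 0" "y \<notin> I_seg" using assms by (auto simp: I_seg_iff)
  show "(2 * y * root_out y)\<^sup>2 = 1 + 4 * y\<^sup>2"
    using y by (simp add: power_mult_distrib root_out_sq field_simps)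
  define a where "a = y * root_out y"
  have sq: "a\<^sup>2 = y\<^sup>2 + 1/4" unfolding a_def using y by (simp add: power_mult_distrib root_out_sq field_simps)
  from arg_cong[OF this, of Im] have im: "Re a * Im a = Re y * Im y" by (simp add: power2_eq_square mult.commute)
  have "Re (a / y) > 0" using Re_root_out_pos[OF y(2)] y(1) by (simp add: a_def)
  then have pos: "Re a * Re y + Im a * Im y > 0" using y(1)
    by (simp add: Re_divide zero_less_divide_iff sum_power2_gt_zero_iff complex_eq_iff)
       (smt (verit) not_sum_power2_lt_zero)
  have "Re a > 0"
  proof (rule ccontr)
    assume "\<not> Re a > 0"
    then have a: "Re a \<le> 0" by simp
    show False
    proof (cases "Re a = 0")
      case True
      then have "Im y = 0" using im assms by auto
      then show False using pos True by simp
    next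
      case False
      then have "(Re a * Re y + Im a * Im y) * Re a < 0" using a pos by (simp add: mult_pos_neg)
      also have "(Re a * Re y + Im a * Im y) * Re a = (Re a)\<^sup>2 * Re y + (Re a * Im a) * Im y"
        by (simp add: power2_eq_square algebra_simps)
      also have "\<dots> = Re y * ((Re a)\<^sup>2 + (Im y)\<^sup>2)" unfolding im by (simp add: power2_eq_square algebra_simps)
      finally show False using assms by (smt (verit) mult_nonneg_nonneg zero_le_power2)
    qed
  qed
  then show "0 < Re (2 * y * root_out y) \<or> Re (2 * y * root_out y) = 0 \<and> 0 \<le> Im (2 * y * root_out y)"
    unfolding a_def by simp
qed

lemma w_in_eq_w_out: assumes "Re y > 0" shows "w_in y = w_out y"
proof -
  have y: "y \<noteq> 0" using assms by auto
  have "2 * y * (root_out y + 1 / (2 * y)) = 1 + root_in y" unfolding root_in_eq[OF assms] using y by (simp add: field_simps)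
  then show ?thesis unfolding w_in_def using w_out_times[OF y] one_plus_root_in[of y] y
    by (simp add: field_simps)
qed

lemma level_eq_exp_minus_V: "Re y > 0 \<Longrightarrow> level y = norm (exp_minus_V y)"
  by (simp add: level_def exp_minus_V_def w_in_eq_w_out root_in_eq norm_mult)

lemma Re_root_in_eq: "Re (root_in y) = sqrt ((norm (1 + 4 * y\<^sup>2) + Re (1 + 4 * y\<^sup>2)) / 2)"
  by (simp add: root_in_def)

lemma norm_one_plus_root_in: "norm (1 + root_in y) = sqrt (1 + 2 * Re (root_in y) + norm (1 + 4 * y\<^sup>2))"
proof -
  have "(norm (1 + root_in y))\<^sup>2 = 1 + 2 * Re (root_in y) + (norm (root_in y))\<^sup>2"
    unfolding cmod_power2 by (simp add: power2_eq_square algebra_simps)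
  also have "(norm (root_in y))\<^sup>2 = norm (1 + 4 * y\<^sup>2)" by (metis norm_power root_in_sq)
  finally show ?thesis by (metis norm_ge_zero real_sqrt_abs abs_of_nonneg)
qed

text \<open>\<open>root_in\<close> jumps across the two rays, but only by its sign, and there it is purely
  imaginary; its real part and the modulus of \<open>1 + root_in\<close> do not see the jump.\<close>

lemma continuous_level: "continuous_on UNIV level"
proof -
  have eq: "level = (\<lambda>y. 2 * norm y / sqrt (1 + 2 * sqrt ((norm (1 + 4 * y\<^sup>2) + Re (1 + 4 * y\<^sup>2)) / 2) + norm (1 + 4 * y\<^sup>2))
      * exp (sqrt ((norm (1 + 4 * y\<^sup>2) + Re (1 + 4 * y\<^sup>2)) / 2)))"
    unfolding level_def w_in_def norm_divide norm_one_plus_root_in Re_root_in_eq norm_mult by simp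
  have nz: "1 + 2 * sqrt ((norm (1 + 4 * y\<^sup>2) + Re (1 + 4 * y\<^sup>2)) / 2) + norm (1 + 4 * y\<^sup>2) \<noteq> 0" for y :: complex
    using Re_root_in[of y] unfolding Re_root_in_eq by (smt (verit) norm_ge_zero)
  show ?thesis unfolding eq by (intro continuous_intros) (use nz in auto)
qed

lemma level_on_rays: assumes "Re y = 0" "\<bar>Im y\<bar> \<ge> 1/2" shows "level y = 1"
proof -
  have z: "1 + 4 * y\<^sup>2 = of_real (1 - 4 * (Im y)\<^sup>2)"
    using assms(1) by (simp add: complex_eq_iff power2_eq_square)
  have "(1/2)\<^sup>2 \<le> (Im y)\<^sup>2" using assms(2) abs_le_square_iff[of "1/2" "Im y"] by simp
  then have t: "4 * (Im y)\<^sup>2 \<ge> 1" by (simp add: power2_eq_square)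
  have n: "norm (1 + 4 * y\<^sup>2) = 4 * (Im y)\<^sup>2 - 1" unfolding z norm_of_real using t by simp
  have r: "Re (root_in y) = 0" unfolding Re_root_in_eq n using z by simp
  have "norm (1 + root_in y) = 2 * \<bar>Im y\<bar>" unfolding norm_one_plus_root_in r n
    by (simp add: real_sqrt_mult)
  moreover have "norm y = \<bar>Im y\<bar>" using assms(1) by (simp add: cmod_def)
  ultimately show ?thesis using assms(2) unfolding level_def r w_in_def norm_divide by (simp add: norm_mult)
qed

text \<open>With \<open>s = root_in y\<close> in \<open>(0, 1]\<close> the claim is \<open>(1 - s) exp (2
  s) < 1 + s\<close>.\<close>

lemma level_on_segment: assumes "Re y = 0" "\<bar>Im y\<bar> < 1/2" shows "level y < 1"
proof -
  have t: "(Im y)\<^sup>2 < (1/2)\<^sup>2" using assms(2) abs_square_less_1[of "2 * Im y"] unfolding power_mult_distrib power_divide by (simp add: abs_mult)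
  define s where "s = sqrt (1 - 4 * (Im y)\<^sup>2)"
  have s: "0 < s" "s \<le> 1" "s\<^sup>2 = 1 - 4 * (Im y)\<^sup>2" using t unfolding s_def by (auto simp: power2_eq_square)
  have "1 + 4 * y\<^sup>2 = of_real (1 - 4 * (Im y)\<^sup>2)"
    using assms(1) by (simp add: complex_eq_iff power2_eq_square)
  then have S: "root_in y = of_real s" unfolding root_in_def s_def using t
    by (simp only:) (subst csqrt_of_real, auto simp: power2_eq_square)
  have "norm (1 + root_in y) = 1 + s" unfolding S using s(1) by (metis abs_of_pos add_pos_pos norm_of_real of_real_1 of_real_add zero_less_one)
  then have L: "level y = 2 * \<bar>Im y\<bar> / (1 + s) * exp s"
    using assms(1) unfolding level_def w_in_def norm_divide S by (simp add: norm_mult cmod_def real_sqrt_mult)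
  define f where "f x = (1 + x) * exp (- x) - (1 - x) * exp (x::real)" for x
  have "f 0 < f s"
  proof (rule DERIV_pos_imp_increasing_open[OF s(1)])
    fix x assume x: "0 < x" "x < s"
    have "(f has_real_derivative x * (exp x - exp (-x))) (at x)"
      unfolding f_def by (auto intro!: derivative_eq_intros simp: algebra_simps)
    moreover have "x * (exp x - exp (-x)) > 0" using x by simp
    ultimately show "\<exists>D. (f has_real_derivative D) (at x) \<and> 0 < D" by blast
  qed (auto simp: f_def intro!: continuous_intros)
  then have "(1 - s) * exp s < (1 + s) * exp (- s)" by (simp add: f_def)
  then have "(1 - s) * exp s * exp s < (1 + s) * exp (- s) * exp s" by simp
  then have *: "(1 - s) * (exp s)\<^sup>2 < 1 + s" by (simp add: mult.assoc power2_eq_square flip: exp_add)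
  have "(2 * \<bar>Im y\<bar> * exp s)\<^sup>2 = (1 - s\<^sup>2) * (exp s)\<^sup>2" using s(3) by (simp add: power_mult_distrib)
  also have "\<dots> = (1 + s) * ((1 - s) * (exp s)\<^sup>2)" by (simp add: power2_eq_square algebra_simps)
  also have "\<dots> < (1 + s)\<^sup>2" using * s(1) by (simp add: power2_eq_square)
  finally have "2 * \<bar>Im y\<bar> * exp s < 1 + s" by (rule power2_less_imp_less) (use s(1) in simp)
  then show ?thesis unfolding L using s(1) by (simp add: field_simps)
qed

text \<open>By \<open>DERIV_exp_minus_V\<close> the horizontal logarithmic derivative of the modulus is
  \<open>2 Re root_out\<close>, which is positive off the segment.\<close>

lemma level_increasing: assumes "0 \<le> a" "a < b" shows "level (Complex a t) < level (Complex b t)"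
proof (rule DERIV_pos_imp_increasing_open[OF assms(2)])
  have eq: "Complex s t = of_real s + \<i> * of_real t" for s by (simp add: complex_eq_iff)
  show "continuous_on {a..b} (\<lambda>s. level (Complex s t))"
    unfolding eq by (rule continuous_on_compose2[OF continuous_level]) (auto intro!: continuous_intros)
  fix s assume s: "a < s" "s < b"
  then have s0: "0 < s" using assms by simp
  then have y: "Complex s t \<notin> I_seg" by (simp add: I_seg_iff)
  have n: "exp_minus_V (Complex s t) \<noteq> 0" by (rule exp_minus_V_nonzero[OF nonzero_off_I_seg[OF y]])
  have v: "((\<lambda>s. Complex s t) has_vector_derivative 1) (at s)"
    unfolding eq by (auto intro!: derivative_eq_intros)
  have "((\<lambda>s. norm (exp_minus_V (Complex s t))) has_real_derivative norm (exp_minus_V (Complex s t)) * Re (2 * root_out (Complex s t))) (at s)"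
    using DERIV_norm_comp[where \<gamma>="\<lambda>s. Complex s t", OF DERIV_exp_minus_V[OF y] v n] n by simp
  then have "((\<lambda>s. level (Complex s t)) has_real_derivative norm (exp_minus_V (Complex s t)) * Re (2 * root_out (Complex s t))) (at s)"
    by (rule has_field_derivative_transform_within_open[where S="{0<..}"]) (use s0 in \<open>auto simp: level_eq_exp_minus_V\<close>)
  then show "\<exists>D. ((\<lambda>s. level (Complex s t)) has_real_derivative D) (at s) \<and> 0 < D"
    using Re_root_out_pos[OF y] n by (intro exI conjI) (assumption, simp)
qed

section \<open>The eyebrows as level curves\<close>

lemma level_gt_1_outside_strip: assumes "Re y \<noteq> 0" "\<bar>Im y\<bar> \<ge> 1/2" shows "level y > 1"
proof -
  have "level (Complex 0 t) < level (Complex s t)" if "0 < s" for s t using level_increasing[of 0 s t] that by simp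
  moreover have "level (Complex 0 (Im y)) = 1" "level (Complex 0 (- Im y)) = 1" using assms by (auto intro!: level_on_rays)
  moreover have "level y = level (Complex (Re y) (Im y))" by simp
  moreover have "- y = Complex (- Re y) (- Im y)" by (simp add: complex_eq_iff)
  then have "level y = level (Complex (- Re y) (- Im y))" using level_minus[of y] by simp
  ultimately show ?thesis using assms(1) by (cases "Re y > 0") (metis, metis neg_0_less_iff_less linorder_neqE_linordered_idom)
qed

lemma level_gt_1_far_right: assumes "Re y \<ge> 1" shows "level y > 1"
proof (cases "\<bar>Im y\<bar> \<ge> 1/2")
  case True then show ?thesis using level_gt_1_outside_strip assms by auto
next
  case False
  then have t: "(Im y)\<^sup>2 \<le> (1/2)\<^sup>2" using abs_le_square_iff[of "Im y" "1/2"] by simp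
  have s: "(Re y)\<^sup>2 \<ge> 1" using assms by (simp add: one_le_power)
  have "Re (1 + 4 * y\<^sup>2) = 1 + 4 * ((Re y)\<^sup>2 - (Im y)\<^sup>2)" by (simp add: power2_eq_square)
  also have "\<dots> \<ge> 4" using s t by (simp add: power2_eq_square)
  finally have r: "Re (1 + 4 * y\<^sup>2) \<ge> 4" .
  then have nn: "norm (1 + 4 * y\<^sup>2) \<ge> 4" using complex_Re_le_cmod order_trans by blast
  have "4 \<le> (a + b) / 2" if "4 \<le> a" "4 \<le> b" for a b :: real using that by simp
  from this[OF nn r] have "sqrt 4 \<le> Re (root_in y)" unfolding Re_root_in_eq by (rule real_sqrt_le_mono)
  then have S: "2 \<le> Re (root_in y)" by simp
  have y1: "norm y \<ge> 1" using assms complex_Re_le_cmod order_trans by blast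
  have "(norm (root_in y))\<^sup>2 \<le> 1 + 4 * (norm y)\<^sup>2"
    using norm_triangle_ineq[of 1 "4 * y\<^sup>2"] by (simp add: root_in_sq norm_mult norm_power flip: norm_power[of "root_in y"])
  also have "\<dots> \<le> (1 + 2 * norm y)\<^sup>2" by (simp add: power2_eq_square algebra_simps)
  finally have "norm (root_in y) \<le> 1 + 2 * norm y" by (rule power2_le_imp_le) simp
  then have "norm (1 + root_in y) \<le> 4 * norm y" using norm_triangle_ineq[of 1 "root_in y"] y1 by simp
  then have "1/2 \<le> norm (w_in y)" unfolding w_in_def norm_divide using one_plus_root_in[of y]
    by (simp add: norm_mult field_simps)
  moreover have "exp (Re (root_in y)) \<ge> 3" using S exp_ge_add_one_self[of "Re (root_in y)"] by linarith
  ultimately have "1/2 * 3 \<le> level y" unfolding level_def by (intro mult_mono) auto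
  then show ?thesis by simp
qed

lemma level_gt_1_far_left: assumes "Re y \<le> - 1" shows "level y > 1"
  using level_gt_1_far_right[of "- y"] assms by (simp add: level_minus)

lemma norm_exp_minus_V_minus: "y \<noteq> 0 \<Longrightarrow> norm (exp_minus_V (- y)) = 1 / norm (exp_minus_V y)"
  by (simp add: exp_minus_V_def w_out_minus root_out_minus norm_mult norm_divide exp_minus norm_inverse field_simps)

lemma Re_V_fun: assumes "y \<noteq> 0" shows "Re (V_fun (p_fun y) y) = - ln (norm (exp_minus_V y))"
proof -
  have p: "p_fun y = - \<i> * w_out y" unfolding p_fun_def w_out_def root_out_def by (simp add: algebra_simps)
  have w: "w_out y \<noteq> 0" using assms by (rule w_out_nonzero)
  have "\<i> * y * (p_fun y - inverse (p_fun y)) = y * (w_out y + 1 / w_out y)"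
    unfolding p using w by (simp add: field_simps)
  also have "\<dots> = 2 * y * root_out y" using w_out_plus_inverse[OF assms] by (simp add: mult_ac)
  finally have "V_fun (p_fun y) y = - Ln (p_fun y) - 2 * y * root_out y" by (simp add: V_fun_def)
  then show ?thesis unfolding exp_minus_V_def norm_mult using w by (simp add: p norm_mult ln_mult)
qed

lemma zero_level_left: "zero_level \<inter> {y. Re y < 0} = {y. Re y < 0 \<and> level y = 1}"
proof -
  have "(Re (V_fun (p_fun y) y) = 0) \<longleftrightarrow> level y = 1" if y: "Re y < 0" for y
  proof -
    have y0: "y \<noteq> 0" using y by auto
    have "Re (V_fun (p_fun y) y) = 0 \<longleftrightarrow> norm (exp_minus_V y) = 1" unfolding Re_V_fun[OF y0] using exp_minus_V_nonzero[OF y0] by simp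
    also have "\<dots> \<longleftrightarrow> norm (exp_minus_V (- y)) = 1" unfolding norm_exp_minus_V_minus[OF y0] using exp_minus_V_nonzero[OF y0] by auto
    also have "\<dots> \<longleftrightarrow> level y = 1" using level_eq_exp_minus_V[of "- y"] y by (simp add: level_minus)
    finally show ?thesis .
  qed
  then show ?thesis unfolding zero_level_def by (auto simp: I_seg_iff)
qed

lemma zero_level_right: "zero_level \<inter> {y. Re y > 0} = {y. Re y > 0 \<and> level y = 1}"
proof -
  have "(Re (V_fun (p_fun y) y) = 0) \<longleftrightarrow> level y = 1" if y: "Re y > 0" for y
  proof -
    have y0: "y \<noteq> 0" using y by auto
    show ?thesis unfolding Re_V_fun[OF y0] level_eq_exp_minus_V[OF y] using exp_minus_V_nonzero[OF y0] by simp
  qed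
  then show ?thesis unfolding zero_level_def by (auto simp: I_seg_iff)
qed

lemma closure_uminus_image: "closure (uminus ` S) = uminus ` closure (S :: complex set)"
  using closure_injective_linear_image[of "uminus :: complex \<Rightarrow> complex" S]
  by (simp add: linear_iff)

lemma eyebrow_inf_eq: "eyebrow_inf = uminus ` eyebrow_zero"
proof -
  have "zero_level \<inter> {y. Re y > 0} = uminus ` (zero_level \<inter> {y. Re y < 0})"
    unfolding zero_level_left zero_level_right image_def
    by (auto simp: level_minus intro!: exI[of _ "- _"])
  then show ?thesis unfolding eyebrow_inf_def eyebrow_zero_def using closure_uminus_image by metis
qed

text \<open>The corners are limits of points of the open arc. On a horizontal line slightly closer to the
  real axis than the corner, the level is below \<open>1\<close> on the imaginary axis by
  \<open>level_on_segment\<close> and above \<open>1\<close> a little to the side by continuity,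
  so the intermediate value theorem gives a point of the arc near the corner.\<close>

lemma corner_in_closure:
  assumes t: "\<bar>t\<bar> = 1/2"
  shows "Complex 0 t \<in> closure {y. Re y < 0 \<and> level y = 1}"
  unfolding closure_approachable
proof (intro allI impI)
  fix e :: real assume e: "e > 0"
  define s where "s = e / 2"
  have s: "s > 0" using e by (simp add: s_def)
  have cr: "continuous_on UNIV (\<lambda>r. level (Complex s (r * t)))"
  proof -
    have eq: "Complex s (r * t) = of_real s + \<i> * of_real (r * t)" for r by (simp add: complex_eq_iff)
    show ?thesis unfolding eq by (rule continuous_on_compose2[OF continuous_level]) (auto intro!: continuous_intros)
  qed
  have "level (Complex s (1 * t)) > 1" by (rule level_gt_1_outside_strip) (use s t in auto)
  moreover have "((\<lambda>r. level (Complex s (r * t))) \<longlongrightarrow> level (Complex s (1 * t))) (at_left 1)"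
    using cr by (metis (no_types, lifting) UNIV_I continuous_on_eq_continuous_within filterlim_at_split isCont_def)
  ultimately have "\<forall>\<^sub>F r in at_left 1. level (Complex s (r * t)) > 1" using order_tendstoD(1) by blast
  moreover have "\<forall>\<^sub>F r in at_left 1. r > max 0 (1 - s)"
    by (rule eventually_at_leftI[of "max 0 (1 - s)"]) (use s in auto)
  moreover have "\<forall>\<^sub>F r in at_left (1::real). r < 1" by (simp add: eventually_at_filter)
  ultimately have "\<forall>\<^sub>F r in at_left 1. level (Complex s (r * t)) > 1 \<and> r > max 0 (1 - s) \<and> r < 1"
    by (intro eventually_conj)
  then obtain r where r: "level (Complex s (r * t)) > 1" "r > max 0 (1 - s)" "r < 1"
    using eventually_happens[of _ "at_left (1::real)"] by (auto simp: trivial_limit_at_left_real)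
  have "\<bar>r * t\<bar> = r * (1/2)" unfolding abs_mult t using r by simp
  then have "\<bar>r * t\<bar> < 1/2" using r by simp
  then have "level (Complex 0 (r * t)) < 1" by (intro level_on_segment) auto
  moreover have "continuous_on {0..s} (\<lambda>x. level (Complex x (r * t)))"
  proof -
    have eq: "Complex x (r * t) = of_real x + \<i> * of_real (r * t)" for x by (simp add: complex_eq_iff)
    show ?thesis unfolding eq by (rule continuous_on_compose2[OF continuous_level]) (auto intro!: continuous_intros)
  qed
  ultimately obtain x where x: "0 \<le> x" "x \<le> s" "level (Complex x (r * t)) = 1"
    using IVT'[of "\<lambda>x. level (Complex x (r * t))" 0 1 s] r(1) s by auto
  have "x \<noteq> 0" using x(3) \<open>level (Complex 0 (r * t)) < 1\<close> by auto
  define c where "c = cnj (- Complex x (r * t))"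
  have cn: "level (cnj y) = level y" for y
  proof -
    have "1 + 4 * (cnj y)\<^sup>2 = cnj (1 + 4 * y\<^sup>2)" by simp
    then have "Re (root_in (cnj y)) = Re (root_in y)" "norm (1 + root_in (cnj y)) = norm (1 + root_in y)"
      unfolding norm_one_plus_root_in Re_root_in_eq by (simp_all only: complex_mod_cnj cnj.simps)
    then show ?thesis unfolding level_def w_in_def norm_divide by (simp add: norm_mult)
  qed
  have "level c = 1" unfolding c_def cn level_minus by (rule x(3))
  moreover have "Re c < 0" using x \<open>x \<noteq> 0\<close> by (simp add: c_def)
  moreover have "dist c (Complex 0 t) < e"
  proof -
    have "c - Complex 0 t = Complex (- x) ((r - 1) * t)" unfolding c_def by (simp add: complex_eq_iff algebra_simps)
    then have "dist c (Complex 0 t) \<le> \<bar>x\<bar> + \<bar>(r - 1) * t\<bar>" unfolding dist_norm using cmod_le[of "c - Complex 0 t"] by simp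
    also have "\<bar>(r - 1) * t\<bar> = (1 - r) / 2" using r t by (simp add: abs_mult)
    also have "\<bar>x\<bar> + (1 - r) / 2 \<le> s + s / 2" using x r by (intro add_mono) auto
    finally show ?thesis using s unfolding s_def by linarith
  qed
  ultimately show "\<exists>y\<in>{y. Re y < 0 \<and> level y = 1}. dist y (Complex 0 t) < e" by blast
qed

lemma eyebrow_zero_iff: "y \<in> eyebrow_zero \<longleftrightarrow> Re y \<le> 0 \<and> \<bar>Im y\<bar> \<le> 1/2 \<and> level y = 1"
proof
  have cl: "closed {y. Re y \<le> 0 \<and> \<bar>Im y\<bar> \<le> 1/2 \<and> level y = 1}"
  proof -
    have "closed {y. level y = 1}" using continuous_closed_vimage[of "{1}" level] continuous_level
      by (auto simp: vimage_def continuous_on_eq_continuous_at)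
    then show ?thesis
      by (intro closed_Collect_conj closed_Collect_le continuous_intros) auto
  qed
  have sub: "{y. Re y < 0 \<and> level y = 1} \<subseteq> {y. Re y \<le> 0 \<and> \<bar>Im y\<bar> \<le> 1/2 \<and> level y = 1}"
  proof clarify
    fix y assume "Re y < 0" "level y = 1"
    then show "Re y \<le> 0 \<and> \<bar>Im y\<bar> \<le> 1/2 \<and> level y = 1"
      using level_gt_1_outside_strip[of y] by (cases "\<bar>Im y\<bar> \<ge> 1/2") auto
  qed
  assume "y \<in> eyebrow_zero"
  then show "Re y \<le> 0 \<and> \<bar>Im y\<bar> \<le> 1/2 \<and> level y = 1"
    unfolding eyebrow_zero_def zero_level_left using closure_minimal[OF sub cl] by auto
next
  assume a: "Re y \<le> 0 \<and> \<bar>Im y\<bar> \<le> 1/2 \<and> level y = 1"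
  show "y \<in> eyebrow_zero"
  proof (cases "Re y = 0")
    case True
    have "\<bar>Im y\<bar> = 1/2" using level_on_segment[OF True] a by force
    from corner_in_closure[OF this] show ?thesis using True
      unfolding eyebrow_zero_def zero_level_left by (metis complex.collapse)
  next
    case False
    then show ?thesis using a closure_subset unfolding eyebrow_zero_def zero_level_left by fastforce
  qed
qed

lemma norm_eyebrow_le: "y \<in> eyebrow_zero \<Longrightarrow> norm y \<le> 2"
  using level_gt_1_far_left[of y] cmod_le[of y] unfolding eyebrow_zero_iff by force

lemma closed_eyebrow_zero: "closed eyebrow_zero" by (simp add: eyebrow_zero_def)

lemma corners_in_eyebrow: "\<i> / 2 \<in> eyebrow_zero" "- \<i> / 2 \<in> eyebrow_zero"
  by (auto simp: eyebrow_zero_iff intro!: level_on_rays)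

lemma compl_eyebrow_zero: "- eyebrow_zero = {y. Re y > 0} \<union> {y. level y < 1} \<union> {y. level y > 1} \<union> {y. \<bar>Im y\<bar> > 1/2}"
  using level_gt_1_outside_strip by (auto simp: eyebrow_zero_iff not_le)

text \<open>Because the two branches agree on the right half-plane, the inner branch inside the eye and
  the outer branch outside it fit together across the right eyebrow; only the left eyebrow
  remains as a cut.\<close>

lemma w_lim_right: "Re y > 0 \<Longrightarrow> w_lim y = w_out y"
  by (simp add: w_lim_def eyebrow_zero_iff w_in_eq_w_out)

lemma w_lim_inside: "level y < 1 \<Longrightarrow> w_lim y = w_in y"
  by (simp add: w_lim_def eyebrow_zero_iff)

lemma w_lim_outside: "level y > 1 \<Longrightarrow> w_lim y = w_out y"
  by (cases "Re y > 0") (auto simp: w_lim_right w_lim_def eyebrow_zero_iff w_in_eq_w_out)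

lemma level_ge_1_strip: "\<bar>Im y\<bar> \<ge> 1/2 \<Longrightarrow> level y \<ge> 1"
  using level_gt_1_outside_strip[of y] level_on_rays[of y] by (cases "Re y = 0") auto

lemma w_lim_outside_strip: "\<bar>Im y\<bar> > 1/2 \<Longrightarrow> w_lim y = w_out y"
  using level_ge_1_strip[of y] by (cases "Re y > 0") (auto simp: w_lim_right w_lim_def eyebrow_zero_iff w_in_eq_w_out)

lemma w_lim_eyebrow: "y \<in> eyebrow_zero \<Longrightarrow> w_lim y = 0" by (simp add: w_lim_def)

lemma level_lt_1_slit: assumes "level y < 1" shows "1 + 4 * y\<^sup>2 \<notin> \<real>\<^sub>\<le>\<^sub>0"
proof
  assume "1 + 4 * y\<^sup>2 \<in> \<real>\<^sub>\<le>\<^sub>0"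
  then have "Re (1 + 4 * y\<^sup>2) \<le> 0" "Im (1 + 4 * y\<^sup>2) = 0" by (auto simp: complex_nonpos_Reals_iff)
  then have 1: "1 + 4 * ((Re y)\<^sup>2 - (Im y)\<^sup>2) \<le> 0" "Re y * Im y = 0" by (auto simp: power2_eq_square)
  have "Re y = 0"
  proof (rule ccontr)
    assume "Re y \<noteq> 0"
    then have "Im y = 0" using 1(2) by simp
    then show False using 1(1) zero_le_power2[of "Re y"] by simp
  qed
  moreover from this 1(1) have "(1/2)\<^sup>2 \<le> (Im y)\<^sup>2" by (simp add: power2_eq_square)
  then have "\<bar>Im y\<bar> \<ge> 1/2" using abs_le_square_iff[of "1/2" "Im y"] by simp
  ultimately show False using level_on_rays[of y] assms by simp
qed

lemma holomorphic_w_in: "w_in holomorphic_on {y. level y < 1}"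
  unfolding w_in_def[abs_def] root_in_def
  by (intro holomorphic_intros) (use level_lt_1_slit one_plus_root_in[unfolded root_in_def] in auto)

lemma open_level: "open {y. level y < c}" "open {y. level y > c}"
  using continuous_level by (auto intro!: open_Collect_less continuous_on_const)

lemma holomorphic_w_lim: "w_lim holomorphic_on - eyebrow_zero"
  unfolding compl_eyebrow_zero
proof (intro holomorphic_on_Un)
  have W: "w_lim holomorphic_on S" if "\<And>y. y \<in> S \<Longrightarrow> w_lim y = w_out y" "S \<inter> I_seg = {}" for S
    using holomorphic_transform[OF holomorphic_on_subset[OF holomorphic_w_out, of S], of w_lim] that by auto
  show "w_lim holomorphic_on {y. 0 < Re y}" by (rule W) (auto simp: w_lim_right I_seg_iff)
  show "w_lim holomorphic_on {y. level y < 1}"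
    using holomorphic_transform[OF holomorphic_w_in, of w_lim] by (auto simp: w_lim_inside)
  have "level y \<le> 1" if "y \<in> I_seg" for y
    using that level_on_segment[of y] level_on_rays[of y] by (force simp: I_seg_iff)
  then show "w_lim holomorphic_on {y. 1 < level y}" by (intro W) (force simp: w_lim_outside)+
  show "w_lim holomorphic_on {y. 1/2 < \<bar>Im y\<bar>}" by (intro W) (auto simp: w_lim_outside_strip I_seg_iff)
qed (auto intro!: open_level open_Un open_Collect_less continuous_intros)

lemma w_lim_quadratic: assumes "y \<notin> eyebrow_zero" shows "y * (w_lim y)\<^sup>2 + w_lim y = y"
proof (cases "Re y > 0 \<or> level y < 1")
  case True then show ?thesis using assms w_in_quadratic by (simp add: w_lim_def)
next
  case False
  then have "y \<noteq> 0" using level_on_segment[of 0] by auto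
  then show ?thesis using False assms w_out_quadratic by (simp add: w_lim_def)
qed

lemma w_lim_eq_0_iff: assumes "y \<notin> eyebrow_zero" shows "w_lim y = 0 \<longleftrightarrow> y = 0"
proof -
  have "w_lim 0 = 0" using level_on_segment[of 0] by (simp add: w_lim_inside w_in_eq_0_iff)
  then show ?thesis using w_lim_quadratic[OF assms] by auto
qed

lemma w_lim_at_infinity: assumes "norm y > 2" shows "w_lim y = w_out y" "y \<notin> eyebrow_zero"
proof -
  show "y \<notin> eyebrow_zero" using assms norm_eyebrow_le[of y] by auto
  have "\<bar>Re y\<bar> \<ge> 1 \<or> \<bar>Im y\<bar> > 1/2" using cmod_le[of y] assms by linarith
  then show "w_lim y = w_out y" using level_gt_1_far_left[of y] level_gt_1_far_right[of y]
    by (auto simp: w_lim_outside_strip abs_if intro: w_lim_outside split: if_splits)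
qed

text \<open>Every point off the eyebrow is joined to \<open>1\<close>. Points inside the curve move
  horizontally to the right, where the level stays below \<open>1\<close> until the right
  half-plane is reached; points outside it in the left half-plane move to the left, where the
  level grows.\<close>

lemma connected_compl_eyebrow_zero: "connected (- eyebrow_zero)"
proof -
  define S where "S = - eyebrow_zero"
  have con: "connected_component S a b" if "convex T" "T \<subseteq> S" "a \<in> T" "b \<in> T" for T a b
    using connected_componentI[of T S a b] that convex_connected by auto
  have seg: "connected_component S a b" if "closed_segment a b \<subseteq> S" for a b
    by (rule con[OF convex_closed_segment that]) auto
  have H: "closed_segment (Complex a t) (Complex b t) \<subseteq> S" if "\<And>s. min a b \<le> s \<Longrightarrow> s \<le> max a b \<Longrightarrow> Complex s t \<in> S" for a b t
  proof
    fix z assume "z \<in> closed_segment (Complex a t) (Complex b t)"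
    then obtain u where u: "0 \<le> u" "u \<le> 1" "z = (1 - u) *\<^sub>R Complex a t + u *\<^sub>R Complex b t"
      by (auto simp: closed_segment_def)
    then have z: "z = Complex ((1 - u) * a + u * b) t" by (simp add: complex_eq_iff algebra_simps)
    have "(1 - u) * a + u * b \<in> closed_segment a b" using u by (auto simp: closed_segment_def)
    then show "z \<in> S" unfolding z using that by (auto simp: closed_segment_eq_real_ivl split: if_splits)
  qed
  have R: "connected_component S 1 y" if "Re y > 0" for y
    by (rule con[of "{y. Re y > 0}"]) (use that in \<open>auto simp: S_def compl_eyebrow_zero convex_halfspace_Re_gt\<close>)
  have up: "connected_component S (1 + \<i>) y" if "Im y > 1/2" for y
    by (rule con[OF convex_halfspace_Im_gt[of "1/2"]]) (use that in \<open>auto simp: S_def compl_eyebrow_zero\<close>)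
  have up1: "connected_component S 1 y" if "Im y > 1/2" for y
    by (rule connected_component_trans[OF R up]) (use that in auto)
  have left: "connected_component S (- 2 + \<i>) y" if "Re y \<le> - 1" for y
    by (rule con[of "{y. Re y \<le> - 1}"]) (use that level_gt_1_far_left in \<open>auto simp: S_def compl_eyebrow_zero convex_halfspace_Re_le\<close>)
  have left1: "connected_component S 1 y" if "Re y \<le> - 1" for y
    by (rule connected_component_trans[OF up1 left]) (use that in auto)
  have "connected_component S 1 y" if y: "y \<in> S" for y
  proof -
    have yC: "y = Complex (Re y) (Im y)" by simp
    consider "Re y > 0" | "Re y \<le> - 1" | "Re y \<le> 0" "level y < 1" | "Re y < 0" "level y \<ge> 1" "Re y > - 1" | "Re y = 0" "level y \<ge> 1"
      by linarith
    then show ?thesis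
    proof cases
      case 3
      have "connected_component S (Complex 1 (Im y)) (Complex (Re y) (Im y))"
      proof (rule seg, rule H)
        fix s assume s: "min 1 (Re y) \<le> s" "s \<le> max 1 (Re y)"
        show "Complex s (Im y) \<in> S"
        proof (cases "s > 0")
          case True then show ?thesis by (simp add: S_def compl_eyebrow_zero)
        next
          case False
          have m: "level (Complex s (Im y)) = level (Complex (- s) (- Im y))" for s
            using level_minus[of "Complex s (Im y)"] by (metis complex_minus)
          have "level (Complex s (Im y)) \<le> level (Complex (Re y) (Im y))"
            unfolding m using level_increasing[of "- s" "- Re y" "- Im y"] s False 3 by (cases "s = Re y") auto
          then show ?thesis using 3 by (simp add: S_def compl_eyebrow_zero)
        qed
      qed
      then show ?thesis using connected_component_trans[OF R[of "Complex 1 (Im y)"], of y] by simp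
    next
      case 4
      have "level y > 1"
      proof (rule ccontr)
        assume "\<not> level y > 1"
        then have "level y = 1" using 4 by simp
        then show False using y 4 level_gt_1_outside_strip[of y] by (auto simp: S_def eyebrow_zero_iff)
      qed
      have "connected_component S (Complex (- 1) (Im y)) (Complex (Re y) (Im y))"
      proof (rule seg, rule H)
        fix s assume s: "min (- 1) (Re y) \<le> s" "s \<le> max (- 1) (Re y)"
        have m: "level (Complex s (Im y)) = level (Complex (- s) (- Im y))" for s
          using level_minus[of "Complex s (Im y)"] by (metis complex_minus)
        have "level (Complex s (Im y)) \<ge> level (Complex (Re y) (Im y))"
          unfolding m using level_increasing[of "- Re y" "- s" "- Im y"] s 4 by (cases "s = Re y") auto
        then show "Complex s (Im y) \<in> S" using \<open>level y > 1\<close> by (simp add: S_def compl_eyebrow_zero)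
      qed
      then show ?thesis using connected_component_trans[OF left1[of "Complex (- 1) (Im y)"], of y] by simp
    next
      case 5
      have "\<bar>Im y\<bar> > 1/2" using y 5 level_on_segment[of y] level_on_rays[of y] by (cases "\<bar>Im y\<bar> < 1/2") (auto simp: S_def eyebrow_zero_iff)
      have "connected_component S (Complex 1 (Im y)) (Complex (Re y) (Im y))"
        by (rule seg, rule H) (use \<open>\<bar>Im y\<bar> > 1/2\<close> in \<open>auto simp: S_def compl_eyebrow_zero\<close>)
      then show ?thesis using connected_component_trans[OF R[of "Complex 1 (Im y)"], of y] by simp
    qed (auto intro: R left1)
  qed
  then show ?thesis unfolding S_def[symmetric] connected_iff_connected_component
    by (meson connected_component_sym connected_component_trans)
qed

section \<open>Identification of the two continuations\<close>

lemma p_fun_eq: "p_fun y = - \<i> * w_out y"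
  unfolding p_fun_def w_out_def root_out_def by (simp add: algebra_simps)

lemma level_0: "level 0 < 1" by (rule level_on_segment) auto

lemma zero_notin_eyebrow: "0 \<notin> eyebrow_zero" using level_0 by (simp add: eyebrow_zero_iff)

lemma zorder_w_lim: "zorder (\<lambda>y. - \<i> * w_lim y) 0 = 1"
proof (rule zorder_eqI)
  show "open {y. level y < 1}" by (rule open_level)
  show "(\<lambda>y. - \<i> * (2 / (1 + root_in y))) holomorphic_on {y. level y < 1}"
    unfolding root_in_def by (intro holomorphic_intros) (use level_lt_1_slit one_plus_root_in[unfolded root_in_def] in auto)
qed (use level_0 one_plus_root_in in \<open>auto simp: w_lim_inside w_in_def\<close>)

text \<open>Two holomorphic functions on the connected complement of the eyebrow that agree with
  \<open>p_fun\<close> near infinity coincide.\<close>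

lemma p_zero_eq: "p_zero = (\<lambda>y. - \<i> * w_lim y)"
  unfolding p_zero_def
proof (rule the_equality, intro conjI ballI)
  show "(\<lambda>y. - \<i> * w_lim y) holomorphic_on - eyebrow_zero" by (intro holomorphic_intros holomorphic_w_lim)
  show "\<forall>\<^sub>F y in at_infinity. - \<i> * w_lim y = p_fun y"
    unfolding eventually_at_infinity p_fun_eq using w_lim_at_infinity by (intro exI[of _ 3]) auto
  show "(- \<i> * w_lim y = 0) = (y = 0)" if "y \<in> - eyebrow_zero" for y using w_lim_eq_0_iff that by simp
  show "zorder (\<lambda>y. - \<i> * w_lim y) 0 = 1" by (rule zorder_w_lim)
  show "- \<i> * w_lim y = 0" if "y \<in> eyebrow_zero" for y using w_lim_eyebrow[OF that] by simp
next
  fix f :: "complex \<Rightarrow> complex"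
  assume a: "f holomorphic_on - eyebrow_zero \<and>
         (\<forall>\<^sub>F y in at_infinity. f y = p_fun y) \<and>
         (\<forall>y\<in>- eyebrow_zero. (f y = 0) = (y = 0)) \<and>
         zorder f 0 = 1 \<and> (\<forall>y\<in>eyebrow_zero. f y = 0)"
  then obtain b where b: "\<And>y. b \<le> norm y \<Longrightarrow> f y = p_fun y" by (auto simp: eventually_at_infinity)
  show "f = (\<lambda>y. - \<i> * w_lim y)"
  proof
    fix y show "f y = - \<i> * w_lim y"
    proof (cases "y \<in> eyebrow_zero")
      case True then show ?thesis using a w_lim_eyebrow by simp
    next
      case False
      define U where "U = {y :: complex. norm y > max 2 b}"
      show ?thesis
      proof (rule analytic_continuation_open[of U "- eyebrow_zero" f "\<lambda>y. - \<i> * w_lim y" y])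
        show "open U" unfolding U_def by (intro open_Collect_less continuous_intros)
        have "of_real (max 2 b + 1) \<in> U" unfolding U_def by (simp only: norm_of_real mem_Collect_eq)
        then show "U \<noteq> {}" by blast
        show "U \<subseteq> - eyebrow_zero" using w_lim_at_infinity(2) by (auto simp: U_def)
        show "f z = - \<i> * w_lim z" if "z \<in> U" for z using that b w_lim_at_infinity(1) by (auto simp: U_def p_fun_eq)
      qed (use a False closed_eyebrow_zero connected_compl_eyebrow_zero in \<open>auto intro!: holomorphic_intros holomorphic_w_lim\<close>)
    qed
  qed
qed

lemma mem_eyebrow_inf: "y \<in> eyebrow_inf \<longleftrightarrow> - y \<in> eyebrow_zero"
  unfolding eyebrow_inf_eq by (metis image_eqI imageE minus_minus)

text \<open>The function on the right-hand side continues \<open>p_fun\<close> because \<open>w_out (- y)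
  = 1 / w_out y\<close>; its pole at the origin comes from the simple zero of
  \<open>w_lim\<close>.\<close>

lemma p_inf_eq: "p_inf = (\<lambda>y. - \<i> / w_lim (- y))"
  unfolding p_inf_def
proof (rule the_equality, intro conjI ballI)
  define S where "S = - eyebrow_inf - {0}"
  have S: "- y \<in> - eyebrow_zero" "w_lim (- y) \<noteq> 0" if "y \<in> S" for y
    using that w_lim_eq_0_iff[of "- y"] by (auto simp: S_def mem_eyebrow_inf)
  have "(\<lambda>y::complex. - y) holomorphic_on S" by (intro holomorphic_intros)
  then have "(\<lambda>y. w_lim (- y)) holomorphic_on S"
    using holomorphic_on_compose_gen[of uminus S w_lim "- eyebrow_zero"] holomorphic_w_lim S
    by (auto simp: o_def image_subset_iff)
  then have hol: "(\<lambda>y. - \<i> / w_lim (- y)) holomorphic_on S" using S(2) by (intro holomorphic_intros)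
  then show "(\<lambda>y. - \<i> / w_lim (- y)) holomorphic_on - eyebrow_inf - {0}" by (simp add: S_def)
  have inf: "- \<i> / w_lim (- y) = p_fun y" if "norm y > 2" for y
  proof -
    have "y \<noteq> 0" using that by auto
    then show ?thesis using w_lim_at_infinity(1)[of "- y"] that w_out_nonzero by (simp add: p_fun_eq w_out_minus)
  qed
  show "\<forall>\<^sub>F y in at_infinity. - \<i> / w_lim (- y) = p_fun y"
    unfolding eventually_at_infinity using inf by (intro exI[of _ 3]) auto
  show "- \<i> / w_lim (- y) \<noteq> 0" if "y \<in> - eyebrow_inf - {0}" for y using S(2) that by (simp add: S_def)
  define A where "A = {y. level y < 1}"
  define g where "g y = \<i> * (1 + root_in y) / 2" for y
  have A: "open A" "0 \<in> A" unfolding A_def using level_0 by (auto intro: open_level)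
  have holg: "g holomorphic_on A" unfolding g_def root_in_def A_def
    by (intro holomorphic_intros) (use level_lt_1_slit in auto)
  have g0: "g 0 \<noteq> 0" using one_plus_root_in by (simp add: g_def)
  have fg: "- \<i> / w_lim (- y) = g y / y" if "y \<in> A" "y \<noteq> 0" for y
    using that one_plus_root_in[of y] by (simp add: w_lim_inside A_def level_minus w_in_minus g_def w_in_def root_in_minus field_simps)
  show "zorder (\<lambda>y. - \<i> / w_lim (- y)) 0 = - 1"
    by (rule zorder_eqI[OF A holg g0]) (use fg in \<open>auto simp: power_int_minus divide_inverse\<close>)
  have "is_pole (\<lambda>w. g w / (w - 0) ^ 1) 0" by (rule is_pole_basic[OF holg A g0]) simp
  moreover have "\<forall>\<^sub>F x in at 0. g x / (x - 0) ^ 1 = - \<i> / w_lim (- x)"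
    unfolding eventually_at_topological using A fg by (intro exI[of _ A]) auto
  ultimately show "is_pole (\<lambda>y. - \<i> / w_lim (- y)) 0" using is_pole_cong[OF _ refl] by fast
  show "- \<i> / w_lim (- 0) = 0" using w_lim_eq_0_iff[OF zero_notin_eyebrow] by simp
  show "- \<i> / w_lim (- y) = 0" if "y \<in> eyebrow_inf" for y using w_lim_eyebrow that by (simp add: mem_eyebrow_inf)
  fix f :: "complex \<Rightarrow> complex"
  assume a: "f holomorphic_on - eyebrow_inf - {0} \<and>
         (\<forall>\<^sub>F y in at_infinity. f y = p_fun y) \<and>
         (\<forall>y\<in>- eyebrow_inf - {0}. f y \<noteq> 0) \<and>
         is_pole f 0 \<and> zorder f 0 = - 1 \<and> f 0 = 0 \<and> (\<forall>y\<in>eyebrow_inf. f y = 0)"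
  then obtain b where b: "\<And>y. b \<le> norm y \<Longrightarrow> f y = p_fun y" by (auto simp: eventually_at_infinity)
  show "f = (\<lambda>y. - \<i> / w_lim (- y))"
  proof
    fix y show "f y = - \<i> / w_lim (- y)"
    proof (cases "y \<in> S")
      case False 
      then consider "y = 0" | "y \<in> eyebrow_inf" by (auto simp: S_def)
      then show ?thesis
        using a w_lim_eyebrow[of "- y"] w_lim_eq_0_iff[OF zero_notin_eyebrow] by cases (auto simp: mem_eyebrow_inf)
    next
      case True
      define U where "U = {y :: complex. norm y > max 2 b}"
      have op: "open (- eyebrow_inf)" unfolding eyebrow_inf_def by (intro open_Compl closed_closure)
      have "- eyebrow_inf = uminus ` (- eyebrow_zero)" unfolding eyebrow_inf_eq 
        by (auto simp: image_iff) (metis minus_minus ComplI)+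
      then have "connected (- eyebrow_inf)"
        using connected_continuous_image[OF continuous_on_minus[OF continuous_on_id] connected_compl_eyebrow_zero] by simp
      then have con: "connected S" unfolding S_def by (intro connected_open_delete op) auto
      show ?thesis
      proof (rule analytic_continuation_open[of U S f "\<lambda>y. - \<i> / w_lim (- y)" y])
        show "open U" unfolding U_def by (intro open_Collect_less continuous_intros)
        have "of_real (max 2 b + 1) \<in> U" unfolding U_def by (simp only: norm_of_real mem_Collect_eq)
        then show "U \<noteq> {}" by blast
        show "U \<subseteq> S" using w_lim_at_infinity(2) by (auto simp: U_def S_def mem_eyebrow_inf)
        show "f z = - \<i> / w_lim (- z)" if "z \<in> U" for z using that b inf by (auto simp: U_def)
        show "open S" unfolding S_def using op by auto
      qed (use a True con hol in \<open>auto simp: S_def\<close>)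
    qed
  qed
qed

section \<open>Reverse Bessel polynomials in the right half-plane\<close>

text \<open>\<open>theta\<close> lists the reverse Bessel polynomials, and \<open>phi n z = exp (- z)
  theta n z\<close> is, up to a constant, \<open>z^(n + 1/2)\<close> times the modified Bessel
  function \<open>K\<close> of order \<open>n + 1/2\<close>. Its odd part gives
  \<open>psi\<close>, which vanishes to order \<open>2 n + 1\<close> at the origin and belongs
  in the same way to the function \<open>I\<close>.\<close>

fun theta :: "nat \<Rightarrow> complex poly" where
  "theta 0 = 1"
| "theta (Suc 0) = [:1, 1:]"
| "theta (Suc (Suc n)) = [:of_nat (2 * n + 3):] * theta (Suc n) + [:0, 0, 1:] * theta n"

definition phi :: "nat \<Rightarrow> complex \<Rightarrow> complex" where "phi n z = exp (- z) * poly (theta n) z"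
definition psi :: "nat \<Rightarrow> complex \<Rightarrow> complex" where "psi n z = phi n (- z) - phi n z"

lemma poly_theta_rec: "poly (theta (Suc (Suc n))) z = of_nat (2 * n + 3) * poly (theta (Suc n)) z + z\<^sup>2 * poly (theta n) z"
  by (simp add: power2_eq_square algebra_simps)

lemma pderiv_theta: "poly (pderiv (theta (Suc n))) z = poly (theta (Suc n)) z - z * poly (theta n) z"
proof (induction n rule: induct_nat_012)
  case (ge2 n)
  have "poly (pderiv (theta (Suc (Suc (Suc n))))) z = of_nat (2 * n + 5) * poly (pderiv (theta (Suc (Suc n)))) z
    + 2 * z * poly (theta (Suc n)) z + z\<^sup>2 * poly (pderiv (theta (Suc n))) z"
    by (subst theta.simps(3)) (simp del: theta.simps add: pderiv_add pderiv_mult pderiv_smult pderiv_pCons power2_eq_square algebra_simps)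
  then show ?case
    unfolding ge2 poly_theta_rec[of "Suc n"] poly_theta_rec[of n] by (simp add: power2_eq_square algebra_simps)
qed (simp_all add: pderiv_pCons algebra_simps pderiv_add pderiv_mult pderiv_smult numeral_eq_Suc)

lemma theta_no_common_zero: "z \<noteq> 0 \<Longrightarrow> \<not> (poly (theta (Suc n)) z = 0 \<and> poly (theta n) z = 0)"
proof (induction n)
  case (Suc n) then show ?case unfolding poly_theta_rec by auto
qed simp

lemma Re_inverse_pos: "Re (1 / w) > 0" if "Re w > 0"
  using that by (auto simp: Re_divide intro!: divide_pos_pos add_pos_nonneg)

lemma Re_inverse_nonneg: "Re (1 / w) \<ge> 0" if "Re w \<ge> 0"
  using that by (auto simp: Re_divide intro!: divide_nonneg_nonneg add_nonneg_nonneg)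

text \<open>With \<open>r n = z theta n / theta (n + 1)\<close> the recursion reads \<open>r (n + 1) = 1 /
  ((2 n + 3) / z + r n)\<close>, and both the sum and the inversion preserve positive real part.\<close>

lemma theta_right_halfplane:
  assumes z: "Re z \<ge> 0" "z \<noteq> 0"
  shows "poly (theta n) z \<noteq> 0 \<and> poly (theta (Suc n)) z \<noteq> 0 \<and> Re (z * poly (theta n) z / poly (theta (Suc n)) z) > 0"
proof (induction n)
  case 0
  have n: "1 + z \<noteq> 0" using z by (auto simp: complex_eq_iff)
  have "z / (1 + z) = 1 / (1 / z + 1)" using z n by (simp add: field_simps)
  moreover have "Re (1 / (1 / z + 1)) > 0" using Re_inverse_nonneg[OF z(1)] by (intro Re_inverse_pos) simp
  ultimately show ?case using n by (simp add: add.commute)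
next
  case (Suc n)
  define r where "r = z * poly (theta n) z / poly (theta (Suc n)) z"
  have r: "Re r > 0" "poly (theta (Suc n)) z \<noteq> 0" using Suc by (auto simp: r_def)
  define q where "q = of_nat (2 * n + 3) / z + r"
  have "Re (of_nat (2 * n + 3) / z) = of_nat (2 * n + 3) * Re (1 / z)" by (simp add: Re_divide)
  also have "\<dots> \<ge> 0" using Re_inverse_nonneg[OF z(1)] by simp
  finally have q: "Re q > 0" using r by (simp add: q_def)
  then have q0: "q \<noteq> 0" by auto
  have eq: "poly (theta (Suc (Suc n))) z = z * poly (theta (Suc n)) z * q"
    unfolding poly_theta_rec q_def r_def using z r by (simp add: field_simps power2_eq_square)
  have "z * poly (theta (Suc n)) z / poly (theta (Suc (Suc n))) z = 1 / q"
    unfolding eq using z r q0 by simp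
  then show ?case using Re_inverse_pos[OF q] r eq z q0 by auto
qed

lemma theta_at_0: "poly (theta n) 0 \<noteq> 0"
proof (induction n rule: induct_nat_012)
  case (ge2 n)
  have "(of_nat (2 * n + 3) :: complex) \<noteq> 0" by (simp only: of_nat_eq_0_iff)
  then show ?case unfolding poly_theta_rec using ge2 by simp
qed simp_all

lemma phi_nonzero: "Re z \<ge> 0 \<Longrightarrow> phi n z \<noteq> 0"
  using theta_right_halfplane[of z n] theta_at_0[of n] by (cases "z = 0") (auto simp: phi_def)

lemma phi_rec: "phi (Suc (Suc n)) z = of_nat (2 * n + 3) * phi (Suc n) z + z\<^sup>2 * phi n z"
  unfolding phi_def poly_theta_rec by (simp add: algebra_simps)

lemma DERIV_phi: "(phi (Suc n) has_field_derivative - z * phi n z) (at z)"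
proof -
  have "((\<lambda>z. exp (- z) * poly (theta (Suc n)) z) has_field_derivative
     - exp (- z) * poly (theta (Suc n)) z + poly (pderiv (theta (Suc n))) z * exp (- z)) (at z)"
    by (rule DERIV_mult[OF _ poly_DERIV]) (auto intro!: derivative_eq_intros)
  then show ?thesis unfolding phi_def[abs_def] pderiv_theta by (simp add: algebra_simps)
qed

lemma DERIV_z_phi: "((\<lambda>z. z * phi n z) has_field_derivative of_nat (2 * n + 2) * phi n z - phi (Suc n) z) (at z)"
proof (cases n)
  case 0
  show ?thesis unfolding 0 phi_def[abs_def]
    by (auto intro!: derivative_eq_intros simp: algebra_simps)
next
  case (Suc k)
  have "((\<lambda>z. z * phi n z) has_field_derivative 1 * phi n z + (- z * phi k z) * z) (at z)"
    unfolding Suc by (rule DERIV_mult[OF DERIV_ident DERIV_phi])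
  then show ?thesis unfolding Suc phi_rec by (simp add: algebra_simps power2_eq_square)
qed

lemma DERIV_psi: "(psi (Suc n) has_field_derivative - z * psi n z) (at z)"
proof -
  have "((\<lambda>z. phi (Suc n) (- z)) has_field_derivative - (- z) * phi n (- z) * (- 1)) (at z)"
    by (rule DERIV_chain2[OF DERIV_phi]) (auto intro!: derivative_eq_intros)
  from DERIV_diff[OF this DERIV_phi[of n z]] show ?thesis
    unfolding psi_def[abs_def] by (simp add: algebra_simps)
qed

lemma DERIV_z_psi: "((\<lambda>z. z * psi n z) has_field_derivative of_nat (2 * n + 2) * psi n z - psi (Suc n) z) (at z)"
proof -
  have "((\<lambda>z. (- z) * phi n (- z)) has_field_derivative (of_nat (2 * n + 2) * phi n (- z) - phi (Suc n) (- z)) * (- 1)) (at z)"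
    by (rule DERIV_chain2[OF DERIV_z_phi]) (auto intro!: derivative_eq_intros)
  from DERIV_diff[OF DERIV_minus[OF this] DERIV_z_phi[of n z]] show ?thesis
    unfolding psi_def[abs_def] by (simp add: algebra_simps)
qed

lemma psi_0: "psi n 0 = 0" by (simp add: psi_def)

text \<open>The order of vanishing grows by two with each integration of \<open>psi (n + 1)' = - z psi
  n\<close>.\<close>

lemma psi_bound: "\<exists>C\<ge>0. \<forall>z. norm z \<le> r \<longrightarrow> norm (psi n z) \<le> C * norm z ^ (2 * n + 1)"
proof (induction n)
  case 0
  have "norm (psi 0 z) \<le> 2 * exp r * norm z ^ (2 * 0 + 1)" if z: "norm z \<le> r" for z
  proof -
    have "norm (psi 0 z - psi 0 0) \<le> 2 * exp r * norm (z - 0)"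
    proof (rule field_differentiable_bound[of "cball 0 r" "psi 0" "\<lambda>z. exp z + exp (- z)"])
      fix w :: complex assume w: "w \<in> cball 0 r"
      show "(psi 0 has_field_derivative exp w + exp (- w)) (at w within cball 0 r)"
        unfolding psi_def[abs_def] phi_def by (auto intro!: derivative_eq_intros)
      have "norm (exp w) \<le> exp r" "norm (exp (- w)) \<le> exp r"
        using w order_trans[OF norm_exp[of w]] order_trans[OF norm_exp[of "- w"]] by auto
      then show "norm (exp w + exp (- w)) \<le> 2 * exp r" by norm
    qed (use z in \<open>auto intro: order_trans[OF norm_ge_zero z]\<close>)
    then show ?thesis by (simp add: psi_0)
  qed
  then show ?case by (intro exI[of _ "2 * exp r"]) auto
next
  case (Suc n)
  then obtain C where C: "C \<ge> 0" "\<And>z. norm z \<le> r \<Longrightarrow> norm (psi n z) \<le> C * norm z ^ (2 * n + 1)" by auto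
  have "norm (psi (Suc n) z) \<le> C * norm z ^ (2 * Suc n + 1)" if z: "norm z \<le> r" for z
  proof -
    have "norm (psi (Suc n) z - psi (Suc n) 0) \<le> (C * norm z ^ (2 * n + 2)) * norm (z - 0)"
    proof (rule field_differentiable_bound[of "cball 0 (norm z)"])
      fix w :: complex assume w: "w \<in> cball 0 (norm z)"
      show "(psi (Suc n) has_field_derivative - w * psi n w) (at w within cball 0 (norm z))"
        by (rule has_field_derivative_at_within[OF DERIV_psi])
      have "norm w \<le> norm z" using w by simp
      have "norm (- w * psi n w) \<le> norm z * (C * norm z ^ (2 * n + 1))"
        unfolding norm_mult norm_minus_cancel
      proof (intro mult_mono)
        have "norm (psi n w) \<le> C * norm w ^ (2 * n + 1)" using C(2) \<open>norm w \<le> norm z\<close> z by simp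
        also have "\<dots> \<le> C * norm z ^ (2 * n + 1)" using C(1) \<open>norm w \<le> norm z\<close> by (intro mult_left_mono power_mono) auto
        finally show "norm (psi n w) \<le> C * norm z ^ (2 * n + 1)" .
      qed (use \<open>norm w \<le> norm z\<close> in auto)
      then show "norm (- w * psi n w) \<le> C * norm z ^ (2 * n + 2)" by (simp add: mult_ac)
    qed auto
    then show ?thesis by (simp add: psi_0 mult_ac)
  qed
  then show ?case using C(1) by (intro exI[of _ C]) auto
qed

lemma psi_rec: "psi (Suc (Suc n)) z = of_nat (2 * n + 3) * psi (Suc n) z + z\<^sup>2 * psi n z"
  unfolding psi_def phi_rec by (simp add: algebra_simps)

lemma psi_no_common_zero: "z \<noteq> 0 \<Longrightarrow> \<not> (psi (Suc n) z = 0 \<and> psi n z = 0)"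
proof (induction n)
  case 0
  show ?case
  proof
    assume "psi (Suc 0) z = 0 \<and> psi 0 z = 0"
    then have 1: "exp z * (1 - z) = exp (- z) * (1 + z)" and 2: "exp z = exp (- z)"
      by (auto simp: psi_def phi_def)
    from 1 have "exp z * (2 * z) = 0" unfolding 2[symmetric] by (simp add: algebra_simps)
    then show False using 0 by simp
  qed
next
  case (Suc n) then show ?case unfolding psi_rec by auto
qed

text \<open>The quantity \<open>Re (cnj B P) / r^N\<close>, with \<open>B = psi (n + 1)\<close> and
  \<open>P = - z psi n\<close> on the ray through \<open>z\<close>, starts from \<open>0\<close>
  at the origin and has a positive derivative, because the Bessel system contributes \<open>Re z
  (|P|^2 + |B|^2)\<close>. So it is positive at \<open>z\<close>.\<close>

lemma psi_right_halfplane: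
  assumes z: "Re z > 0"
  shows "psi (Suc n) z \<noteq> 0 \<and> Re (- z * psi n z / psi (Suc n) z) > 0"
proof -
  have z0: "z \<noteq> 0" using z by auto
  define N where "N = 2 * n + 2"
  define B where "B r = psi (Suc n) (of_real r * z)" for r :: real
  define P where "P r = - (of_real r * z) * psi n (of_real r * z)" for r :: real
  define E where "E r = Re (cnj (B r) * P r) / r ^ N" for r :: real
  have dl: "((\<lambda>r. of_real r * z) has_vector_derivative z) (at r)" for r :: real
    by (auto intro!: derivative_eq_intros)
  have dB: "(B has_vector_derivative z * P r) (at r)" for r
    using field_vector_diff_chain_at[OF dl DERIV_psi] by (simp add: B_def[abs_def] P_def o_def)
  have dP: "(P has_vector_derivative of_nat N * P r / of_real r + z * B r) (at r)" if r: "r > 0" for r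
  proof -
    have "((\<lambda>r. - (of_real r * z * psi n (of_real r * z))) has_vector_derivative
       - (z * (of_nat N * psi n (of_real r * z) - psi (Suc n) (of_real r * z)))) (at r)"
      using has_vector_derivative_minus[OF field_vector_diff_chain_at[OF dl DERIV_z_psi]] by (simp add: o_def N_def)
    then show ?thesis unfolding P_def[abs_def] B_def using r by (simp add: algebra_simps)
  qed
  have dE: "(E has_real_derivative Re z * ((norm (P r))\<^sup>2 + (norm (B r))\<^sup>2) / r ^ N) (at r)" if r: "r > 0" for r
  proof -
    have Npos: "N > 0" by (simp add: N_def)
    have "((\<lambda>r. cnj (B r) * P r) has_vector_derivative
        cnj (B r) * (of_nat N * P r / of_real r + z * B r) + cnj (z * P r) * P r) (at r)"
      by (rule has_vector_derivative_mult[OF has_vector_derivative_cnj[OF dB] dP[OF r]])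
    then have 1: "((\<lambda>r. Re (cnj (B r) * P r)) has_real_derivative
        Re (cnj (B r) * (of_nat N * P r / of_real r + z * B r) + cnj (z * P r) * P r)) (at r)"
      using has_field_derivative_Re by blast
    define K where "K = Re (cnj (B r) * P r)"
    have 2: "Re (cnj (B r) * (of_nat N * P r / of_real r + z * B r) + cnj (z * P r) * P r)
      = real N * K / r + Re z * ((norm (P r))\<^sup>2 + (norm (B r))\<^sup>2)" (is "?L = _")
    proof -
      have e: "cnj (B r) * (of_nat N * P r / of_real r + z * B r) + cnj (z * P r) * P r
        = of_real (real N / r) * (cnj (B r) * P r) + z * (B r * cnj (B r)) + cnj z * (P r * cnj (P r))"
        using r by (simp add: field_simps)
      show ?thesis unfolding e complex_norm_square[symmetric] K_def
        by (simp add: algebra_simps flip: of_real_power)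
    qed
    have "((\<lambda>r. Re (cnj (B r) * P r) / r ^ N) has_real_derivative
       (?L * r ^ N - K * (real N * r ^ (N - 1))) / (r ^ N * r ^ N)) (at r)"
      unfolding K_def using DERIV_divide[OF 1 DERIV_pow[of N r]] r by simp
    moreover have "(?L * r ^ N - K * (real N * r ^ (N - 1))) / (r ^ N * r ^ N)
      = Re z * ((norm (P r))\<^sup>2 + (norm (B r))\<^sup>2) / r ^ N"
    proof -
      have "r ^ N = r * r ^ (N - 1)" using Npos by (metis Suc_pred' power_Suc)
      then show ?thesis unfolding 2 using r by (simp add: field_simps)
    qed
    ultimately show ?thesis unfolding E_def[abs_def] by simp
  qed
  have pos: "Re z * ((norm (P r))\<^sup>2 + (norm (B r))\<^sup>2) / r ^ N > 0" if r: "r > 0" for r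
  proof -
    have "P r \<noteq> 0 \<or> B r \<noteq> 0" using psi_no_common_zero[of "of_real r * z" n] r z0 by (auto simp: P_def B_def)
    then have "(norm (P r))\<^sup>2 + (norm (B r))\<^sup>2 > 0" by (auto simp: add_pos_nonneg add_nonneg_pos)
    then show ?thesis using z r by simp
  qed
  have mono: "E a < E b" if "0 < a" "a < b" for a b
    by (rule DERIV_pos_imp_increasing[OF that(2)]) (use dE pos that in \<open>meson less_le_trans\<close>)
  have "(E \<longlongrightarrow> 0) (at_right 0)"
  proof -
    obtain C1 where C1: "C1 \<ge> 0" "\<And>w. norm w \<le> norm z \<Longrightarrow> norm (psi (Suc n) w) \<le> C1 * norm w ^ (2 * Suc n + 1)"
      using psi_bound[of "norm z" "Suc n"] by auto
    obtain C2 where C2: "C2 \<ge> 0" "\<And>w. norm w \<le> norm z \<Longrightarrow> norm (psi n w) \<le> C2 * norm w ^ (2 * n + 1)"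
      using psi_bound[of "norm z" n] by auto
    define M where "M = C1 * norm z ^ (N + 1) * (norm z * (C2 * norm z ^ (2 * n + 1)))"
    have "norm (E r) \<le> M * r" if r: "0 < r" "r < 1" for r
    proof -
      have w: "norm (of_real r * z) = r * norm z" "norm (of_real r * z) \<le> norm z" using r by (auto simp: norm_mult mult_left_le_one_le)
      have "norm (B r) \<le> C1 * (r * norm z) ^ (N + 1)" using C1(2)[OF w(2)] unfolding w(1) by (simp add: B_def N_def)
      moreover have "norm (P r) \<le> norm z * (C2 * norm z ^ (2 * n + 1))"
      proof -
        have "norm (psi n (of_real r * z)) \<le> C2 * (r * norm z) ^ (2 * n + 1)" using C2(2)[OF w(2)] unfolding w(1) .
        also have "\<dots> \<le> C2 * norm z ^ (2 * n + 1)" using w C2(1) r by (intro mult_left_mono power_mono) auto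
        finally show ?thesis unfolding P_def norm_mult norm_minus_cancel using r w(2)
          by (intro mult_mono) (auto simp: norm_mult)
      qed
      ultimately have "norm (cnj (B r) * P r) \<le> (C1 * (r * norm z) ^ (N + 1)) * (norm z * (C2 * norm z ^ (2 * n + 1)))"
        unfolding norm_mult complex_mod_cnj by (intro mult_mono) (use r C1(1) in auto)
      also have "\<dots> = M * r * r ^ N" by (simp add: M_def power_mult_distrib mult_ac)
      finally have "\<bar>Re (cnj (B r) * P r)\<bar> \<le> M * r * r ^ N" using abs_Re_le_cmod order_trans by blast
      then show ?thesis unfolding E_def using r by (simp add: field_simps)
    qed
    then have "\<forall>\<^sub>F r in at_right 0. norm (E r) \<le> M * r"
      unfolding eventually_at_right_field by (intro exI[of _ 1]) auto
    moreover have "((\<lambda>r. M * r) \<longlongrightarrow> 0) (at_right 0)" by (auto intro!: tendsto_eq_intros)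
    ultimately show ?thesis by (rule Lim_null_comparison)
  qed
  moreover have "\<forall>\<^sub>F r in at_right 0. E r \<le> E (1/2)"
    unfolding eventually_at_right_field using mono by (intro exI[of _ "1/2"]) (auto intro: less_imp_le)
  ultimately have "0 \<le> E (1/2)" by (rule tendsto_upperbound) simp
  also have "\<dots> < E 1" by (rule mono) auto
  finally have E1: "Re (cnj (psi (Suc n) z) * (- z * psi n z)) > 0" by (simp add: E_def B_def P_def)
  then have ne: "psi (Suc n) z \<noteq> 0" by auto
  have "- z * psi n z / psi (Suc n) z = (cnj (psi (Suc n) z) * (- z * psi n z)) / of_real ((norm (psi (Suc n) z))\<^sup>2)"
    by (subst complex_div_cnj) (simp add: mult_ac)
  then have "Re (- z * psi n z / psi (Suc n) z) = Re (cnj (psi (Suc n) z) * (- z * psi n z)) / (norm (psi (Suc n) z))\<^sup>2"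
    by (simp only: Re_divide_of_real)
  then show ?thesis using E1 ne by simp
qed

text \<open>The argument \<open>2 n y\<close> is the scaling in which the equilibria of the Riccati
  equations below do not depend on \<open>n\<close>. \<open>bessel_U\<close> is the rational
  solution for \<open>m = 1/2\<close>, \<open>bessel_J\<close> is the analogous quotient for
  \<open>psi\<close>, and \<open>bessel_R\<close> compares the two solutions.\<close>

definition bessel_U :: "nat \<Rightarrow> complex \<Rightarrow> complex" where
  "bessel_U n y = (2 * of_nat n * y) * phi (n - 1) (2 * of_nat n * y) / phi n (2 * of_nat n * y)"
definition bessel_J :: "nat \<Rightarrow> complex \<Rightarrow> complex" where
  "bessel_J n y = - (2 * of_nat n * y) * psi (n - 1) (2 * of_nat n * y) / psi n (2 * of_nat n * y)"
definition bessel_R :: "nat \<Rightarrow> complex \<Rightarrow> complex" where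
  "bessel_R n y = psi n (2 * of_nat n * y) / phi n (2 * of_nat n * y)"

lemma DERIV_bessel_U:
  assumes n: "n > 0" and y: "y \<noteq> 0" and ph: "phi n (2 * of_nat n * y) \<noteq> 0"
  shows "(bessel_U n has_field_derivative 2 * of_nat n * ((bessel_U n y)\<^sup>2 + bessel_U n y / y - 1)) (at y)"
proof -
  obtain m where m: "n = Suc m" using n by (cases n) auto
  define z where "z = 2 * of_nat n * y"
  have z: "z \<noteq> 0" "phi n z \<noteq> 0" using y n ph by (auto simp: z_def)
  have d: "((\<lambda>y. 2 * of_nat n * y) has_field_derivative 2 * of_nat n) (at y)" by (auto intro!: derivative_eq_intros)
  have 1: "((\<lambda>z. z * phi m z / phi n z) has_field_derivative
     ((of_nat (2 * m + 2) * phi m z - phi n z) * phi n z - z * phi m z * (- z * phi m z)) / (phi n z * phi n z)) (at z)"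
    unfolding m by (rule DERIV_divide[OF DERIV_z_phi DERIV_phi]) (use z in \<open>simp add: m\<close>)
  have A: "(bessel_U n has_field_derivative
     ((of_nat (2 * m + 2) * phi m z - phi n z) * phi n z - z * phi m z * (- z * phi m z)) / (phi n z * phi n z) * (2 * of_nat n)) (at y)"
    unfolding bessel_U_def[abs_def] using DERIV_chain2[where f="\<lambda>z. z * phi m z / phi n z" and g="\<lambda>y. 2 * of_nat n * y" and x=y and s=UNIV, OF 1[unfolded z_def] d]
    by (simp add: z_def m)
  have B: "bessel_U n y = z * phi m z / phi n z" by (simp add: bessel_U_def z_def m)
  have C: "((of_nat (2 * m + 2) * phi m z - phi n z) * phi n z - z * phi m z * (- z * phi m z)) / (phi n z * phi n z)
      = (z * phi m z / phi n z)\<^sup>2 + (z * phi m z / phi n z) / y - 1"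
  proof -
    have zy: "z / y = of_nat (2 * m + 2)" using y by (simp add: z_def m)
    have "(z * phi m z / phi n z) / y = (z / y) * phi m z / phi n z" by simp
    then have "(z * phi m z / phi n z) / y = of_nat (2 * m + 2) * phi m z / phi n z"
      unfolding zy .
    then show ?thesis using z by (simp only:) (simp add: field_simps power2_eq_square)
  qed
  show ?thesis using A unfolding C B by (simp only: mult.commute)
qed

lemma DERIV_bessel_J:
  assumes n: "n > 0" and y: "y \<noteq> 0" and ph: "psi n (2 * of_nat n * y) \<noteq> 0"
  shows "(bessel_J n has_field_derivative - 2 * of_nat n * ((bessel_J n y)\<^sup>2 - bessel_J n y / y - 1)) (at y)"
proof -
  obtain m where m: "n = Suc m" using n by (cases n) auto
  define z where "z = 2 * of_nat n * y"
  have z: "z \<noteq> 0" "psi n z \<noteq> 0" using y n ph by (auto simp: z_def)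
  have d: "((\<lambda>y. 2 * of_nat n * y) has_field_derivative 2 * of_nat n) (at y)" by (auto intro!: derivative_eq_intros)
  have 1: "((\<lambda>z. z * psi m z / psi n z) has_field_derivative
     ((of_nat (2 * m + 2) * psi m z - psi n z) * psi n z - z * psi m z * (- z * psi m z)) / (psi n z * psi n z)) (at z)"
    unfolding m by (rule DERIV_divide[OF DERIV_z_psi DERIV_psi]) (use z in \<open>simp add: m\<close>)
  have A: "((\<lambda>y. - bessel_J n y) has_field_derivative
     ((of_nat (2 * m + 2) * psi m z - psi n z) * psi n z - z * psi m z * (- z * psi m z)) / (psi n z * psi n z) * (2 * of_nat n)) (at y)"
    unfolding bessel_J_def[abs_def] using DERIV_chain2[where f="\<lambda>z. z * psi m z / psi n z" and g="\<lambda>y. 2 * of_nat n * y" and x=y and s=UNIV, OF 1[unfolded z_def] d]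
    by (simp add: z_def m)
  have bj: "bessel_J n y = - (z * psi m z / psi n z)" by (simp add: bessel_J_def z_def m)
  have C: "((of_nat (2 * m + 2) * psi m z - psi n z) * psi n z - z * psi m z * (- z * psi m z)) / (psi n z * psi n z)
      = (bessel_J n y)\<^sup>2 - bessel_J n y / y - 1"
  proof -
    have zy: "z / y = of_nat (2 * m + 2)" using y by (simp add: z_def m)
    have "(z * psi m z / psi n z) / y = (z / y) * psi m z / psi n z" by simp
    then have "(z * psi m z / psi n z) / y = of_nat (2 * m + 2) * psi m z / psi n z"
      unfolding zy .
    then have "bessel_J n y / y = - (of_nat (2 * m + 2) * psi m z / psi n z)" unfolding bj by (simp only: minus_divide_left[symmetric])
    then show ?thesis using z by (simp only:) (simp add: bj field_simps power2_eq_square)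
  qed
  have "((\<lambda>y. - bessel_J n y) has_field_derivative ((bessel_J n y)\<^sup>2 - bessel_J n y / y - 1) * (2 * of_nat n)) (at y)" using A unfolding C .
  from DERIV_minus[OF this]
  have "(bessel_J n has_field_derivative - (((bessel_J n y)\<^sup>2 - bessel_J n y / y - 1) * (2 * of_nat n))) (at y)"
    by (simp only: minus_minus)
  moreover have "- (((bessel_J n y)\<^sup>2 - bessel_J n y / y - 1) * (2 * of_nat n)) = - 2 * of_nat n * ((bessel_J n y)\<^sup>2 - bessel_J n y / y - 1)"
    by (simp add: algebra_simps)
  ultimately show ?thesis by (simp only:)
qed

lemma Re_scaled: "n > 0 \<Longrightarrow> (Re (2 * of_nat n * y) > 0) = (Re y > 0)" "(n::nat) > 0 \<Longrightarrow> Re y \<ge> 0 \<Longrightarrow> Re (2 * of_nat n * y) \<ge> 0"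
  by (auto simp: zero_less_mult_iff)

lemma Re_bessel_U_pos: assumes "n > 0" "Re y \<ge> 0" "y \<noteq> 0" shows "Re (bessel_U n y) > 0"
proof -
  obtain m where m: "n = Suc m" using assms by (cases n) auto
  define z where "z = 2 * of_nat n * y"
  have z: "Re z \<ge> 0" "z \<noteq> 0" using Re_scaled(2)[OF assms(1,2)] assms by (auto simp: z_def)
  have "bessel_U n y = z * poly (theta m) z / poly (theta n) z"
    unfolding bessel_U_def z_def[symmetric] phi_def by (simp add: m)
  then show ?thesis using theta_right_halfplane[OF z, of m] by (simp add: m)
qed

lemma bessel_J_right: assumes "n > 0" "Re y > 0" shows "psi n (2 * of_nat n * y) \<noteq> 0" "Re (bessel_J n y) > 0"
proof -
  obtain m where m: "n = Suc m" using assms by (cases n) auto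
  have "Re (2 * of_nat n * y) > 0" using Re_scaled(1) assms by blast
  from psi_right_halfplane[OF this, of m] show "psi n (2 * of_nat n * y) \<noteq> 0" "Re (bessel_J n y) > 0"
    by (auto simp: bessel_J_def m)
qed

lemma phi_right: "n > 0 \<Longrightarrow> Re y \<ge> 0 \<Longrightarrow> phi n (2 * of_nat n * y) \<noteq> 0"
  by (intro phi_nonzero Re_scaled(2))

text \<open>Schwarz-Pick gives \<open>|c| |f - a| |f + b| \<le> Re f / Re y\<close>, and \<open>|f +
  b|\<close> is at least \<open>Re f\<close>.\<close>

lemma halfplane_riccati:
  assumes der: "\<And>y. Re y > 0 \<Longrightarrow> (f has_field_derivative c * ((f y - a y) * (f y + b y))) (at y)"
    and pos: "\<And>y. Re y > 0 \<Longrightarrow> Re (f y) > 0" and b: "Re (b y) \<ge> 0" and y: "Re y > 0" and c: "c \<noteq> 0"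
  shows "norm (f y - a y) \<le> 1 / (norm c * Re y)"
proof -
  have "f holomorphic_on {y. 0 < Re y}"
    by (rule holomorphic_onI) (use der in \<open>auto simp: field_differentiable_def intro: has_field_derivative_at_within\<close>)
  from halfplane_Schwarz_Pick[OF this pos y]
  have "norm (c * ((f y - a y) * (f y + b y))) \<le> Re (f y) / Re y" using DERIV_imp_deriv[OF der[OF y]] by simp
  then have 1: "norm c * norm (f y - a y) * norm (f y + b y) \<le> Re (f y) / Re y" by (simp add: norm_mult)
  have "Re (f y) \<le> norm (f y + b y)" using complex_Re_le_cmod[of "f y + b y"] b by simp
  then have "norm c * norm (f y - a y) * Re (f y) \<le> norm c * norm (f y - a y) * norm (f y + b y)"
    by (intro mult_left_mono) auto
  with 1 have "norm c * norm (f y - a y) * Re (f y) \<le> Re (f y) / Re y" by linarith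
  then have "norm c * norm (f y - a y) * Re y \<le> 1" using pos[OF y] y by (simp add: field_simps)
  then show ?thesis using y c by (simp add: field_simps)
qed

lemma w_out_minus_inverse: assumes "y \<noteq> 0" shows "w_out y - 1 / w_out y = - 1 / y"
proof -
  have "w_out y - 1 / w_out y = - (1 / (2 * y) + 1 / (2 * y))" unfolding inverse_w_out[OF assms] by (simp add: w_out_def)
  also have "1 / (2 * y) + 1 / (2 * y) = 1 / y" using assms by (simp add: field_simps)
  finally show ?thesis by simp
qed

text \<open>The equilibria of the Riccati equation for \<open>bessel_U\<close> are \<open>w_out\<close>
  and \<open>- 1 / w_out\<close>.\<close>

lemma bessel_U_estimate: assumes n: "n > 0" and y: "Re y > 0"
  shows "norm (bessel_U n y - w_out y) \<le> 1 / (2 * real n * Re y)"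
proof -
  have eq: "u\<^sup>2 + u / y - 1 = (u - w_out y) * (u + 1 / w_out y)" if "Re y > 0" for y u
  proof -
    have "y \<noteq> 0" using that by auto
    then have y: "y \<noteq> 0" "w_out y \<noteq> 0" using w_out_nonzero[of y] by auto
    have "w_out y - 1 / w_out y = - 1 / y" by (rule w_out_minus_inverse[OF y(1)])
    moreover have "(u - w_out y) * (u + 1 / w_out y) = u\<^sup>2 - u * (w_out y - 1 / w_out y) - 1"
      using y by (simp add: field_simps power2_eq_square)
    ultimately show ?thesis by (simp only:) (simp add: field_simps)
  qed
  have y': "y \<noteq> 0" "y \<notin> I_seg" using y by (auto simp: I_seg_iff)
  have "norm (bessel_U n y - w_out y) \<le> 1 / (norm (2 * of_nat n :: complex) * Re y)"
  proof (rule halfplane_riccati[where b="\<lambda>y. 1 / w_out y"])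
    fix y :: complex assume y: "0 < Re y"
    then have y': "y \<noteq> 0" by auto
    show "(bessel_U n has_field_derivative 2 * of_nat n * ((bessel_U n y - w_out y) * (bessel_U n y + 1 / w_out y))) (at y)"
      using DERIV_bessel_U[OF n y' phi_right[OF n]] y unfolding eq[OF y] by simp
    show "0 < Re (bessel_U n y)" using Re_bessel_U_pos[OF n _ y'] y by simp
  next
    show "0 \<le> Re (1 / w_out y)" using Re_inverse_pos[OF Re_w_out_pos[OF y'(2)]] by simp
  qed (use n y in auto)
  then show ?thesis by (simp add: norm_mult)
qed

text \<open>The Riccati equation for \<open>bessel_J\<close> has the equilibria \<open>1 / w_out\<close>
  and \<open>- w_out\<close>; the one with positive real part is selected.\<close>

lemma bessel_J_estimate: assumes n: "n > 0" and y: "Re y > 0"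
  shows "norm (bessel_J n y - 1 / w_out y) \<le> 1 / (2 * real n * Re y)"
proof -
  have eq: "u\<^sup>2 - u / y - 1 = (u - 1 / w_out y) * (u + w_out y)" if "Re y > 0" for y u
  proof -
    have "y \<noteq> 0" using that by auto
    then have y: "y \<noteq> 0" "w_out y \<noteq> 0" using w_out_nonzero[of y] by auto
    have "w_out y - 1 / w_out y = - 1 / y" by (rule w_out_minus_inverse[OF y(1)])
    moreover have "(u - 1 / w_out y) * (u + w_out y) = u\<^sup>2 + u * (w_out y - 1 / w_out y) - 1"
      using y by (simp add: field_simps power2_eq_square)
    ultimately show ?thesis by (simp only:) (simp add: field_simps)
  qed
  have y': "y \<noteq> 0" "y \<notin> I_seg" using y by (auto simp: I_seg_iff)
  have "norm (bessel_J n y - 1 / w_out y) \<le> 1 / (norm (- 2 * of_nat n :: complex) * Re y)"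
  proof (rule halfplane_riccati[where b=w_out])
    fix y :: complex assume y: "0 < Re y"
    then have y': "y \<noteq> 0" by auto
    show "(bessel_J n has_field_derivative - 2 * of_nat n * ((bessel_J n y - 1 / w_out y) * (bessel_J n y + w_out y))) (at y)"
      using DERIV_bessel_J[OF n y' bessel_J_right(1)[OF n y]] unfolding eq[OF y] by simp
    show "0 < Re (bessel_J n y)" by (rule bessel_J_right(2)[OF n y])
  next
    show "0 \<le> Re (w_out y)" using Re_w_out_pos[OF y'(2)] by simp
  qed (use n y in auto)
  then show ?thesis by (simp add: norm_mult)
qed

lemma DERIV_bessel_R:
  assumes n: "n > 0" and y: "Re y > 0"
  shows "(bessel_R n has_field_derivative bessel_R n y * (2 * of_nat n * (bessel_J n y + bessel_U n y))) (at y)"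
proof -
  obtain m where m: "n = Suc m" using n by (cases n) auto
  define z where "z = 2 * of_nat n * y"
  have z: "phi n z \<noteq> 0" "psi n z \<noteq> 0" using phi_right[OF n, of y] bessel_J_right(1)[OF n y] y by (auto simp: z_def)
  have d: "((\<lambda>y. 2 * of_nat n * y) has_field_derivative 2 * of_nat n) (at y)" by (auto intro!: derivative_eq_intros)
  have 1: "((\<lambda>z. psi n z / phi n z) has_field_derivative
     ((- z * psi m z) * phi n z - psi n z * (- z * phi m z)) / (phi n z * phi n z)) (at z)"
    unfolding m by (rule DERIV_divide[OF DERIV_psi DERIV_phi]) (use z in \<open>simp add: m\<close>)
  have A: "(bessel_R n has_field_derivative
     ((- z * psi m z) * phi n z - psi n z * (- z * phi m z)) / (phi n z * phi n z) * (2 * of_nat n)) (at y)"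
    unfolding bessel_R_def[abs_def] using DERIV_chain2[where f="\<lambda>z. psi n z / phi n z" and g="\<lambda>y. 2 * of_nat n * y" and x=y and s=UNIV, OF 1[unfolded z_def] d]
    by (simp add: z_def m)
  have B: "bessel_R n y = psi n z / phi n z" "bessel_J n y = - z * psi m z / psi n z" "bessel_U n y = z * phi m z / phi n z"
    by (simp_all add: bessel_R_def bessel_J_def bessel_U_def z_def m)
  have C: "((- z * psi m z) * phi n z - psi n z * (- z * phi m z)) / (phi n z * phi n z)
     = psi n z / phi n z * (- z * psi m z / psi n z + z * phi m z / phi n z)"
    using z by (simp add: field_simps)
  show ?thesis using A unfolding C B by (simp only: mult_ac)
qed

lemma bessel_R_nonzero: "n > 0 \<Longrightarrow> Re y > 0 \<Longrightarrow> bessel_R n y \<noteq> 0"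
  using phi_right[of n y] bessel_J_right(1)[of n y] by (simp add: bessel_R_def)

text \<open>The logarithmic derivative of the ratio is \<open>2 n (J + U)\<close>, and both terms have
  positive real part.\<close>

lemma bessel_R_increasing: assumes n: "n > 0" and ab: "0 \<le> a" "a < b"
  shows "norm (bessel_R n (Complex a t)) < norm (bessel_R n (Complex b t))"
proof (rule norm_horizontally_increasing[OF ab(2), of _ "\<lambda>y. bessel_R n y * (2 * of_nat n * (bessel_J n y + bessel_U n y))"])
  fix s assume s: "a < s" "s < b"
  define y where "y = Complex s t"
  have y: "Re y > 0" "y \<noteq> 0" using s ab by (auto simp: y_def complex_eq_iff)
  show "(bessel_R n has_field_derivative bessel_R n (Complex s t) * (2 * of_nat n * (bessel_J n (Complex s t) + bessel_U n (Complex s t)))) (at (Complex s t))"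
    using DERIV_bessel_R[OF n y(1)] by (simp add: y_def)
  show nz: "bessel_R n (Complex s t) \<noteq> 0" using bessel_R_nonzero[OF n y(1)] by (simp add: y_def)
  have "Re (bessel_J n y + bessel_U n y) > 0" using bessel_J_right(2)[OF n y(1)] Re_bessel_U_pos[OF n _ y(2)] y by simp
  then show "0 < Re (bessel_R n (Complex s t) * (2 * of_nat n * (bessel_J n (Complex s t) + bessel_U n (Complex s t))) / bessel_R n (Complex s t))"
    using nz n by (simp add: y_def)
next
  obtain m where m: "n = Suc m" using n by (cases n) auto
  have c1: "continuous_on UNIV (phi n)"
    unfolding m by (rule DERIV_continuous_on, rule has_field_derivative_at_within, rule DERIV_phi)
  have c2: "continuous_on UNIV (psi n)"
    unfolding m by (rule DERIV_continuous_on, rule has_field_derivative_at_within, rule DERIV_psi)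
  have eq: "Complex s t = of_real s + \<i> * of_real t" for s by (simp add: complex_eq_iff)
  have d: "continuous_on {a..b} (\<lambda>s. 2 * of_nat n * (of_real s + \<i> * of_real t))"
    by (intro continuous_intros)
  have "continuous_on {a..b} (\<lambda>s. norm (psi n (2 * of_nat n * (of_real s + \<i> * of_real t)) / phi n (2 * of_nat n * (of_real s + \<i> * of_real t))))"
    by (rule continuous_on_norm, rule continuous_on_divide,
        rule continuous_on_compose2[OF c2 d subset_UNIV], rule continuous_on_compose2[OF c1 d subset_UNIV])
       (use ab in \<open>auto intro!: phi_right[OF n]\<close>)
  then show "continuous_on {a..b} (\<lambda>s. norm (bessel_R n (Complex s t)))"
    unfolding bessel_R_def eq .
qed

text \<open>By definition \<open>phi (- z) = phi z + psi z\<close>, so the values at \<open>- y\<close>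
  are combinations of those at \<open>y\<close> with \<open>bessel_R\<close> as the relative
  weight.\<close>

lemma bessel_U_reflect: assumes n: "n > 0" and y: "Re y > 0"
  shows "phi n (- (2 * of_nat n * y)) = phi n (2 * of_nat n * y) * (1 + bessel_R n y)"
    "1 + bessel_R n y \<noteq> 0 \<Longrightarrow> bessel_U n (- y) = (bessel_J n y * bessel_R n y - bessel_U n y) / (1 + bessel_R n y)"
proof -
  obtain m where m: "n = Suc m" using n by (cases n) auto
  define z where "z = 2 * of_nat n * y"
  have z: "phi n z \<noteq> 0" "psi n z \<noteq> 0" using phi_right[OF n, of y] bessel_J_right(1)[OF n y] y by (auto simp: z_def)
  have e: "phi n (- z) = phi n z + psi n z" "phi m (- z) = phi m z + psi m z" by (simp_all add: psi_def)
  have "bessel_R n y = psi n z / phi n z" by (simp add: bessel_R_def z_def)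
  then show 1: "phi n (- (2 * of_nat n * y)) = phi n (2 * of_nat n * y) * (1 + bessel_R n y)"
    using z e unfolding z_def[symmetric] by (simp add: field_simps)
  assume nz: "1 + bessel_R n y \<noteq> 0"
  have "bessel_U n (- y) = - z * (phi m z + psi m z) / (phi n z * (1 + bessel_R n y))"
    using 1 e(2) by (simp add: bessel_U_def z_def m)
  also have "\<dots> = (bessel_J n y * bessel_R n y - bessel_U n y) / (1 + bessel_R n y)"
  proof -
    have e3: "bessel_J n y = - z * psi m z / psi n z" "bessel_R n y = psi n z / phi n z" "bessel_U n y = z * phi m z / phi n z"
      by (simp_all add: bessel_J_def bessel_R_def bessel_U_def z_def m)
    have a: "1 + psi n z / phi n z = (phi n z + psi n z) / phi n z" using z by (simp add: field_simps)
    have nz': "phi n z + psi n z \<noteq> 0" using nz z unfolding e3 a by auto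
    show ?thesis unfolding e3 a using z nz' by (simp add: field_simps)
  qed
  finally show "bessel_U n (- y) = (bessel_J n y * bessel_R n y - bessel_U n y) / (1 + bessel_R n y)" .
qed

section \<open>Crossing the imaginary rays\<close>

lemma Re_root_out_ge:
  assumes r: "1/2 < r" and y: "r \<le> norm y"
  shows "sqrt (1 - 1 / (4 * r\<^sup>2)) \<le> Re (root_out y)"
proof -
  define z where "z = 1 / (4 * y\<^sup>2) + 1"
  have "Re (1 / (4 * y\<^sup>2)) \<ge> - norm (1 / (4 * y\<^sup>2))" using abs_Re_le_cmod[of "1 / (4 * y\<^sup>2)"] by linarith
  also have "norm (1 / (4 * y\<^sup>2)) = 1 / (4 * (norm y)\<^sup>2)" by (simp add: norm_divide norm_mult norm_power)
  finally have "Re z \<ge> 1 - 1 / (4 * (norm y)\<^sup>2)" by (simp add: z_def)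
  moreover have "1 / (4 * (norm y)\<^sup>2) \<le> 1 / (4 * r\<^sup>2)" using r y by (intro divide_left_mono mult_left_mono power_mono mult_pos_pos zero_less_power) auto
  ultimately have z: "1 - 1 / (4 * r\<^sup>2) \<le> Re z" by linarith
  moreover have "Re z \<le> (norm z + Re z) / 2" using complex_Re_le_cmod[of z] by simp
  ultimately show ?thesis unfolding root_out_def z_def[symmetric] by simp
qed

lemma norm_root_out_le: "0 < r \<Longrightarrow> r \<le> norm y \<Longrightarrow> norm (root_out y) \<le> sqrt (1 / (4 * r\<^sup>2) + 1)"
proof -
  assume r: "0 < r" "r \<le> norm y"
  have "norm (1 / (4 * y\<^sup>2) + 1) \<le> norm (1 / (4 * y\<^sup>2)) + 1" using norm_triangle_ineq[of "1 / (4 * y\<^sup>2)" 1] by simp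
  also have "norm (1 / (4 * y\<^sup>2)) = 1 / (4 * (norm y)\<^sup>2)" by (simp add: norm_divide norm_mult norm_power)
  also have "1 / (4 * (norm y)\<^sup>2) \<le> 1 / (4 * r\<^sup>2)" using r by (intro divide_left_mono mult_left_mono power_mono mult_pos_pos zero_less_power) auto
  finally show ?thesis unfolding root_out_def by simp
qed

lemma phi_no_common_zero: "n > 0 \<Longrightarrow> z \<noteq> 0 \<Longrightarrow> phi n z = 0 \<Longrightarrow> phi (n - 1) z \<noteq> 0"
  using theta_no_common_zero[of z "n - 1"] by (cases n) (auto simp: phi_def)

lemma DERIV_phi_scaled: "n > 0 \<Longrightarrow> ((\<lambda>y. phi n (2 * of_nat n * y)) has_field_derivative
    - (2 * of_nat n * y) * phi (n - 1) (2 * of_nat n * y) * (2 * of_nat n)) (at y)"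
proof -
  assume n: "n > 0"
  then obtain m where m: "n = Suc m" by (cases n) auto
  have d: "((\<lambda>y. 2 * of_nat n * y) has_field_derivative 2 * of_nat n) (at y)" by (auto intro!: derivative_eq_intros)
  show ?thesis using DERIV_chain2[where f="phi n" and g="\<lambda>y. 2 * of_nat n * y" and x=y and s=UNIV, OF _ d,
      of "- (2 * of_nat n * y) * phi m (2 * of_nat n * y)"] DERIV_phi[of m "2 * of_nat n * y"] by (simp add: m)
qed

lemma continuous_phi: "continuous_on UNIV (phi n)"
  unfolding phi_def by (intro continuous_intros)

lemma norm_w_out_le: assumes "1/2 \<le> norm y" shows "norm (w_out y) \<le> 3"
proof -
  have "norm (root_out y) \<le> sqrt (1 / (4 * (1/2)\<^sup>2) + 1)" by (rule norm_root_out_le) (use assms in auto)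
  also have "\<dots> \<le> 2" by (simp add: power2_eq_square real_le_lsqrt)
  finally have "norm (root_out y) \<le> 2" .
  moreover have "norm (1 / (2 * y)) \<le> 1" using assms by (simp add: norm_divide norm_mult) (auto simp: divide_le_eq_1)
  ultimately show ?thesis unfolding w_out_def using norm_triangle_ineq4[of "root_out y" "1 / (2 * y)"] by linarith
qed

text \<open>Along a horizontal line the error \<open>e = U - w\<close> satisfies \<open>e' = 2 n e (e + 2
  root_out) - w'\<close>. When \<open>|e| = \<eta>\<close> and the line is followed to the left,
  the first term pushes \<open>|e|\<close> down at rate at least \<open>2 n \<kappa>\<close>,
  and it outweighs \<open>w'\<close>; hence \<open>|e| < \<eta>\<close> persists. The barrier is
  applied to the polynomial form \<open>|Psi|^2 - \<eta>^2 |phi|^2\<close> of this inequality,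
  which makes sense before it is known that \<open>phi\<close> has no zero on the line.\<close>

lemma strip_estimate_left:
  assumes n: "n > 0" and \<eta>: "0 < \<eta>" "\<eta> \<le> \<kappa>" and M: "M < 2 * real n * \<kappa> * \<eta>" and start: "1 / (2 * real n) < \<eta>"
    and t: "\<bar>t\<bar> > 1/2"
    and \<kappa>: "\<And>s. \<kappa> \<le> Re (root_out (Complex s t))" and Wb: "\<And>s. norm (w_out (Complex s t) / (2 * root_out (Complex s t) * (Complex s t)\<^sup>2)) \<le> M"
    and s: "s \<le> 1"
  shows "phi n (2 * of_nat n * Complex s t) \<noteq> 0 \<and> norm (bessel_U n (Complex s t) - w_out (Complex s t)) < \<eta>"
proof -
  define \<gamma> where "\<gamma> r = Complex (1 - r) t" for r
  define ph where "ph y = phi n (2 * of_nat n * y)" for y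
  define \<Psi> where "\<Psi> y = (2 * of_nat n * y) * phi (n - 1) (2 * of_nat n * y) - w_out y * ph y" for y
  (* Psi is phi times the error, so F < 0 says that phi does not vanish and the error is below
     \<eta>. *)
  define F where "F r = (norm (\<Psi> (\<gamma> r)))\<^sup>2 - \<eta>\<^sup>2 * (norm (ph (\<gamma> r)))\<^sup>2" for r
  define e where "e y = bessel_U n y - w_out y" for y
  have I: "\<gamma> r \<notin> I_seg" for r using t by (auto simp: \<gamma>_def I_seg_iff)
  have y0: "\<gamma> r \<noteq> 0" for r by (rule nonzero_off_I_seg[OF I])
  have \<gamma>eq: "\<gamma> r = of_real (1 - r) + \<i> * of_real t" for r by (simp add: \<gamma>_def complex_eq_iff)
  have d\<gamma>: "(\<gamma> has_vector_derivative - 1) (at r)" for r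
    unfolding \<gamma>eq[abs_def] by (auto intro!: derivative_eq_intros)
  have cont\<gamma>: "continuous_on UNIV \<gamma>" unfolding \<gamma>eq[abs_def] by (intro continuous_intros)
  have contph: "continuous_on UNIV (\<lambda>r. ph (\<gamma> r))" unfolding ph_def
    by (rule continuous_on_compose2[OF continuous_phi _ subset_UNIV]) (intro continuous_intros cont\<gamma>)
  have contph1: "continuous_on UNIV (\<lambda>r. phi (n - 1) (2 * of_nat n * \<gamma> r))"
    by (rule continuous_on_compose2[OF continuous_phi _ subset_UNIV]) (intro continuous_intros cont\<gamma>)
  have contW: "continuous_on UNIV (\<lambda>r. w_out (\<gamma> r))"
    by (rule continuous_on_compose2[OF holomorphic_on_imp_continuous_on[OF holomorphic_w_out] cont\<gamma>]) (use I in auto)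
  have contF: "continuous_on UNIV F" unfolding F_def[abs_def] \<Psi>_def
    by (intro continuous_intros contph contph1 contW cont\<gamma>)
  have eP: "e (\<gamma> r) = \<Psi> (\<gamma> r) / ph (\<gamma> r)" if "ph (\<gamma> r) \<noteq> 0" for r
    using that by (simp add: e_def \<Psi>_def ph_def bessel_U_def field_simps)
  have F0: "F 0 < 0"
  proof -
    have g0: "Re (\<gamma> 0) = 1" by (simp add: \<gamma>_def)
    have p0: "ph (\<gamma> 0) \<noteq> 0" unfolding ph_def by (rule phi_right[OF n]) (simp add: g0)
    have "norm (e (\<gamma> 0)) \<le> 1 / (2 * real n * Re (\<gamma> 0))" unfolding e_def by (rule bessel_U_estimate[OF n]) (simp add: g0)
    then have "norm (\<Psi> (\<gamma> 0) / ph (\<gamma> 0)) < \<eta>" using start g0 eP[OF p0] by simp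
    then have "norm (\<Psi> (\<gamma> 0)) < \<eta> * norm (ph (\<gamma> 0))" using p0 by (simp add: norm_divide field_simps)
    then have "(norm (\<Psi> (\<gamma> 0)))\<^sup>2 < (\<eta> * norm (ph (\<gamma> 0)))\<^sup>2" by (rule power_strict_mono) auto
    then show ?thesis by (simp add: F_def power_mult_distrib)
  qed
  have "F r < 0" if "r \<ge> 0" for r
  proof (rule barrier[of 0 r F])
    show "continuous_on {0..r} F" by (rule continuous_on_subset[OF contF]) simp
    (* At a zero of F, phi cannot vanish: Psi would vanish too, and with it the neighbouring phi. *)
    fix x assume x: "0 \<le> x" "F x = 0"
    define y where "y = \<gamma> x"
    have eqn: "norm (\<Psi> y) = \<eta> * norm (ph y)"
    proof -
      have "(norm (\<Psi> y))\<^sup>2 = (\<eta> * norm (ph y))\<^sup>2" using x(2) by (simp add: F_def y_def power_mult_distrib)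
      then show ?thesis using \<eta> by (simp add: power2_eq_iff_nonneg)
    qed
    have yn: "y \<noteq> 0" unfolding y_def by (rule y0)
    have phn: "ph y \<noteq> 0"
    proof
      assume z: "ph y = 0"
      then have "\<Psi> y = 0" using eqn by simp
      then have "phi (n - 1) (2 * of_nat n * y) = 0" using z yn n by (simp add: \<Psi>_def)
      moreover have "2 * of_nat n * y \<noteq> 0" using yn n by simp
      ultimately show False using phi_no_common_zero[OF n] z by (auto simp: ph_def)
    qed
    have ne: "norm (e y) = \<eta>" using eP[of x] phn eqn by (simp add: y_def norm_divide)
    then have en: "e y \<noteq> 0" using \<eta> by auto
    define W' where "W' = w_out y / (2 * root_out y * y\<^sup>2)"
    have quad: "u\<^sup>2 + u / y - 1 = (u - w_out y) * ((u - w_out y) + 2 * root_out y)" for u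
    proof -
      have w: "w_out y \<noteq> 0" by (rule w_out_nonzero[OF yn])
      have "(u - w_out y) * ((u - w_out y) + 2 * root_out y) = (u - w_out y) * (u + 1 / w_out y)"
        unfolding w_out_plus_inverse[OF yn, symmetric] by simp
      also have "\<dots> = u\<^sup>2 - u * (w_out y - 1 / w_out y) - 1" using w by (simp add: field_simps power2_eq_square)
      finally show ?thesis unfolding w_out_minus_inverse[OF yn] by simp
    qed
    have "(e has_field_derivative 2 * of_nat n * (e y * (e y + 2 * root_out y)) - W') (at y)"
      unfolding e_def[abs_def] W'_def
      using DERIV_diff[OF DERIV_bessel_U[OF n yn] DERIV_w_out] phn I[of x] unfolding quad by (simp add: ph_def y_def)
    from DERIV_norm_comp[OF this[unfolded y_def] d\<gamma>] en
    have de: "((\<lambda>r. norm (e (\<gamma> r))) has_real_derivative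
       \<eta> * Re ((2 * of_nat n * (e y * (e y + 2 * root_out y)) - W') * (- 1) / e y)) (at x)"
      unfolding y_def[symmetric] ne by (simp add: y_def)
    define D where "D = Re ((2 * of_nat n * (e y * (e y + 2 * root_out y)) - W') * (- 1) / e y)"
    have de': "((\<lambda>r. norm (e (\<gamma> r))) has_real_derivative \<eta> * D) (at x)" using de unfolding D_def .
    have Dneg: "D < 0"
    proof -
      have "(2 * of_nat n * (e y * (e y + 2 * root_out y)) - W') * (- 1) / e y = - (2 * of_nat n * (e y + 2 * root_out y)) + W' / e y"
        using en by (simp add: field_simps)
      then have "D = Re (- (2 * of_nat n * (e y + 2 * root_out y)) + W' / e y)" unfolding D_def by (simp only:)
      then have "D = - (2 * real n * (Re (e y) + 2 * Re (root_out y))) + Re (W' / e y)" by simp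
      moreover have "Re (W' / e y) \<le> M / \<eta>"
      proof -
        have "Re (W' / e y) \<le> norm W' / \<eta>" using complex_Re_le_cmod[of "W' / e y"] ne by (simp add: norm_divide)
        also have "norm W' \<le> M" unfolding W'_def y_def \<gamma>_def by (rule Wb)
        finally show ?thesis using \<eta> by (simp add: divide_right_mono)
      qed
      moreover have "\<kappa> \<le> Re (e y) + 2 * Re (root_out y)"
        using abs_Re_le_cmod[of "e y"] ne \<eta>(2) \<kappa>[of "1 - x"] unfolding y_def \<gamma>_def by linarith
      then have "2 * real n * \<kappa> \<le> 2 * real n * (Re (e y) + 2 * Re (root_out y))" by (intro mult_left_mono) auto
      moreover have "M / \<eta> < 2 * real n * \<kappa>" using M \<eta> by (simp add: field_simps)
      ultimately show ?thesis by linarith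
    qed
    have "(\<gamma> has_vector_derivative - 1) (at x)" by (rule d\<gamma>)
    from DERIV_norm_comp[OF DERIV_phi_scaled[OF n] this] phn
    have "\<exists>D1. ((\<lambda>r. norm (ph (\<gamma> r))) has_real_derivative D1) (at x)" unfolding ph_def y_def by blast
    then obtain D1 where dph: "((\<lambda>r. norm (ph (\<gamma> r))) has_real_derivative D1) (at x)" by blast
    have "((\<lambda>r. (norm (ph (\<gamma> r)))\<^sup>2 * ((norm (e (\<gamma> r)))\<^sup>2 - \<eta>\<^sup>2)) has_real_derivative
       (norm (ph y))\<^sup>2 * (2 * \<eta> * (\<eta> * D))) (at x)"
      by (rule derivative_eq_intros dph de' refl)+ (simp add: ne y_def[symmetric])
    then have "(F has_real_derivative (norm (ph y))\<^sup>2 * (2 * \<eta> * (\<eta> * D))) (at x)"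
    proof (rule has_field_derivative_transform_within_open[where S="{r. ph (\<gamma> r) \<noteq> 0}"])
      show "open {r. ph (\<gamma> r) \<noteq> 0}" by (intro open_Collect_neq contph continuous_on_const)
      show "x \<in> {r. ph (\<gamma> r) \<noteq> 0}" using phn by (simp add: y_def)
      fix r assume "r \<in> {r. ph (\<gamma> r) \<noteq> 0}"
      then show "(norm (ph (\<gamma> r)))\<^sup>2 * ((norm (e (\<gamma> r)))\<^sup>2 - \<eta>\<^sup>2) = F r"
        by (simp add: eP F_def norm_divide field_simps)
    qed
    moreover have "(norm (ph y))\<^sup>2 * (2 * \<eta> * (\<eta> * D)) < 0"
      using phn \<eta> Dneg by (intro mult_pos_neg) auto
    ultimately show "\<exists>D<0. (F has_real_derivative D) (at x)" by blast
  qed (use F0 that in auto)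
  from this[of "1 - s"] s have neg: "(norm (\<Psi> (Complex s t)))\<^sup>2 < (\<eta> * norm (ph (Complex s t)))\<^sup>2"
    by (simp add: F_def \<gamma>_def power_mult_distrib)
  then have lt: "norm (\<Psi> (Complex s t)) < \<eta> * norm (ph (Complex s t))"
    using \<eta> by (intro power2_less_imp_less[OF neg]) auto
  then have p: "ph (Complex s t) \<noteq> 0" by auto
  have ee: "e (Complex s t) = \<Psi> (Complex s t) / ph (Complex s t)" using eP[of "1 - s"] p by (simp add: \<gamma>_def)
  have "norm (e (Complex s t)) < \<eta>" unfolding ee norm_divide using lt p by (simp add: pos_divide_less_eq)
  then show ?thesis using p by (simp add: ph_def e_def)
qed

text \<open>The distance from the corners keeps \<open>root_out\<close> away from the imaginary axis,
  which yields the constants required by \<open>strip_estimate_left\<close>; to the right of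
  \<open>Re y = 1\<close> the half-plane estimate is used.\<close>

lemma strip_estimate:
  assumes \<epsilon>: "\<epsilon> > 0"
  obtains A N where "A > 0" "N > 0"
    "\<And>n y. n \<ge> N \<Longrightarrow> \<bar>Im y\<bar> \<ge> 1/2 + \<epsilon> \<Longrightarrow> phi n (2 * of_nat n * y) \<noteq> 0 \<and> norm (bessel_U n y - w_out y) \<le> A / real n"
proof -
  define r where "r = 1/2 + \<epsilon>"
  define \<kappa> where "\<kappa> = sqrt (1 - 1 / (4 * r\<^sup>2))"
  have r: "1/2 < r" using \<epsilon> by (simp add: r_def)
  have "(1/2)\<^sup>2 < r\<^sup>2" using r by (intro power_strict_mono) auto
  then have k: "\<kappa> > 0" unfolding \<kappa>_def by (simp add: power2_eq_square field_simps)
  define M where "M = 6 / \<kappa>"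
  define A where "A = M / (2 * \<kappa>) + 1"
  define N where "N = nat \<lceil>A / \<kappa>\<rceil> + 1"
  have A1: "A \<ge> 1" using k by (simp add: A_def M_def)
  then have A: "A > 0" "A \<ge> 1" by auto
  have est: "phi n (2 * of_nat n * y) \<noteq> 0 \<and> norm (bessel_U n y - w_out y) \<le> A / real n"
    if n: "n \<ge> N" and y: "\<bar>Im y\<bar> \<ge> r" for n y
  proof -
    have n0: "n > 0" using n by (simp add: N_def)
    have nA: "A / \<kappa> \<le> real n" using n unfolding N_def by linarith
    have Wb: "norm (w_out z / (2 * root_out z * z\<^sup>2)) \<le> M" and qb: "\<kappa> \<le> Re (root_out z)" if "\<bar>Im z\<bar> \<ge> r" for z
    proof -
      have z: "r \<le> norm z" using that abs_Im_le_cmod[of z] by linarith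
      show q: "\<kappa> \<le> Re (root_out z)" unfolding \<kappa>_def by (rule Re_root_out_ge[OF r z])
      have "norm (root_out z) \<ge> \<kappa>" using q complex_Re_le_cmod order_trans by blast
      moreover have "(norm z)\<^sup>2 \<ge> (1/2)\<^sup>2" using z r by (intro power_mono) auto
      ultimately have "\<kappa> * (1/2)\<^sup>2 \<le> norm (root_out z) * (norm z)\<^sup>2" using k by (intro mult_mono) auto
      then have "2 * (\<kappa> * (1/2)\<^sup>2) \<le> norm (2 * root_out z * z\<^sup>2)" by (simp add: norm_mult norm_power)
      moreover have "norm (w_out z) \<le> 3" by (rule norm_w_out_le) (use z r in auto)
      ultimately have "norm (w_out z) / norm (2 * root_out z * z\<^sup>2) \<le> 3 / (2 * (\<kappa> * (1/2)\<^sup>2))"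
        using k by (intro frac_le) auto
      also have "\<dots> = M" using k by (simp add: M_def power2_eq_square field_simps)
      finally show "norm (w_out z / (2 * root_out z * z\<^sup>2)) \<le> M" by (simp add: norm_divide)
    qed
    show ?thesis
    proof (cases "Re y \<ge> 1")
      case True
      have "norm (bessel_U n y - w_out y) \<le> 1 / (2 * real n * Re y)" by (rule bessel_U_estimate[OF n0]) (use True in simp)
      also have "\<dots> \<le> A / real n"
      proof -
        have "1 / (2 * Re y) \<le> A" 
        proof -
          have "1 * 1 \<le> A * (2 * Re y)" using True A by (intro mult_mono) auto
          then show ?thesis using True by (simp add: field_simps)
        qed
        then show ?thesis using n0 by (simp add: field_simps)
      qed
      finally show ?thesis using phi_right[OF n0, of y] True by simp
    next
      case False
      have "phi n (2 * of_nat n * Complex (Re y) (Im y)) \<noteq> 0 \<and> norm (bessel_U n (Complex (Re y) (Im y)) - w_out (Complex (Re y) (Im y))) < A / real n"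
      proof (rule strip_estimate_left[OF n0, where \<kappa>=\<kappa> and M=M])
        show "0 < A / real n" using A n0 by simp
        show "A / real n \<le> \<kappa>" using nA n0 k by (simp add: field_simps)
        have "M < 2 * \<kappa> * A" using k by (simp add: A_def field_simps)
        then show "M < 2 * real n * \<kappa> * (A / real n)" using n0 by (simp add: field_simps)
        show "1 / (2 * real n) < A / real n" using A n0 by (simp add: field_simps)
        show "\<bar>Im y\<bar> > 1/2" using y r by simp
        show "\<kappa> \<le> Re (root_out (Complex s (Im y)))" for s by (rule qb) (use y in simp)
        show "norm (w_out (Complex s (Im y)) / (2 * root_out (Complex s (Im y)) * (Complex s (Im y))\<^sup>2)) \<le> M" for s
          by (rule Wb) (use y in simp)
        show "Re y \<le> 1" using False by simp
      qed
      then show ?thesis by simp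
    qed
  qed
  show ?thesis
  proof (rule that[OF A(1), of N])
    show "N > 0" by (simp add: N_def)
  qed (use est in \<open>simp add: r_def\<close>)
qed

lemma phi_cnj: "phi n (cnj z) = cnj (phi n z)"
proof (induction n rule: induct_nat_012)
  case (ge2 n) then show ?case unfolding phi_rec by simp
qed (simp_all add: phi_def exp_cnj)

lemma exp_minus_V_at_i: "norm (exp_minus_V \<i>) = 1"
proof -
  have q: "root_out \<i> = of_real (sqrt (3/4))"
    unfolding root_out_def by (subst csqrt_of_real_nonneg) auto
  have "w_out \<i> = Complex (sqrt (3/4)) (1/2)" unfolding w_out_def q by (simp add: complex_eq_iff)
  then have "norm (w_out \<i>) = 1" by (simp add: cmod_def power2_eq_square)
  moreover have "norm (exp (2 * \<i> * root_out \<i>)) = 1" unfolding q by simp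
  ultimately show ?thesis by (simp add: exp_minus_V_def norm_mult)
qed

text \<open>This fixes the size of the ratio at one point. At \<open>y = i\<close> the values of
  \<open>phi\<close> at \<open>2 n y\<close> and \<open>- 2 n y\<close> are complex conjugates,
  so \<open>phi (- z) / phi z\<close> has modulus \<open>1\<close>, as has
  \<open>exp_minus_V\<close>. On the line \<open>Im y = 1\<close> both \<open>bessel_U y\<close>
  and \<open>bessel_U (- y)\<close> are known up to \<open>O(1/n)\<close>, so the logarithmic
  derivative of \<open>phi (- z) / phi z\<close> divided by \<open>exp_minus_V ^ (2 n)\<close>
  is bounded along the segment from \<open>i\<close> to \<open>1 + i\<close>.\<close>

lemma anchor:
  obtains C N where "C > 0" "N > 0"
    "\<And>n. n \<ge> N \<Longrightarrow> level (1 + \<i>) ^ (2 * n) / C \<le> norm (bessel_R n (1 + \<i>)) \<and> norm (bessel_R n (1 + \<i>)) \<le> C * level (1 + \<i>) ^ (2 * n)"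
proof -
  obtain A N1 where A: "A > 0" "N1 > 0" and est:
    "\<And>n y. n \<ge> N1 \<Longrightarrow> \<bar>Im y\<bar> \<ge> 1/2 + 1/2 \<Longrightarrow> phi n (2 * of_nat n * y) \<noteq> 0 \<and> norm (bessel_U n y - w_out y) \<le> A / real n"
    using strip_estimate[of "1/2"] by auto
  define L where "L = level (1 + \<i>)"
  have L: "L > 1" unfolding L_def by (rule level_gt_1_far_right) simp
  define E where "E = exp (4 * A)"
  have E: "E \<ge> 1" using A by (simp add: E_def)
  obtain N2 where N2: "2 * E < L ^ N2" using real_arch_pow[OF L] by blast
  define C where "C = 2 * E"
  have main: "L ^ (2 * n) / C \<le> norm (bessel_R n (1 + \<i>)) \<and> norm (bessel_R n (1 + \<i>)) \<le> C * L ^ (2 * n)" if n: "n \<ge> max N1 N2" for n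
  proof -
    have n0: "n > 0" using n A by auto
    define B where "B y = phi n (- (2 * of_nat n * y)) / phi n (2 * of_nat n * y)" for y
    (* B = 1 + R is used instead of R because its logarithmic derivative is controlled on the
       whole segment, including the end point i on the axis. *)
    define G where "G y = B y / exp_minus_V y ^ (2 * n)" for y
    define g' where "g' y = G y * (2 * of_nat n * (bessel_U n y + bessel_U n (- y) - 2 * root_out y))" for y
    have on: "y \<notin> I_seg" "phi n (2 * of_nat n * y) \<noteq> 0" "phi n (2 * of_nat n * (- y)) \<noteq> 0"
      "norm (bessel_U n y - w_out y) \<le> A / real n" "norm (bessel_U n (- y) - w_out (- y)) \<le> A / real n" "y \<noteq> 0"
      if "Im y = 1" for y
    proof -
      show "y \<notin> I_seg" using that by (simp add: I_seg_iff)
      show "y \<noteq> 0" using that by auto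
    qed (use est[of n y] est[of n "- y"] n that in auto)
    have Gder: "(G has_field_derivative g' y) (at y)" and Gnz: "G y \<noteq> 0" and Gbd: "norm (g' y / G y) \<le> 4 * A"
      if y: "Im y = 1" for y
    proof -
      note o = on[OF y]
      have FWn: "exp_minus_V y \<noteq> 0" by (rule exp_minus_V_nonzero[OF o(6)])
      define a where "a = phi n (2 * of_nat n * (- y))"
      define b where "b = phi n (2 * of_nat n * y)"
      have ab: "a \<noteq> 0" "b \<noteq> 0" using o by (auto simp: a_def b_def)
      have d2: "((\<lambda>y. phi n (2 * of_nat n * y)) has_field_derivative b * (- 2 * of_nat n * bessel_U n y)) (at y)"
      proof -
        have e: "- (2 * of_nat n * y) * phi (n - 1) (2 * of_nat n * y) * (2 * of_nat n) = b * (- 2 * of_nat n * bessel_U n y)"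
          using ab(2) unfolding bessel_U_def b_def[symmetric] by (simp add: field_simps)
        show ?thesis using DERIV_phi_scaled[OF n0, of y] unfolding e .
      qed
      have d1: "((\<lambda>y. phi n (2 * of_nat n * (- y))) has_field_derivative a * (2 * of_nat n * bessel_U n (- y))) (at y)"
      proof -
        have e: "- (2 * of_nat n * (- y)) * phi (n - 1) (2 * of_nat n * (- y)) * (2 * of_nat n) * (- 1) = a * (2 * of_nat n * bessel_U n (- y))"
          using ab(1) unfolding bessel_U_def a_def[symmetric] by (simp add: field_simps)
        have m: "((\<lambda>y::complex. - y) has_field_derivative - 1) (at y)" by (auto intro!: derivative_eq_intros)
        show ?thesis using DERIV_chain2[where f="\<lambda>y. phi n (2 * of_nat n * y)" and g="\<lambda>y. - y" and x=y and s=UNIV, OF DERIV_phi_scaled[OF n0] m] unfolding e .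
      qed
      have d3: "((\<lambda>y. exp_minus_V y ^ (2 * n)) has_field_derivative exp_minus_V y ^ (2 * n) * (2 * of_nat n * (2 * root_out y))) (at y)"
      proof -
        have e: "of_nat (2 * n) * (exp_minus_V y * (2 * root_out y) * exp_minus_V y ^ (2 * n - Suc 0)) = exp_minus_V y ^ (2 * n) * (2 * of_nat n * (2 * root_out y))"
        proof -
          have "exp_minus_V y ^ (2 * n) = exp_minus_V y ^ (2 * n - Suc 0) * exp_minus_V y" using n0 by (metis Suc_pred' One_nat_def mult.commute nat_0_less_mult_iff pos2 power_Suc)
          then show ?thesis by simp
        qed
        show ?thesis using DERIV_power[OF DERIV_exp_minus_V[OF o(1)], of "2 * n"] unfolding e .
      qed
      define f where "f = exp_minus_V y ^ (2 * n)"
      have f: "f \<noteq> 0" using FWn by (simp add: f_def)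
      have Gy: "G y = a / b / f" by (simp add: G_def B_def a_def b_def f_def)
      show "G y \<noteq> 0" using Gy ab f by simp
      have "((\<lambda>y. phi n (2 * of_nat n * (- y)) / phi n (2 * of_nat n * y) / exp_minus_V y ^ (2 * n)) has_field_derivative
         ((a * (2 * of_nat n * bessel_U n (- y)) * b - a * (b * (- 2 * of_nat n * bessel_U n y))) / (b * b) * f - a / b * (f * (2 * of_nat n * (2 * root_out y)))) / (f * f)) (at y)"
        using DERIV_divide[OF DERIV_divide[OF d1 d2] d3] ab f unfolding a_def[symmetric] b_def[symmetric] f_def[symmetric] by blast
      moreover have "((a * (2 * of_nat n * bessel_U n (- y)) * b - a * (b * (- 2 * of_nat n * bessel_U n y))) / (b * b) * f - a / b * (f * (2 * of_nat n * (2 * root_out y)))) / (f * f) = g' y"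
        unfolding g'_def Gy using ab f by (simp add: field_simps)
      moreover have "(\<lambda>y. phi n (2 * of_nat n * (- y)) / phi n (2 * of_nat n * y) / exp_minus_V y ^ (2 * n)) = G"
        by (simp add: G_def[abs_def] B_def)
      ultimately show "(G has_field_derivative g' y) (at y)" by simp
      have "g' y / G y = 2 * of_nat n * ((bessel_U n y - w_out y) + (bessel_U n (- y) - w_out (- y)))"
        using \<open>G y \<noteq> 0\<close> unfolding g'_def w_out_minus[OF o(6)] w_out_plus_inverse[OF o(6), symmetric] by simp
      then have "norm (g' y / G y) = 2 * real n * norm ((bessel_U n y - w_out y) + (bessel_U n (- y) - w_out (- y)))" by (simp add: norm_mult)
      also have "\<dots> \<le> 2 * real n * (A / real n + A / real n)"
        by (intro mult_left_mono order_trans[OF norm_triangle_ineq] add_mono o) auto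
      also have "\<dots> = 4 * A" using n0 by (simp add: field_simps)
      finally show "norm (g' y / G y) \<le> 4 * A" .
    qed
    have seg: "Im z = 1" if "z \<in> closed_segment \<i> (1 + \<i>) \<or> z \<in> closed_segment (1 + \<i>) \<i>" for z
      using that by (auto simp: closed_segment_def)
    have 1: "norm (G (1 + \<i>)) \<le> norm (G \<i>) * exp (4 * A * norm ((1 + \<i>) - \<i>))"
      by (rule norm_le_exp_log_deriv_bound[where g'=g']) (use seg Gder Gnz Gbd in blast)+
    have 2: "norm (G \<i>) \<le> norm (G (1 + \<i>)) * exp (4 * A * norm (\<i> - (1 + \<i>)))"
      by (rule norm_le_exp_log_deriv_bound[where g'=g']) (use seg Gder Gnz Gbd in blast)+
    have Gi: "norm (G \<i>) = 1"
    proof -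
      have "phi n (- (2 * of_nat n * \<i>)) = cnj (phi n (2 * of_nat n * \<i>))"
        using phi_cnj[of n "2 * of_nat n * \<i>"] by simp
      then have "norm (B \<i>) = 1" using on(2)[of \<i>] by (simp add: B_def norm_divide)
      then show ?thesis by (simp add: G_def norm_divide norm_power exp_minus_V_at_i)
    qed
    have LF: "L = norm (exp_minus_V (1 + \<i>))" unfolding L_def by (rule level_eq_exp_minus_V) simp
    have Lp: "L ^ (2 * n) > 0" using L by simp
    have nB: "norm (B (1 + \<i>)) = norm (G (1 + \<i>)) * L ^ (2 * n)"
    proof -
      have "exp_minus_V (1 + \<i>) \<noteq> 0" using LF L by auto
      then show ?thesis unfolding G_def LF by (simp add: norm_divide norm_power)
    qed
    have up: "norm (B (1 + \<i>)) \<le> E * L ^ (2 * n)"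
      unfolding nB using 1 Lp unfolding Gi by (intro mult_right_mono) (auto simp: E_def)
    have lo: "L ^ (2 * n) \<le> E * norm (B (1 + \<i>))"
    proof -
      have "1 \<le> norm (G (1 + \<i>)) * E" using 2 unfolding Gi by (simp add: E_def norm_minus_commute)
      then have "1 * L ^ (2 * n) \<le> norm (G (1 + \<i>)) * E * L ^ (2 * n)" using Lp by (intro mult_right_mono) auto
      then show ?thesis unfolding nB by (simp add: mult_ac)
    qed
    have Rb: "bessel_R n (1 + \<i>) = B (1 + \<i>) - 1"
    proof -
      have "phi n (2 * of_nat n * (1 + \<i>)) \<noteq> 0" using on(2)[of "1 + \<i>"] by simp
      then show ?thesis by (simp add: bessel_R_def B_def psi_def field_simps)
    qed
    have L2: "2 * E \<le> L ^ (2 * n)"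
    proof -
      have "L ^ N2 \<le> L ^ (2 * n)" using L n by (intro power_increasing) auto
      then show ?thesis using N2 by simp
    qed
    have "norm (bessel_R n (1 + \<i>)) \<le> norm (B (1 + \<i>)) + 1" unfolding Rb using norm_triangle_ineq4[of "B (1 + \<i>)" 1] by simp
    also have "\<dots> \<le> E * L ^ (2 * n) + E * L ^ (2 * n)"
    proof -
      have "1 * 1 \<le> E * L ^ (2 * n)" using E L by (intro mult_mono) auto
      then show ?thesis using up by simp
    qed
    finally have u: "norm (bessel_R n (1 + \<i>)) \<le> C * L ^ (2 * n)" by (simp add: C_def)
    have "norm (B (1 + \<i>)) \<le> norm (bessel_R n (1 + \<i>)) + 1" unfolding Rb using norm_triangle_ineq2[of "B (1 + \<i>)" 1] by simp
    then have "L ^ (2 * n) \<le> E * (norm (bessel_R n (1 + \<i>)) + 1)" using lo E by (smt (verit) mult_left_mono)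
    then have "L ^ (2 * n) \<le> C * norm (bessel_R n (1 + \<i>))" using L2 by (simp add: C_def algebra_simps)
    then show ?thesis using u E by (simp add: C_def field_simps)
  qed
  show ?thesis
  proof (rule that[of C "max N1 N2"])
    show "0 < C" using E by (simp add: C_def)
    show "0 < max N1 N2" using A by simp
  qed (use main in \<open>simp add: L_def\<close>)
qed

text \<open>The logarithmic derivatives of \<open>bessel_R\<close> and of \<open>exp_minus_V ^ (2
  n)\<close> differ by \<open>2 n\<close> times the sum of the errors in
  \<open>bessel_U_estimate\<close> and \<open>bessel_J_estimate\<close>, that is by at most
  \<open>2 / Re y\<close>. Integrating from the anchor point gives the bounds.\<close>

lemma bessel_R_two_sided:
  assumes \<delta>: "0 < \<delta>" "\<delta> \<le> 1" and M: "M \<ge> 0"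
  obtains C N where "C > 0" "N > 0"
    "\<And>n t. n \<ge> N \<Longrightarrow> \<delta> \<le> Re t \<Longrightarrow> norm t \<le> M \<Longrightarrow>
       level t ^ (2 * n) / C \<le> norm (bessel_R n t) \<and> norm (bessel_R n t) \<le> C * level t ^ (2 * n)"
proof -
  obtain C0 N where C0: "C0 > 0" "N > 0" and an:
    "\<And>n. n \<ge> N \<Longrightarrow> level (1 + \<i>) ^ (2 * n) / C0 \<le> norm (bessel_R n (1 + \<i>)) \<and> norm (bessel_R n (1 + \<i>)) \<le> C0 * level (1 + \<i>) ^ (2 * n)"
    using anchor by blast
  define K where "K = exp (2 / \<delta> * (M + 2))"
  have K: "K > 0" by (simp add: K_def)
  have main: "level t ^ (2 * n) / (C0 * K) \<le> norm (bessel_R n t) \<and> norm (bessel_R n t) \<le> C0 * K * level t ^ (2 * n)"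
    if n: "n \<ge> N" and t: "\<delta> \<le> Re t" "norm t \<le> M" for n t
  proof -
    have n0: "n > 0" using n C0 by simp
    define Q where "Q y = bessel_R n y / exp_minus_V y ^ (2 * n)" for y
    define g' where "g' y = Q y * (2 * of_nat n * (bessel_J n y + bessel_U n y - 2 * root_out y))" for y
    have Qder: "(Q has_field_derivative g' y) (at y)" and Qnz: "Q y \<noteq> 0" and Qbd: "norm (g' y / Q y) \<le> 2 / \<delta>"
      if y: "Re y \<ge> \<delta>" for y
    proof -
      have Ry: "Re y > 0" using y \<delta> by simp
      have yI: "y \<notin> I_seg" using Ry by (simp add: I_seg_iff)
      have y0: "y \<noteq> 0" by (rule nonzero_off_I_seg[OF yI])
      have FWn: "exp_minus_V y \<noteq> 0" by (rule exp_minus_V_nonzero[OF y0])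
      define r where "r = bessel_R n y"
      have r: "r \<noteq> 0" unfolding r_def by (rule bessel_R_nonzero[OF n0 Ry])
      define f where "f = exp_minus_V y ^ (2 * n)"
      have f: "f \<noteq> 0" using FWn by (simp add: f_def)
      have d3: "((\<lambda>y. exp_minus_V y ^ (2 * n)) has_field_derivative f * (2 * of_nat n * (2 * root_out y))) (at y)"
      proof -
        have e: "of_nat (2 * n) * (exp_minus_V y * (2 * root_out y) * exp_minus_V y ^ (2 * n - Suc 0)) = f * (2 * of_nat n * (2 * root_out y))"
        proof -
          have "f = exp_minus_V y ^ (2 * n - Suc 0) * exp_minus_V y" unfolding f_def using n0 by (metis Suc_pred' One_nat_def mult.commute nat_0_less_mult_iff pos2 power_Suc)
          then show ?thesis by simp
        qed
        show ?thesis using DERIV_power[OF DERIV_exp_minus_V[OF yI], of "2 * n"] unfolding e .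
      qed
      have d1: "(bessel_R n has_field_derivative r * (2 * of_nat n * (bessel_J n y + bessel_U n y))) (at y)"
        unfolding r_def by (rule DERIV_bessel_R[OF n0 Ry])
      have Qy: "Q y = r / f" by (simp add: Q_def r_def f_def)
      show "Q y \<noteq> 0" using Qy r f by simp
      have "(Q has_field_derivative (r * (2 * of_nat n * (bessel_J n y + bessel_U n y)) * f - r * (f * (2 * of_nat n * (2 * root_out y)))) / (f * f)) (at y)"
        unfolding Q_def[abs_def] using DERIV_divide[OF d1 d3] f unfolding r_def[symmetric] f_def[symmetric] by blast
      moreover have "(r * (2 * of_nat n * (bessel_J n y + bessel_U n y)) * f - r * (f * (2 * of_nat n * (2 * root_out y)))) / (f * f) = g' y"
        unfolding g'_def Qy using f by (simp add: field_simps)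
      ultimately show "(Q has_field_derivative g' y) (at y)" by simp
      have "g' y / Q y = 2 * of_nat n * ((bessel_J n y - 1 / w_out y) + (bessel_U n y - w_out y))"
        using \<open>Q y \<noteq> 0\<close> unfolding g'_def w_out_plus_inverse[OF y0, symmetric] by simp
      then have "norm (g' y / Q y) = 2 * real n * norm ((bessel_J n y - 1 / w_out y) + (bessel_U n y - w_out y))" by (simp add: norm_mult)
      also have "\<dots> \<le> 2 * real n * (1 / (2 * real n * Re y) + 1 / (2 * real n * Re y))"
        by (intro mult_left_mono order_trans[OF norm_triangle_ineq] add_mono bessel_J_estimate bessel_U_estimate n0 Ry) auto
      also have "\<dots> = 2 / Re y" using n0 Ry by (simp add: field_simps)
      also have "\<dots> \<le> 2 / \<delta>" using y \<delta> by (intro divide_left_mono) auto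
      finally show "norm (g' y / Q y) \<le> 2 / \<delta>" .
    qed
    define a where "a = 1 + \<i>"
    have seg: "Re z \<ge> \<delta>" if "z \<in> closed_segment a t \<or> z \<in> closed_segment t a" for z
    proof -
      have "convex {z. Re z \<ge> \<delta>}" by (rule convex_halfspace_Re_ge)
      moreover have "a \<in> {z. Re z \<ge> \<delta>}" "t \<in> {z. Re z \<ge> \<delta>}" using t \<delta> by (auto simp: a_def)
      ultimately have "closed_segment a t \<subseteq> {z. Re z \<ge> \<delta>}" by (intro closed_segment_subset)
      then show ?thesis using that closed_segment_commute[of t a] by auto
    qed
    have "norm a \<le> 2" using norm_triangle_ineq[of 1 "\<i>"] by (simp add: a_def)
    then have len: "norm (t - a) \<le> M + 2" "norm (a - t) \<le> M + 2"
      using norm_triangle_ineq4[of t a] t(2) by (auto simp: norm_minus_commute)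
    have "exp (2 / \<delta> * norm (t - a)) \<le> K" "exp (2 / \<delta> * norm (a - t)) \<le> K"
      unfolding K_def using len \<delta> by (auto intro!: divide_right_mono)
    moreover have "norm (Q t) \<le> norm (Q a) * exp (2 / \<delta> * norm (t - a))"
      by (rule norm_le_exp_log_deriv_bound[where g'=g']) (use seg Qder Qnz Qbd in blast)+
    moreover have "norm (Q a) \<le> norm (Q t) * exp (2 / \<delta> * norm (a - t))"
      by (rule norm_le_exp_log_deriv_bound[where g'=g']) (use seg Qder Qnz Qbd in blast)+
    ultimately have Q: "norm (Q t) \<le> norm (Q a) * K" "norm (Q a) \<le> norm (Q t) * K"
      by (meson mult_left_mono norm_ge_zero order_trans)+
    have lp: "level z > 0" if "Re z > 0" for z
    proof -
      have "z \<noteq> 0" using that by auto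
      then show ?thesis using level_eq_exp_minus_V[OF that] exp_minus_V_nonzero[of z] by simp
    qed
    have la: "level a > 0" "level t > 0" using lp[of a] lp[of t] t \<delta> by (auto simp: a_def)
    have Rn: "norm (bessel_R n z) = norm (Q z) * level z ^ (2 * n)" if "Re z > 0" for z
    proof -
      have "z \<noteq> 0" using that by auto
      then have "exp_minus_V z \<noteq> 0" by (rule exp_minus_V_nonzero)
      then show ?thesis unfolding Q_def level_eq_exp_minus_V[OF that] by (simp add: norm_divide norm_power)
    qed
    have ra: "Re a > 0" "Re t > 0" using t \<delta> by (auto simp: a_def)
    have pa: "level a ^ (2 * n) > 0" "level t ^ (2 * n) > 0" using la by auto
    from an[OF n, folded a_def] have "1 / C0 \<le> norm (Q a)" "norm (Q a) \<le> C0"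
      unfolding Rn[OF ra(1)] using pa(1) C0(1) by (auto simp: field_simps)
    then have "norm (Q t) \<le> C0 * K" "1 / C0 \<le> norm (Q t) * K"
      using Q K by (auto intro: order_trans mult_right_mono)
    then show ?thesis unfolding Rn[OF ra(2)] using pa(2) C0 K by (auto simp: field_simps)
  qed
  show ?thesis by (rule that[of "C0 * K" N]) (use C0 K main in auto)
qed

section \<open>The asymptotics for the first rational solution\<close>

text \<open>For small \<open>R\<close> the Moebius formula of \<open>bessel_U_reflect\<close> gives
  \<open>- U(t)\<close>, close to \<open>- w_out t\<close>, the inner branch at \<open>-
  t\<close>.\<close>

lemma bessel_U_reflect_small:
  assumes n: "n > 0" and t: "Re t > 0" and R: "norm (bessel_R n t) \<le> 1/2"
  shows "norm (bessel_U n (- t) + w_out t) \<le> 2 * (1 / (2 * real n * Re t) + norm (bessel_R n t) * (2 * norm (root_out t) + 1 / (2 * real n * Re t)))"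
proof -
  have t0: "t \<noteq> 0" using t by auto
  define R where "R = bessel_R n t"
  have n1: "norm (1 + R) \<ge> 1/2" using norm_triangle_ineq2[of 1 "- R"] assms(3) by (simp add: R_def)
  then have nz: "1 + R \<noteq> 0" by auto
  have "bessel_U n (- t) + w_out t = ((w_out t - bessel_U n t) + R * ((bessel_J n t - 1 / w_out t) + (w_out t + 1 / w_out t))) / (1 + R)"
    using bessel_U_reflect(2)[OF n t] nz unfolding R_def[symmetric] by (simp add: field_simps)
  moreover have tri: "norm (bessel_J n t + w_out t) \<le> norm (bessel_J n t - 1 / w_out t) + norm (w_out t + 1 / w_out t)"
    using norm_triangle_ineq[of "bessel_J n t - 1 / w_out t" "w_out t + 1 / w_out t"] by simp
  ultimately have "norm (bessel_U n (- t) + w_out t) \<le> (norm (w_out t - bessel_U n t) + norm R * (norm (bessel_J n t - 1 / w_out t) + norm (w_out t + 1 / w_out t))) / norm (1 + R)"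
    by (simp only: norm_divide) (intro divide_right_mono order_trans[OF norm_triangle_ineq] add_mono order_refl,
      auto simp: norm_mult intro!: mult_left_mono)
  also have "\<dots> \<le> (1 / (2 * real n * Re t) + norm R * (1 / (2 * real n * Re t) + 2 * norm (root_out t))) / norm (1 + R)"
    using bessel_U_estimate[OF n t] bessel_J_estimate[OF n t]
    by (intro divide_right_mono add_mono mult_left_mono) (auto simp: norm_minus_commute w_out_plus_inverse[OF t0] norm_mult)
  also have "\<dots> \<le> (1 / (2 * real n * Re t) + norm R * (1 / (2 * real n * Re t) + 2 * norm (root_out t))) / (1/2)"
    using n1 nz t n by (intro divide_left_mono) (auto intro!: add_nonneg_nonneg mult_nonneg_nonneg)
  finally show ?thesis by (simp add: R_def add.commute)
qed

text \<open>For large \<open>R\<close> it gives \<open>J(t)\<close>, close to \<open>1 / w_out t\<close>,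
  the outer branch at \<open>- t\<close>.\<close>

lemma bessel_U_reflect_large:
  assumes n: "n > 0" and t: "Re t > 0" and R: "norm (bessel_R n t) \<ge> 2"
  shows "norm (bessel_U n (- t) - 1 / w_out t) \<le> 2 * (1 / (2 * real n * Re t)) + 2 / norm (bessel_R n t) * (2 * norm (root_out t) + 1 / (2 * real n * Re t))"
proof -
  have t0: "t \<noteq> 0" using t by auto
  define R where "R = bessel_R n t"
  have n1: "norm (1 + R) \<ge> norm R / 2" using norm_triangle_ineq2[of R "- 1"] assms(3) by (simp add: R_def add.commute)
  have R0: "norm R \<ge> 2" using assms(3) by (simp add: R_def)
  then have np: "norm (1 + R) > 0" using n1 by linarith
  then have nz: "1 + R \<noteq> 0" by auto
  have "bessel_U n (- t) - 1 / w_out t = ((bessel_J n t - 1 / w_out t) * R - ((bessel_U n t - w_out t) + (w_out t + 1 / w_out t))) / (1 + R)"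
  proof -
    have gen: "(J * R - U) / (1 + R) - v = ((J - v) * R - ((U - w) + (w + v))) / (1 + R)" for J U v w :: complex
      using nz by (simp add: field_simps)
    have "bessel_U n (- t) = (bessel_J n t * R - bessel_U n t) / (1 + R)" using bessel_U_reflect(2)[OF n t] nz by (simp add: R_def)
    then show ?thesis by (simp only: gen)
  qed
  also have "norm \<dots> \<le> (norm (bessel_J n t - 1 / w_out t) * norm R + (norm (bessel_U n t - w_out t) + norm (w_out t + 1 / w_out t))) / norm (1 + R)"
  proof -
    have tri: "norm (bessel_U n t + 1 / w_out t) \<le> norm (bessel_U n t - w_out t) + norm (w_out t + 1 / w_out t)"
      using norm_triangle_ineq[of "bessel_U n t - w_out t" "w_out t + 1 / w_out t"] by simp
    show ?thesis unfolding norm_divide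
      by (intro divide_right_mono order_trans[OF norm_triangle_ineq4] add_mono) (use tri in \<open>auto simp: norm_mult\<close>)
  qed
  also have "\<dots> \<le> (1 / (2 * real n * Re t) * norm R + (1 / (2 * real n * Re t) + 2 * norm (root_out t))) / norm (1 + R)"
    using bessel_U_estimate[OF n t] bessel_J_estimate[OF n t]
    by (intro divide_right_mono add_mono mult_right_mono) (auto simp: w_out_plus_inverse[OF t0] norm_mult)
  also have "\<dots> \<le> (1 / (2 * real n * Re t) * norm R + (1 / (2 * real n * Re t) + 2 * norm (root_out t))) / (norm R / 2)"
  proof (rule divide_left_mono[OF n1])
    show "0 < norm (1 + R) * (norm R / 2)" using np R0 by (intro mult_pos_pos) auto
  qed (use t n in \<open>auto intro!: add_nonneg_nonneg mult_nonneg_nonneg\<close>)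
  also have "\<dots> = 2 * (1 / (2 * real n * Re t)) + 2 / norm R * (2 * norm (root_out t) + 1 / (2 * real n * Re t))"
  proof -
    define x where "x = 1 / (2 * real n * Re t)"
    have "norm R \<noteq> 0" using R0 by auto
    then show ?thesis unfolding x_def[symmetric] by (simp add: field_simps)
  qed
  finally show ?thesis by (simp add: R_def)
qed

lemma power_two_n_ge: "\<kappa> > 0 \<Longrightarrow> 2 * real n * \<kappa> \<le> (1 + \<kappa>) ^ (2 * n)"
  using Bernoulli_inequality[of \<kappa> "2 * n"] by simp

text \<open>Bernoulli's inequality turns exponential smallness into the order \<open>1/n\<close> that is
  needed.\<close>

lemma power_two_n_le: assumes "0 < \<kappa>" "\<kappa> < 1" "0 \<le> l" "l \<le> 1 - \<kappa>" "n > 0" shows "l ^ (2 * n) \<le> 1 / (2 * real n * \<kappa>)"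
proof -
  have "l * (1 + \<kappa>) \<le> (1 - \<kappa>) * (1 + \<kappa>)" using assms by (intro mult_right_mono) auto
  also have "\<dots> \<le> 1" using assms by (simp add: algebra_simps)
  finally have "(l * (1 + \<kappa>)) ^ (2 * n) \<le> 1" using assms by (intro power_le_one) auto
  then have "l ^ (2 * n) * (1 + \<kappa>) ^ (2 * n) \<le> 1" by (simp add: power_mult_distrib)
  moreover have "l ^ (2 * n) * (2 * real n * \<kappa>) \<le> l ^ (2 * n) * (1 + \<kappa>) ^ (2 * n)"
    using power_two_n_ge[OF assms(1), of n] assms(3) by (intro mult_left_mono) auto
  ultimately have "l ^ (2 * n) * (2 * real n * \<kappa>) \<le> 1" by linarith
  then show ?thesis using assms by (simp add: field_simps)
qed

lemma level_small_near_segment: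
  assumes d: "0 < d" "d < 1/2"
  obtains r \<kappa> where "0 < r" "0 < \<kappa>" "\<kappa> < 1" "\<And>y. \<bar>Re y\<bar> \<le> r \<Longrightarrow> \<bar>Im y\<bar> \<le> 1/2 - d \<Longrightarrow> level y \<le> 1 - \<kappa>"
proof -
  define K where "K = closed_segment (Complex 0 (- (1/2 - d))) (Complex 0 (1/2 - d))"
  have Keq: "K = {z. Re z = 0 \<and> Im z \<in> closed_segment (- (1/2 - d)) (1/2 - d)}"
    unfolding K_def by (subst closed_segment_same_Re) simp_all
  have "closed_segment (- (1/2 - d)) (1/2 - d) = {- (1/2 - d)..1/2 - d}"
    using d by (simp add: closed_segment_eq_real_ivl)
  then have K: "y \<in> K \<longleftrightarrow> Re y = 0 \<and> \<bar>Im y\<bar> \<le> 1/2 - d" for y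
    unfolding Keq by (simp only: mem_Collect_eq atLeastAtMost_iff) linarith
  have "compact K" unfolding K_def by (rule compact_segment)
  moreover have "K \<subseteq> {y. level y < 1}" using level_on_segment d by (auto simp: K)
  ultimately obtain e where e: "e > 0" "(\<Union>x\<in>K. ball x e) \<subseteq> {y. level y < 1}"
    using compact_subset_open_imp_ball_epsilon_subset[of K "{y. level y < 1}"] open_level(1) by blast
  define r where "r = e / 2"
  define B where "B = cbox (Complex (- r) (- (1/2 - d))) (Complex r (1/2 - d))"
  have B: "y \<in> B \<longleftrightarrow> \<bar>Re y\<bar> \<le> r \<and> \<bar>Im y\<bar> \<le> 1/2 - d" for y
    by (auto simp: B_def in_cbox_complex_iff abs_le_iff)
  have "compact B" unfolding B_def by (rule compact_cbox)
  moreover have "0 \<in> B" using d e by (simp add: B r_def)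
  ultimately obtain y0 where y0: "y0 \<in> B" "\<And>y. y \<in> B \<Longrightarrow> level y \<le> level y0"
    using continuous_attains_sup[of B level] continuous_on_subset[OF continuous_level] by blast
  have l1: "level y0 < 1"
  proof -
    have "Complex 0 (Im y0) \<in> K" using y0(1) by (simp add: K B)
    moreover have "dist (Complex 0 (Im y0)) y0 < e"
    proof -
      have "Complex 0 (Im y0) - y0 = - of_real (Re y0)" by (simp add: complex_eq_iff)
      then show ?thesis using y0(1) e unfolding dist_norm by (simp add: B r_def)
    qed
    ultimately have "y0 \<in> (\<Union>x\<in>K. ball x e)" by (intro UN_I[of "Complex 0 (Im y0)"]) simp_all
    then show ?thesis using e(2) by blast
  qed
  show ?thesis
  proof (rule that[of r "(1 - level y0) / 2"])
    have "level y0 \<ge> 0" by (simp add: level_def)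
    then show "(1 - level y0) / 2 < 1" by simp
    fix y assume "\<bar>Re y\<bar> \<le> r" "\<bar>Im y\<bar> \<le> 1/2 - d"
    then have "level y \<le> level y0" by (intro y0(2)) (simp add: B)
    then show "level y \<le> 1 - (1 - level y0) / 2" using l1 by (simp add: field_simps)
  qed (use e l1 in \<open>auto simp: r_def\<close>)
qed

text \<open>On both sides of the segment the error is \<open>O(1 / (n |Re y|))\<close>: on the right by
  \<open>bessel_U_estimate\<close>, on the left because \<open>bessel_R\<close> is small, being
  increasing in the real part and exponentially small at distance \<open>r\<close> from the
  axis. The maximum principle of \<open>disc_max_crossing_axis\<close> removes the factor
  \<open>1 / |Re y|\<close>.\<close>

lemma bessel_near_segment:
  assumes d: "0 < d" "d < 1/4"
  obtains r C N where "0 < r" "C > 0" "N > 0"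
    "\<And>n y. n \<ge> N \<Longrightarrow> \<bar>Re y\<bar> \<le> r \<Longrightarrow> \<bar>Im y\<bar> \<le> 1/2 - 2 * d \<Longrightarrow>
       level y < 1 \<and> phi n (2 * of_nat n * y) \<noteq> 0 \<and> norm (bessel_U n y - w_in y) \<le> C / real n"
proof -
  obtain r1 \<kappa> where r1: "0 < r1" "0 < \<kappa>" "\<kappa> < 1" and lev1: "\<And>y. \<bar>Re y\<bar> \<le> r1 \<Longrightarrow> \<bar>Im y\<bar> \<le> 1/2 - d \<Longrightarrow> level y \<le> 1 - \<kappa>"
    using level_small_near_segment[of d] d by auto
  define r where "r = min r1 d"
  have r: "0 < r" "r \<le> r1" "r \<le> d" "r \<le> 1" using r1 d by (auto simp: r_def)
  obtain C1 N1 where C1: "C1 > 0" "N1 > 0" and Rest: "\<And>n t. n \<ge> N1 \<Longrightarrow> r \<le> Re t \<Longrightarrow> norm t \<le> 2 \<Longrightarrow>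
       level t ^ (2 * n) / C1 \<le> norm (bessel_R n t) \<and> norm (bessel_R n t) \<le> C1 * level t ^ (2 * n)"
    using bessel_R_two_sided[of r 2] r by auto
  define C2 where "C2 = C1 / (2 * \<kappa>)"
  define N where "N = N1 + nat \<lceil>2 * C2\<rceil>"
  have C2: "C2 > 0" using C1 r1 by (simp add: C2_def)
  define M where "M = 2 + 8 * C2"
  have Rs: "norm (bessel_R n t) \<le> C2 / real n" "norm (bessel_R n t) \<le> 1/2"
    if n: "n \<ge> N" and t: "0 \<le> Re t" "Re t \<le> r" "\<bar>Im t\<bar> \<le> 1/2 - d" for n t
  proof -
    have n0: "n > 0" "n \<ge> N1" using n C1 by (auto simp: N_def)
    define t' where "t' = Complex r (Im t)"
    have "norm (bessel_R n t) \<le> norm (bessel_R n t')"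
      using bessel_R_increasing[OF n0(1) t(1), of r "Im t"] t unfolding t'_def
      by (cases "Re t = r") (auto simp: less_le)
    also have "\<dots> \<le> C1 * level t' ^ (2 * n)"
    proof -
      have "norm t' \<le> 2" using cmod_le[of t'] r t(3) d unfolding t'_def by simp
      then show ?thesis using Rest[OF n0(2), of t'] by (simp add: t'_def)
    qed
    also have "level t' ^ (2 * n) \<le> 1 / (2 * real n * \<kappa>)"
    proof (rule power_two_n_le[OF r1(2,3) _ _ n0(1)])
      show "level t' \<le> 1 - \<kappa>" by (rule lev1) (use r t in \<open>auto simp: t'_def\<close>)
    qed (simp add: level_def)
    finally have "norm (bessel_R n t) \<le> C1 * (1 / (2 * real n * \<kappa>))" using C1 by simp
    moreover have "C1 * (1 / (2 * real n * \<kappa>)) = C2 / real n" by (simp add: C2_def)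
    ultimately show 1: "norm (bessel_R n t) \<le> C2 / real n" by simp
    have "2 * C2 \<le> real n" using n unfolding N_def by linarith
    then have "C2 / real n \<le> 1/2" using n0 by (simp add: field_simps)
    then show "norm (bessel_R n t) \<le> 1/2" using 1 by linarith
  qed
  have phn: "phi n (2 * of_nat n * y) \<noteq> 0" if n: "n \<ge> N" and y: "\<bar>Re y\<bar> \<le> r" "\<bar>Im y\<bar> \<le> 1/2 - d" for n y
  proof (cases "Re y \<ge> 0")
    case True
    have "n > 0" using n C1 by (auto simp: N_def)
    then show ?thesis using phi_right[of n y] True by simp
  next
    case False
    have n0: "n > 0" using n C1 by (auto simp: N_def)
    have t: "Re (- y) > 0" using False by simp
    have "norm (bessel_R n (- y)) \<le> 1/2" by (rule Rs(2)[OF n]) (use y False in auto)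
    then have "1 + bessel_R n (- y) \<noteq> 0" using norm_triangle_ineq2[of 1 "- bessel_R n (- y)"] by force
    moreover have "phi n (2 * of_nat n * (- y)) \<noteq> 0" using phi_right[OF n0, of "- y"] t by simp
    ultimately show ?thesis using bessel_U_reflect(1)[OF n0 t] by simp
  qed
  have main: "level y < 1 \<and> phi n (2 * of_nat n * y) \<noteq> 0 \<and> norm (bessel_U n y - w_in y) \<le> 3 * M / r / real n"
    if n: "n \<ge> N" and y: "\<bar>Re y\<bar> \<le> r / 2" "\<bar>Im y\<bar> \<le> 1/2 - 2 * d" for n y
  proof (intro conjI)
    have n0: "n > 0" using n C1 by (auto simp: N_def)
    have "level y \<le> 1 - \<kappa>" by (rule lev1) (use y r d in auto)
    then show "level y < 1" using r1 by simp
    show "phi n (2 * of_nat n * y) \<noteq> 0" by (rule phn[OF n]) (use y r d in auto)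
    define c where "c = Complex 0 (Im y)"
    define T where "T = {y. phi n (2 * of_nat n * y) \<noteq> 0} \<inter> {y. level y < 1}"
    have box: "\<bar>Re z\<bar> \<le> r" "\<bar>Im z\<bar> \<le> 1/2 - d" if "norm (z - c) \<le> r" for z
    proof -
      show "\<bar>Re z\<bar> \<le> r" using abs_Re_le_cmod[of "z - c"] that by (simp add: c_def)
      have "\<bar>Im z - Im y\<bar> \<le> d" using abs_Im_le_cmod[of "z - c"] that r by (simp add: c_def)
      then show "\<bar>Im z\<bar> \<le> 1/2 - d" using y by linarith
    qed
    have "norm (bessel_U n y - w_in y) \<le> 3 * (M / real n) / r"
    proof (rule disc_max_crossing_axis[of "\<lambda>y. bessel_U n y - w_in y" T c r])
      have "bessel_U n holomorphic_on T" unfolding bessel_U_def phi_def T_def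
        by (intro holomorphic_intros) auto
      moreover have "w_in holomorphic_on T" by (rule holomorphic_on_subset[OF holomorphic_w_in]) (auto simp: T_def)
      ultimately show "(\<lambda>y. bessel_U n y - w_in y) holomorphic_on T" by (rule holomorphic_on_diff)
      have "continuous_on UNIV (\<lambda>y. phi n (2 * of_nat n * y))"
        by (rule continuous_on_compose2[OF continuous_phi _ subset_UNIV]) (intro continuous_intros)
      then have "open {y. phi n (2 * of_nat n * y) \<noteq> 0}" by (rule open_Collect_neq) (rule continuous_on_const)
      then show "open T" unfolding T_def using open_level(1) by (rule open_Int)
      show "cball c r \<subseteq> T"
      proof
        fix z assume "z \<in> cball c r"
        then have "norm (z - c) \<le> r" by (simp add: dist_norm norm_minus_commute)
        from box[OF this] show "z \<in> T" using phn[OF n] lev1[of z] r r1 by (auto simp: T_def)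
      qed
      show "norm (y - c) \<le> r / 2"
      proof -
        have "y - c = of_real (Re y)" by (simp add: c_def complex_eq_iff)
        then show ?thesis using y by simp
      qed
      fix z assume z: "norm (z - c) = r" "Re z \<noteq> 0"
      note bz = box[of z] 
      show "norm (bessel_U n z - w_in z) * \<bar>Re z\<bar> \<le> M / real n"
      proof (cases "Re z > 0")
        case True
        have "norm (bessel_U n z - w_in z) * \<bar>Re z\<bar> \<le> 1 / (2 * real n * Re z) * Re z"
        proof -
          have "norm (bessel_U n z - w_out z) * Re z \<le> 1 / (2 * real n * Re z) * Re z"
            by (rule mult_right_mono[OF bessel_U_estimate[OF n0 True]]) (use True in simp)
          then show ?thesis unfolding w_in_eq_w_out[OF True] using True by (simp only: abs_of_pos)
        qed
        also have "\<dots> = (1/2) / real n" using True by simp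
        also have "\<dots> \<le> M / real n" using C2 by (intro divide_right_mono) (auto simp: M_def)
        finally show ?thesis .
      next
        case False
        define t where "t = - z"
        have t: "Re t > 0" using False z by (simp add: t_def)
        have tb: "Re t \<le> r" "\<bar>Im t\<bar> \<le> 1/2 - d" using bz z by (auto simp: t_def)
        have R: "norm (bessel_R n t) \<le> C2 / real n" "norm (bessel_R n t) \<le> 1/2" using Rs[OF n _ tb] t by auto
        have "w_in z = - w_out t" using arg_cong[OF w_in_eq_w_out[OF t], of uminus] by (simp add: t_def w_in_minus)
        then have "norm (bessel_U n z - w_in z) = norm (bessel_U n (- t) + w_out t)" by (simp add: t_def)
        also have "\<dots> \<le> 2 * (1 / (2 * real n * Re t) + norm (bessel_R n t) * (2 * norm (root_out t) + 1 / (2 * real n * Re t)))"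
          by (rule bessel_U_reflect_small[OF n0 t R(2)])
        finally have "norm (bessel_U n z - w_in z) * Re t \<le> 2 * (1 / (2 * real n * Re t) + norm (bessel_R n t) * (2 * norm (root_out t) + 1 / (2 * real n * Re t))) * Re t"
          using t by (intro mult_right_mono) auto
        also have "\<dots> = 2 * (1 / (2 * real n)) + 2 * norm (bessel_R n t) * (2 * norm (root_out t) * Re t + 1 / (2 * real n))"
          using t n0 by (simp add: field_simps)
        also have "\<dots> \<le> 2 * (1 / (2 * real n)) + 2 * (C2 / real n) * (3 + 1)"
        proof (intro add_mono mult_mono order_refl)
          have "2 * norm (root_out t) * Re t \<le> norm (2 * t * root_out t)"
            using mult_right_mono[OF complex_Re_le_cmod[of t] norm_ge_zero[of "root_out t"]] by (simp add: norm_mult mult_ac)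
          also have "\<dots> = sqrt (norm (1 + 4 * t\<^sup>2))" unfolding root_in_eq[OF t, symmetric] root_in_def by simp
          also have "norm (1 + 4 * t\<^sup>2) \<le> 3\<^sup>2"
          proof -
            have "norm t \<le> 1" using cmod_le[of t] tb r d t by linarith
            then have "(norm t)\<^sup>2 \<le> 1" by (simp add: power_le_one)
            then show ?thesis using norm_triangle_ineq[of 1 "4 * t\<^sup>2"] by (simp add: norm_mult norm_power)
          qed
          finally show "2 * norm (root_out t) * Re t \<le> 3" by simp
          show "1 / (2 * real n) \<le> 1" using n0 by simp
        qed (use R t C2 in auto)
        also have "\<dots> \<le> M / real n" using n0 unfolding M_def by (simp add: field_simps)
        finally show ?thesis using t by (simp add: t_def)
      qed
    qed (use r in \<open>auto simp: c_def\<close>)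
    then show "norm (bessel_U n y - w_in y) \<le> 3 * M / r / real n" by (simp add: field_simps)
  qed
  show ?thesis
  proof (rule that[of "r/2" "3 * M / r" N])
    show "3 * M / r > 0" using C2 r by (simp add: M_def)
    show "N > 0" using C1 by (simp add: N_def)
  qed (use r main in auto)
qed

definition away :: "real \<Rightarrow> complex set" where
  "away d = {y. \<forall>z\<in>eyebrow_zero. d \<le> dist y z}"

text \<open>The plane off a neighbourhood of the eyebrow is covered by four regions: the outside of the
  horizontal strip (\<open>strip_estimate\<close>), the right half-plane
  (\<open>bessel_U_estimate\<close>), a neighbourhood of the open segment
  (\<open>bessel_near_segment\<close>), and the part of the strip in the left half-plane. In the
  last one the level of \<open>- y\<close> is bounded away from \<open>1\<close> by compactness,
  so \<open>bessel_R\<close> is either small or large of order at least \<open>n\<close>.\<close>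

lemma bessel_asymptotics:
  assumes d: "0 < d" "d \<le> 1/4"
  obtains C N where "C > 0" "N > 0"
    "\<And>n y. n \<ge> N \<Longrightarrow> y \<in> away d \<Longrightarrow> phi n (2 * of_nat n * y) \<noteq> 0 \<and> norm (bessel_U n y - w_lim y) \<le> C / real n"
proof -
  define e where "e = d / 4"
  have e: "0 < e" "e < 1/4" using d by (auto simp: e_def)
  obtain r C1 N1 where r: "0 < r" "C1 > 0" "N1 > 0" and I: "\<And>n y. n \<ge> N1 \<Longrightarrow> \<bar>Re y\<bar> \<le> r \<Longrightarrow> \<bar>Im y\<bar> \<le> 1/2 - 2 * e \<Longrightarrow>
       level y < 1 \<and> phi n (2 * of_nat n * y) \<noteq> 0 \<and> norm (bessel_U n y - w_in y) \<le> C1 / real n"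
    using bessel_near_segment[OF e] by metis
  obtain C2 N2 where C2: "C2 > 0" "N2 > 0" and St: "\<And>n y. n \<ge> N2 \<Longrightarrow> \<bar>Im y\<bar> \<ge> 1/2 + e \<Longrightarrow> phi n (2 * of_nat n * y) \<noteq> 0 \<and> norm (bessel_U n y - w_out y) \<le> C2 / real n"
    using strip_estimate[OF e(1)] by metis
  define \<delta> where "\<delta> = min r e"
  have \<delta>: "0 < \<delta>" "\<delta> \<le> r" "\<delta> \<le> e" "\<delta> \<le> 1" using r e by (auto simp: \<delta>_def)
  obtain C3 N3 where C3: "C3 > 0" "N3 > 0" and Rt: "\<And>n t. n \<ge> N3 \<Longrightarrow> \<delta> \<le> Re t \<Longrightarrow> norm t \<le> 2 \<Longrightarrow>
       level t ^ (2 * n) / C3 \<le> norm (bessel_R n t) \<and> norm (bessel_R n t) \<le> C3 * level t ^ (2 * n)"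
    using bessel_R_two_sided[OF \<delta>(1,4), of 2] by auto
  (* Points t = - y of the fourth region with Re t at most 1, together with a segment on the line
     Re t = 1: larger t are compared with that segment by monotonicity of the ratio. *)
  define X where "X = {t. \<delta> \<le> Re t \<and> Re t \<le> 1 \<and> \<bar>Im t\<bar> \<le> 1/2 + e \<and> - t \<in> away d} \<union> {t. Re t = 1 \<and> \<bar>Im t\<bar> \<le> 1}"
  have levX: "level t \<noteq> 1" if "t \<in> X" for t
  proof
    assume l: "level t = 1"
    have Rt: "Re t > 0" using that \<delta> by (auto simp: X_def)
    have "Re t < 1" using level_gt_1_far_right[of t] l by fastforce
    then have om: "- t \<in> away d" using that by (auto simp: X_def)
    have "\<bar>Im t\<bar> < 1/2" using level_gt_1_outside_strip[of t] l Rt by fastforce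
    then have "- t \<in> eyebrow_zero" using l Rt by (simp add: eyebrow_zero_iff level_minus)
    then show False using om d by (force simp: away_def)
  qed
  have compX: "compact X"
  proof -
    have "closed {t. - t \<in> away d}"
    proof -
      have "{t. - t \<in> away d} = (\<Inter>z\<in>eyebrow_zero. {t. d \<le> dist (- t) z})" by (auto simp: away_def)
      then show ?thesis by (auto intro!: closed_INT closed_Collect_le continuous_intros)
    qed
    then have cl: "closed X" unfolding X_def
      by (intro closed_Un closed_Collect_conj closed_Collect_le closed_Collect_eq continuous_intros)
    have "X \<subseteq> cball 0 3"
    proof
      fix t assume "t \<in> X"
      then have "\<bar>Re t\<bar> \<le> 1" "\<bar>Im t\<bar> \<le> 1" using \<delta> e by (auto simp: X_def)
      then show "t \<in> cball 0 3" using cmod_le[of t] by simp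
    qed
    then show ?thesis using cl by (meson bounded_cball bounded_subset compact_eq_bounded_closed)
  qed
  have "1 \<in> X" by (simp add: X_def)
  moreover have "continuous_on X (\<lambda>t. \<bar>level t - 1\<bar>)"
    using continuous_on_subset[OF continuous_level subset_UNIV] by (intro continuous_intros)
  ultimately obtain t0 where t0: "t0 \<in> X" "\<And>t. t \<in> X \<Longrightarrow> \<bar>level t0 - 1\<bar> \<le> \<bar>level t - 1\<bar>"
    using continuous_attains_inf[OF compX, of "\<lambda>t. \<bar>level t - 1\<bar>"] by blast
  define \<kappa> where "\<kappa> = min (1/2) \<bar>level t0 - 1\<bar>"
  have \<kappa>: "0 < \<kappa>" "\<kappa> < 1" using levX[OF t0(1)] by (auto simp: \<kappa>_def)
  have lk: "level t \<le> 1 - \<kappa> \<or> level t \<ge> 1 + \<kappa>" if "t \<in> X" for t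
    using t0(2)[OF that] by (auto simp: \<kappa>_def abs_if min_def split: if_splits)
  define q where "q = sqrt (1 / (4 * \<delta>\<^sup>2) + 1)"
  define b where "b = 2 * q + 1 / (2 * \<delta>)"
  define C4 where "C4 = C3 / (2 * \<kappa>)"
  define C5 where "C5 = 2 * (1 / (2 * \<delta>) + C4 * b)"
  have pos: "q > 0" "b > 0" "C4 > 0" "C5 > 0" using \<delta> C3 \<kappa> 
    by (auto simp: q_def b_def C4_def C5_def intro!: add_pos_pos mult_pos_pos add_pos_nonneg)
  define N where "N = N1 + N2 + N3 + nat \<lceil>2 * C4\<rceil>"
  define C where "C = C1 + C2 + 1 / \<delta> + C5"
  have "1 / \<delta> > 0" using \<delta> by simp
  then have Cge: "C1 \<le> C" "C2 \<le> C" "1 / \<delta> \<le> C" "C5 \<le> C" "C > 0" using r C2 pos unfolding C_def by linarith+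
  have main: "phi n (2 * of_nat n * y) \<noteq> 0 \<and> norm (bessel_U n y - w_lim y) \<le> C / real n"
    if n: "n \<ge> N" and y: "y \<in> away d" for n y
  proof -
    have nn: "n > 0" "n \<ge> N1" "n \<ge> N2" "n \<ge> N3" using n r by (auto simp: N_def)
    have Cn: "x / real n \<le> C / real n" if "x \<le> C" for x using that by (intro divide_right_mono) auto
    have nC4: "2 * C4 \<le> real n" using n unfolding N_def by linarith
    consider (A) "\<bar>Im y\<bar> \<ge> 1/2 + e" | (B) "Re y \<ge> \<delta>" | (D) "\<bar>Im y\<bar> < 1/2 + e" "\<bar>Re y\<bar> < \<delta>" | (E) "\<bar>Im y\<bar> < 1/2 + e" "Re y \<le> - \<delta>"
      by linarith
    then show ?thesis
    proof cases
      case A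
      then have "w_lim y = w_out y" using e by (intro w_lim_outside_strip) auto
      then show ?thesis using St[OF nn(3) A] Cn[OF Cge(2)] by auto
    next
      case B
      then have Ry: "Re y > 0" using \<delta> by simp
      have "norm (bessel_U n y - w_out y) \<le> 1 / (2 * real n * Re y)" by (rule bessel_U_estimate[OF nn(1) Ry])
      also have "\<dots> \<le> 1 / (real n * \<delta>)" using B \<delta> nn by (intro divide_left_mono mult_mono) auto
      also have "\<dots> = (1 / \<delta>) / real n" by (simp add: field_simps)
      also have "\<dots> \<le> C / real n" by (rule Cn[OF Cge(3)])
      finally show ?thesis using phi_right[OF nn(1), of y] Ry by (simp add: w_lim_right)
    next
      case D
      have "\<bar>Im y\<bar> \<le> 1/2 - 2 * e"
      proof (rule ccontr)
        assume a: "\<not> \<bar>Im y\<bar> \<le> 1/2 - 2 * e"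
        define z where "z = (if Im y \<ge> 0 then \<i> / 2 else - \<i> / 2)"
        have "z \<in> eyebrow_zero" using corners_in_eyebrow by (simp add: z_def)
        then have "d \<le> dist y z" using y by (simp add: away_def)
        also have "\<dots> \<le> \<bar>Re (y - z)\<bar> + \<bar>Im (y - z)\<bar>" unfolding dist_norm by (rule cmod_le)
        also have "Re (y - z) = Re y" by (simp add: z_def)
        also have "\<bar>Im (y - z)\<bar> \<le> 2 * e" using a D by (auto simp: z_def abs_if split: if_splits)
        finally show False using D \<delta> e by (simp add: e_def)
      qed
      then have "level y < 1 \<and> phi n (2 * of_nat n * y) \<noteq> 0 \<and> norm (bessel_U n y - w_in y) \<le> C1 / real n"
        using D \<delta> by (intro I nn) auto
      then show ?thesis using Cn[OF Cge(1)] by (auto simp: w_lim_inside)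
    next
      case E
      define t where "t = - y"
      have t: "Re t \<ge> \<delta>" "Re t > 0" "\<bar>Im t\<bar> \<le> 1/2 + e" "- t \<in> away d" using E \<delta> y by (auto simp: t_def)
      have t00: "t \<noteq> 0" using t(2) by auto
      have qb: "norm (root_out t) \<le> q" unfolding q_def
        by (rule norm_root_out_le[OF \<delta>(1)]) (use t complex_Re_le_cmod[of t] in simp)
      have a1: "1 / (2 * real n * Re t) \<le> (1 / (2 * \<delta>)) / real n"
      proof -
        have "1 / (2 * real n * Re t) \<le> 1 / (2 * real n * \<delta>)" using t \<delta> nn by (intro divide_left_mono mult_left_mono) auto
        then show ?thesis by (simp add: field_simps)
      qed
      have a2: "2 * norm (root_out t) + 1 / (2 * real n * Re t) \<le> b"
      proof -
        have "(1 / (2 * \<delta>)) / real n \<le> 1 / (2 * \<delta>)" using nn \<delta> by (simp add: field_simps)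
        then show ?thesis using a1 qb by (simp add: b_def)
      qed
      have a3: "2 * norm (root_out t) + 1 / (2 * real n * Re t) \<ge> 0" using t nn by simp
      have ph: "phi n (2 * of_nat n * y) \<noteq> 0" if "1 + bessel_R n t \<noteq> 0"
        using bessel_U_reflect(1)[OF nn(1) t(2)] that phi_right[OF nn(1), of t] t(2) by (simp add: t_def)
      have lt1: "level t < 1 \<or> level t > 1" "level t < 1 \<Longrightarrow> level t \<le> 1 - \<kappa> \<and> t \<in> X" "level t > 1 \<Longrightarrow> norm (bessel_R n t) \<ge> real n / C4"
      proof -
        have inX: "t \<in> X" if "Re t \<le> 1" using t that by (simp add: X_def)
        show dich: "level t < 1 \<or> level t > 1"
        proof (cases "Re t \<le> 1")
          case True then show ?thesis using levX[OF inX] by linarith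
        next
          case False then show ?thesis using level_gt_1_far_right[of t] by simp
        qed
        show "level t \<le> 1 - \<kappa> \<and> t \<in> X" if l: "level t < 1"
        proof -
          have "Re t \<le> 1" using level_gt_1_far_right[of t] l by linarith
          from inX[OF this] lk[OF inX[OF this]] show ?thesis using l \<kappa> by auto
        qed
        show "norm (bessel_R n t) \<ge> real n / C4" if l: "level t > 1"
        proof -
          define t' where "t' = (if Re t \<le> 1 then t else Complex 1 (Im t))"
          have t': "t' \<in> X" "Re t' \<ge> \<delta>" "norm t' \<le> 2" "level t' > 1"
          proof -
            show "t' \<in> X" using inX t(3) e by (auto simp: t'_def X_def)
            show "Re t' \<ge> \<delta>" using t \<delta> by (simp add: t'_def)
            show "norm t' \<le> 2" using cmod_le[of t'] t e by (auto simp: t'_def split: if_splits)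
            show "level t' > 1" using l level_gt_1_far_right[of t'] by (auto simp: t'_def)
          qed
          have "1 + \<kappa> \<le> level t'" using lk[OF t'(1)] t'(4) \<kappa> by auto
          then have "(1 + \<kappa>) ^ (2 * n) \<le> level t' ^ (2 * n)" using \<kappa> by (intro power_mono) auto
          then have "2 * real n * \<kappa> \<le> level t' ^ (2 * n)" using power_two_n_ge[OF \<kappa>(1), of n] by linarith
          then have "2 * real n * \<kappa> / C3 \<le> level t' ^ (2 * n) / C3" using C3 by (intro divide_right_mono) auto
          also have "\<dots> \<le> norm (bessel_R n t')" using Rt[OF nn(4) t'(2,3)] by blast
          also have "\<dots> \<le> norm (bessel_R n t)"
          proof (cases "Re t \<le> 1")
            case False
            then show ?thesis using bessel_R_increasing[OF nn(1), of 1 "Re t" "Im t"] by (simp add: t'_def)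
          qed (simp add: t'_def)
          finally show ?thesis using \<kappa> C3 by (simp add: C4_def field_simps)
        qed
      qed
      show ?thesis
      proof (cases "level t < 1")
        case True
        have X: "level t \<le> 1 - \<kappa>" "t \<in> X" using lt1(2)[OF True] by auto
        have "norm t \<le> 2"
        proof -
          have "Re t \<le> 1" using X(2) by (auto simp: X_def)
          then show ?thesis using cmod_le[of t] t e by linarith
        qed
        then have "norm (bessel_R n t) \<le> C3 * level t ^ (2 * n)" using Rt[OF nn(4) t(1)] by blast
        also have "\<dots> \<le> C3 * (1 / (2 * real n * \<kappa>))"
          using C3 \<kappa> X(1) nn(1) by (intro mult_left_mono power_two_n_le) (auto simp: level_def)
        also have "\<dots> = C4 / real n" by (simp add: C4_def)
        finally have R: "norm (bessel_R n t) \<le> C4 / real n" .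
        also have "\<dots> \<le> 1/2" using nC4 nn by (simp add: field_simps)
        finally have R2: "norm (bessel_R n t) \<le> 1/2" .
        have nz: "1 + bessel_R n t \<noteq> 0" using norm_triangle_ineq2[of 1 "- bessel_R n t"] R2 by force
        have "w_in y = - w_out t" using arg_cong[OF w_in_eq_w_out[OF t(2)], of uminus] by (simp add: t_def w_in_minus)
        then have "w_lim y = - w_out t" using True w_lim_inside[of y] by (simp add: t_def level_minus)
        then have "norm (bessel_U n y - w_lim y) = norm (bessel_U n (- t) + w_out t)" by (simp add: t_def)
        also have "\<dots> \<le> 2 * (1 / (2 * real n * Re t) + norm (bessel_R n t) * (2 * norm (root_out t) + 1 / (2 * real n * Re t)))"
          by (rule bessel_U_reflect_small[OF nn(1) t(2) R2])
        also have "\<dots> \<le> 2 * ((1 / (2 * \<delta>)) / real n + (C4 / real n) * b)"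
          by (intro mult_left_mono add_mono mult_mono a1 a2 R a3) (use pos in auto)
        also have "\<dots> = C5 / real n" unfolding C5_def by (simp add: add_divide_distrib)
        also have "\<dots> \<le> C / real n" by (rule Cn[OF Cge(4)])
        finally show ?thesis using ph[OF nz] by simp
      next
        case False
        then have l: "level t > 1" using lt1(1) by simp
        have R: "norm (bessel_R n t) \<ge> real n / C4" by (rule lt1(3)[OF l])
        moreover have "real n / C4 \<ge> 2" using nC4 pos by (simp add: field_simps)
        ultimately have R2: "norm (bessel_R n t) \<ge> 2" by linarith
        have nz: "1 + bessel_R n t \<noteq> 0" using norm_triangle_ineq2[of "bessel_R n t" "- 1"] R2 by (force simp: add.commute)
        have "w_lim y = 1 / w_out t" using w_lim_outside[of y] l w_out_minus[OF t00] by (simp add: t_def level_minus)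
        then have "norm (bessel_U n y - w_lim y) = norm (bessel_U n (- t) - 1 / w_out t)" by (simp add: t_def)
        also have "\<dots> \<le> 2 * (1 / (2 * real n * Re t)) + 2 / norm (bessel_R n t) * (2 * norm (root_out t) + 1 / (2 * real n * Re t))"
          by (rule bessel_U_reflect_large[OF nn(1) t(2) R2])
        also have "\<dots> \<le> 2 * ((1 / (2 * \<delta>)) / real n) + 2 / (real n / C4) * b"
        proof -
          have "real n / C4 > 0" using nn pos by simp
          then have "norm (bessel_R n t) * (real n / C4) > 0" using R2 by (intro mult_pos_pos) auto
          then have r1: "2 / norm (bessel_R n t) \<le> 2 / (real n / C4)" by (intro divide_left_mono R) auto
          show ?thesis by (rule add_mono[OF mult_left_mono[OF a1] mult_mono[OF r1 a2 _ a3]]) (use nn pos in auto)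
        qed
        also have "\<dots> = C5 / real n" unfolding C5_def by (simp add: add_divide_distrib)
        also have "\<dots> \<le> C / real n" by (rule Cn[OF Cge(4)])
        finally show ?thesis using ph[OF nz] by simp
      qed
    qed
  qed
  show ?thesis
  proof (rule that[OF Cge(5), of N])
    show "N > 0" using r by (simp add: N_def)
  qed (use main in blast)
qed

section \<open>Rational functions and uniqueness of the rational solution\<close>

text \<open>Equality of \<open>f\<close> with a quotient of polynomials off the zeros of the denominator.
  In contrast to \<open>rational_function\<close> this leaves the values at finitely many points
  open, which makes it closed under all the operations below, including \<open>deriv\<close>.\<close>

definition ratl :: "(complex \<Rightarrow> complex) \<Rightarrow> bool" where
  "ratl f \<longleftrightarrow> (\<exists>P Q. Q \<noteq> 0 \<and> (\<forall>x. poly Q x \<noteq> 0 \<longrightarrow> f x = poly P x / poly Q x))"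

lemma ratlI: "Q \<noteq> 0 \<Longrightarrow> (\<And>x. poly Q x \<noteq> 0 \<Longrightarrow> f x = poly P x / poly Q x) \<Longrightarrow> ratl f"
  unfolding ratl_def by blast

lemma rational_function_ratl: "rational_function f \<Longrightarrow> ratl f"
  unfolding rational_function_def ratl_def by blast

lemma ratl_const: "ratl (\<lambda>x. c)" by (rule ratlI[of 1 _ "[:c:]"]) auto
lemma ratl_id: "ratl (\<lambda>x. x)" by (rule ratlI[of 1 _ "[:0, 1:]"]) auto

lemma ratl_add: assumes "ratl f" "ratl g" shows "ratl (\<lambda>x. f x + g x)"
proof -
  obtain P Q where 1: "Q \<noteq> 0" "\<And>x. poly Q x \<noteq> 0 \<Longrightarrow> f x = poly P x / poly Q x" using assms(1) unfolding ratl_def by blast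
  obtain R S where 2: "S \<noteq> 0" "\<And>x. poly S x \<noteq> 0 \<Longrightarrow> g x = poly R x / poly S x" using assms(2) unfolding ratl_def by blast
  show ?thesis by (rule ratlI[of "Q * S" _ "P * S + R * Q"]) (use 1 2 in \<open>auto simp: add_frac_eq\<close>)
qed

lemma ratl_mult: assumes "ratl f" "ratl g" shows "ratl (\<lambda>x. f x * g x)"
proof -
  obtain P Q where 1: "Q \<noteq> 0" "\<And>x. poly Q x \<noteq> 0 \<Longrightarrow> f x = poly P x / poly Q x" using assms(1) unfolding ratl_def by blast
  obtain R S where 2: "S \<noteq> 0" "\<And>x. poly S x \<noteq> 0 \<Longrightarrow> g x = poly R x / poly S x" using assms(2) unfolding ratl_def by blast
  show ?thesis by (rule ratlI[of "Q * S" _ "P * R"]) (use 1 2 in auto)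
qed

lemma ratl_minus: "ratl f \<Longrightarrow> ratl (\<lambda>x. - f x)"
  using ratl_mult[OF ratl_const[of "- 1"]] by simp

lemma ratl_diff: "ratl f \<Longrightarrow> ratl g \<Longrightarrow> ratl (\<lambda>x. f x - g x)"
  using ratl_add[OF _ ratl_minus] by simp

lemma ratl_inverse: assumes "ratl f" shows "ratl (\<lambda>x. inverse (f x))"
proof -
  obtain P Q where 1: "Q \<noteq> 0" "\<And>x. poly Q x \<noteq> 0 \<Longrightarrow> f x = poly P x / poly Q x" using assms(1) unfolding ratl_def by blast
  show ?thesis
  proof (cases "P = 0")
    case True then show ?thesis by (intro ratlI[of Q _ 0]) (use 1 in auto)
  next
    case False
    then show ?thesis by (intro ratlI[of "P * Q" _ "Q * Q"]) (use 1 in auto)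
  qed
qed

lemma ratl_divide: "ratl f \<Longrightarrow> ratl g \<Longrightarrow> ratl (\<lambda>x. f x / g x)"
  using ratl_mult[OF _ ratl_inverse] by (simp add: divide_inverse)

lemma open_nonroots: "open {x. poly Q x \<noteq> (0::complex)}"
  by (intro open_Collect_neq continuous_intros)

lemma DERIV_poly_quotient:
  assumes "poly Q x \<noteq> (0::complex)"
  shows "((\<lambda>x. poly P x / poly Q x) has_field_derivative
     (poly (pderiv P * Q - P * pderiv Q) x) / poly (Q * Q) x) (at x)"
  using DERIV_divide[OF poly_DERIV poly_DERIV assms] by simp

lemma ratl_DERIV:
  assumes "\<And>x. poly Q x \<noteq> 0 \<Longrightarrow> f x = poly P x / poly Q x" "poly Q x \<noteq> (0::complex)"
  shows "(f has_field_derivative (poly (pderiv P * Q - P * pderiv Q) x) / poly (Q * Q) x) (at x)"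
  by (rule has_field_derivative_transform_within_open[OF DERIV_poly_quotient[OF assms(2)] open_nonroots[of Q]])
     (use assms in auto)

lemma ratl_deriv: assumes "ratl f" shows "ratl (deriv f)"
proof -
  obtain P Q where 1: "Q \<noteq> 0" "\<And>x. poly Q x \<noteq> 0 \<Longrightarrow> f x = poly P x / poly Q x" using assms(1) unfolding ratl_def by blast
  show ?thesis
    by (rule ratlI[of "Q * Q" _ "pderiv P * Q - P * pderiv Q"])
       (use 1(1) DERIV_imp_deriv[OF ratl_DERIV[OF 1(2)]] in auto)
qed

text \<open>A common factor that is not a unit lowers the degree of the denominator.\<close>

lemma poly_lowest_terms:
  fixes P Q :: "'a :: field poly"
  assumes "Q \<noteq> 0"
  shows "\<exists>A B G. P = A * G \<and> Q = B * G \<and> coprime A B"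
  using assms
proof (induction "degree Q" arbitrary: P Q rule: less_induct)
  case less
  show ?case
  proof (cases "coprime P Q")
    case True
    then show ?thesis by (intro exI[of _ P] exI[of _ Q] exI[of _ 1]) simp
  next
    case False
    then obtain D where D: "D dvd P" "D dvd Q" "\<not> is_unit D" by (auto elim: not_coprimeE)
    then obtain P' Q' where PQ: "P = D * P'" "Q = D * Q'" by (auto elim!: dvdE)
    have nz: "D \<noteq> 0" "Q' \<noteq> 0" using PQ(2) less.prems by auto
    have "degree Q' < degree Q" using D(3) is_unit_iff_degree[OF nz(1)] degree_mult_eq[OF nz] PQ(2) by simp
    from less.hyps[OF this nz(2), of P'] obtain A B G where "P' = A * G" "Q' = B * G" "coprime A B" by blast
    then show ?thesis using PQ by (intro exI[of _ A] exI[of _ B] exI[of _ "D * G"]) (simp add: mult_ac)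
  qed
qed

lemma ratl_normalize: assumes "ratl f"
  obtains g where "rational_function g" "finite {x. g x \<noteq> f x}"
proof -
  obtain P Q where 1: "Q \<noteq> 0" "\<And>x. poly Q x \<noteq> 0 \<Longrightarrow> f x = poly P x / poly Q x" using assms(1) unfolding ratl_def by blast
  obtain A B G where PQ: "P = A * G" "Q = B * G" and "coprime A B" using poly_lowest_terms[OF 1(1), of P] by blast
  moreover have "B \<noteq> 0" using PQ 1 by auto
  ultimately have "rational_function (\<lambda>x. poly A x / poly B x)" unfolding rational_function_def by blast
  moreover have "{x. poly A x / poly B x \<noteq> f x} \<subseteq> {x. poly Q x = 0}"
  proof clarify
    fix x assume ne: "poly A x / poly B x \<noteq> f x"
    show "poly Q x = 0"
    proof (rule ccontr)
      assume q: "poly Q x \<noteq> 0"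
      then have "poly G x \<noteq> 0" by (simp add: PQ)
      then show False using ne 1(2)[OF q] by (simp add: PQ)
    qed
  qed
  then have "finite {x. poly A x / poly B x \<noteq> f x}" using poly_roots_finite[OF 1(1)] finite_subset by blast
  ultimately show ?thesis by (rule that)
qed

lemma eventually_notin_finite: "finite A \<Longrightarrow> \<forall>\<^sub>F x in at (x0::complex). x \<notin> A"
proof -
  assume "finite A"
  then have "open (- (A - {x0}))" "x0 \<in> - (A - {x0})"
    using open_Compl[OF finite_imp_closed[OF finite_Diff]] by blast+
  then show ?thesis unfolding eventually_at_topological by (intro exI[of _ "- (A - {x0})"]) auto
qed

lemma rational_function_cases:
  assumes "rational_function g"
  shows "g analytic_on {x0} \<or> (is_pole g x0 \<and> g x0 = 0)"
proof -
  obtain P Q where 1: "Q \<noteq> 0" "coprime P Q" "g = (\<lambda>x. poly P x / poly Q x)"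
    using assms by (auto simp: rational_function_def)
  show ?thesis
  proof (cases "poly Q x0 = 0")
    case False
    have "(\<lambda>x. poly P x / poly Q x) holomorphic_on {x. poly Q x \<noteq> 0}" by (intro holomorphic_intros) auto
    then have "g analytic_on {x0}" unfolding 1(3) analytic_at using open_nonroots[of Q] False by blast
    then show ?thesis by simp
  next
    case True
    have P: "poly P x0 \<noteq> 0"
    proof
      assume "poly P x0 = 0"
      then have "[:- x0, 1:] dvd P" "[:- x0, 1:] dvd Q" using True by (auto simp: poly_eq_0_iff_dvd)
      then have "is_unit [:- x0, 1:]" using 1(2) by (meson coprime_def)
      then show False by (simp add: is_unit_iff_degree)
    qed
    have "is_pole (\<lambda>x. poly P x / poly Q x) x0"
    proof (rule is_pole_divide)
      show "isCont (poly P) x0" by simp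
      have "poly Q \<midarrow>x0\<rightarrow> 0" using True by (metis isCont_def poly_isCont)
      moreover have "\<forall>\<^sub>F x in at x0. poly Q x \<noteq> 0" using eventually_notin_finite[OF poly_roots_finite[OF 1(1)]] by simp
      ultimately show "filterlim (poly Q) (at 0) (at x0)" by (simp add: filterlim_at)
      show "poly P x0 \<noteq> 0" by (rule P)
    qed
    then show ?thesis using True by (simp add: 1(3))
  qed
qed

lemma analytic_not_pole: "f analytic_on {x} \<Longrightarrow> \<not> is_pole f x"
  using not_is_pole_holomorphic[of _ x f] by (auto simp: analytic_at)

lemma rational_function_analytic: "rational_function g \<Longrightarrow> g x0 \<noteq> 0 \<Longrightarrow> g analytic_on {x0}"
  using rational_function_cases[of g x0] by auto

lemma rational_function_eq_at:
  assumes g: "rational_function g" and f: "f analytic_on {x0}" and eq: "\<forall>\<^sub>F x in at x0. g x = f x"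
  shows "g analytic_on {x0} \<and> g x0 = f x0"
proof -
  have "\<not> is_pole g x0" using analytic_not_pole[OF f] is_pole_cong[OF eq refl] by simp
  then have an: "g analytic_on {x0}" using rational_function_cases[OF g, of x0] by simp
  have "g \<midarrow>x0\<rightarrow> g x0" "f \<midarrow>x0\<rightarrow> f x0"
    using analytic_at_imp_isCont[OF an] analytic_at_imp_isCont[OF f] by (auto simp: isCont_def)
  moreover have "g \<midarrow>x0\<rightarrow> f x0" using calculation(2) tendsto_cong[OF eq] by simp
  ultimately have "g x0 = f x0" using tendsto_unique[of "at x0" g] by simp
  with an show ?thesis by simp
qed

lemma rational_function_unique:
  assumes g: "rational_function g" and f: "rational_function f" and fin: "finite {x. g x \<noteq> f x}"
  shows "g = f"
proof
  fix x0
  have eq: "\<forall>\<^sub>F x in at x0. g x = f x" using eventually_notin_finite[OF fin, of x0] by simp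
  show "g x0 = f x0"
  proof (cases "f analytic_on {x0}")
    case True then show ?thesis using rational_function_eq_at[OF g True eq] by simp
  next
    case False
    then have p: "is_pole f x0" "f x0 = 0" using rational_function_cases[OF f, of x0] by auto
    then have "is_pole g x0" using is_pole_cong[OF eq refl] by simp
    then have "\<not> g analytic_on {x0}" using analytic_not_pole by blast
    then show ?thesis using rational_function_cases[OF g, of x0] p by auto
  qed
qed

lemma eventually_nonroot_at_infinity: "Q \<noteq> 0 \<Longrightarrow> \<forall>\<^sub>F x in at_infinity. poly Q x \<noteq> (0::complex)"
proof -
  assume "Q \<noteq> 0"
  then have "bounded {x. poly Q x = 0}" by (intro finite_imp_bounded poly_roots_finite)
  then obtain b where "\<And>x. poly Q x = 0 \<Longrightarrow> norm x \<le> b" by (auto simp: bounded_iff)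
  then show ?thesis unfolding eventually_at_infinity by (intro exI[of _ "b + 1"]) force
qed

lemma pderiv_over_poly: "P \<noteq> 0 \<Longrightarrow> ((\<lambda>x. poly (pderiv P) x / poly P x) \<longlongrightarrow> (0::complex)) at_infinity"
proof (cases "degree P = 0")
  case True
  then have "pderiv P = 0" by (simp add: pderiv_eq_0_iff)
  then show ?thesis by simp
next
  case False
  then show ?thesis by (intro poly_divide_tendsto_0_at_infinity) (simp add: degree_pderiv)
qed

lemma ratl_alternative:
  assumes "ratl f" shows "(\<forall>\<^sub>F x in at_infinity. f x \<noteq> 0) \<or> (finite {x. f x \<noteq> 0})"
proof -
  obtain P Q where 1: "Q \<noteq> 0" "\<And>x. poly Q x \<noteq> 0 \<Longrightarrow> f x = poly P x / poly Q x" using assms(1) unfolding ratl_def by blast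
  show ?thesis
  proof (cases "P = 0")
    case True
    then have "{x. f x \<noteq> 0} \<subseteq> {x. poly Q x = 0}" using 1 by auto
    then show ?thesis using poly_roots_finite[OF 1(1)] finite_subset by blast
  next
    case False
    then have "P * Q \<noteq> 0" using 1 by simp
    from eventually_nonroot_at_infinity[OF this] have "\<forall>\<^sub>F x in at_infinity. f x \<noteq> 0"
      by eventually_elim (use 1 in auto)
    then show ?thesis by simp
  qed
qed

text \<open>The logarithmic derivative of a polynomial of degree \<open>k\<close> is asymptotic to
  \<open>k / x\<close>.\<close>

lemma ratl_logderiv_tendsto: assumes "ratl f" shows "((\<lambda>x. deriv f x / f x) \<longlongrightarrow> 0) at_infinity"
proof -
  obtain P Q where 1: "Q \<noteq> 0" "\<And>x. poly Q x \<noteq> 0 \<Longrightarrow> f x = poly P x / poly Q x" using assms(1) unfolding ratl_def by blast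
  show ?thesis
  proof (cases "P = 0")
    case True
    have "\<forall>\<^sub>F x in at_infinity. 0 = deriv f x / f x"
      using eventually_nonroot_at_infinity[OF 1(1)] by eventually_elim (use 1 True in auto)
    from tendsto_cong[OF this, of 0] show ?thesis by simp
  next
    case False
    then have "P * Q \<noteq> 0" using 1 by simp
    from eventually_nonroot_at_infinity[OF this]
    have ev: "\<forall>\<^sub>F x in at_infinity. poly (pderiv P) x / poly P x - poly (pderiv Q) x / poly Q x = deriv f x / f x"
    proof eventually_elim
      case (elim x)
      then have nz: "poly P x \<noteq> 0" "poly Q x \<noteq> 0" by auto
      have df: "deriv f x = poly (pderiv P * Q - P * pderiv Q) x / poly (Q * Q) x"
        by (rule DERIV_imp_deriv, rule ratl_DERIV) (use 1 nz in auto)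
      show ?case unfolding df 1(2)[OF nz(2)] using nz by (simp add: field_simps)
    qed
    have "((\<lambda>x. poly (pderiv P) x / poly P x - poly (pderiv Q) x / poly Q x) \<longlongrightarrow> 0) at_infinity"
      using tendsto_diff[OF pderiv_over_poly[OF False] pderiv_over_poly[OF 1(1)]] by simp
    then show ?thesis unfolding tendsto_cong[OF ev] .
  qed
qed

lemma eventually_deriv_zero:
  assumes "\<forall>\<^sub>F x in at_infinity. f x = (0::complex)" shows "\<forall>\<^sub>F x in at_infinity. deriv f x = 0"
proof -
  obtain b where b: "\<And>x. b \<le> norm x \<Longrightarrow> f x = 0" using assms by (auto simp: eventually_at_infinity)
  have "deriv f x = 0" if "b + 1 \<le> norm x" for x
  proof (rule DERIV_imp_deriv)
    show "(f has_field_derivative 0) (at x)"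
      by (rule has_field_derivative_transform_within_open[of "\<lambda>_. 0" _ _ "{x. norm x > b}"])
         (use b that in \<open>auto intro!: open_Collect_less continuous_intros\<close>)
  qed
  then show ?thesis unfolding eventually_at_infinity by blast
qed

lemma finite_imp_eventually_at_infinity: "finite {x. \<not> P (x::complex)} \<Longrightarrow> \<forall>\<^sub>F x in at_infinity. P x"
proof -
  assume "finite {x. \<not> P x}"
  then obtain b where "\<And>x. \<not> P x \<Longrightarrow> norm x \<le> b" using finite_imp_bounded[of "{x. \<not> P x}"] by (auto simp: bounded_iff)
  then show ?thesis unfolding eventually_at_infinity by (intro exI[of _ "b + 1"]) force
qed

lemma ratl_deriv2_tendsto: assumes "ratl f" shows "((\<lambda>x. deriv (deriv f) x / f x) \<longlongrightarrow> 0) at_infinity"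
proof -
  have l: "((\<lambda>x. (deriv (deriv f) x / deriv f x) * (deriv f x / f x)) \<longlongrightarrow> 0) at_infinity"
    using tendsto_mult[OF ratl_logderiv_tendsto[OF ratl_deriv[OF assms]] ratl_logderiv_tendsto[OF assms]] by simp
  have ev: "\<forall>\<^sub>F x in at_infinity. (deriv (deriv f) x / deriv f x) * (deriv f x / f x) = deriv (deriv f) x / f x"
    using ratl_alternative[OF ratl_deriv[OF assms]]
  proof
    assume "\<forall>\<^sub>F x in at_infinity. deriv f x \<noteq> 0" then show ?thesis by eventually_elim auto
  next
    assume "finite {x. deriv f x \<noteq> 0}"
    then have "\<forall>\<^sub>F x in at_infinity. deriv f x = 0" using finite_imp_eventually_at_infinity[of "\<lambda>x. deriv f x = 0"] by simp
    from eventually_deriv_zero[OF this] show ?thesis by eventually_elim auto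
  qed
  show ?thesis using l unfolding tendsto_cong[OF ev] .
qed

lemma eventually_norm_gt: "\<forall>\<^sub>F x::complex in at_infinity. norm x > b"
  unfolding eventually_at_infinity by (intro exI[of _ "b + 1"]) auto

lemma rational_holomorphic_near_infinity:
  assumes "rational_function f" obtains b where "f holomorphic_on {x. norm x > b}"
proof -
  obtain P Q where 1: "Q \<noteq> 0" "f = (\<lambda>x. poly P x / poly Q x)"
    using assms by (auto simp: rational_function_def)
  have "bounded {x. poly Q x = 0}" using 1 by (intro finite_imp_bounded poly_roots_finite)
  then obtain b where "\<And>x. poly Q x = 0 \<Longrightarrow> norm x \<le> b" by (auto simp: bounded_iff)
  then have "f holomorphic_on {x. norm x > b}" unfolding 1(2) by (intro holomorphic_intros) force
  then show ?thesis by (rule that)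
qed

text \<open>Subtract the equations for \<open>u1\<close> and \<open>u2\<close> and divide by the
  difference \<open>d\<close>. Every term that contains a derivative carries a factor \<open>d'
  / d\<close>, \<open>d'' / d\<close> or a derivative of \<open>u1\<close> or \<open>u2\<close>,
  and these tend to \<open>0\<close>; the terms over \<open>x\<close> tend to \<open>0\<close>
  as well. What remains in the limit is the derivative of \<open>4 u^3 - 4 / u\<close> at
  \<open>u = 1\<close>, which is \<open>16\<close>. So \<open>0 = 16\<close> unless
  \<open>d\<close> vanishes identically.\<close>

lemma rational_solution_unique:
  assumes u1: "rational_solution n m u1" and u2: "rational_solution n m u2"
  shows "u1 = u2"
proof -
  have r: "rational_function u1" "rational_function u2" using assms by (auto simp: rational_solution_def)
  have t: "(u1 \<longlongrightarrow> 1) at_infinity" "(u2 \<longlongrightarrow> 1) at_infinity" using assms by (auto simp: rational_solution_def)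
  define d where "d x = u1 x - u2 x" for x
  have rd: "ratl d" unfolding d_def using r by (intro ratl_diff rational_function_ratl)
  show ?thesis
  proof (rule rational_function_unique[OF r], rule ccontr)
    assume "infinite {x. u1 x \<noteq> u2 x}"
    then have "infinite {x. d x \<noteq> 0}" by (simp add: d_def)
    then have dn: "\<forall>\<^sub>F x in at_infinity. d x \<noteq> 0" using ratl_alternative[OF rd] by blast
    obtain b1 where b1: "u1 holomorphic_on {x. norm x > b1}" using rational_holomorphic_near_infinity[OF r(1)] .
    obtain b2 where b2: "u2 holomorphic_on {x. norm x > b2}" using rational_holomorphic_near_infinity[OF r(2)] .
    define b where "b = max b1 b2"
    have op: "open {x::complex. norm x > b}" by (intro open_Collect_less continuous_intros)
    have h: "u1 holomorphic_on {x. norm x > b}" "u2 holomorphic_on {x. norm x > b}"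
      by (rule holomorphic_on_subset[OF b1], force simp: b_def, rule holomorphic_on_subset[OF b2], force simp: b_def)
    have h': "deriv u1 holomorphic_on {x. norm x > b}" "deriv u2 holomorphic_on {x. norm x > b}"
      using h op by (auto intro: holomorphic_deriv)
    have D1: "deriv d x = deriv u1 x - deriv u2 x" if "norm x > b" for x
      unfolding d_def using h op that by (intro deriv_diff holomorphic_on_imp_differentiable_at[of _ "{x. norm x > b}"]) auto
    have D2: "deriv (deriv d) x = deriv (deriv u1) x - deriv (deriv u2) x" if x: "norm x > b" for x
    proof (rule DERIV_imp_deriv)
      have "((\<lambda>x. deriv u1 x - deriv u2 x) has_field_derivative deriv (deriv u1) x - deriv (deriv u2) x) (at x)"
        by (rule DERIV_diff; rule holomorphic_derivI[of _ "{x. norm x > b}"]) (use h' op x in auto)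
      then show "(deriv d has_field_derivative deriv (deriv u1) x - deriv (deriv u2) x) (at x)"
        by (rule has_field_derivative_transform_within_open[OF _ op]) (use D1 x in auto)
    qed
    define A where "A x = deriv u1 x" for x
    define B where "B x = deriv u2 x" for x
    have lt: "((\<lambda>x. deriv u x) \<longlongrightarrow> 0) at_infinity" if "rational_function u" "(u \<longlongrightarrow> 1) at_infinity" for u
    proof -
      have "((\<lambda>x. (deriv u x / u x) * u x) \<longlongrightarrow> 0 * 1) at_infinity"
        by (rule tendsto_mult[OF ratl_logderiv_tendsto[OF rational_function_ratl[OF that(1)]] that(2)])
      moreover have "\<forall>\<^sub>F x in at_infinity. u x \<noteq> 0" using that(2) tendsto_imp_eventually_ne[OF that(2), of 0] by simp
      then have ev: "\<forall>\<^sub>F x in at_infinity. (deriv u x / u x) * u x = deriv u x" by eventually_elim simp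
      ultimately show ?thesis unfolding tendsto_cong[OF ev] by simp
    qed
    have lA: "(A \<longlongrightarrow> 0) at_infinity" "(B \<longlongrightarrow> 0) at_infinity"
      using lt[OF r(1) t(1)] lt[OF r(2) t(2)] by (simp_all add: A_def[abs_def] B_def[abs_def])
    have inv: "((\<lambda>x::complex. 1 / x) \<longlongrightarrow> 0) at_infinity"
      unfolding divide_inverse mult_1_left by (rule tendsto_inverse_0)
    define c where "c = 4 * (of_int n + m)"
    define Rhs where "Rhs x = (A x + B x) / u1 x * (deriv d x / d x) - (B x)\<^sup>2 / (u1 x * u2 x) - (deriv d x / d x) * (1 / x)
      + c * (u1 x + u2 x) * (1 / x) + 4 * ((u1 x)\<^sup>2 + u1 x * u2 x + (u2 x)\<^sup>2) + 4 / (u1 x * u2 x)" for x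
    have "(Rhs \<longlongrightarrow> (0 + 0) / 1 * 0 - 0\<^sup>2 / (1 * 1) - 0 * 0 + c * (1 + 1) * 0 + 4 * (1\<^sup>2 + 1 * 1 + 1\<^sup>2) + 4 / (1 * 1)) at_infinity"
      unfolding Rhs_def[abs_def]
      by (intro tendsto_intros lA t ratl_logderiv_tendsto rd inv) auto
    then have R16: "(Rhs \<longlongrightarrow> 16) at_infinity" by simp
    have ev: "\<forall>\<^sub>F x in at_infinity. Rhs x = deriv (deriv d) x / d x"
    proof -
      have "\<forall>\<^sub>F x in at_infinity. u1 x \<noteq> 0" "\<forall>\<^sub>F x in at_infinity. u2 x \<noteq> 0"
        using tendsto_imp_eventually_ne[OF t(1), of 0] tendsto_imp_eventually_ne[OF t(2), of 0] by auto
      then show ?thesis using dn eventually_norm_gt[of "max b 0"]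
      proof eventually_elim
        case (elim x)
        then have x: "norm x > b" "x \<noteq> 0" by auto
        have P1: "deriv A x = (A x)\<^sup>2 / u1 x - A x / x + (c * (u1 x)\<^sup>2 + 4 * (1 - (m - of_int n + 1))) / x + 4 * (u1 x) ^ 3 - 4 / u1 x"
          using u1 elim x unfolding rational_solution_def painleve_III_def A_def[abs_def] c_def by auto
        have P2: "deriv B x = (B x)\<^sup>2 / u2 x - B x / x + (c * (u2 x)\<^sup>2 + 4 * (1 - (m - of_int n + 1))) / x + 4 * (u2 x) ^ 3 - 4 / u2 x"
          using u2 elim x unfolding rational_solution_def painleve_III_def B_def[abs_def] c_def by auto
        have d1: "deriv d x = A x - B x" using D1[OF x(1)] by (simp add: A_def B_def)
        have d2: "deriv (deriv d) x = deriv A x - deriv B x" using D2[OF x(1)] by (simp add: A_def[abs_def] B_def[abs_def])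
        define a where "a = u1 x" define e where "e = u2 x"
        have nz: "a \<noteq> 0" "e \<noteq> 0" "a - e \<noteq> 0" using elim by (auto simp: a_def e_def d_def)
        have "Rhs x * (a - e) = deriv A x - deriv B x"
        proof -
          have c1: "deriv d x / d x * (a - e) = A x - B x" using nz by (simp add: d1 d_def a_def e_def)
          have "Rhs x * (a - e) = (A x + B x) / a * (deriv d x / d x * (a - e)) - (B x)\<^sup>2 * (a - e) / (a * e)
            - (deriv d x / d x * (a - e)) * (1 / x) + c * (a + e) * (a - e) * (1 / x)
            + 4 * (a\<^sup>2 + a * e + e\<^sup>2) * (a - e) + 4 * (a - e) / (a * e)"
          proof -
            have gen: "(s * L - t - L * r + c * w * r + 4 * q + k) * v =
              s * (L * v) - t * v - (L * v) * r + c * w * v * r + 4 * q * v + k * v" for s L t r w q k v :: complex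
              by (simp add: algebra_simps)
            show ?thesis unfolding Rhs_def a_def[symmetric] e_def[symmetric] gen by simp
          qed
          also have "\<dots> = deriv A x - deriv B x" unfolding c1 P1 P2 a_def[symmetric] e_def[symmetric]
          proof -
            have 1: "(a - e) / (a * e) = 1 / e - 1 / a" using nz by (simp add: field_simps)
            have 2: "(B x)\<^sup>2 * (a - e) / (a * e) = (B x)\<^sup>2 / e - (B x)\<^sup>2 / a" using nz by (simp add: field_simps)
            have 3: "(A x + B x) / a * (A x - B x) = (A x)\<^sup>2 / a - (B x)\<^sup>2 / a"
              by (simp add: power2_eq_square algebra_simps diff_divide_distrib add_divide_distrib)
            have 4: "4 * (a - e) / (a * e) = 4 / e - 4 / a" using nz by (simp add: field_simps)
            show "(A x + B x) / a * (A x - B x) - (B x)\<^sup>2 * (a - e) / (a * e) - (A x - B x) * (1 / x) + c * (a + e) * (a - e) * (1 / x) +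
              4 * (a\<^sup>2 + a * e + e\<^sup>2) * (a - e) + 4 * (a - e) / (a * e) =
              (A x)\<^sup>2 / a - A x / x + (c * a\<^sup>2 + 4 * (1 - (m - of_int n + 1))) / x + 4 * a ^ 3 - 4 / a -
              ((B x)\<^sup>2 / e - B x / x + (c * e\<^sup>2 + 4 * (1 - (m - of_int n + 1))) / x + 4 * e ^ 3 - 4 / e)"
              unfolding 2 3 4 by (simp add: diff_divide_distrib add_divide_distrib algebra_simps power2_eq_square power3_eq_cube)
          qed
          finally show ?thesis .
        qed
        then show ?case unfolding d2 using nz by (simp add: d_def a_def e_def field_simps)
      qed
    qed
    have "((\<lambda>x. deriv (deriv d) x / d x) \<longlongrightarrow> 16) at_infinity" using R16 unfolding tendsto_cong[OF ev] .
    from tendsto_unique[OF trivial_limit_at_infinity this ratl_deriv2_tendsto[OF rd]] show False by simp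
  qed
qed

lemma u_rat_eqI: "rational_solution n m u \<Longrightarrow> u_rat n m = u"
  unfolding u_rat_def using rational_solution_unique by (intro the_equality) auto

lemma rational_limit_at_infinity:
  assumes u: "rational_function u" and bd: "\<forall>\<^sub>F x in at_infinity. norm (u x) \<le> B"
  obtains c where "(u \<longlongrightarrow> c) at_infinity"
proof -
  obtain P Q where 1: "Q \<noteq> 0" "u = (\<lambda>x. poly P x / poly Q x)"
    using u by (auto simp: rational_function_def)
  have ev: "\<forall>\<^sub>F x in at_infinity. u x - poly (P mod Q) x / poly Q x = poly (P div Q) x"
    using eventually_nonroot_at_infinity[OF 1(1)]
  proof eventually_elim
    case (elim x)
    have e: "poly P x = poly (P div Q) x * poly Q x + poly (P mod Q) x"
      by (metis div_mult_mod_eq poly_add poly_mult)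
    have gen: "(d * q + r) / q - r / q = d" if "q \<noteq> 0" for d q r :: complex
      using that by (simp add: add_divide_distrib)
    show ?case unfolding 1(2) e by (rule gen[OF elim])
  qed
  have r0: "((\<lambda>x. poly (P mod Q) x / poly Q x) \<longlongrightarrow> 0) at_infinity"
  proof (cases "P mod Q = 0")
    case False
    then show ?thesis using degree_mod_less[OF 1(1), of P] by (intro poly_divide_tendsto_0_at_infinity) auto
  qed simp
  have "\<forall>\<^sub>F x in at_infinity. dist (poly (P mod Q) x / poly Q x) 0 < 1" using r0 by (rule tendstoD) simp
  with ev bd have b2: "\<forall>\<^sub>F x in at_infinity. norm (poly (P div Q) x) \<le> B + 1"
  proof eventually_elim
    case (elim x)
    then show ?case using norm_triangle_ineq4[of "u x" "poly (P mod Q) x / poly Q x"] by (simp add: dist_norm)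
  qed
  have "degree (P div Q) = 0"
  proof (rule ccontr)
    assume "degree (P div Q) \<noteq> 0"
    then have "filterlim (poly (P div Q)) at_infinity at_infinity" by (intro filterlim_poly_at_infinity) simp
    then have "\<forall>\<^sub>F x in at_infinity. norm (poly (P div Q) x) \<ge> B + 2"
      unfolding filterlim_iff by (rule allE[of _ "\<lambda>z. norm z \<ge> B + 2"]) (auto simp: eventually_at_infinity)
    with b2 have "\<forall>\<^sub>F x::complex in at_infinity. False" by eventually_elim auto
    then show False by (simp add: eventually_False trivial_limit_at_infinity)
  qed
  then obtain c where c: "P div Q = [:c:]" by (auto elim: degree_eq_zeroE)
  have "((\<lambda>x. poly (P div Q) x + poly (P mod Q) x / poly Q x) \<longlongrightarrow> c + 0) at_infinity"
    using r0 unfolding c by (intro tendsto_intros) auto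
  moreover have ev2: "\<forall>\<^sub>F x in at_infinity. poly (P div Q) x + poly (P mod Q) x / poly Q x = u x"
    using ev by eventually_elim (metis diff_add_cancel)
  ultimately have "(u \<longlongrightarrow> c) at_infinity" unfolding tendsto_cong[OF ev2] by simp
  then show ?thesis by (rule that)
qed

lemma fourth_root_of_unity_near_1: assumes "(c::complex)^4 = 1" "norm (c - 1) \<le> 1/2" shows "c = 1"
proof -
  have "(c - 1) * ((c + 1) * ((c - \<i>) * (c + \<i>))) = 0"
    using assms(1) by (simp add: algebra_simps power4_eq_xxxx)
  moreover have "\<bar>Re c - 1\<bar> \<le> 1/2" using abs_Re_le_cmod[of "c - 1"] assms(2) by simp
  then have "c + 1 \<noteq> 0" "c - \<i> \<noteq> 0" "c + \<i> \<noteq> 0" by (auto simp: complex_eq_iff)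
  ultimately show ?thesis by simp
qed

text \<open>A bounded rational function has a limit \<open>c\<close> at infinity, and its derivatives tend
  to \<open>0\<close>. The equation then gives \<open>c^4 = 1\<close>, and \<open>1\<close> is
  the only fourth root of unity near \<open>1\<close>. At points where the equation is not known
  it follows by continuity.\<close>

lemma rational_solutionI:
  assumes u: "rational_function u"
    and P: "finite {x. \<not> painleve_III (of_int n + m) (m - of_int n + 1) u x}"
    and bd: "\<forall>\<^sub>F x in at_infinity. norm (u x - 1) \<le> 1/2"
  shows "rational_solution n m u"
  unfolding rational_solution_def
proof (intro conjI allI impI)
  show "rational_function u" by (rule u)
next
  fix x0 assume x0: "x0 \<noteq> 0 \<and> u x0 \<noteq> 0"
  have an: "u analytic_on {x0}" using rational_function_analytic[OF u] x0 by simp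
  then have an1: "deriv u analytic_on {x0}" by (rule analytic_deriv)
  then have an2: "deriv (deriv u) analytic_on {x0}" by (rule analytic_deriv)
  define r where "r x = (deriv u x)\<^sup>2 / u x - deriv u x / x
       + (4 * (of_int n + m) * (u x)\<^sup>2 + 4 * (1 - (m - of_int n + 1))) / x + 4 * (u x) ^ 3 - 4 / u x" for x
  have c: "isCont (deriv (deriv u)) x0" "isCont (deriv u) x0" "isCont u x0"
    using an an1 an2 by (auto intro: analytic_at_imp_isCont)
  have "isCont r x0" unfolding r_def[abs_def] using c x0 by (intro continuous_intros) auto
  then have 1: "r \<midarrow>x0\<rightarrow> r x0" by (simp add: isCont_def)
  have 2: "deriv (deriv u) \<midarrow>x0\<rightarrow> deriv (deriv u) x0" using c by (simp add: isCont_def)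
  have ev: "\<forall>\<^sub>F x in at x0. deriv (deriv u) x = r x"
    using eventually_notin_finite[OF P, of x0] by eventually_elim (simp add: painleve_III_def r_def)
  have "r \<midarrow>x0\<rightarrow> deriv (deriv u) x0" using 2 unfolding tendsto_cong[OF ev] .
  with 1 have "deriv (deriv u) x0 = r x0" using tendsto_unique[of "at x0" r] by simp
  then show "painleve_III (of_int n + m) (m - of_int n + 1) u x0" by (simp add: painleve_III_def r_def)
next
  have "\<forall>\<^sub>F x in at_infinity. norm (u x) \<le> 2"
    using bd
  proof eventually_elim
    case (elim x) then show ?case using norm_triangle_ineq[of "u x - 1" 1] by simp
  qed
  then obtain c where c: "(u \<longlongrightarrow> c) at_infinity" using rational_limit_at_infinity[OF u] by blast
  have nt: "at_infinity \<noteq> (bot :: complex filter)" by (rule trivial_limit_at_infinity)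
  have "((\<lambda>x. norm (u x - 1)) \<longlongrightarrow> norm (c - 1)) at_infinity" by (intro tendsto_intros c)
  from tendsto_upperbound[OF this bd nt] have c1: "norm (c - 1) \<le> 1/2" .
  then have c0: "c \<noteq> 0" by auto
  have r: "ratl u" by (rule rational_function_ratl[OF u])
  have ne: "\<forall>\<^sub>F x in at_infinity. u x \<noteq> 0" using tendsto_imp_eventually_ne[OF c c0] .
  have inv: "((\<lambda>x::complex. 1 / x) \<longlongrightarrow> 0) at_infinity"
    unfolding divide_inverse mult_1_left by (rule tendsto_inverse_0)
  have "((\<lambda>x. (deriv u x / u x)\<^sup>2 * u x - (deriv u x / u x) * u x * (1 / x) + (4 * (of_int n + m) * (u x)\<^sup>2 + 4 * (1 - (m - of_int n + 1))) * (1 / x)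
     + 4 * (u x) ^ 3 - 4 / u x - (deriv (deriv u) x / u x) * u x) \<longlongrightarrow>
     0\<^sup>2 * c - 0 * c * 0 + (4 * (of_int n + m) * c\<^sup>2 + 4 * (1 - (m - of_int n + 1))) * 0 + 4 * c ^ 3 - 4 / c - 0 * c) at_infinity"
    by (intro tendsto_intros ratl_logderiv_tendsto ratl_deriv2_tendsto r inv c c0)
  moreover have ev: "\<forall>\<^sub>F x in at_infinity. (deriv u x / u x)\<^sup>2 * u x - (deriv u x / u x) * u x * (1 / x) + (4 * (of_int n + m) * (u x)\<^sup>2 + 4 * (1 - (m - of_int n + 1))) * (1 / x)
     + 4 * (u x) ^ 3 - 4 / u x - (deriv (deriv u) x / u x) * u x = 0"
    using ne finite_imp_eventually_at_infinity[OF P]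
  proof eventually_elim
    case (elim x)
    from elim(2) show ?case unfolding painleve_III_def using elim(1) by (simp add: power2_eq_square)
  qed
  ultimately have "((\<lambda>x::complex. 0) \<longlongrightarrow> 4 * c ^ 3 - 4 / c) at_infinity"
    unfolding tendsto_cong[OF ev] by simp
  then have "4 * c ^ 3 - 4 / c = 0" using tendsto_unique[OF nt _ tendsto_const] by blast
  then have "c ^ 4 = 1" using c0 by (simp add: field_simps power4_eq_xxxx power3_eq_cube)
  then have "c = 1" using fourth_root_of_unity_near_1 c1 by blast
  then show "(u \<longlongrightarrow> 1) at_infinity" using c by simp
qed

section \<open>Riccati solutions and the case one half\<close>

text \<open>This is the statement that is propagated from \<open>m\<close> to \<open>m + 1\<close>. The
  value at the origin belongs to it because the transform divides by \<open>u\<close>, and its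
  behaviour near the zero of \<open>w_lim\<close> has to be known.\<close>

definition asymptotics_at :: "complex \<Rightarrow> bool" where
  "asymptotics_at m \<longleftrightarrow> (\<forall>d. 0 < d \<longrightarrow> d \<le> 1/4 \<longrightarrow> (\<exists>C N. \<forall>n\<ge>N. \<exists>u. rational_solution (int n) m u \<and> u 0 = 0 \<and>
     (\<forall>y\<in>away d. u analytic_on {of_nat n * y} \<and> norm (u (of_nat n * y) - w_lim y) \<le> C / real n)))"

lemma away_antimono: "d \<le> d' \<Longrightarrow> away d' \<subseteq> away d" by (auto simp: away_def)

lemma away_not_eyebrow: "0 < d \<Longrightarrow> y \<in> away d \<Longrightarrow> y \<notin> eyebrow_zero" by (force simp: away_def)

lemma away_far: "d \<le> 1/4 \<Longrightarrow> norm y \<ge> 3 \<Longrightarrow> y \<in> away d"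
proof -
  assume d: "d \<le> 1/4" and y: "norm y \<ge> 3"
  have "d \<le> dist y z" if "z \<in> eyebrow_zero" for z
    using norm_eyebrow_le[OF that] norm_triangle_ineq2[of y z] y d by (simp add: dist_norm)
  then show ?thesis by (simp add: away_def)
qed

lemma w_lim_near_1_at_infinity: obtains B where "B \<ge> 3" "\<And>y. norm y \<ge> B \<Longrightarrow> norm (w_lim y - 1) \<le> 1/4"
proof -
  have inv: "((\<lambda>x::complex. 1 / x) \<longlongrightarrow> 0) at_infinity" unfolding divide_inverse mult_1_left by (rule tendsto_inverse_0)
  have 1: "((\<lambda>y::complex. (1 / y)\<^sup>2 / 4 + 1) \<longlongrightarrow> 0\<^sup>2 / 4 + 1) at_infinity" by (intro tendsto_intros inv) auto
  have 2: "((\<lambda>y. csqrt ((1 / y)\<^sup>2 / 4 + 1)) \<longlongrightarrow> csqrt 1) at_infinity"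
    by (rule isCont_tendsto_compose[OF continuous_at_csqrt]) (use 1 in auto)
  have "((\<lambda>y. csqrt ((1 / y)\<^sup>2 / 4 + 1) - (1 / y) / 2) \<longlongrightarrow> csqrt 1 - 0 / 2) at_infinity"
    by (intro tendsto_intros 2 inv) auto
  then have "((\<lambda>y. csqrt ((1 / y)\<^sup>2 / 4 + 1) - (1 / y) / 2) \<longlongrightarrow> 1) at_infinity" by simp
  moreover have "csqrt ((1 / y)\<^sup>2 / 4 + 1) - (1 / y) / 2 = w_out y" for y
    by (simp add: w_out_def root_out_def power_divide mult.commute)
  ultimately have "(w_out \<longlongrightarrow> 1) at_infinity" by simp
  from tendstoD[OF this, of "1/4"] obtain b where b: "\<And>y. norm y \<ge> b \<Longrightarrow> dist (w_out y) 1 < 1/4"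
    by (auto simp: eventually_at_infinity)
  show ?thesis
  proof (rule that[of "max 3 b"])
    fix y :: complex assume "max 3 b \<le> norm y"
    then show "norm (w_lim y - 1) \<le> 1/4" using w_lim_at_infinity(1)[of y] b[of y] by (simp add: dist_norm)
  qed simp
qed

text \<open>Far from the eyebrow the estimate places \<open>u\<close> near \<open>w_lim\<close>, which is
  near \<open>1\<close>; by \<open>rational_solutionI\<close> the limit at infinity must then be
  \<open>1\<close>.\<close>

lemma rational_solution_from_estimate:
  assumes u: "rational_function u"
    and P: "finite {x. \<not> painleve_III (of_int (int n) + m) (m - of_int (int n) + 1) u x}"
    and n: "n > 0" and d: "d \<le> 1/4" and C: "4 * C \<le> real n"
    and est: "\<And>y. y \<in> away d \<Longrightarrow> norm (u (of_nat n * y) - w_lim y) \<le> C / real n"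
  shows "rational_solution (int n) m u"
proof (rule rational_solutionI[OF u P])
  obtain B where B: "B \<ge> 3" "\<And>y. norm y \<ge> B \<Longrightarrow> norm (w_lim y - 1) \<le> 1/4" using w_lim_near_1_at_infinity by blast
  have "norm (u x - 1) \<le> 1/2" if x: "norm x \<ge> real n * B" for x
  proof -
    define y where "y = x / of_nat n"
    have xy: "x = of_nat n * y" using n by (simp add: y_def)
    have y: "norm y \<ge> B" using x n by (simp add: y_def norm_divide field_simps)
    then have "y \<in> away d" using B(1) by (intro away_far d) simp
    from est[OF this] have "norm (u x - w_lim y) \<le> C / real n" by (simp add: xy)
    also have "\<dots> \<le> 1/4" using C n by (simp add: field_simps)
    finally show ?thesis using B(2)[OF y] norm_triangle_ineq[of "u x - w_lim y" "w_lim y - 1"] by simp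
  qed
  then show "\<forall>\<^sub>F x in at_infinity. norm (u x - 1) \<le> 1/2" unfolding eventually_at_infinity by blast
qed

lemma painleve_cong:
  assumes S: "open S" "x \<in> S" "\<And>z. z \<in> S \<Longrightarrow> g z = f z" and f: "painleve_III a b f x"
  shows "painleve_III a b g x"
proof -
  have d: "deriv g z = deriv f z" if "z \<in> S" for z
    by (rule deriv_cong_ev) (use S that in \<open>auto simp: eventually_nhds intro!: exI[of _ S]\<close>)
  have "deriv (deriv g) x = deriv (deriv f) x"
    by (rule deriv_cong_ev) (use S d in \<open>auto simp: eventually_nhds intro!: exI[of _ S]\<close>)
  then show ?thesis using f S d[OF S(2)] by (simp add: painleve_III_def)
qed

text \<open>Differentiating the Riccati equation and eliminating gives the Painleve equation with \<open>m
  = 1/2\<close>.\<close>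

lemma riccati_painleve:
  assumes S: "open S" "x \<in> S" and S0: "\<And>z. z \<in> S \<Longrightarrow> z \<noteq> 0" and fx: "f x \<noteq> 0"
    and der: "\<And>z. z \<in> S \<Longrightarrow> (f has_field_derivative 2 * (f z)\<^sup>2 + 2 * c * f z / z - 2) (at z)"
  shows "painleve_III (c + 1/2) (1/2 - c + 1) f x"
proof -
  define p where "p = f x"
  define p1 where "p1 = 2 * p\<^sup>2 + 2 * c * p / x - 2"
  have x0: "x \<noteq> 0" using S0 S(2) by blast
  have d1: "deriv f z = 2 * (f z)\<^sup>2 + 2 * c * f z / z - 2" if "z \<in> S" for z using DERIV_imp_deriv[OF der[OF that]] .
  have dfx: "(f has_field_derivative p1) (at x)" using der[OF S(2)] by (simp add: p1_def p_def)
  have "((\<lambda>z. 2 * (f z)\<^sup>2 + 2 * c * f z / z - 2) has_field_derivative 4 * p * p1 + (2 * c * p1 * x - 2 * c * p) / (x * x)) (at x)"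
    by (rule derivative_eq_intros dfx refl x0)+ (simp add: p_def)
  then have "(deriv f has_field_derivative 4 * p * p1 + (2 * c * p1 * x - 2 * c * p) / (x * x)) (at x)"
    by (rule has_field_derivative_transform_within_open[OF _ S(1,2)]) (simp add: d1)
  then have d2: "deriv (deriv f) x = 4 * p * p1 + (2 * c * p1 * x - 2 * c * p) / (x * x)" by (rule DERIV_imp_deriv)
  have p: "p \<noteq> 0" using fx by (simp add: p_def)
  have "4 * p * p1 + (2 * c * p1 * x - 2 * c * p) / (x * x) = p1\<^sup>2 / p - p1 / x + (4 * (c + 1/2) * p\<^sup>2 + 4 * (1 - (1/2 - c + 1))) / x + 4 * p ^ 3 - 4 / p"
  proof -
    have gen: "4 * p * q + (2 * c * q * x - 2 * c * p) * (s * s) = q\<^sup>2 * r - q * s + ((4 * c + 2) * p\<^sup>2 + (4 * c - 2)) * s + 4 * p ^ 3 - 4 * r"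
      if "p * r = 1" "x * s = 1" "q = 2 * p\<^sup>2 + 2 * c * p * s - 2" for r s q :: complex
      using that by algebra
    have e: "4 * (c + 1/2) = 4 * c + 2" "4 * (1 - (1/2 - c + 1)) = 4 * c - 2" by (simp_all add: algebra_simps)
    show ?thesis unfolding e unfolding divide_inverse inverse_mult_distrib
      by (rule gen) (use p x0 in \<open>simp_all add: p1_def divide_inverse\<close>)
  qed
  then show ?thesis unfolding painleve_III_def d2 d1[OF S(2)] p_def[symmetric] p1_def by simp
qed

lemma analytic_set_open: "open {z. f analytic_on {z}}"
proof -
  have "\<exists>e>0. ball z e \<subseteq> {z. f analytic_on {z}}" if "f analytic_on {z}" for z
  proof -
    obtain S where S: "open S" "z \<in> S" "f holomorphic_on S" using \<open>f analytic_on {z}\<close> by (auto simp: analytic_at)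
    then obtain e where "e > 0" "ball z e \<subseteq> S" using open_contains_ball by blast
    then show ?thesis using S by (intro exI[of _ e]) (auto simp: analytic_at)
  qed
  then show ?thesis by (auto simp: open_contains_ball)
qed

lemma asymptotics_at_half: "asymptotics_at (1/2)"
  unfolding asymptotics_at_def
proof (intro allI impI)
  fix d :: real assume d: "0 < d" "d \<le> 1/4"
  obtain C N where C: "C > 0" "N > 0" and be: "\<And>n y. n \<ge> N \<Longrightarrow> y \<in> away d \<Longrightarrow> phi n (2 * of_nat n * y) \<noteq> 0 \<and> norm (bessel_U n y - w_lim y) \<le> C / real n"
    using bessel_asymptotics[OF d] by metis
  define N' where "N' = max N (nat \<lceil>4 * C\<rceil>)"
  have "\<exists>u. rational_solution (int n) (1/2) u \<and> u 0 = 0 \<and>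
     (\<forall>y\<in>away d. u analytic_on {of_nat n * y} \<and> norm (u (of_nat n * y) - w_lim y) \<le> C / real n)" if n: "n \<ge> N'" for n
  proof -
    have nN: "n \<ge> N" "n > 0" "4 * C \<le> real n" using n C unfolding N'_def by (auto simp: nat_le_iff ceiling_le_iff)
    define P where "P = [:0, 2:] * pcompose (theta (n - 1)) [:0, 2:]"
    define Q where "Q = pcompose (theta n) [:0, 2:]"
    have p0: "poly (pcompose (theta k) [:0, 2:]) 0 \<noteq> 0" for k using theta_at_0[of k] by (simp add: poly_pcompose)
    have Q: "Q \<noteq> 0" using p0[of n] by (auto simp: Q_def)
    have P: "P \<noteq> 0" using p0[of "n - 1"] by (auto simp: P_def)
    define f where "f x = bessel_U n (x / of_nat n)" for x
    have fq: "f x = poly P x / poly Q x" for x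
      using nN(2) by (simp add: f_def bessel_U_def P_def Q_def poly_pcompose phi_def mult.commute)
    have phQ: "phi n (2 * x) \<noteq> 0 \<longleftrightarrow> poly Q x \<noteq> 0" for x by (simp add: phi_def Q_def poly_pcompose mult.commute)
    have "ratl f" by (rule ratlI[OF Q fq])
    then obtain u where u: "rational_function u" "finite {x. u x \<noteq> f x}" by (rule ratl_normalize)
    have fan: "f analytic_on {x}" if "poly Q x \<noteq> 0" for x
    proof -
      have "(\<lambda>x. poly P x / poly Q x) holomorphic_on {x. poly Q x \<noteq> 0}" by (intro holomorphic_intros) auto
      then show ?thesis unfolding fq[abs_def] analytic_at using open_nonroots[of Q] that by blast
    qed
    have ueq: "u analytic_on {x} \<and> u x = f x" if "poly Q x \<noteq> 0" for x
      by (rule rational_function_eq_at[OF u(1) fan[OF that]]) (use eventually_notin_finite[OF u(2), of x] in simp)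
    have est: "u analytic_on {of_nat n * y} \<and> norm (u (of_nat n * y) - w_lim y) \<le> C / real n" if "y \<in> away d" for y
    proof -
      have b: "phi n (2 * of_nat n * y) \<noteq> 0 \<and> norm (bessel_U n y - w_lim y) \<le> C / real n" by (rule be[OF nN(1) that])
      then have "poly Q (of_nat n * y) \<noteq> 0" using phQ[of "of_nat n * y"] by (simp add: mult.assoc)
      from ueq[OF this] b show ?thesis using nN(2) by (simp add: f_def)
    qed
    define A where "A = {x. u x \<noteq> f x} \<union> {0} \<union> {x. poly P x = 0} \<union> {x. poly Q x = 0}"
    have finA: "finite A" using u(2) poly_roots_finite[OF P] poly_roots_finite[OF Q] by (simp add: A_def)
    then have opA: "open (- A)" by (intro open_Compl finite_imp_closed)
    have pnl: "painleve_III (of_int (int n) + 1/2) (1/2 - of_int (int n) + 1) u x" if x: "x \<in> - A" for x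
    proof (rule painleve_cong[OF opA x])
      show "u z = f z" if "z \<in> - A" for z using that by (simp add: A_def)
      have "painleve_III (of_nat n + 1/2) (1/2 - of_nat n + 1) f x"
      proof (rule riccati_painleve[OF opA x])
        show "f x \<noteq> 0" using x by (simp add: A_def fq)
        fix z assume z: "z \<in> - A"
        then show "z \<noteq> 0" by (simp add: A_def)
        then have zn: "z / of_nat n \<noteq> 0" using nN(2) by (simp add: neq0_conv)
        have "phi n (2 * of_nat n * (z / of_nat n)) \<noteq> 0" using z phQ[of z] nN(2) by (simp add: A_def)
        note D = DERIV_bessel_U[OF nN(2) zn this]
        have d: "((\<lambda>x. x / of_nat n) has_field_derivative 1 / of_nat n) (at z)" by (rule DERIV_cdivide[OF DERIV_ident])
        have "(f has_field_derivative 2 * of_nat n * ((bessel_U n (z / of_nat n))\<^sup>2 + bessel_U n (z / of_nat n) / (z / of_nat n) - 1) * (1 / of_nat n)) (at z)"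
          unfolding f_def[abs_def] by (rule DERIV_chain2[where f="bessel_U n" and g="\<lambda>x. x / of_nat n" and s=UNIV, OF D d])
        moreover have "2 * of_nat n * ((bessel_U n (z / of_nat n))\<^sup>2 + bessel_U n (z / of_nat n) / (z / of_nat n) - 1) * (1 / of_nat n)
          = 2 * (f z)\<^sup>2 + 2 * of_nat n * f z / z - 2"
        proof -
          define b where "b = f z"
          have "bessel_U n (z / of_nat n) = b" by (simp add: b_def f_def)
          moreover have "2 * k * X * (1 / k) = 2 * X" if "k \<noteq> 0" for k X :: complex using that by simp
          then have "2 * of_nat n * (b\<^sup>2 + b / (z / of_nat n) - 1) * (1 / of_nat n) = 2 * (b\<^sup>2 + b / (z / of_nat n) - 1)"
            using nN(2) by (metis of_nat_0_eq_iff less_numeral_extra(3))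
          moreover have "b / (z / of_nat n) = of_nat n * b / z" by simp
          ultimately show ?thesis unfolding b_def[symmetric] by (simp only:) (simp add: algebra_simps)
        qed
        ultimately show "(f has_field_derivative 2 * (f z)\<^sup>2 + 2 * of_nat n * f z / z - 2) (at z)" by simp
      qed
      then show "painleve_III (of_int (int n) + 1/2) (1/2 - of_int (int n) + 1) f x" by simp
    qed
    have "finite {x. \<not> painleve_III (of_int (int n) + 1/2) (1/2 - of_int (int n) + 1) u x}"
      by (rule finite_subset[OF _ finA]) (use pnl in blast)
    then have "rational_solution (int n) (1/2) u"
      using rational_solution_from_estimate[OF u(1) _ nN(2) d(2) nN(3)] est by blast
    moreover have "u 0 = 0" using ueq[of 0] p0[of n] by (simp add: fq P_def Q_def)
    ultimately show ?thesis using est by blast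
  qed
  then show "\<exists>C N. \<forall>n\<ge>N. \<exists>u. rational_solution (int n) (1/2) u \<and> u 0 = 0 \<and>
     (\<forall>y\<in>away d. u analytic_on {of_nat n * y} \<and> norm (u (of_nat n * y) - w_lim y) \<le> C / real n)" by blast
qed

section \<open>The Baecklund transformation\<close>

text \<open>\<open>backlund_Y\<close> is the auxiliary function that turns the second-order equation into
  a first-order system for \<open>(u, Y)\<close>, with \<open>N\<close> in the role of
  \<open>n\<close>.\<close>

definition backlund_Y :: "complex \<Rightarrow> complex \<Rightarrow> (complex \<Rightarrow> complex) \<Rightarrow> complex \<Rightarrow> complex" where
  "backlund_Y N m u x = (x * deriv u x / u x + 2 * x * (u x - 1 / u x) + 2 * N) / (2 * m + 1)"
definition backlund_v :: "complex \<Rightarrow> complex \<Rightarrow> (complex \<Rightarrow> complex) \<Rightarrow> complex \<Rightarrow> complex" where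
  "backlund_v N m u x = (1 - backlund_Y N m u x) / (u x * (1 + backlund_Y N m u x))"

text \<open>The Painleve equation is used exactly once, to eliminate the second derivative; the terms with
  the first derivative then regroup into \<open>backlund_Y\<close>.\<close>

lemma DERIV_backlund_Y:
  assumes an: "u analytic_on {x}" and x: "x \<noteq> 0" and ux: "u x \<noteq> 0" and a: "2 * m + 1 \<noteq> 0"
    and P: "painleve_III (N + m) (m - N + 1) u x"
  shows "(backlund_Y N m u has_field_derivative 2 * (u x + 1 / u x) * backlund_Y N m u x + 2 * (u x - 1 / u x)) (at x)"
proof -
  define p where "p = u x"
  define p1 where "p1 = deriv u x"
  define p2 where "p2 = deriv (deriv u) x"
  define c where "c = 2 * m + 1"
  have p: "p \<noteq> 0" "c \<noteq> 0" using ux a by (auto simp: p_def c_def)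
  have m: "m = (c - 1) / 2" by (simp add: c_def)
  have du: "(u has_field_derivative p1) (at x)" unfolding p1_def
    using an analytic_on_imp_differentiable_at[of u "{x}" x] DERIV_deriv_iff_field_differentiable by blast
  have ddu: "(deriv u has_field_derivative p2) (at x)" unfolding p2_def
    using analytic_deriv[OF an] analytic_on_imp_differentiable_at[of "deriv u" "{x}" x] DERIV_deriv_iff_field_differentiable by blast
  have P': "p2 = p1\<^sup>2 / p - p1 / x + (4 * (N + m) * p\<^sup>2 + 4 * (N - m)) / x + 4 * p ^ 3 - 4 / p"
    using P by (simp add: painleve_III_def p_def p1_def p2_def)
  have Y: "backlund_Y N m u x = (x * p1 / p + 2 * x * (p - 1 / p) + 2 * N) / c" by (simp add: backlund_Y_def p_def p1_def c_def)
  have 1: "((\<lambda>x. x * deriv u x / u x) has_field_derivative ((p1 + p2 * x) * p - x * p1 * p1) / (p * p)) (at x)"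
    using DERIV_divide[OF DERIV_mult[OF DERIV_ident ddu] du] ux by (simp add: p_def p1_def)
  have 2: "((\<lambda>x. 1 / u x) has_field_derivative - p1 / (p * p)) (at x)"
    using DERIV_divide[OF DERIV_const[of 1] du] ux by (simp add: p_def)
  have 3: "((\<lambda>x. 2 * x * (u x - 1 / u x)) has_field_derivative 2 * (p - 1 / p) + (p1 - - p1 / (p * p)) * (2 * x)) (at x)"
    using DERIV_mult[OF DERIV_cmult_Id[of 2] DERIV_diff[OF du 2]] by (simp add: p_def)
  have 4: "(backlund_Y N m u has_field_derivative (((p1 + p2 * x) * p - x * p1 * p1) / (p * p) + (2 * (p - 1 / p) + (p1 - - p1 / (p * p)) * (2 * x)) + 0) / c) (at x)"
    unfolding backlund_Y_def[abs_def] c_def by (rule DERIV_cdivide[OF DERIV_add[OF DERIV_add[OF 1 3] DERIV_const]])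
  have "((p1 + p2 * x) * p - x * p1 * p1) / (p * p) + (2 * (p - 1 / p) + (p1 - - p1 / (p * p)) * (2 * x)) + 0
     = 2 * (p + 1 / p) * (x * p1 / p + 2 * x * (p - 1 / p) + 2 * N) + 2 * c * (p - 1 / p)"
  proof -
    have gen: "((p1 + q * x) * p - x * p1 * p1) * (r * r) + (2 * (p - 1 * r) + (p1 - - p1 * (r * r)) * (2 * x)) + 0
       = 2 * (p + 1 * r) * (x * p1 * r + 2 * x * (p - 1 * r) + 2 * N) + 2 * (2 * m + 1) * (p - 1 * r)"
      if "p * r = 1" "x * s = 1" "q = p1\<^sup>2 * r - p1 * s + (4 * (N + m) * p\<^sup>2 + 4 * (N - m)) * s + 4 * p ^ 3 - 4 * r"
      for r s q :: complex
      using that by algebra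
    show ?thesis unfolding c_def divide_inverse inverse_mult_distrib
      by (rule gen[of _ "inverse x"]) (use p x P' in \<open>simp_all add: divide_inverse\<close>)
  qed
  then have "(((p1 + p2 * x) * p - x * p1 * p1) / (p * p) + (2 * (p - 1 / p) + (p1 - - p1 / (p * p)) * (2 * x)) + 0) / c
     = (2 * (p + 1 / p) * (x * p1 / p + 2 * x * (p - 1 / p) + 2 * N) + 2 * c * (p - 1 / p)) / c" by (simp only:)
  also have "\<dots> = 2 * (p + 1 / p) * backlund_Y N m u x + 2 * (p - 1 / p)"
  proof -
    have gen: "(k * X + 2 * c * d) / c = k * (X / c) + 2 * d" for k X d :: complex
      using p(2) by (simp add: add_divide_distrib)
    show ?thesis unfolding Y by (rule gen)
  qed
  finally show ?thesis using 4 by (simp only: p_def)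
qed

lemma DERIV_u_from_backlund_Y:
  assumes an: "u analytic_on {x}" and x: "x \<noteq> 0" and ux: "u x \<noteq> 0" and a: "2 * m + 1 \<noteq> 0"
  shows "(u has_field_derivative u x * ((2 * m + 1) * backlund_Y N m u x - 2 * x * (u x - 1 / u x) - 2 * N) / x) (at x)"
proof -
  have "(2 * m + 1) * backlund_Y N m u x = x * deriv u x / u x + 2 * x * (u x - 1 / u x) + 2 * N"
    using a by (simp add: backlund_Y_def)
  then have "u x * ((2 * m + 1) * backlund_Y N m u x - 2 * x * (u x - 1 / u x) - 2 * N) / x = deriv u x"
    using x ux by simp
  then show ?thesis
    using an analytic_on_imp_differentiable_at[of u "{x}" x] DERIV_deriv_iff_field_differentiable by force
qed

text \<open>With \<open>v = (1 - Y) / (u (1 + Y))\<close> the system is symmetric: \<open>u\<close> is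
  recovered from \<open>v\<close> by the same formula, and \<open>Y' = - 2 (v + 1/v) Y - 2 (v -
  1/v)\<close>. Eliminating \<open>Y\<close> from the equations for \<open>v\<close> and
  \<open>Y\<close> instead of \<open>u\<close> and \<open>Y\<close> gives the Painleve equation
  with \<open>m + 1\<close>.\<close>

lemma backlund_system:
  fixes u Y :: "complex \<Rightarrow> complex"
  assumes S: "open S" "x \<in> S" and S0: "\<And>z. z \<in> S \<Longrightarrow> z \<noteq> 0 \<and> u z \<noteq> 0 \<and> Y z \<noteq> 1 \<and> Y z \<noteq> - 1"
    and du: "\<And>z. z \<in> S \<Longrightarrow> (u has_field_derivative u z * (c * Y z - 2 * z * (u z - 1 / u z) - 2 * N) / z) (at z)"
    and dY: "\<And>z. z \<in> S \<Longrightarrow> (Y has_field_derivative 2 * (u z + 1 / u z) * Y z + 2 * (u z - 1 / u z)) (at z)"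
    and c: "c = 2 * m + 1"
  shows "painleve_III (N + (m + 1)) ((m + 1) - N + 1) (\<lambda>z. (1 - Y z) / (u z * (1 + Y z))) x"
proof -
  define v where "v z = (1 - Y z) / (u z * (1 + Y z))" for z
  have uv: "u z = (1 - Y z) / (v z * (1 + Y z))" "v z \<noteq> 0" "1 + Y z \<noteq> 0" "1 - Y z \<noteq> 0" if "z \<in> S" for z
  proof -
    have nz: "1 + Y z \<noteq> 0" "1 - Y z \<noteq> 0" "u z \<noteq> 0"
      using S0[OF that] by (auto simp: add_eq_0_iff)
    then show "1 + Y z \<noteq> 0" "1 - Y z \<noteq> 0" "v z \<noteq> 0" "u z = (1 - Y z) / (v z * (1 + Y z))"
      by (auto simp: v_def)
  qed
  have dYv: "2 * (u z + 1 / u z) * Y z + 2 * (u z - 1 / u z) = - 2 * (v z + 1 / v z) * Y z - 2 * (v z - 1 / v z)" if "z \<in> S" for z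
  proof -
    define a where "a = 1 - Y z" define b where "b = 1 + Y z"
    have nz: "a \<noteq> 0" "b \<noteq> 0" "u z \<noteq> 0" using uv[OF that] S0[OF that] by (auto simp: a_def b_def)
    have v: "v z = a / (u z * b)" by (simp add: v_def a_def b_def)
    have 1: "v z * b = a * (1 / u z)" "1 / v z * a = u z * b" unfolding v using nz by simp_all
    have "2 * (u z + 1 / u z) * Y z + 2 * (u z - 1 / u z) = 2 * (u z * b) - 2 * (a * (1 / u z))"
    proof -
      have "2 * (p + i) * y + 2 * (p - i) = 2 * (p * (1 + y)) - 2 * ((1 - y) * i)" for p i y :: complex
        by (simp add: algebra_simps)
      then show ?thesis unfolding a_def b_def .
    qed
    also have "\<dots> = 2 * (1 / v z * a) - 2 * (v z * b)" by (simp only: 1)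
    also have "\<dots> = - 2 * (v z + 1 / v z) * Y z - 2 * (v z - 1 / v z)"
    proof -
      have "2 * (i * (1 - y)) - 2 * (p * (1 + y)) = - 2 * (p + i) * y - 2 * (p - i)" for p i y :: complex
        by (simp add: algebra_simps)
      then show ?thesis unfolding a_def b_def .
    qed
    finally show ?thesis .
  qed
  have dv: "(v has_field_derivative 2 * (v z)\<^sup>2 - 2 + (2 * N - c * Y z) * v z / z) (at z)" if z: "z \<in> S" for z
  proof -
    define p where "p = u z" define y where "y = Y z"
    define p1 where "p1 = p * (c * y - 2 * z * (p - 1 / p) - 2 * N) / z"
    define y1 where "y1 = 2 * (p + 1 / p) * y + 2 * (p - 1 / p)"
    have nz: "p \<noteq> 0" "1 + y \<noteq> 0" "1 - y \<noteq> 0" "z \<noteq> 0" using uv[OF z] S0[OF z] by (auto simp: p_def y_def)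
    have d1: "(u has_field_derivative p1) (at z)" "(Y has_field_derivative y1) (at z)"
      using du[OF z] dY[OF z] by (simp_all add: p_def y_def p1_def y1_def)
    have A: "((\<lambda>z. 1 - Y z) has_field_derivative - y1) (at z)" using DERIV_diff[OF DERIV_const[of 1] d1(2)] by simp
    have B: "((\<lambda>z. 1 + Y z) has_field_derivative y1) (at z)" using DERIV_add[OF DERIV_const[of 1] d1(2)] by simp
    have D: "(v has_field_derivative (- y1 * (p * (1 + y)) - (1 - y) * (p1 * (1 + y) + y1 * p)) / ((p * (1 + y)) * (p * (1 + y)))) (at z)"
      unfolding v_def[abs_def] using DERIV_divide[OF A DERIV_mult[OF d1(1) B]] nz by (simp add: p_def y_def)
    define w where "w = (1 - y) / (p * (1 + y))"
    have "(- y1 * (p * (1 + y)) - (1 - y) * (p1 * (1 + y) + y1 * p)) / ((p * (1 + y)) * (p * (1 + y)))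
      = w * (- 2 * y1 / ((1 - y) * (1 + y)) - p1 / p)"
    proof -
      define a where "a = 1 - y" define b where "b = 1 + y"
      have ab: "a \<noteq> 0" "b \<noteq> 0" "a + b = 2" using nz by (auto simp: a_def b_def)
      have "(- y1 * (p * b) - a * (p1 * b + y1 * p)) / ((p * b) * (p * b)) = a / (p * b) * (- (a + b) * y1 / (a * b) - p1 / p)"
        using ab(1,2) nz(1) by (simp add: field_simps)
      then show ?thesis unfolding w_def a_def[symmetric] b_def[symmetric] ab(3) by simp
    qed
    also have "- 2 * y1 / ((1 - y) * (1 + y)) - p1 / p = 2 * (w - 1 / w) + (2 * N - c * y) / z"
    proof -
      have p1p: "p1 / p = (c * y - 2 * N) / z - 2 * (p - 1 / p)"
        unfolding p1_def using nz by (simp add: diff_divide_distrib)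
      define a where "a = 1 - y" define b where "b = 1 + y"
      have ab: "a \<noteq> 0" "b \<noteq> 0" "y = b - 1" "a = 2 - b" using nz by (auto simp: a_def b_def)
      have "- 2 * y1 / (a * b) + 2 * (p - 1 / p) = 2 * (w - 1 / w)"
      proof -
        have "2 * (p + i) * y + 2 * (p - i) = 2 * p * (1 + y) - 2 * i * (1 - y)" for i :: complex
          by (simp add: algebra_simps)
        from this[of "1 / p"] have y1: "y1 = 2 * p * b - 2 / p * a" unfolding y1_def a_def b_def by simp
        have w: "w = a / (p * b)" by (simp add: w_def a_def b_def)
        have g: "A0 + 2 * (p - i) = 2 * (w - k)" if "A0 = 4 * t - 4 * r" "w = 2 * t - i" "k = 2 * r - p" for A0 t r i k :: complex
          unfolding that by (simp add: algebra_simps)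
        have A0: "- 2 * y1 / (a * b) = 4 / (p * b) - 4 * p / a" unfolding y1 using ab(1,2) nz(1) by (simp add: field_simps)
        have B0: "w = 2 / (p * b) - 1 / p" unfolding w ab(4) using ab(2) nz(1) by (simp add: field_simps)
        have C0: "1 / w = 2 * p / a - p"
        proof -
          have "1 / w = p * b / a" unfolding w using ab(1,2) nz(1) by simp
          moreover have "b = 2 - a" using ab(4) by simp
          ultimately show ?thesis using ab(1) by (simp add: field_simps)
        qed
        show ?thesis by (rule g[of _ "1 / (p * b)" "p / a"]) (use A0 B0 C0 in simp_all)
      qed
      then show ?thesis unfolding p1p a_def[symmetric] b_def[symmetric] by (simp add: algebra_simps diff_divide_distrib)
    qed
    also have "w * (2 * (w - 1 / w) + (2 * N - c * y) / z) = 2 * w\<^sup>2 - 2 + (2 * N - c * y) * w / z"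
    proof -
      have "w \<noteq> 0" using nz by (simp add: w_def)
      then show ?thesis by (simp add: algebra_simps power2_eq_square)
    qed
    finally show ?thesis using D by (simp add: w_def v_def p_def y_def)
  qed
  define q where "q = v x" define y where "y = Y x"
  define q1 where "q1 = 2 * q\<^sup>2 - 2 + (2 * N - c * y) * q / x"
  define y1 where "y1 = - 2 * (q + 1 / q) * y - 2 * (q - 1 / q)"
  have nz: "q \<noteq> 0" "x \<noteq> 0" using uv(2)[OF S(2)] S0[OF S(2)] by (auto simp: q_def)
  have d1: "(v has_field_derivative q1) (at x)" "(Y has_field_derivative y1) (at x)"
    using dv[OF S(2)] dY[OF S(2)] unfolding dYv[OF S(2)] by (simp_all add: q_def y_def q1_def y1_def)
  have "((\<lambda>z. 2 * (v z)\<^sup>2 - 2 + (2 * N - c * Y z) * v z / z) has_field_derivative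
     4 * q * q1 + (((2 * N - c * y) * q1 - c * y1 * q) * x - (2 * N - c * y) * q) / (x * x)) (at x)"
    by (rule derivative_eq_intros d1 refl nz)+ (simp add: q_def y_def algebra_simps)
  then have "(deriv v has_field_derivative 4 * q * q1 + (((2 * N - c * y) * q1 - c * y1 * q) * x - (2 * N - c * y) * q) / (x * x)) (at x)"
    by (rule has_field_derivative_transform_within_open[OF _ S]) (use DERIV_imp_deriv[OF dv] in simp)
  then have d2: "deriv (deriv v) x = 4 * q * q1 + (((2 * N - c * y) * q1 - c * y1 * q) * x - (2 * N - c * y) * q) / (x * x)" by (rule DERIV_imp_deriv)
  have d1x: "deriv v x = q1" by (rule DERIV_imp_deriv[OF d1(1)])
  have "4 * q * q1 + (((2 * N - c * y) * q1 - c * y1 * q) * x - (2 * N - c * y) * q) / (x * x)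
     = q1\<^sup>2 / q - q1 / x + (4 * (N + (m + 1)) * q\<^sup>2 + 4 * (1 - ((m + 1) - N + 1))) / x + 4 * q ^ 3 - 4 / q"
  proof -
    define b where "b = 2 * N - c * y"
    have q1: "q1 = 2 * q\<^sup>2 - 2 + b * q / x" by (simp add: q1_def b_def)
    have cy: "c * y1 * q = (b - 2 * N) * 2 * (q\<^sup>2 + 1) - 2 * c * (q\<^sup>2 - 1)"
    proof -
      have g: "(- 2 * (q + i) * y - 2 * (q - i)) * q = - 2 * (q\<^sup>2 + 1) * y - 2 * (q\<^sup>2 - 1)" if "q * i = 1" for i
        using that by algebra
      have yq: "y1 * q = - 2 * (q\<^sup>2 + 1) * y - 2 * (q\<^sup>2 - 1)" unfolding y1_def by (rule g) (use nz in simp)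
      have "c * y1 * q = c * (y1 * q)" by simp
      then have "c * y1 * q = - (c * y) * 2 * (q\<^sup>2 + 1) - 2 * c * (q\<^sup>2 - 1)" unfolding yq by (simp add: algebra_simps)
      also have "- (c * y) = b - 2 * N" by (simp add: b_def)
      finally show ?thesis .
    qed
    have gen: "4 * q * t + ((b * t - ((b - 2 * N) * 2 * (q\<^sup>2 + 1) - 2 * (2 * m + 1) * (q\<^sup>2 - 1))) * x - b * q) * (s * s)
      = t\<^sup>2 * r - t * s + (4 * (N + (m + 1)) * q\<^sup>2 + 4 * (1 - ((m + 1) - N + 1))) * s + 4 * q ^ 3 - 4 * r"
      if "q * r = 1" "x * s = 1" "t = 2 * q\<^sup>2 - 2 + b * q * s" for r s t :: complex
      using that by algebra
    show ?thesis unfolding b_def[symmetric] cy unfolding c divide_inverse inverse_mult_distrib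
      by (rule gen) (use nz q1 in \<open>simp_all add: divide_inverse\<close>)
  qed
  then show ?thesis unfolding v_def[symmetric] painleve_III_def d2 d1x by (simp add: q_def)
qed

lemma ratl_zeros_finite: assumes "ratl f" shows "finite {x. f x = 0} \<or> finite {x. f x \<noteq> 0}"
proof -
  obtain P Q where 1: "Q \<noteq> 0" "\<And>x. poly Q x \<noteq> 0 \<Longrightarrow> f x = poly P x / poly Q x" using assms(1) unfolding ratl_def by blast
  show ?thesis
  proof (cases "P = 0")
    case True
    then have "{x. f x \<noteq> 0} \<subseteq> {x. poly Q x = 0}" using 1 by auto
    then show ?thesis using poly_roots_finite[OF 1(1)] finite_subset by blast
  next
    case False
    have "{x. f x = 0} \<subseteq> {x. poly Q x = 0} \<union> {x. poly P x = 0}"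
    proof
      fix x assume "x \<in> {x. f x = 0}"
      then show "x \<in> {x. poly Q x = 0} \<union> {x. poly P x = 0}" using 1(2)[of x] by (cases "poly Q x = 0") auto
    qed
    then show ?thesis using poly_roots_finite[OF 1(1)] poly_roots_finite[OF False] by (meson finite_UnI finite_subset)
  qed
qed

text \<open>The transform is a rational function. The values \<open>Y = 1\<close> and \<open>Y = -
  1\<close> can occur only finitely often, because a constant \<open>Y\<close> equal to
  \<open>1\<close> or \<open>- 1\<close> would force \<open>u = 0\<close> or \<open>1 / u =
  0\<close>.\<close>

lemma backlund:
  assumes u: "rational_solution (int n) m u" and a: "2 * m + 1 \<noteq> 0"
  obtains v where "rational_function v" "finite {x. v x \<noteq> backlund_v (of_nat n) m u x}"
    "finite {x. \<not> painleve_III (of_int (int n) + (m + 1)) ((m + 1) - of_int (int n) + 1) v x}"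
proof -
  have r: "rational_function u" and P: "\<And>x. x \<noteq> 0 \<Longrightarrow> u x \<noteq> 0 \<Longrightarrow> painleve_III (of_nat n + m) (m - of_nat n + 1) u x"
    and lim: "(u \<longlongrightarrow> 1) at_infinity"
    using u by (auto simp: rational_solution_def)
  have ru: "ratl u" by (rule rational_function_ratl[OF r])
  define Y where "Y = backlund_Y (of_nat n) m u"
  have rY: "ratl Y" unfolding Y_def backlund_Y_def[abs_def]
    by (intro ratl_divide ratl_add ratl_mult ratl_diff ratl_const ratl_id ru ratl_deriv)
  have rV: "ratl (backlund_v (of_nat n) m u)" unfolding backlund_v_def[abs_def] Y_def[symmetric]
    by (intro ratl_divide ratl_add ratl_mult ratl_diff ratl_const ratl_id ru rY)
  obtain v where v: "rational_function v" "finite {x. v x \<noteq> backlund_v (of_nat n) m u x}" using ratl_normalize[OF rV] .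
  have fu: "finite {x. u x = 0}"
  proof (rule ccontr)
    assume "infinite {x. u x = 0}"
    then have "finite {x. u x \<noteq> 0}" using ratl_zeros_finite[OF ru] by blast
    then have "\<forall>\<^sub>F x in at_infinity. u x = 0" using finite_imp_eventually_at_infinity[of "\<lambda>x. u x = 0"] by simp
    moreover have "\<forall>\<^sub>F x in at_infinity. u x \<noteq> 0" using tendsto_imp_eventually_ne[OF lim, of 0] by simp
    ultimately have "\<forall>\<^sub>F x::complex in at_infinity. False" by eventually_elim simp
    then show False by (simp add: eventually_False trivial_limit_at_infinity)
  qed
  define A0 where "A0 = {x. u x = 0} \<union> {0}"
  have A0: "finite A0" "open (- A0)" using fu by (auto simp: A0_def intro!: open_Compl finite_imp_closed)
  have good: "u analytic_on {x}" "x \<noteq> 0" "u x \<noteq> 0" if "x \<in> - A0" for x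
    using that rational_function_analytic[OF r, of x] by (auto simp: A0_def)
  have dY: "(Y has_field_derivative 2 * (u x + 1 / u x) * Y x + 2 * (u x - 1 / u x)) (at x)" if "x \<in> - A0" for x
    unfolding Y_def using good[OF that] by (intro DERIV_backlund_Y P a)
  have nonconst: "finite {x. Y x - s = 0}" if s: "s = 1 \<or> s = - 1" for s
  proof (rule ccontr)
    assume "infinite {x. Y x - s = 0}"
    then have f: "finite {x. Y x - s \<noteq> 0}" using ratl_zeros_finite[OF ratl_diff[OF rY ratl_const]] by blast
    define T where "T = - (A0 \<union> {x. Y x - s \<noteq> 0})"
    have fT: "finite (A0 \<union> {x. Y x - s \<noteq> 0})" using f A0 by simp
    then have "open T" unfolding T_def by (intro open_Compl finite_imp_closed)
    moreover have "T \<noteq> {}" using fT infinite_UNIV_char_0[where 'a=complex] unfolding T_def by (metis Compl_empty_eq double_compl)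
    ultimately obtain x where x: "x \<in> T" "open T" by blast
    have "(Y has_field_derivative 0) (at x)"
      by (rule has_field_derivative_transform_within_open[of "\<lambda>_. s" _ _ T]) (use x in \<open>auto simp: T_def\<close>)
    moreover have "x \<in> - A0" using x by (simp add: T_def)
    ultimately have "2 * (u x + 1 / u x) * Y x + 2 * (u x - 1 / u x) = 0" using DERIV_unique[OF dY] by blast
    moreover have "Y x = s" using x by (simp add: T_def)
    moreover have "2 * (p + i) * 1 + 2 * (p - i) = 4 * p" "2 * (p + i) * (- 1) + 2 * (p - i) = - 4 * i" for p i :: complex
      by (simp_all add: algebra_simps)
    ultimately have "4 * u x = 0 \<or> - 4 * (1 / u x) = 0" using s by metis
    then show False using good(3)[OF \<open>x \<in> - A0\<close>] by simp
  qed
  define A where "A = A0 \<union> {x. Y x - 1 = 0} \<union> {x. Y x - (- 1) = 0} \<union> {x. v x \<noteq> backlund_v (of_nat n) m u x}"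
  have fA: "finite A" using A0 nonconst[of 1] nonconst[of "- 1"] v(2) by (simp add: A_def)
  then have oA: "open (- A)" by (intro open_Compl finite_imp_closed)
  have "painleve_III (of_int (int n) + (m + 1)) ((m + 1) - of_int (int n) + 1) v x" if x: "x \<in> - A" for x
  proof (rule painleve_cong[OF oA x])
    show "v z = backlund_v (of_nat n) m u z" if "z \<in> - A" for z using that by (simp add: A_def)
    have "painleve_III (of_nat n + (m + 1)) ((m + 1) - of_nat n + 1) (\<lambda>z. (1 - Y z) / (u z * (1 + Y z))) x"
    proof (rule backlund_system[OF oA x, where c="2 * m + 1"])
      fix z assume "z \<in> - A"
      then have z: "z \<in> - A0" "Y z \<noteq> 1" "Y z \<noteq> - 1" by (auto simp: A_def add_eq_0_iff2)
      show "z \<noteq> 0 \<and> u z \<noteq> 0 \<and> Y z \<noteq> 1 \<and> Y z \<noteq> - 1" using good[OF z(1)] z by blast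
      show "(Y has_field_derivative 2 * (u z + 1 / u z) * Y z + 2 * (u z - 1 / u z)) (at z)" by (rule dY[OF z(1)])
      show "(u has_field_derivative u z * ((2 * m + 1) * Y z - 2 * z * (u z - 1 / u z) - 2 * of_nat n) / z) (at z)"
        unfolding Y_def using good[OF z(1)] a by (intro DERIV_u_from_backlund_Y)
    qed simp
    then show "painleve_III (of_int (int n) + (m + 1)) ((m + 1) - of_int (int n) + 1) (backlund_v (of_nat n) m u) x"
      unfolding backlund_v_def[abs_def] Y_def by simp
  qed
  then have "{x. \<not> painleve_III (of_int (int n) + (m + 1)) ((m + 1) - of_int (int n) + 1) v x} \<subseteq> A" by blast
  then have "finite {x. \<not> painleve_III (of_int (int n) + (m + 1)) ((m + 1) - of_int (int n) + 1) v x}"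
    using fA finite_subset by blast
  with v show ?thesis by (rule that)
qed

section \<open>Calculus of errors of order one over n\<close>

definition unif_bdd :: "complex set \<Rightarrow> (nat \<Rightarrow> complex \<Rightarrow> complex) \<Rightarrow> bool" where
  "unif_bdd S F \<longleftrightarrow> (\<exists>C N. \<forall>n\<ge>N. \<forall>y\<in>S. norm (F n y) \<le> C)"

lemma unif_bddI: "(\<And>n y. n \<ge> N \<Longrightarrow> y \<in> S \<Longrightarrow> norm (F n y) \<le> C) \<Longrightarrow> unif_bdd S F"
  unfolding unif_bdd_def by blast

lemma unif_bddE: assumes "unif_bdd S F"
  obtains C N where "C > 0" "N > 0" "\<And>n y. n \<ge> N \<Longrightarrow> y \<in> S \<Longrightarrow> norm (F n y) \<le> C"
proof -
  obtain C N where C: "\<And>n y. n \<ge> N \<Longrightarrow> y \<in> S \<Longrightarrow> norm (F n y) \<le> C" using assms unfolding unif_bdd_def by blast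
  show ?thesis
  proof (rule that[of "\<bar>C\<bar> + 1" "N + 1"])
    fix n y assume "n \<ge> N + 1" "y \<in> S"
    then show "norm (F n y) \<le> \<bar>C\<bar> + 1" using C[of n y] by simp
  qed auto
qed

lemma unif_bdd_subset: "unif_bdd S F \<Longrightarrow> T \<subseteq> S \<Longrightarrow> unif_bdd T F"
  unfolding unif_bdd_def by blast

lemma unif_bdd_cong: assumes "unif_bdd S F" "\<And>n y. n \<ge> N0 \<Longrightarrow> y \<in> S \<Longrightarrow> G n y = F n y" shows "unif_bdd S G"
proof -
  obtain C N where C: "\<And>n y. n \<ge> N \<Longrightarrow> y \<in> S \<Longrightarrow> norm (F n y) \<le> C" using unif_bddE[OF assms(1)] by metis
  show ?thesis by (rule unif_bddI[of "max N N0" _ _ C]) (use C assms(2) in auto)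
qed

lemma unif_bdd_const: "unif_bdd S (\<lambda>n y. c)" by (rule unif_bddI[of 0 _ _ "norm c"]) simp

lemma unif_bdd_add: assumes "unif_bdd S F" "unif_bdd S G" shows "unif_bdd S (\<lambda>n y. F n y + G n y)"
proof -
  obtain C N where C: "\<And>n y. n \<ge> N \<Longrightarrow> y \<in> S \<Longrightarrow> norm (F n y) \<le> C" using unif_bddE[OF assms(1)] by metis
  obtain D M where D: "\<And>n y. n \<ge> M \<Longrightarrow> y \<in> S \<Longrightarrow> norm (G n y) \<le> D" using unif_bddE[OF assms(2)] by metis
  show ?thesis by (rule unif_bddI[of "max N M" _ _ "C + D"]) (use C D in \<open>auto intro!: order_trans[OF norm_triangle_ineq] add_mono\<close>)
qed

lemma unif_bdd_mult: assumes "unif_bdd S F" "unif_bdd S G" shows "unif_bdd S (\<lambda>n y. F n y * G n y)"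
proof -
  obtain C N where C: "C > 0" "\<And>n y. n \<ge> N \<Longrightarrow> y \<in> S \<Longrightarrow> norm (F n y) \<le> C" using unif_bddE[OF assms(1)] by metis
  obtain D M where D: "D > 0" "\<And>n y. n \<ge> M \<Longrightarrow> y \<in> S \<Longrightarrow> norm (G n y) \<le> D" using unif_bddE[OF assms(2)] by metis
  show ?thesis
  proof (rule unif_bddI[of "max N M" _ _ "C * D"])
    fix n y assume "n \<ge> max N M" "y \<in> S"
    then show "norm (F n y * G n y) \<le> C * D"
      unfolding norm_mult using C D by (intro mult_mono) (auto intro: less_imp_le)
  qed
qed

lemma unif_bdd_minus: "unif_bdd S F \<Longrightarrow> unif_bdd S (\<lambda>n y. - F n y)" unfolding unif_bdd_def by simp

lemma unif_bdd_diff: "unif_bdd S F \<Longrightarrow> unif_bdd S G \<Longrightarrow> unif_bdd S (\<lambda>n y. F n y - G n y)"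
  using unif_bdd_add[OF _ unif_bdd_minus, of S F G] by simp

lemma unif_bdd_over_n: "unif_bdd S F \<Longrightarrow> unif_bdd S (\<lambda>n y. F n y / of_nat n)"
proof -
  assume "unif_bdd S F"
  then obtain C N where C: "C > 0" "N > 0" "\<And>n y. n \<ge> N \<Longrightarrow> y \<in> S \<Longrightarrow> norm (F n y) \<le> C" by (rule unif_bddE) blast
  have "norm (F n y / of_nat n) \<le> C" if "n \<ge> N" "y \<in> S" for n y
  proof -
    have n: "real n \<ge> 1" using that C(2) by simp
    then have "norm (F n y) / real n \<le> norm (F n y) / 1" by (intro divide_left_mono) auto
    then show ?thesis using C(3)[OF that] by (simp add: norm_divide)
  qed
  then show ?thesis by (rule unif_bddI)
qed

definition approx_on :: "complex set \<Rightarrow> (nat \<Rightarrow> complex \<Rightarrow> complex) \<Rightarrow> (complex \<Rightarrow> complex) \<Rightarrow> bool" where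
  "approx_on S F g \<longleftrightarrow> unif_bdd S (\<lambda>n y. of_nat n * (F n y - g y))"

lemma approx_on_bdd: assumes "approx_on S F g" "unif_bdd S (\<lambda>n. g)" shows "unif_bdd S F"
proof (rule unif_bdd_cong[of _ "\<lambda>n y. g y + of_nat n * (F n y - g y) / of_nat n"])
  show "unif_bdd S (\<lambda>n y. g y + of_nat n * (F n y - g y) / of_nat n)"
    using assms unfolding approx_on_def by (intro unif_bdd_add unif_bdd_over_n)
  show "F n y = g y + of_nat n * (F n y - g y) / of_nat n" if "1 \<le> n" for n y using that by simp
qed

lemma approx_on_add:
  assumes "approx_on S F f" "approx_on S G g" shows "approx_on S (\<lambda>n y. F n y + G n y) (\<lambda>y. f y + g y)"
  using unif_bdd_add[OF assms[unfolded approx_on_def]] unfolding approx_on_def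
  by (rule unif_bdd_cong) (simp add: algebra_simps)

lemma approx_on_const: "approx_on S (\<lambda>n. g) g" unfolding approx_on_def using unif_bdd_const[of S 0] by simp

lemma approx_on_minus: "approx_on S F f \<Longrightarrow> approx_on S (\<lambda>n y. - F n y) (\<lambda>y. - f y)"
  unfolding approx_on_def by (drule unif_bdd_minus) (simp add: algebra_simps)

lemma approx_on_diff:
  "approx_on S F f \<Longrightarrow> approx_on S G g \<Longrightarrow> approx_on S (\<lambda>n y. F n y - G n y) (\<lambda>y. f y - g y)"
  using approx_on_add[OF _ approx_on_minus, of S F f G g] by simp

lemma approx_on_mult:
  assumes "approx_on S F f" "approx_on S G g" "unif_bdd S (\<lambda>n. f)" "unif_bdd S (\<lambda>n. g)"
  shows "approx_on S (\<lambda>n y. F n y * G n y) (\<lambda>y. f y * g y)"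
proof -
  have "unif_bdd S (\<lambda>n y. of_nat n * (F n y - f y) * G n y + f y * (of_nat n * (G n y - g y)))"
    by (rule unif_bdd_add[OF unif_bdd_mult[OF assms(1)[unfolded approx_on_def] approx_on_bdd[OF assms(2,4)]]
      unif_bdd_mult[OF assms(3) assms(2)[unfolded approx_on_def]]])
  then show ?thesis unfolding approx_on_def by (rule unif_bdd_cong) (simp add: algebra_simps)
qed

text \<open>Here and below the bound on \<open>1 / f\<close> replaces a lower bound for
  \<open>|f|\<close>.\<close>

lemma approx_on_eventually_ne:
  assumes F: "approx_on S F f" and inv: "unif_bdd S (\<lambda>n y. 1 / f y)" and f0: "\<And>y. y \<in> S \<Longrightarrow> f y \<noteq> 0"
  obtains c N where "c > 0" "N > 0" "\<And>n y. n \<ge> N \<Longrightarrow> y \<in> S \<Longrightarrow> c \<le> norm (F n y)"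
proof -
  obtain C N where C: "C > 0" "N > 0" "\<And>n y. n \<ge> N \<Longrightarrow> y \<in> S \<Longrightarrow> norm (of_nat n * (F n y - f y)) \<le> C"
    using unif_bddE[OF F[unfolded approx_on_def]] by metis
  obtain D :: real where D: "D > 0" "\<And>y. y \<in> S \<Longrightarrow> norm (1 / f y) \<le> D"
  proof -
    obtain D0 N0 where "\<forall>n\<ge>(N0::nat). \<forall>y\<in>S. norm (1 / f y) \<le> D0" using inv unfolding unif_bdd_def by blast
    then have "norm (1 / f y) \<le> \<bar>D0\<bar> + 1" if "y \<in> S" for y using that by fastforce
    then show ?thesis using that[of "\<bar>D0\<bar> + 1"] by simp
  qed
  define N' where "N' = N + nat \<lceil>2 * C * D\<rceil>"
  have "1 / (2 * D) \<le> norm (F n y)" if n: "n \<ge> N'" and y: "y \<in> S" for n y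
  proof -
    have n0: "n > 0" "n \<ge> N" using n C by (auto simp: N'_def)
    have nCD: "2 * C * D \<le> real n" using n unfolding N'_def by linarith
    have "norm (f y) > 0" using f0[OF y] by simp
    then have lo: "1 / D \<le> norm (f y)" using D(2)[OF y] D(1) by (simp add: norm_divide field_simps)
    have "real n * norm (F n y - f y) \<le> C" using C(3)[OF n0(2) y] by (simp add: norm_mult)
    then have "norm (F n y - f y) \<le> C / real n" using n0 by (simp add: field_simps)
    also have "\<dots> \<le> 1 / (2 * D)" using nCD n0 D by (simp add: field_simps)
    finally have "norm (f y) - 1 / (2 * D) \<le> norm (F n y)" using norm_triangle_ineq2[of "f y" "F n y"] by (simp add: norm_minus_commute)
    moreover have "1 / D = 1 / (2 * D) + 1 / (2 * D)" using D by simp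
    ultimately show ?thesis using lo by linarith
  qed
  then show ?thesis using that[of "1 / (2 * D)" N'] D C by (auto simp: N'_def)
qed

lemma approx_on_inverse_bdd:
  assumes "approx_on S F f" "unif_bdd S (\<lambda>n y. 1 / f y)" "\<And>y. y \<in> S \<Longrightarrow> f y \<noteq> 0"
  shows "unif_bdd S (\<lambda>n y. 1 / F n y)"
proof -
  obtain c N where c: "c > 0" "\<And>n y. n \<ge> N \<Longrightarrow> y \<in> S \<Longrightarrow> c \<le> norm (F n y)" using approx_on_eventually_ne[OF assms] by metis
  show ?thesis
  proof (rule unif_bddI[of N _ _ "1 / c"])
    fix n y assume "n \<ge> N" "y \<in> S"
    then show "norm (1 / F n y) \<le> 1 / c" using c(1) c(2)[of n y] by (simp add: norm_divide frac_le)
  qed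
qed

lemma approx_on_divide:
  assumes F: "approx_on S F f" and G: "approx_on S G g" and b: "unif_bdd S (\<lambda>n. f)" "unif_bdd S (\<lambda>n y. 1 / g y)"
    and g0: "\<And>y. y \<in> S \<Longrightarrow> g y \<noteq> 0"
  shows "approx_on S (\<lambda>n y. F n y / G n y) (\<lambda>y. f y / g y)"
proof -
  obtain c N where c: "c > 0" "\<And>n y. n \<ge> N \<Longrightarrow> y \<in> S \<Longrightarrow> c \<le> norm (G n y)" using approx_on_eventually_ne[OF G b(2) g0] by metis
  have "unif_bdd S (\<lambda>n y. of_nat n * (F n y - f y) * (1 / G n y) - f y * (of_nat n * (G n y - g y)) * (1 / G n y) * (1 / g y))"
  proof -
    have i: "unif_bdd S (\<lambda>n y. 1 / G n y)" using G b(2) g0 by (rule approx_on_inverse_bdd)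
    show ?thesis
      by (rule unif_bdd_diff[OF unif_bdd_mult[OF F[unfolded approx_on_def] i]
        unif_bdd_mult[OF unif_bdd_mult[OF unif_bdd_mult[OF b(1) G[unfolded approx_on_def]] i] b(2)]])
  qed
  then show ?thesis unfolding approx_on_def
  proof (rule unif_bdd_cong)
    fix n y assume "n \<ge> N" "y \<in> S"
    then have "G n y \<noteq> 0" "g y \<noteq> 0" using c(1) c(2)[of n y] g0 by auto
    moreover have "k * (a / G' - b / g') = k * (a - b) * (1 / G') - b * (k * (G' - g')) * (1 / G') * (1 / g')"
      if "G' \<noteq> 0" "g' \<noteq> 0" for k a b G' g' :: complex using that by (simp add: field_simps)
    ultimately show "of_nat n * (F n y / G n y - f y / g y) = of_nat n * (F n y - f y) * (1 / G n y) - f y * (of_nat n * (G n y - g y)) * (1 / G n y) * (1 / g y)"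
      by blast
  qed
qed

text \<open>The radius grows with \<open>|y|\<close>, so that Cauchy's estimate on these discs yields
  \<open>|y| |f'|\<close> bounded when \<open>f\<close> is bounded.\<close>

lemma away_ball:
  assumes e: "0 < e" "e \<le> 1/4" and k: "0 < k" "k \<le> e / 5" and y: "y \<in> away (2 * e)" and z: "norm (z - y) \<le> k * (1 + norm y)"
  shows "z \<in> away e"
  unfolding away_def
proof (intro CollectI ballI)
  fix w assume w: "w \<in> eyebrow_zero"
  have 1: "2 * e \<le> norm (y - w)" using y w by (simp add: away_def dist_norm)
  have 2: "norm y - 2 \<le> norm (y - w)" using norm_triangle_ineq2[of y w] norm_eyebrow_le[OF w] by linarith
  define K where "K = k * (1 + norm y)"
  have 3: "norm (y - w) - K \<le> norm (z - w)"
    using norm_triangle_ineq[of "y - z" "z - w"] z by (simp add: norm_minus_commute K_def)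
  have K1: "K \<le> e / 5 * (1 + norm y)" unfolding K_def using k by (intro mult_right_mono) auto
  show "e \<le> dist z w"
  proof (cases "norm y \<le> 4")
    case True
    then have "e / 5 * (1 + norm y) \<le> e / 5 * 5" using e by (intro mult_left_mono) auto
    then show ?thesis using 1 3 K1 unfolding dist_norm by linarith
  next
    case False
    have "e / 5 * (1 + norm y) \<le> 1/20 * (1 + norm y)" using e by (intro mult_right_mono) auto
    then have "K \<le> 1/20 + norm y / 20" using K1 by (simp add: algebra_simps)
    then show ?thesis using 2 3 e False unfolding dist_norm by linarith
  qed
qed

lemma deriv_bound_cball:
  assumes r: "r > 0" and an: "\<And>z. norm (z - y) \<le> r \<Longrightarrow> g analytic_on {z}" and bd: "\<And>z. norm (z - y) \<le> r \<Longrightarrow> norm (g z) \<le> B"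
  shows "norm (deriv g y) \<le> B / r"
proof -
  have "g analytic_on cball y r" using an by (subst analytic_on_analytic_at) (auto simp: dist_norm norm_minus_commute)
  then have h: "g holomorphic_on cball y r" by (rule analytic_imp_holomorphic)
  have "norm ((deriv ^^ 1) g y) \<le> fact 1 * B / r ^ 1"
  proof (rule Cauchy_inequality)
    show "g holomorphic_on ball y r" by (rule holomorphic_on_subset[OF h ball_subset_cball])
    show "continuous_on (cball y r) g" by (rule holomorphic_on_imp_continuous_on[OF h])
    show "norm (g x) \<le> B" if "norm (y - x) = r" for x using bd[of x] that by (simp add: norm_minus_commute)
  qed (rule r)
  then show ?thesis by simp
qed

lemma near_zero_radius:
  obtains r where "0 < r" "r \<le> 1/4" "\<And>y. norm y \<le> r \<Longrightarrow> level y < 1" "\<And>d y. d \<le> r \<Longrightarrow> norm y \<le> r \<Longrightarrow> y \<in> away d"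
proof -
  have "\<exists>e>0. ball 0 e \<subseteq> {y. level y < 1}" using open_level(1)[of 1] level_0 by (simp add: open_contains_ball)
  then obtain e where e: "e > 0" "ball 0 e \<subseteq> {y. level y < 1}" by blast
  define r where "r = min (1/4) (e / 4)"
  have r: "0 < r" "r \<le> 1/4" "4 * r \<le> e" using e by (auto simp: r_def)
  have l: "level y < 1" if "norm y \<le> 3 * r" for y
  proof -
    have "y \<in> ball 0 e" using that r by simp
    then show ?thesis using e(2) by blast
  qed
  have "y \<in> away d" if "d \<le> r" "norm y \<le> r" for d y
    unfolding away_def
  proof (intro CollectI ballI)
    fix z assume "z \<in> eyebrow_zero"
    then have "level z = 1" by (simp add: eyebrow_zero_iff)
    then have "norm z > 3 * r" using l[of z] by (cases "norm z \<le> 3 * r") auto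
    then show "d \<le> dist y z" using norm_triangle_ineq2[of z y] that r by (simp add: dist_norm norm_minus_commute)
  qed
  then show ?thesis using that[OF r(1,2)] l r(1) by force
qed

text \<open>Off a neighbourhood of the origin \<open>w_lim\<close> is bounded away from \<open>0\<close>,
  since \<open>y = w / (1 - w^2)\<close>. For \<open>1 + w^2\<close> use \<open>y^2 (1 + w^2)^2
  = w^2 (1 + 4 y^2)\<close>: it vanishes only at the corners of the eye.\<close>

lemma w_lim_bounds:
  assumes r: "0 < r" "r \<le> 1/4" and level: "\<And>y. norm y \<le> r \<Longrightarrow> level y < 1" and d: "0 < d" "d \<le> 1/4"
  shows "unif_bdd (away d) (\<lambda>n. w_lim)"
    and "unif_bdd (away d \<inter> {y. r / 2 \<le> norm y}) (\<lambda>n y. 1 / w_lim y)"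
    and "unif_bdd (away d \<inter> {y. r / 2 \<le> norm y}) (\<lambda>n y. 1 / (1 + (w_lim y)\<^sup>2))"
    and "\<And>y. y \<in> away d \<Longrightarrow> r / 2 \<le> norm y \<Longrightarrow> w_lim y \<noteq> 0"
    and "\<And>y. y \<in> away d \<Longrightarrow> r / 2 \<le> norm y \<Longrightarrow> 1 + (w_lim y)\<^sup>2 \<noteq> 0"
proof -
  have "norm (w_lim y) \<le> sqrt (1 / (4 * r\<^sup>2) + 1) + 1 / (2 * r) + 1" if y: "y \<in> away d" for y
  proof -
    have ye: "y \<notin> eyebrow_zero" by (rule away_not_eyebrow[OF d(1) y])
    have pos: "sqrt (1 / (4 * r\<^sup>2) + 1) \<ge> 0" "1 / (2 * r) \<ge> 0" using r by auto
    show ?thesis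
    proof (cases "Re y > 0 \<or> level y < 1")
      case True
      then have "norm (w_lim y) \<le> 1" using ye norm_w_in_le[of y] by (simp add: w_lim_def)
      then show ?thesis using pos by linarith
    next
      case False
      then have yr: "r \<le> norm y" using level[of y] by linarith
      have "norm (w_lim y) \<le> norm (root_out y) + norm (1 / (2 * y))"
        using False ye norm_triangle_ineq4[of "root_out y" "1 / (2 * y)"] by (simp add: w_lim_def w_out_def)
      moreover have "norm (root_out y) \<le> sqrt (1 / (4 * r\<^sup>2) + 1)" by (rule norm_root_out_le[OF r(1) yr])
      moreover have "norm (1 / (2 * y)) \<le> 1 / (2 * r)" using yr r by (simp add: norm_divide norm_mult frac_le)
      ultimately show ?thesis by linarith
    qed
  qed
  then show "unif_bdd (away d) (\<lambda>n. w_lim)" by (rule unif_bddI)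
  have low: "3 * r / 8 \<le> norm (w_lim y)" if y: "y \<in> away d" "r / 2 \<le> norm y" for y
  proof (cases "norm (w_lim y) \<le> 1/2")
    case True
    have "y = y * (w_lim y)\<^sup>2 + w_lim y" using w_lim_quadratic[OF away_not_eyebrow[OF d(1) y(1)]] by simp
    then have "norm y \<le> norm y * (norm (w_lim y))\<^sup>2 + norm (w_lim y)"
      by (metis norm_triangle_ineq norm_mult norm_power)
    also have "norm y * (norm (w_lim y))\<^sup>2 \<le> norm y * (1/2)\<^sup>2" using True by (intro mult_left_mono power_mono) auto
    finally show ?thesis using y(2) by (simp add: power2_eq_square)
  qed (use r in simp)
  then show ne: "w_lim y \<noteq> 0" if "y \<in> away d" "r / 2 \<le> norm y" for y using low[OF that] r by auto
  show "unif_bdd (away d \<inter> {y. r / 2 \<le> norm y}) (\<lambda>n y. 1 / w_lim y)"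
  proof (rule unif_bddI[of 0 _ _ "1 / (3 * r / 8)"])
    fix n :: nat and y assume "y \<in> away d \<inter> {y. r / 2 \<le> norm y}"
    then show "norm (1 / w_lim y) \<le> 1 / (3 * r / 8)" unfolding norm_divide using low[of y] r by (intro frac_le) auto
  qed
  have low2: "3 * r / 8 * d \<le> norm (1 + (w_lim y)\<^sup>2)" if y: "y \<in> away d" "r / 2 \<le> norm y" for y
  proof -
    define w where "w = w_lim y"
    have q: "y * w\<^sup>2 + w = y" using w_lim_quadratic[OF away_not_eyebrow[OF d(1) y(1)]] by (simp add: w_def)
    have y0: "y \<noteq> 0" using y(2) r by auto
    from arg_cong[OF q, of "\<lambda>t. t - y * w\<^sup>2"] have "y * (1 - w\<^sup>2) = w" by (simp add: right_diff_distrib)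
    then have w2: "(y * (1 - w\<^sup>2))\<^sup>2 = w\<^sup>2" by simp
    have A: "y\<^sup>2 * (1 + w\<^sup>2)\<^sup>2 = (y * (1 - w\<^sup>2))\<^sup>2 + 4 * y\<^sup>2 * w\<^sup>2" by (simp add: power2_eq_square algebra_simps)
    have "y\<^sup>2 * (1 + w\<^sup>2)\<^sup>2 = w\<^sup>2 * (1 + 4 * y\<^sup>2)" unfolding A w2 by (simp add: algebra_simps)
    then have e: "(norm y)\<^sup>2 * (norm (1 + w\<^sup>2))\<^sup>2 = (norm w)\<^sup>2 * norm (1 + 4 * y\<^sup>2)"
      by (metis norm_mult norm_power)
    have fac: "1 + 4 * y\<^sup>2 = 4 * ((y - \<i> / 2) * (y - - \<i> / 2))" by (simp add: power2_eq_square algebra_simps)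
    have "d\<^sup>2 * (norm y)\<^sup>2 \<le> norm (1 + 4 * y\<^sup>2)"
    proof (cases "norm y \<le> 2")
      case True
      have "d * d \<le> norm (y - \<i> / 2) * norm (y - - \<i> / 2)"
        using y(1) corners_in_eyebrow d by (intro mult_mono) (auto simp: away_def dist_norm)
      then have "4 * d\<^sup>2 \<le> norm (1 + 4 * y\<^sup>2)" unfolding fac by (simp add: norm_mult power2_eq_square)
      moreover have "d\<^sup>2 * (norm y)\<^sup>2 \<le> d\<^sup>2 * 2\<^sup>2" using True by (intro mult_left_mono power_mono) auto
      ultimately show ?thesis by simp
    next
      case False
      then have "2\<^sup>2 \<le> (norm y)\<^sup>2" by (intro power_mono) auto
      moreover have "4 * (norm y)\<^sup>2 - 1 \<le> norm (1 + 4 * y\<^sup>2)"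
        using norm_triangle_ineq2[of "4 * y\<^sup>2" "- 1"] by (simp add: norm_mult norm_power add.commute)
      moreover have "d\<^sup>2 * (norm y)\<^sup>2 \<le> 1 * (norm y)\<^sup>2" using d by (intro mult_right_mono power_le_one) auto
      ultimately show ?thesis by simp
    qed
    then have "(norm w)\<^sup>2 * (d\<^sup>2 * (norm y)\<^sup>2) \<le> (norm y)\<^sup>2 * (norm (1 + w\<^sup>2))\<^sup>2" unfolding e by (intro mult_left_mono) auto
    then have "(norm w * d)\<^sup>2 \<le> (norm (1 + w\<^sup>2))\<^sup>2" using y0 by (simp add: power_mult_distrib mult_ac)
    then have "norm w * d \<le> norm (1 + w\<^sup>2)" by (rule power2_le_imp_le) simp
    moreover have "3 * r / 8 * d \<le> norm w * d" using low[OF y] d by (intro mult_right_mono) (auto simp: w_def)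
    ultimately show ?thesis by (simp add: w_def)
  qed
  have rd: "3 * r / 8 * d > 0" using r d by simp
  show "1 + (w_lim y)\<^sup>2 \<noteq> 0" if "y \<in> away d" "r / 2 \<le> norm y" for y using low2[OF that] rd by auto
  show "unif_bdd (away d \<inter> {y. r / 2 \<le> norm y}) (\<lambda>n y. 1 / (1 + (w_lim y)\<^sup>2))"
  proof (rule unif_bddI[of 0 _ _ "1 / (3 * r / 8 * d)"])
    fix n :: nat and y assume "y \<in> away d \<inter> {y. r / 2 \<le> norm y}"
    then show "norm (1 / (1 + (w_lim y)\<^sup>2)) \<le> 1 / (3 * r / 8 * d)"
      unfolding norm_divide using low2[of y] rd by (intro frac_le) auto
  qed
qed

section \<open>From m to m + 1\<close>

lemma analytic_scaled: "u analytic_on {c * y} \<Longrightarrow> (\<lambda>y. u (c * y)) analytic_on {y :: complex}"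
  using analytic_on_compose[of "\<lambda>y. c * y" "{y}" u] by (simp add: o_def analytic_intros)

lemma deriv_scaled:
  assumes "u analytic_on {c * y}" shows "deriv (\<lambda>y. u (c * y)) y = c * deriv u (c * y :: complex)"
proof (rule DERIV_imp_deriv)
  have 1: "(u has_field_derivative deriv u (c * y)) (at (c * y))"
    using assms analytic_on_imp_differentiable_at[of u "{c * y}" "c * y"] DERIV_deriv_iff_field_differentiable by blast
  have 2: "((\<lambda>y. c * y) has_field_derivative c) (at y)" by (auto intro!: derivative_eq_intros)
  show "((\<lambda>y. u (c * y)) has_field_derivative c * deriv u (c * y)) (at y)"
    using DERIV_chain2[where f=u and g="\<lambda>y. c * y" and x=y and s=UNIV, OF 1 2] by (simp add: mult.commute)
qed

lemma backlund_Y_scaled: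
  assumes "u analytic_on {of_nat n * y}"
  shows "backlund_Y (of_nat n) m u (of_nat n * y) =
    (y * deriv (\<lambda>y. u (of_nat n * y)) y / u (of_nat n * y) + 2 * of_nat n * y * (u (of_nat n * y) - 1 / u (of_nat n * y)) + 2 * of_nat n) / (2 * m + 1)"
  unfolding backlund_Y_def deriv_scaled[OF assms] by (simp add: mult_ac)

lemma DERIV_backlund_Y_scaled:
  assumes u: "rational_solution (int n) m u" and an: "u analytic_on {of_nat n * y}"
    and y: "of_nat n * y \<noteq> 0" and u0: "u (of_nat n * y) \<noteq> 0" and a: "2 * m + 1 \<noteq> 0"
  shows "((\<lambda>y. backlund_Y (of_nat n) m u (of_nat n * y)) has_field_derivative
     of_nat n * (2 * (u (of_nat n * y) + 1 / u (of_nat n * y)) * backlund_Y (of_nat n) m u (of_nat n * y) + 2 * (u (of_nat n * y) - 1 / u (of_nat n * y)))) (at y)"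
proof -
  have P: "painleve_III (of_nat n + m) (m - of_nat n + 1) u (of_nat n * y)"
    using u y u0 by (auto simp: rational_solution_def)
  have 2: "((\<lambda>y. of_nat n * y) has_field_derivative of_nat n) (at y)" by (auto intro!: derivative_eq_intros)
  show ?thesis
    using DERIV_chain2[where f="backlund_Y (of_nat n) m u" and g="\<lambda>y. of_nat n * y" and x=y and s=UNIV, OF DERIV_backlund_Y[OF an y u0 a P] 2]
    by (simp only: mult.commute)
qed

lemma eq_at_by_continuity:
  assumes "isCont f (a :: complex)" "isCont g a" "\<forall>\<^sub>F x in at a. f x = (g x :: complex)"
  shows "f a = g a"
proof -
  have "f \<midarrow>a\<rightarrow> f a" "g \<midarrow>a\<rightarrow> g a" using assms by (auto simp: isCont_def)
  moreover have "f \<midarrow>a\<rightarrow> g a" using calculation(2) unfolding tendsto_cong[OF assms(3)] .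
  ultimately show ?thesis using tendsto_unique[of "at a" f] by simp
qed

lemma holomorphic_quotient_at_0:
  assumes "f holomorphic_on T" "open T" "0 \<in> T" "f 0 = 0"
  obtains g where "g holomorphic_on T" "\<And>y. f y = y * g y" "g 0 = deriv f 0"
proof -
  define g where "g z = (if z = 0 then deriv f 0 else (f z - f 0) / (z - 0))" for z
  have "g holomorphic_on T" unfolding g_def using pole_lemma_open[OF assms(1,2), of 0] .
  moreover have "f y = y * g y" for y using assms(4) by (simp add: g_def)
  moreover have "g 0 = deriv f 0" by (simp add: g_def)
  ultimately show ?thesis by (rule that)
qed

lemma max_modulus_cball:
  assumes "f holomorphic_on T" "cball 0 r \<subseteq> T" "r > 0" and bd: "\<And>z. norm z = r \<Longrightarrow> norm (f z) \<le> B" and y: "norm y \<le> r"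
  shows "norm (f y) \<le> B"
proof (rule maximum_modulus_frontier[of f "cball 0 r"])
  show "f holomorphic_on interior (cball 0 r)" using holomorphic_on_subset[OF assms(1)] assms(2) interior_subset by blast
  show "continuous_on (closure (cball 0 r)) f"
    using continuous_on_subset[OF holomorphic_on_imp_continuous_on[OF assms(1)] assms(2)] by simp
qed (use bd y in auto)

text \<open>Both \<open>u\<close> and its transform vanish at the origin, where the formula for the
  transform has the form \<open>0 / 0\<close>. Write \<open>u(n y) = y V(y)\<close>. By the
  maximum principle \<open>V\<close> stays close to \<open>w_in / y\<close> and has no zero in
  the disc, so \<open>Y\<close> is holomorphic there, and in the same way \<open>1 + Y\<close>
  has no zero. The equation for \<open>Z = 1 - Y\<close> shows that \<open>Z\<close> has a zero
  of order at least two at the origin: the value of the equation at \<open>0\<close> gives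
  \<open>Z(0) = 0\<close>, and the next order gives \<open>(V(0) - 2 n) Z'(0) = 0\<close> with
  \<open>|V(0)| \<le> 3\<close>. Hence \<open>Z / (y V (1 + Y))\<close> is holomorphic and
  vanishes at the origin.\<close>

lemma disc_extension:
  assumes n: "n \<ge> 2" and r: "0 < r" "r \<le> 1/4" and level: "\<And>y. norm y \<le> r \<Longrightarrow> level y < 1"
    and u: "rational_solution (int n) m u" and u0: "u 0 = 0" and a: "2 * m + 1 \<noteq> 0"
    and an: "\<And>y. norm y \<le> r \<Longrightarrow> u analytic_on {of_nat n * y}"
    and est: "\<And>y. norm y = r \<Longrightarrow> norm (u (of_nat n * y) - w_in y) \<le> r / 3"
    and estY: "\<And>y. norm y = r \<Longrightarrow> norm (backlund_Y (of_nat n) m u (of_nat n * y) - (1 - (w_in y)\<^sup>2) / (1 + (w_in y)\<^sup>2)) \<le> 1/2"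
  obtains h T where "open T" "cball 0 r \<subseteq> T" "h holomorphic_on T" "h 0 = 0"
    "\<And>y. y \<in> T \<Longrightarrow> y \<noteq> 0 \<Longrightarrow> backlund_v (of_nat n) m u (of_nat n * y) = h y"
proof -
  define N where "N = (of_nat n :: complex)"
  have N0: "N \<noteq> 0" using n by (simp add: N_def)
  define g where "g y = u (N * y)" for y
  define T where "T = {y. level y < 1} \<inter> {y. u analytic_on {N * y}}"
  have "open ((\<lambda>y. N * y) -` {z. u analytic_on {z}})"
    by (rule open_vimage[OF analytic_set_open]) (intro continuous_intros)
  then have oT: "open T" unfolding T_def by (intro open_Int open_level) (simp add: vimage_def)
  have cT: "cball 0 r \<subseteq> T" using level an by (auto simp: T_def N_def)
  have z0: "0 \<in> cball (0::complex) r" using r by simp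
  have gan: "g analytic_on {y}" if "y \<in> T" for y
    unfolding g_def[abs_def] by (rule analytic_scaled) (use that in \<open>simp add: T_def\<close>)
  have "g analytic_on T" using gan by (subst analytic_on_analytic_at) blast
  then have gh: "g holomorphic_on T" by (rule analytic_imp_holomorphic)
  have g0: "g 0 = 0" by (simp add: g_def u0)
  obtain V where V: "V holomorphic_on T" "\<And>y. g y = y * V y" "V 0 = deriv g 0"
    using holomorphic_quotient_at_0[OF gh oT _ g0] cT z0 by blast
  define R1 where "R1 y = 2 / (1 + root_in y)" for y
  have R1h: "R1 holomorphic_on T" unfolding R1_def[abs_def] root_in_def
    by (intro holomorphic_intros) (use level_lt_1_slit one_plus_root_in[unfolded root_in_def] in \<open>auto simp: T_def\<close>)
  have w_in: "w_in y = y * R1 y" for y by (simp add: w_in_def R1_def)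
  have R1b: "2/3 \<le> norm (R1 y)" "norm (R1 y) \<le> 2" if y: "norm y \<le> r" for y
  proof -
    have "(norm (root_in y))\<^sup>2 \<le> 1 + 4 * (norm y)\<^sup>2"
      using norm_triangle_ineq[of 1 "4 * y\<^sup>2"] by (simp add: root_in_sq norm_mult norm_power flip: norm_power[of "root_in y"])
    also have "(norm y)\<^sup>2 \<le> (1/4)\<^sup>2" using y r by (intro power_mono) auto
    finally have "(norm (root_in y))\<^sup>2 \<le> 2\<^sup>2" by (simp add: power2_eq_square)
    then have "norm (root_in y) \<le> 2" by (rule power2_le_imp_le) simp
    then have up: "norm (1 + root_in y) \<le> 3" using norm_triangle_ineq[of 1 "root_in y"] by simp
    have lo: "1 \<le> norm (1 + root_in y)" using complex_Re_le_cmod[of "1 + root_in y"] Re_root_in[of y] by simp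
    have n0: "norm (1 + root_in y) > 0" using lo by linarith
    show "2/3 \<le> norm (R1 y)" "norm (R1 y) \<le> 2" unfolding R1_def norm_divide using up lo n0 by (simp_all add: field_simps)
  qed
  have VR: "norm (V y - R1 y) \<le> 1/3" if "norm y \<le> r" for y
  proof (rule max_modulus_cball[of "\<lambda>y. V y - R1 y" T r])
    show "(\<lambda>y. V y - R1 y) holomorphic_on T" by (intro holomorphic_intros V R1h)
    fix z :: complex assume z: "norm z = r"
    have "g z - w_in z = z * (V z - R1 z)" using V(2) w_in by (simp add: algebra_simps)
    then have "r * norm (V z - R1 z) \<le> r / 3" using est[OF z] z by (simp add: g_def N_def norm_mult)
    then show "norm (V z - R1 z) \<le> 1/3" using r by simp
  qed (use cT r that in auto)
  have Vb: "V y \<noteq> 0" "norm (V y) \<le> 3" if y: "norm y \<le> r" for y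
  proof -
    show "V y \<noteq> 0" using VR[OF y] R1b(1)[OF y] by auto
    show "norm (V y) \<le> 3" using VR[OF y] R1b(2)[OF y] norm_triangle_ineq2[of "V y" "R1 y"] by linarith
  qed
  define T1 where "T1 = {y \<in> T. V y \<noteq> 0}"
  have oT1: "open T1"
  proof -
    have "T1 = T \<inter> V -` (- {0})" by (auto simp: T1_def)
    then show ?thesis using continuous_open_preimage[OF holomorphic_on_imp_continuous_on[OF V(1)] oT, of "- {0}"] by auto
  qed
  have cT1: "cball 0 r \<subseteq> T1" using cT Vb by (auto simp: T1_def)
  have zT1: "0 \<in> T1" using cT1 z0 by blast
  have sub1: "T1 \<subseteq> T" by (auto simp: T1_def)
  note gh1 = holomorphic_on_subset[OF gh sub1] and Vh1 = holomorphic_on_subset[OF V(1) sub1]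
  have dg1: "deriv g holomorphic_on T1" by (rule holomorphic_deriv[OF gh1 oT1])
  define c where "c = 2 * m + 1"
  have c0: "c \<noteq> 0" using a by (simp add: c_def)
  define Y where "Y y = (deriv g y / V y + 2 * N * y * g y + 2 * N - 2 * N / V y) / c" for y
  have Yh: "Y holomorphic_on T1" unfolding Y_def[abs_def]
    by (intro holomorphic_intros gh1 Vh1 dg1) (use c0 in \<open>auto simp: T1_def\<close>)
  define Yn where "Yn y = backlund_Y N m u (N * y)" for y
  have gn0: "g y \<noteq> 0" if "y \<in> T1" "y \<noteq> 0" for y using that V(2)[of y] by (auto simp: T1_def)
  have Yeq: "Yn y = Y y" if y: "y \<in> T1" "y \<noteq> 0" for y
  proof -
    have uan: "u analytic_on {N * y}" using y by (auto simp: T1_def T_def)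
    have "Yn y = (y * deriv g y / g y + 2 * N * y * (g y - 1 / g y) + 2 * N) / c"
      unfolding Yn_def N_def backlund_Y_scaled[OF uan[unfolded N_def]] by (simp add: g_def[abs_def] N_def c_def)
    moreover have "y * deriv g y / g y = deriv g y / V y" using V(2)[of y] y by (simp add: T1_def)
    moreover have "2 * N * y * (g y - 1 / g y) = 2 * N * y * g y - 2 * N / V y"
    proof -
      have "y * (1 / g y) = 1 / V y" using V(2)[of y] y by (simp add: T1_def)
      then have "2 * N * y * (1 / g y) = 2 * N / V y" by (metis mult.assoc times_divide_eq_right mult.right_neutral)
      then show ?thesis by (simp add: right_diff_distrib)
    qed
    ultimately show ?thesis by (simp add: Y_def)
  qed
  define Y0 where "Y0 y = (1 - (w_in y)\<^sup>2) / (1 + (w_in y)\<^sup>2)" for y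
  have rb: "norm ((w_in y)\<^sup>2) \<le> 1/4" if y: "norm y \<le> r" for y
  proof -
    have "norm (w_in y) \<le> (1/4) * 2" unfolding w_in norm_mult using y r R1b(2)[OF y] by (intro mult_mono) auto
    then have "(norm (w_in y))\<^sup>2 \<le> (1/2)\<^sup>2" by (intro power_mono) auto
    then show ?thesis by (simp add: norm_power power_divide)
  qed
  have rn: "1 + (w_in y)\<^sup>2 \<noteq> 0" "norm (1 + (w_in y)\<^sup>2) \<le> 5/4" if y: "norm y \<le> r" for y
  proof -
    show "1 + (w_in y)\<^sup>2 \<noteq> 0"
    proof
      assume "1 + (w_in y)\<^sup>2 = 0"
      then have "(w_in y)\<^sup>2 = - 1" by (simp add: add_eq_0_iff)
      then show False using rb[OF y] by simp
    qed
    show "norm (1 + (w_in y)\<^sup>2) \<le> 5/4" using norm_triangle_ineq[of 1 "(w_in y)\<^sup>2"] rb[OF y] by simp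
  qed
  have YY0: "norm (Y y - Y0 y) \<le> 1/2" if "norm y \<le> r" for y
  proof (rule max_modulus_cball[of "\<lambda>y. Y y - Y0 y" "T1 \<inter> {y. 1 + (w_in y)\<^sup>2 \<noteq> 0}" r])
    have "w_in holomorphic_on T1 \<inter> {y. 1 + (w_in y)\<^sup>2 \<noteq> 0}" by (rule holomorphic_on_subset[OF holomorphic_w_in]) (auto simp: T1_def T_def)
    moreover have "Y holomorphic_on T1 \<inter> {y. 1 + (w_in y)\<^sup>2 \<noteq> 0}" by (rule holomorphic_on_subset[OF Yh]) auto
    ultimately show "(\<lambda>y. Y y - Y0 y) holomorphic_on T1 \<inter> {y. 1 + (w_in y)\<^sup>2 \<noteq> 0}" unfolding Y0_def[abs_def]
      by (intro holomorphic_intros) auto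
    show "cball 0 r \<subseteq> T1 \<inter> {y. 1 + (w_in y)\<^sup>2 \<noteq> 0}" using cT1 rn(1) by auto
    fix z :: complex assume z: "norm z = r"
    have "z \<in> T1" "z \<noteq> 0" using z cT1 r by auto
    from Yeq[OF this] estY[OF z] show "norm (Y z - Y0 z) \<le> 1/2" by (simp add: Yn_def N_def Y0_def)
  qed (use r that in auto)
  have Yn1: "1 + Y y \<noteq> 0" if y: "norm y \<le> r" for y
  proof
    assume "1 + Y y = 0"
    then have "norm (1 + Y0 y) = norm (Y y - Y0 y)"
      by (metis add_diff_cancel_right' add.commute diff_add_cancel minus_diff_eq norm_minus_commute add_diff_eq diff_0 norm_minus_cancel diff_diff_eq2)
    then have "norm (1 + Y0 y) \<le> 1/2" using YY0[OF y] by simp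
    moreover have "1 + Y0 y = 2 / (1 + (w_in y)\<^sup>2)" using rn(1)[OF y] by (simp add: Y0_def field_simps)
    ultimately have "2 / norm (1 + (w_in y)\<^sup>2) \<le> 1/2" by (simp add: norm_divide)
    moreover have "2 / (5/4) \<le> 2 / norm (1 + (w_in y)\<^sup>2)" using rn[OF y] by (intro divide_left_mono) auto
    ultimately show False by simp
  qed
  define T2 where "T2 = {y \<in> T1. 1 + Y y \<noteq> 0}"
  have oT2: "open T2"
  proof -
    have "1 + Y y = 0 \<longleftrightarrow> Y y = - 1" for y using add_eq_0_iff[of 1 "Y y"] by metis
    then have "T2 = T1 \<inter> Y -` (- {- 1})" unfolding T2_def by blast
    then show ?thesis using continuous_open_preimage[OF holomorphic_on_imp_continuous_on[OF Yh] oT1, of "- {- 1}"] by auto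
  qed
  have cT2: "cball 0 r \<subseteq> T2" using cT1 Yn1 by (auto simp: T2_def)
  define Z where "Z y = 1 - Y y" for y
  have Zh: "Z holomorphic_on T1" unfolding Z_def[abs_def] by (intro holomorphic_intros Yh)
  have dZh: "deriv Z holomorphic_on T1" by (rule holomorphic_deriv[OF Zh oT1])
  have ode: "g y * deriv Z y = 2 * N * ((g y)\<^sup>2 + 1) * Z y - 4 * N * (g y)\<^sup>2" if y: "y \<in> T1" "y \<noteq> 0" for y
  proof -
    have uan: "u analytic_on {N * y}" using y by (auto simp: T1_def T_def)
    have "(Yn has_field_derivative N * (2 * (g y + 1 / g y) * Yn y + 2 * (g y - 1 / g y))) (at y)"
      unfolding Yn_def[abs_def] g_def N_def
      by (rule DERIV_backlund_Y_scaled[OF u]) (use uan y N0 gn0[OF y] a in \<open>auto simp: N_def g_def\<close>)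
    then have "(Y has_field_derivative N * (2 * (g y + 1 / g y) * Yn y + 2 * (g y - 1 / g y))) (at y)"
      by (rule has_field_derivative_transform_within_open[of _ _ _ "T1 - {0}"]) (use y oT1 Yeq in auto)
    from DERIV_diff[OF DERIV_const[of 1] this]
    have "(Z has_field_derivative 0 - N * (2 * (g y + 1 / g y) * Yn y + 2 * (g y - 1 / g y))) (at y)" by (simp add: Z_def[abs_def])
    then have dZ: "deriv Z y = 0 - N * (2 * (g y + 1 / g y) * Y y + 2 * (g y - 1 / g y))"
      unfolding Yeq[OF y] by (rule DERIV_imp_deriv)
    have "p * (0 - N * (2 * (p + q) * s + 2 * (p - q))) = 2 * N * (p\<^sup>2 + 1) * (1 - s) - 4 * N * p\<^sup>2" if "p * q = 1" for p q s
      using that by algebra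
    from this[of "g y" "1 / g y"] show ?thesis unfolding dZ Z_def using gn0[OF y] by simp
  qed
  have ev0: "\<forall>\<^sub>F y in at 0. y \<in> T1 \<and> y \<noteq> 0"
    unfolding eventually_at_topological using oT1 zT1 by (intro exI[of _ T1]) auto
  have ci: "isCont F 0" if "F holomorphic_on T1" for F
    using holomorphic_on_imp_continuous_on[OF that] oT1 zT1 by (simp add: continuous_on_eq_continuous_at)
  have Z0: "Z 0 = 0"
  proof -
    have "g 0 * deriv Z 0 = 2 * N * ((g 0)\<^sup>2 + 1) * Z 0 - 4 * N * (g 0)\<^sup>2"
    proof (rule eq_at_by_continuity[of 0 "\<lambda>y. g y * deriv Z y" "\<lambda>y. 2 * N * ((g y)\<^sup>2 + 1) * Z y - 4 * N * (g y)\<^sup>2"])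
      show "\<forall>\<^sub>F y in at 0. g y * deriv Z y = 2 * N * ((g y)\<^sup>2 + 1) * Z y - 4 * N * (g y)\<^sup>2"
        using ev0 by eventually_elim (use ode in blast)
    qed (intro ci holomorphic_intros gh1 Zh dZh)+
    then show ?thesis using g0 N0 by simp
  qed
  obtain Z1 where Z1: "Z1 holomorphic_on T1" "\<And>y. Z y = y * Z1 y" "Z1 0 = deriv Z 0"
    using holomorphic_quotient_at_0[OF Zh oT1 zT1 Z0] by blast
  have Z10: "Z1 0 = 0"
  proof -
    have "V 0 * deriv Z 0 = 2 * N * ((g 0)\<^sup>2 + 1) * Z1 0 - 4 * N * 0 * (V 0)\<^sup>2"
    proof (rule eq_at_by_continuity[of 0 "\<lambda>y. V y * deriv Z y" "\<lambda>y. 2 * N * ((g y)\<^sup>2 + 1) * Z1 y - 4 * N * y * (V y)\<^sup>2"])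
      show "\<forall>\<^sub>F y in at 0. V y * deriv Z y = 2 * N * ((g y)\<^sup>2 + 1) * Z1 y - 4 * N * y * (V y)\<^sup>2"
        using ev0
      proof eventually_elim
        case (elim y)
        have o: "y * V y * deriv Z y = 2 * N * ((g y)\<^sup>2 + 1) * (y * Z1 y) - 4 * N * (y * V y)\<^sup>2"
          using ode[of y] elim V(2)[of y] Z1(2)[of y] by simp
        have "y * (V y * deriv Z y) = y * (2 * N * ((g y)\<^sup>2 + 1) * Z1 y - 4 * N * y * (V y)\<^sup>2)"
          using o by (simp add: power2_eq_square algebra_simps)
        then show ?case using elim by simp
      qed
    qed (intro ci holomorphic_intros gh1 Z1 dZh Vh1)+
    then have "(V 0 - 2 * N) * Z1 0 = 0" using g0 Z1(3) by (simp add: algebra_simps)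
    moreover have "V 0 \<noteq> 2 * N"
    proof
      assume "V 0 = 2 * N"
      then have "norm (V 0) = 2 * real n" by (simp add: N_def norm_mult)
      then show False using Vb(2)[of 0] r n by simp
    qed
    ultimately show ?thesis by simp
  qed
  obtain Z2 where Z2: "Z2 holomorphic_on T1" "\<And>y. Z1 y = y * Z2 y"
    using holomorphic_quotient_at_0[OF Z1(1) oT1 zT1 Z10] by blast
  define h where "h y = y * Z2 y / (V y * (1 + Y y))" for y
  show ?thesis
  proof (rule that[OF oT2 cT2, of h])
    have s: "T2 \<subseteq> T1" by (auto simp: T2_def)
    show "h holomorphic_on T2" unfolding h_def[abs_def]
      by (intro holomorphic_intros holomorphic_on_subset[OF Z2(1) s] holomorphic_on_subset[OF Vh1 s] holomorphic_on_subset[OF Yh s])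
         (auto simp: T2_def T1_def)
    show "h 0 = 0" by (simp add: h_def)
    fix y assume y: "y \<in> T2" "y \<noteq> 0"
    then have y1: "y \<in> T1" "V y \<noteq> 0" "1 + Y y \<noteq> 0" by (auto simp: T2_def T1_def)
    have "backlund_v (of_nat n) m u (of_nat n * y) = (1 - Yn y) / (g y * (1 + Yn y))"
      by (simp add: backlund_v_def Yn_def g_def N_def)
    also have "\<dots> = Z y / (y * V y * (1 + Y y))" unfolding Yeq[OF y1(1) y(2)] V(2) Z_def ..
    also have "\<dots> = h y" unfolding Z1(2) Z2(2) h_def mult.assoc nonzero_mult_divide_mult_cancel_left[OF y(2)] ..
    finally show "backlund_v (of_nat n) m u (of_nat n * y) = h y" .
  qed
qed

lemma unif_bdd_weight:
  "unif_bdd S (\<lambda>n y. of_real (1 / (1 + norm y)))" "unif_bdd S (\<lambda>n y. y * of_real (1 / (1 + norm y)))"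
proof -
  show "unif_bdd S (\<lambda>n y. of_real (1 / (1 + norm y)))"
  proof (rule unif_bddI[of 0 _ _ 1])
    fix y :: complex
    have "1 / (1 + norm y) \<le> 1" "1 / (1 + norm y) \<ge> 0" by (simp_all add: divide_le_eq_1 add_pos_nonneg)
    then show "norm (of_real (1 / (1 + norm y)) :: complex) \<le> 1" unfolding norm_of_real by linarith
  qed
  show "unif_bdd S (\<lambda>n y. y * of_real (1 / (1 + norm y)))"
  proof (rule unif_bddI[of 0 _ _ 1])
    fix y :: complex
    have p: "1 + norm y > 0" by (simp add: add_pos_nonneg)
    then have "norm y * (1 / (1 + norm y)) \<le> 1" by (simp add: field_simps)
    then show "norm (y * of_real (1 / (1 + norm y))) \<le> 1" unfolding norm_mult norm_of_real using p by simp
  qed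
qed

text \<open>Away from the origin, \<open>Y\<close> is at most of order \<open>1 + |y|\<close>, since the
  terms of order \<open>n\<close> in it cancel up to \<open>n (u - w)\<close>. By Cauchy's
  estimate \<open>Y'\<close> is bounded, and the equation for \<open>Y\<close> says \<open>n (Y
  - (1 - u^2) / (1 + u^2)) = Y' u / (2 (1 + u^2))\<close>. Inserting this in the transform gives
  \<open>w + O(1/n)\<close> by the calculus of \<open>approx_on\<close>. On the small disc
  around the origin the maximum principle extends the bound from the circle, by
  \<open>disc_extension\<close>.\<close>

lemma asymptotics_at_step:
  assumes as: "asymptotics_at m" and a: "2 * m + 1 \<noteq> 0"
  shows "asymptotics_at (m + 1)"
  unfolding asymptotics_at_def
proof (intro allI impI)
  fix d :: real assume d: "0 < d" "d \<le> 1/4"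
  obtain r where r: "0 < r" "r \<le> 1/4" and level: "\<And>y. norm y \<le> r \<Longrightarrow> level y < 1"
    and Omr: "\<And>d y. d \<le> r \<Longrightarrow> norm y \<le> r \<Longrightarrow> y \<in> away d" using near_zero_radius by metis
  define d1 where "d1 = min d r"
  have d1: "0 < d1" "d1 \<le> 1/4" "d1 \<le> d" "d1 \<le> r" using d r by (auto simp: d1_def)
  (* Two Cauchy estimates are needed, for u and for Y; each uses up a part of the distance to the
     eyebrow. *)
  define e where "e = d1 / 4"
  have e: "0 < e" "e \<le> 1/4" "2 * e \<le> 1/4" "e \<le> r" "4 * e = d1" "2 * (2 * e) = d1" using d1 by (auto simp: e_def)
  define U where "U n = u_rat (int n) m" for n :: nat
  obtain C1 N1 where IH: "\<And>n. n \<ge> N1 \<Longrightarrow> \<exists>u. rational_solution (int n) m u \<and> u 0 = 0 \<and>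
     (\<forall>y\<in>away e. u analytic_on {of_nat n * y} \<and> norm (u (of_nat n * y) - w_lim y) \<le> C1 / real n)"
    using as e(1,2) unfolding asymptotics_at_def by blast
  have U: "rational_solution (int n) m (U n)" "U n 0 = 0"
    "\<And>y. y \<in> away e \<Longrightarrow> U n analytic_on {of_nat n * y}"
    "\<And>y. y \<in> away e \<Longrightarrow> norm (U n (of_nat n * y) - w_lim y) \<le> C1 / real n" if n: "n \<ge> N1" for n
  proof -
    obtain u where u: "rational_solution (int n) m u" "u 0 = 0"
      "\<forall>y\<in>away e. u analytic_on {of_nat n * y} \<and> norm (u (of_nat n * y) - w_lim y) \<le> C1 / real n" using IH[OF n] by blast
    have eq: "U n = u" unfolding U_def by (rule u_rat_eqI[OF u(1)])
    show "rational_solution (int n) m (U n)" "U n 0 = 0" using u by (simp_all add: eq)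
    show "U n analytic_on {of_nat n * y}" "norm (U n (of_nat n * y) - w_lim y) \<le> C1 / real n" if "y \<in> away e" for y
      using u(3) that by (simp_all add: eq)
  qed
  define f where "f n y = U n (of_nat n * y)" for n y
  have fan: "f n analytic_on {y}" if "n \<ge> N1" "y \<in> away e" for n y
    unfolding f_def[abs_def] by (rule analytic_scaled[OF U(3)[OF that]])
  have fapp: "approx_on (away e) f w_lim" unfolding approx_on_def
  proof (rule unif_bddI[of "N1 + 1" _ _ C1])
    fix n y assume n: "n \<ge> N1 + 1" and y: "y \<in> away e"
    have "norm (f n y - w_lim y) \<le> C1 / real n" unfolding f_def using U(4)[of n y] n y by simp
    then show "norm (of_nat n * (f n y - w_lim y)) \<le> C1" using n by (simp add: norm_mult pos_le_divide_eq mult.commute)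
  qed
  define S0 where "S0 = away e \<inter> {y. r / 2 \<le> norm y}"
  define S1 where "S1 = away (2 * e) \<inter> {y. r / 2 \<le> norm y}"
  define S2 where "S2 = away d1 \<inter> {y. r \<le> norm y}"
  have S: "S1 \<subseteq> S0" "S2 \<subseteq> S1" "S2 \<subseteq> S0" "S0 \<subseteq> away e" "S1 \<subseteq> away (2 * e)"
  proof -
    show "S1 \<subseteq> S0" "S2 \<subseteq> S1" unfolding S0_def S1_def S2_def using away_antimono[of e "2 * e"] away_antimono[of "2 * e" d1] e r by auto
    then show "S2 \<subseteq> S0" by blast
  qed (auto simp: S0_def S1_def)
  note wb = w_lim_bounds[OF r level e(1,2), folded S0_def]
  have wne: "w_lim y \<noteq> 0" "1 + (w_lim y)\<^sup>2 \<noteq> 0" if "y \<in> S0" for y using wb(4,5)[of y] that by (auto simp: S0_def)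
  have fapp0: "approx_on S0 f w_lim" using fapp S(4) unfolding approx_on_def by (rule unif_bdd_subset)
  have fb: "unif_bdd (away e) f" by (rule approx_on_bdd[OF fapp wb(1)])
  have wb0: "unif_bdd S0 (\<lambda>n. w_lim)" by (rule unif_bdd_subset[OF wb(1) S(4)])
  have finv: "unif_bdd S0 (\<lambda>n y. 1 / f n y)" by (rule approx_on_inverse_bdd[OF fapp0 wb(2) wne(1)])
  obtain c2 N2 where c2: "c2 > 0" "N2 > 0" "\<And>n y. n \<ge> N2 \<Longrightarrow> y \<in> S0 \<Longrightarrow> c2 \<le> norm (f n y)"
    using approx_on_eventually_ne[OF fapp0 wb(2) wne(1)] by metis
  have fne: "f n y \<noteq> 0" if "n \<ge> N2" "y \<in> S0" for n y using c2(1) c2(3)[OF that] by auto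
  define k where "k = min (e / 5) (r / 4)"
  have k: "0 < k" "k \<le> e / 5" "k \<le> (2 * e) / 5" "k \<le> r / 4" "k \<le> 1" using e r by (auto simp: k_def)
  have rad: "k * (1 + norm y) > 0" for y :: complex using k by (simp add: add_pos_nonneg)
  have "unif_bdd (away (2 * e)) (\<lambda>n y. y * deriv (f n) y)"
  proof -
    obtain M N where M: "M > 0" "N > 0" "\<And>n y. n \<ge> N \<Longrightarrow> y \<in> away e \<Longrightarrow> norm (f n y) \<le> M" using unif_bddE[OF fb] by metis
    show ?thesis
    proof (rule unif_bddI[of "max N N1" _ _ "M / k"])
      fix n y assume n: "n \<ge> max N N1" and y: "y \<in> away (2 * e)"
      have z: "z \<in> away e" if "norm (z - y) \<le> k * (1 + norm y)" for z by (rule away_ball[OF e(1,2) k(1,2) y that])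
      have "norm (deriv (f n) y) \<le> M / (k * (1 + norm y))"
        by (rule deriv_bound_cball[OF rad]) (use fan M(3) z n in auto)
      then have "norm (y * deriv (f n) y) \<le> norm y * (M / (k * (1 + norm y)))"
        unfolding norm_mult by (intro mult_left_mono) auto
      also have "\<dots> = M / k * (norm y / (1 + norm y))" by simp
      also have "\<dots> \<le> M / k * 1" using M k by (intro mult_left_mono) (auto simp: divide_le_eq_1 add_pos_nonneg)
      finally show "norm (y * deriv (f n) y) \<le> M / k" by simp
    qed
  qed
  then have B1: "unif_bdd S1 (\<lambda>n y. y * deriv (f n) y)" using S(5) by (rule unif_bdd_subset)
  define Y where "Y n y = backlund_Y (of_nat n) m (U n) (of_nat n * y)" for n y
  have Yform: "Y n y = (y * deriv (f n) y / f n y + 2 * of_nat n * y * (f n y - 1 / f n y) + 2 * of_nat n) / (2 * m + 1)"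
    if "n \<ge> N1" "y \<in> away e" for n y
    unfolding Y_def backlund_Y_scaled[OF U(3)[OF that]] by (simp add: f_def[abs_def])
  define \<omega> where "\<omega> y = complex_of_real (1 / (1 + norm y))" for y :: complex
  have YB: "unif_bdd S1 (\<lambda>n y. Y n y * \<omega> y)"
  proof -
    have "unif_bdd S1 (\<lambda>n y. (1 / (2 * m + 1)) * ((y * deriv (f n) y) * (1 / f n y) * \<omega> y
       + 2 * (of_nat n * (f n y - w_lim y)) * ((y * \<omega> y) * (f n y + w_lim y) + \<omega> y) * (1 / f n y)))"
      unfolding \<omega>_def
      by (rule unif_bdd_mult[OF unif_bdd_const unif_bdd_add[OF unif_bdd_mult[OF unif_bdd_mult[OF B1 unif_bdd_subset[OF finv S(1)]] unif_bdd_weight(1)]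
        unif_bdd_mult[OF unif_bdd_mult[OF unif_bdd_mult[OF unif_bdd_const unif_bdd_subset[OF fapp0[unfolded approx_on_def] S(1)]]
          unif_bdd_add[OF unif_bdd_mult[OF unif_bdd_weight(2) unif_bdd_add[OF unif_bdd_subset[OF approx_on_bdd[OF fapp0 wb0] S(1)] unif_bdd_subset[OF wb0 S(1)]]] unif_bdd_weight(1)]]
          unif_bdd_subset[OF finv S(1)]]]])
    then show ?thesis
    proof (rule unif_bdd_cong[of _ _ "max N1 N2"])
      fix n y assume n: "n \<ge> max N1 N2" and y: "y \<in> S1"
      have y0: "y \<in> S0" "y \<in> away e" using y S by auto
      have fn: "f n y \<noteq> 0" by (rule fne) (use n y0 in auto)
      have q: "y * (w_lim y)\<^sup>2 + w_lim y - y = 0" using w_lim_quadratic[OF away_not_eyebrow[OF e(1) y0(2)]] by simp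
      define p where "p = f n y" define w where "w = w_lim y"
      have "2 * N * y * (p - 1 / p) + 2 * N = 2 * (N * (p - w)) * (y * (p + w) + 1) * (1 / p)" for N
      proof -
        have "2 * N * y * (p - i) + 2 * N = 2 * (N * (p - w)) * (y * (p + w) + 1) * i"
          if "p * i = 1" "y * w\<^sup>2 + w - y = 0" for i using that by algebra
        from this[of "1 / p"] show ?thesis using fn q by (simp add: p_def w_def)
      qed
      note E = this
      have "Y n y = (y * deriv (f n) y / p + (2 * of_nat n * y * (p - 1 / p) + 2 * of_nat n)) / (2 * m + 1)"
        unfolding p_def using Yform[of n y] n y0 by (simp add: add.assoc)
      also have "\<dots> = (1 / (2 * m + 1)) * (y * deriv (f n) y * (1 / p) + 2 * (of_nat n * (p - w)) * (y * (p + w) + 1) * (1 / p))"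
        unfolding E by simp
      finally show "Y n y * \<omega> y = (1 / (2 * m + 1)) * ((y * deriv (f n) y) * (1 / f n y) * \<omega> y
       + 2 * (of_nat n * (f n y - w_lim y)) * ((y * \<omega> y) * (f n y + w_lim y) + \<omega> y) * (1 / f n y))"
        unfolding p_def[symmetric] w_def[symmetric] by (simp only:) (simp only: algebra_simps mult_1_right mult_1_left)
    qed
  qed
  have ynz: "y \<noteq> 0" if "y \<in> S0" for y using that r by (auto simp: S0_def)
  have Yan: "Y n analytic_on {y}" and dY: "(Y n has_field_derivative of_nat n * (2 * (f n y + 1 / f n y) * Y n y + 2 * (f n y - 1 / f n y))) (at y)"
    if n: "n \<ge> max N1 N2" and y: "y \<in> S0" for n y
  proof -
    have n0: "n > 0" using n c2 by simp
    have yO: "y \<in> away e" using y S by auto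
    have an: "U n analytic_on {of_nat n * y}" using U(3)[of n y] n yO by simp
    have nz: "U n (of_nat n * y) \<noteq> 0" using fne[of n y] n y by (simp add: f_def)
    have "backlund_Y (of_nat n) m (U n) analytic_on {of_nat n * y}"
      unfolding backlund_Y_def[abs_def] by (intro analytic_intros an analytic_deriv) (use nz a in auto)
    then show "Y n analytic_on {y}" unfolding Y_def[abs_def] by (rule analytic_scaled)
    show "(Y n has_field_derivative of_nat n * (2 * (f n y + 1 / f n y) * Y n y + 2 * (f n y - 1 / f n y))) (at y)"
      unfolding Y_def[abs_def] f_def
      by (rule DERIV_backlund_Y_scaled[OF U(1) an _ nz a]) (use n n0 ynz[OF y] in auto)
  qed
  have dYB: "unif_bdd S2 (\<lambda>n y. deriv (Y n) y)"
  proof -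
    obtain M N where M: "M > 0" "N > 0" "\<And>n y. n \<ge> N \<Longrightarrow> y \<in> S1 \<Longrightarrow> norm (Y n y * \<omega> y) \<le> M" using unif_bddE[OF YB] by metis
    show ?thesis
    proof (rule unif_bddI[of "N + max N1 N2" _ _ "2 * M / k"])
      fix n y assume n: "n \<ge> N + max N1 N2" and y: "y \<in> S2"
      have y2: "y \<in> away (2 * (2 * e))" "r \<le> norm y" using y e by (auto simp: S2_def)
      have z1: "z \<in> S1" if z: "norm (z - y) \<le> k * (1 + norm y)" for z
      proof -
        have "z \<in> away (2 * e)" by (rule away_ball[OF _ e(3) k(1) k(3) y2(1) z]) (use e in simp)
        moreover have "norm y - k * (1 + norm y) \<le> norm z" using z norm_triangle_ineq2[of y z] by (simp add: norm_minus_commute)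
        moreover have "k * (1 + norm y) \<le> norm y / 2"
        proof -
          have "k * (1 + norm y) \<le> r / 4 * (1 + norm y)" using k by (intro mult_right_mono) auto
          also have "\<dots> = r / 4 + (r / 4) * norm y" by (simp add: algebra_simps)
          also have "(r / 4) * norm y \<le> (1/4) * norm y" using r by (intro mult_right_mono) auto
          finally show ?thesis using y2(2) by simp
        qed
        ultimately show ?thesis using y2(2) by (simp add: S1_def)
      qed
      have "norm (deriv (Y n) y) \<le> (2 * M * (1 + norm y)) / (k * (1 + norm y))"
      proof (rule deriv_bound_cball[OF rad])
        fix z assume z: "norm (z - y) \<le> k * (1 + norm y)"
        show "Y n analytic_on {z}" by (rule Yan) (use n z1[OF z] S in auto)
        have "norm (Y n z) * (1 / (1 + norm z)) \<le> M"
          using M(3)[of n z] z1[OF z] n by (simp add: norm_mult \<omega>_def add_nonneg_nonneg flip: of_real_divide)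
        moreover have p: "1 + norm z > 0" by (simp add: add_pos_nonneg)
        ultimately have "norm (Y n z) \<le> M * (1 + norm z)" by (simp add: field_simps)
        also have "1 + norm z \<le> 2 * (1 + norm y)"
        proof -
          have "norm z \<le> norm y + k * (1 + norm y)" using z norm_triangle_ineq2[of z y] by simp
          moreover have "k * (1 + norm y) \<le> 1 * (1 + norm y)" using k by (intro mult_right_mono) auto
          ultimately show ?thesis by simp
        qed
        finally show "norm (Y n z) \<le> 2 * M * (1 + norm y)" using M(1) by (simp add: algebra_simps)
      qed
      also have "\<dots> = 2 * M / k"
      proof -
        have "1 + norm y \<noteq> 0" by (smt (verit) norm_ge_zero)
        then show ?thesis by simp
      qed
      finally show "norm (deriv (Y n) y) \<le> 2 * M / k" .
    qed
  qed
  note wS2 = unif_bdd_subset[OF wb0 S(3)]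
  have f2: "approx_on S2 f w_lim" using fapp0 S(3) unfolding approx_on_def by (rule unif_bdd_subset)
  have fsq: "approx_on S2 (\<lambda>n y. (f n y)\<^sup>2) (\<lambda>y. (w_lim y)\<^sup>2)"
    unfolding power2_eq_square by (rule approx_on_mult[OF f2 f2 wS2 wS2])
  have den: "approx_on S2 (\<lambda>n y. 1 + (f n y)\<^sup>2) (\<lambda>y. 1 + (w_lim y)\<^sup>2)" by (rule approx_on_add[OF approx_on_const fsq])
  have num: "approx_on S2 (\<lambda>n y. 1 - (f n y)\<^sup>2) (\<lambda>y. 1 - (w_lim y)\<^sup>2)" by (rule approx_on_diff[OF approx_on_const fsq])
  have w2b: "unif_bdd S2 (\<lambda>n y. (w_lim y)\<^sup>2)" unfolding power2_eq_square by (rule unif_bdd_mult[OF wS2 wS2])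
  have dinv: "unif_bdd S2 (\<lambda>n y. 1 / (1 + (w_lim y)\<^sup>2))" by (rule unif_bdd_subset[OF wb(3) S(3)])
  have wne2: "1 + (w_lim y)\<^sup>2 \<noteq> 0" "w_lim y \<noteq> 0" if "y \<in> S2" for y using wne[of y] that S(3) by auto
  define Y0 where "Y0 y = (1 - (w_lim y)\<^sup>2) / (1 + (w_lim y)\<^sup>2)" for y
  have q1: "approx_on S2 (\<lambda>n y. (1 - (f n y)\<^sup>2) / (1 + (f n y)\<^sup>2)) Y0"
    unfolding Y0_def[abs_def] by (rule approx_on_divide[OF num den unif_bdd_diff[OF unif_bdd_const w2b] dinv wne2(1)])
  have q2: "unif_bdd S2 (\<lambda>n y. of_nat n * (Y n y - (1 - (f n y)\<^sup>2) / (1 + (f n y)\<^sup>2)))"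
  proof -
    obtain c3 N3 where c3: "c3 > 0" "\<And>n y. n \<ge> N3 \<Longrightarrow> y \<in> S2 \<Longrightarrow> c3 \<le> norm (1 + (f n y)\<^sup>2)"
      using approx_on_eventually_ne[OF den dinv wne2(1)] by metis
    have "unif_bdd S2 (\<lambda>n y. (1/2) * deriv (Y n) y * f n y * (1 / (1 + (f n y)\<^sup>2)))"
      by (rule unif_bdd_mult[OF unif_bdd_mult[OF unif_bdd_mult[OF unif_bdd_const dYB] approx_on_bdd[OF f2 wS2]] approx_on_inverse_bdd[OF den dinv wne2(1)]])
    then show ?thesis
    proof (rule unif_bdd_cong[of _ _ "max N3 (max N1 N2)"])
      fix n y assume n: "n \<ge> max N3 (max N1 N2)" and y: "y \<in> S2"
      define p where "p = f n y"
      have p: "p \<noteq> 0" "1 + p\<^sup>2 \<noteq> 0" using fne[of n y] c3(1) c3(2)[of n y] n y S by (auto simp: p_def)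
      have D: "deriv (Y n) y = of_nat n * (2 * (p + 1 / p) * Y n y + 2 * (p - 1 / p))"
        unfolding p_def by (rule DERIV_imp_deriv[OF dY]) (use n y S in auto)
      have gen: "N * (s - (1 - p\<^sup>2) * j) = (1/2) * (N * (2 * (p + i) * s + 2 * (p - i))) * p * j"
        if "p * i = 1" "(1 + p\<^sup>2) * j = 1" for N s i j
      proof -
        have "2 * (N * (s - (1 - p\<^sup>2) * j)) = (N * (2 * (p + i) * s + 2 * (p - i))) * p * j"
          using that by algebra
        moreover have "a = (1/2) * b * p * j" if "2 * a = b * p * j" for a b :: complex
          using that[symmetric] by (simp add: mult.assoc)
        ultimately show ?thesis by blast
      qed
      show "of_nat n * (Y n y - (1 - (f n y)\<^sup>2) / (1 + (f n y)\<^sup>2)) = (1/2) * deriv (Y n) y * f n y * (1 / (1 + (f n y)\<^sup>2))"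
        unfolding D p_def[symmetric] using gen[of "1 / p" "1 / (1 + p\<^sup>2)" "of_nat n" "Y n y"] p by simp
    qed
  qed
  have Yapp: "approx_on S2 Y Y0"
    using unif_bdd_add[OF q2 q1[unfolded approx_on_def]] unfolding approx_on_def
    by (rule unif_bdd_cong) (simp add: algebra_simps)
  have Y0b: "unif_bdd S2 (\<lambda>n. Y0)"
    using unif_bdd_mult[OF unif_bdd_diff[OF unif_bdd_const[of S2 1] w2b] dinv] by (rule unif_bdd_cong) (simp add: Y0_def)
  have Y01: "1 + Y0 y = 2 / (1 + (w_lim y)\<^sup>2)" if "y \<in> S2" for y
    using wne2(1)[OF that] by (simp add: Y0_def field_simps)
  have app1: "approx_on S2 (\<lambda>n y. 1 + Y n y) (\<lambda>y. 1 + Y0 y)" by (rule approx_on_add[OF approx_on_const Yapp])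
  have app1inv: "unif_bdd S2 (\<lambda>n y. 1 / (1 + Y0 y))"
    using unif_bdd_mult[OF unif_bdd_const[of S2 "1/2"] unif_bdd_add[OF unif_bdd_const[of S2 1] w2b]]
    by (rule unif_bdd_cong) (simp add: Y01)
  have app1ne: "1 + Y0 y \<noteq> 0" if "y \<in> S2" for y using Y01[OF that] wne2(1)[OF that] by simp
  obtain c4 N4 where c4: "c4 > 0" "\<And>n y. n \<ge> N4 \<Longrightarrow> y \<in> S2 \<Longrightarrow> c4 \<le> norm (1 + Y n y)"
    using approx_on_eventually_ne[OF app1 app1inv app1ne] by metis
  define v where "v n y = backlund_v (of_nat n) m (U n) (of_nat n * y)" for n y
  have vY: "v n y = (1 - Y n y) / (f n y * (1 + Y n y))" for n y by (simp add: v_def backlund_v_def Y_def f_def)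
  have vapp: "approx_on S2 v w_lim"
  proof -
    have dd: "approx_on S2 (\<lambda>n y. f n y * (1 + Y n y)) (\<lambda>y. w_lim y * (1 + Y0 y))"
      by (rule approx_on_mult[OF f2 app1 wS2 unif_bdd_add[OF unif_bdd_const Y0b]])
    have nn: "approx_on S2 (\<lambda>n y. 1 - Y n y) (\<lambda>y. 1 - Y0 y)" by (rule approx_on_diff[OF approx_on_const Yapp])
    have "unif_bdd S2 (\<lambda>n y. 1 / (w_lim y * (1 + Y0 y)))"
      using unif_bdd_mult[OF unif_bdd_subset[OF wb(2) S(3)] app1inv]
      by (simp add: divide_inverse mult_ac)
    from approx_on_divide[OF nn dd unif_bdd_diff[OF unif_bdd_const Y0b] this]
    have "approx_on S2 (\<lambda>n y. (1 - Y n y) / (f n y * (1 + Y n y))) (\<lambda>y. (1 - Y0 y) / (w_lim y * (1 + Y0 y)))"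
      using wne2 app1ne by simp
    then show ?thesis unfolding approx_on_def
    proof (rule unif_bdd_cong)
      fix n y assume y: "y \<in> S2"
      have "(1 - Y0 y) / (w_lim y * (1 + Y0 y)) = w_lim y"
      proof -
        have "1 - Y0 y = 2 * (w_lim y)\<^sup>2 / (1 + (w_lim y)\<^sup>2)" using wne2(1)[OF y] by (simp add: Y0_def field_simps)
        then show ?thesis unfolding Y01[OF y] using wne2[OF y] by (simp add: power2_eq_square)
      qed
      then show "of_nat n * (v n y - w_lim y) = of_nat n * ((1 - Y n y) / (f n y * (1 + Y n y)) - (1 - Y0 y) / (w_lim y * (1 + Y0 y)))"
        by (simp add: vY)
    qed
  qed
  obtain C5 N5 where C5: "C5 > 0" "N5 > 0" "\<And>n y. n \<ge> N5 \<Longrightarrow> y \<in> S2 \<Longrightarrow> norm (of_nat n * (v n y - w_lim y)) \<le> C5"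
    using unif_bddE[OF vapp[unfolded approx_on_def]] by metis
  obtain C6 N6 where C6: "C6 > 0" "N6 > 0" "\<And>n y. n \<ge> N6 \<Longrightarrow> y \<in> S2 \<Longrightarrow> norm (of_nat n * (Y n y - Y0 y)) \<le> C6"
    using unif_bddE[OF Yapp[unfolded approx_on_def]] by metis
  (* The last three terms make the errors smaller than the thresholds 1/2 and r/3 of the disc
     argument and 1/4 of the limit at infinity. *)
  define N where "N = N1 + N2 + N4 + N5 + N6 + 2 + nat \<lceil>2 * C6\<rceil> + nat \<lceil>3 * C1 / r\<rceil> + nat \<lceil>4 * C5\<rceil>"
  have main: "\<exists>u. rational_solution (int n) (m + 1) u \<and> u 0 = 0 \<and>
     (\<forall>y\<in>away d1. u analytic_on {of_nat n * y} \<and> norm (u (of_nat n * y) - w_lim y) \<le> C5 / real n)" if n: "n \<ge> N" for n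
  proof -
    have nn: "n \<ge> N1" "n \<ge> N2" "n \<ge> N4" "n \<ge> N5" "n \<ge> N6" "n \<ge> 2" "n > 0" using n by (auto simp: N_def)
    have nr: "2 * C6 \<le> real n" "3 * C1 / r \<le> real n" "4 * C5 \<le> real n" using n unfolding N_def by linarith+
    have circ: "y \<in> S2" if "norm y = r" for y using Omr[OF d1(4), of y] that by (simp add: S2_def)
    have vest: "norm (v n y - w_lim y) \<le> C5 / real n" if "y \<in> S2" for y
      using C5(3)[OF nn(4) that] nn by (simp add: norm_mult pos_le_divide_eq mult.commute)
    obtain h T where h: "open T" "cball 0 r \<subseteq> T" "h holomorphic_on T" "h 0 = 0"
      "\<And>y. y \<in> T \<Longrightarrow> y \<noteq> 0 \<Longrightarrow> backlund_v (of_nat n) m (U n) (of_nat n * y) = h y"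
    proof (rule disc_extension[OF nn(6) r level U(1)[OF nn(1)] U(2)[OF nn(1)] a])
      fix y :: complex assume y: "norm y \<le> r"
      show "U n analytic_on {of_nat n * y}" by (rule U(3)[OF nn(1)]) (rule Omr[OF e(4) y])
    next
      fix y :: complex assume y: "norm y = r"
      have "w_lim y = w_in y" by (rule w_lim_inside[OF level]) (use y in simp)
      moreover have "norm (U n (of_nat n * y) - w_lim y) \<le> C1 / real n" by (rule U(4)[OF nn(1)]) (rule Omr[OF e(4)], use y in simp)
      moreover have "C1 / real n \<le> r / 3" using nr(2) r nn by (simp add: field_simps)
      ultimately show "norm (U n (of_nat n * y) - w_in y) \<le> r / 3" by (metis order_trans)
      have "norm (Y n y - Y0 y) \<le> C6 / real n" using C6(3)[OF nn(5) circ[OF y]] nn by (simp add: norm_mult pos_le_divide_eq mult.commute)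
      also have "\<dots> \<le> 1/2" using nr(1) nn by (simp add: field_simps)
      finally show "norm (backlund_Y (of_nat n) m (U n) (of_nat n * y) - (1 - (w_in y)\<^sup>2) / (1 + (w_in y)\<^sup>2)) \<le> 1/2"
        using \<open>w_lim y = w_in y\<close> by (simp add: Y_def Y0_def)
    next
      fix h T assume "open T" "cball 0 r \<subseteq> T" "h holomorphic_on T" "h 0 = 0"
        "\<And>y. y \<in> T \<Longrightarrow> y \<noteq> 0 \<Longrightarrow> backlund_v (of_nat n) m (U n) (of_nat n * y) = h y"
      then show thesis by (rule that)
    qed
    obtain u where u: "rational_function u" "finite {x. u x \<noteq> backlund_v (of_nat n) m (U n) x}"
      "finite {x. \<not> painleve_III (of_int (int n) + (m + 1)) ((m + 1) - of_int (int n) + 1) u x}"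
      using backlund[OF U(1)[OF nn(1)] a] by blast
    have inner: "u analytic_on {of_nat n * y} \<and> u (of_nat n * y) = h y" if y: "norm y \<le> r" for y
    proof -
      define x where "x = of_nat n * y"
      have xy: "x / of_nat n = y" using nn by (simp add: x_def)
      have yT: "y \<in> T" using h(2) y by auto
      define T' where "T' = (\<lambda>z. z / of_nat n) -` T"
      have oT': "open T'" unfolding T'_def by (rule open_vimage[OF h(1)]) (use nn in \<open>auto intro!: continuous_intros\<close>)
      have xT': "x \<in> T'" using yT xy by (simp add: T'_def)
      have "(\<lambda>z. h (z / of_nat n)) holomorphic_on T'"
      proof -
        have "(\<lambda>z. z / of_nat n) holomorphic_on T'" using nn by (intro holomorphic_intros) auto
        from holomorphic_on_compose_gen[OF this h(3)] show ?thesis by (auto simp: o_def T'_def)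
      qed
      then have an: "(\<lambda>z. h (z / of_nat n)) analytic_on {x}" unfolding analytic_at using oT' xT' by blast
      have "\<forall>\<^sub>F z in at x. u z = h (z / of_nat n)"
      proof -
        have "\<forall>\<^sub>F z in at x. z \<in> T'" using oT' xT' by (auto simp: eventually_at_topological)
        moreover have "\<forall>\<^sub>F z in at x. z \<notin> insert 0 {x. u x \<noteq> backlund_v (of_nat n) m (U n) x}"
          by (rule eventually_notin_finite) (use u(2) in simp)
        ultimately show ?thesis
        proof eventually_elim
          case (elim z)
          then have "z / of_nat n \<in> T" "z / of_nat n \<noteq> 0" using nn by (auto simp: T'_def)
          from h(5)[OF this] elim show ?case using nn by simp
        qed
      qed
      from rational_function_eq_at[OF u(1) an this] show ?thesis by (simp add: x_def[symmetric] xy)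
    qed
    have outer: "u analytic_on {of_nat n * y} \<and> u (of_nat n * y) = v n y" if y: "y \<in> S2" for y
    proof -
      have y0: "y \<in> S0" "y \<in> away e" using y S by auto
      have anU: "U n analytic_on {of_nat n * y}" by (rule U(3)[OF nn(1) y0(2)])
      have nz: "U n (of_nat n * y) \<noteq> 0" using fne[OF nn(2) y0(1)] by (simp add: f_def)
      have anY: "backlund_Y (of_nat n) m (U n) analytic_on {of_nat n * y}"
        unfolding backlund_Y_def[abs_def] by (intro analytic_intros anU analytic_deriv) (use nz a in auto)
      have Y1: "1 + backlund_Y (of_nat n) m (U n) (of_nat n * y) \<noteq> 0" using c4(1) c4(2)[OF nn(3) y] by (auto simp: Y_def)
      have "backlund_v (of_nat n) m (U n) analytic_on {of_nat n * y}"
        unfolding backlund_v_def[abs_def] by (intro analytic_intros anU anY) (use nz Y1 in auto)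
      moreover have "\<forall>\<^sub>F z in at (of_nat n * y). u z = backlund_v (of_nat n) m (U n) z"
        using eventually_notin_finite[OF u(2), of "of_nat n * y"] by simp
      ultimately show ?thesis using rational_function_eq_at[OF u(1)] by (simp add: v_def)
    qed
    have est: "u analytic_on {of_nat n * y} \<and> norm (u (of_nat n * y) - w_lim y) \<le> C5 / real n" if y: "y \<in> away d1" for y
    proof (cases "r \<le> norm y")
      case True
      then have "y \<in> S2" using y by (simp add: S2_def)
      then show ?thesis using outer[of y] vest[of y] by simp
    next
      case False
      then have yr: "norm y \<le> r" by simp
      have w: "w_lim z = w_in z" if "norm z \<le> r" for z by (rule w_lim_inside[OF level[OF that]])
      have "norm (h y - w_in y) \<le> C5 / real n"
      proof (rule max_modulus_cball[of "\<lambda>y. h y - w_in y" "T \<inter> {y. level y < 1}" r])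
        have "w_in holomorphic_on T \<inter> {y. level y < 1}" by (rule holomorphic_on_subset[OF holomorphic_w_in]) auto
        moreover have "h holomorphic_on T \<inter> {y. level y < 1}" by (rule holomorphic_on_subset[OF h(3)]) auto
        ultimately show "(\<lambda>y. h y - w_in y) holomorphic_on T \<inter> {y. level y < 1}" by (intro holomorphic_intros)
        show "cball 0 r \<subseteq> T \<inter> {y. level y < 1}" using h(2) level by auto
        fix z :: complex assume z: "norm z = r"
        have "z \<in> T" "z \<noteq> 0" using h(2) z r by auto
        from h(5)[OF this] have "h z = v n z" by (simp add: v_def)
        then show "norm (h z - w_in z) \<le> C5 / real n" using vest[OF circ[OF z]] w[of z] z by simp
      qed (use r yr in auto)
      then show ?thesis using inner[OF yr] w[OF yr] by simp
    qed
    have "rational_solution (int n) (m + 1) u"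
      by (rule rational_solution_from_estimate[OF u(1) u(3) nn(7) d1(2) nr(3)]) (use est in blast)
    moreover have "u 0 = 0" using inner[of 0] r h(4) by simp
    ultimately show ?thesis using est by blast
  qed
  have "away d \<subseteq> away d1" by (rule away_antimono[OF d1(3)])
  then show "\<exists>C N. \<forall>n\<ge>N. \<exists>u. rational_solution (int n) (m + 1) u \<and> u 0 = 0 \<and>
     (\<forall>y\<in>away d. u analytic_on {of_nat n * y} \<and> norm (u (of_nat n * y) - w_lim y) \<le> C / real n)"
  proof (intro exI[of _ C5] exI[of _ N] allI impI)
    fix n assume "n \<ge> N"
    from main[OF this] obtain u where u: "rational_solution (int n) (m + 1) u" "u 0 = 0"
      and est: "\<And>y. y \<in> away d1 \<Longrightarrow> u analytic_on {of_nat n * y} \<and> norm (u (of_nat n * y) - w_lim y) \<le> C5 / real n" by blast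
    show "\<exists>u. rational_solution (int n) (m + 1) u \<and> u 0 = 0 \<and>
       (\<forall>y\<in>away d. u analytic_on {of_nat n * y} \<and> norm (u (of_nat n * y) - w_lim y) \<le> C5 / real n)"
    proof (intro exI[of _ u] conjI ballI u)
      fix y assume "y \<in> away d"
      then have "y \<in> away d1" using \<open>away d \<subseteq> away d1\<close> by (rule rev_subsetD)
      from est[OF this] show "u analytic_on {of_nat n * y}" "norm (u (of_nat n * y) - w_lim y) \<le> C5 / real n" by simp_all
    qed
  qed
qed

lemma asymptotics_at_half_integer: "asymptotics_at (of_nat k + 1/2)"
proof (induction k)
  case 0 then show ?case using asymptotics_at_half by simp
next
  case (Suc k)
  have "2 * (of_nat k + 1/2 :: complex) + 1 = of_nat (2 * k + 2)" by simp
  also have "\<dots> \<noteq> 0" by (simp only: of_nat_eq_0_iff)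
  finally have "asymptotics_at ((of_nat k + 1/2) + 1)" using asymptotics_at_step[OF Suc] by blast
  then show ?case by (simp add: add_ac)
qed

section \<open>The reflection and the asymptotic theorem\<close>

lemma rational_solution_reflect:
  assumes u: "rational_solution n m u"
  shows "rational_solution n (- m) (\<lambda>x. 1 / u (- x))"
  unfolding rational_solution_def
proof (intro conjI allI impI)
  have r: "rational_function u" and t: "(u \<longlongrightarrow> 1) at_infinity"
    and P: "\<And>x. x \<noteq> 0 \<Longrightarrow> u x \<noteq> 0 \<Longrightarrow> painleve_III (of_int n + m) (m - of_int n + 1) u x"
    using u by (auto simp: rational_solution_def)
  obtain P' Q where PQ: "Q \<noteq> 0" "coprime P' Q" "u = (\<lambda>x. poly P' x / poly Q x)"
    using r by (auto simp: rational_function_def)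
  have P'0: "P' \<noteq> 0"
  proof
    assume "P' = 0"
    then have "((\<lambda>x::complex. 0::complex) \<longlongrightarrow> 1) at_infinity" using t by (simp add: PQ(3))
    then show False using tendsto_unique[OF trivial_limit_at_infinity _ tendsto_const] by fastforce
  qed
  have "coprime (pcompose Q [:0, - 1:]) (pcompose P' [:0, - 1:])"
  proof (rule coprimeI)
    fix D assume D: "D dvd pcompose Q [:0, - 1:]" "D dvd pcompose P' [:0, - 1:]"
    have inv: "pcompose (pcompose R [:0, - 1:]) [:0, - 1:] = R" for R :: "complex poly"
      by (simp add: pcompose_assoc[symmetric] pcompose_pCons)
    have "pcompose D [:0, - 1:] dvd Q" "pcompose D [:0, - 1:] dvd P'"
      using D by (metis dvd_def inv pcompose_mult)+
    then have "is_unit (pcompose D [:0, - 1:])" using PQ(2) by (meson coprime_def)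
    then obtain F where "1 = pcompose D [:0, - 1:] * F" by (auto elim: dvdE)
    then have "pcompose 1 [:0, - 1:] = pcompose (pcompose D [:0, - 1:] * F) [:0, - 1:]" by (rule arg_cong)
    then have "pcompose 1 [:0, - 1:] = D * pcompose F [:0, - 1:]" unfolding pcompose_mult inv .
    then show "is_unit D" by (metis dvd_triv_left pcompose_1)
  qed
  moreover have "pcompose P' [:0, - 1:] \<noteq> 0"
  proof
    assume "pcompose P' [:0, - 1:] = 0"
    then have "poly P' x = 0" for x using poly_pcompose[of P' "[:0, - 1:]" "- x"] by simp
    then show False using P'0 poly_all_0_iff_0 by blast
  qed
  ultimately show "rational_function (\<lambda>x. 1 / u (- x))"
    unfolding rational_function_def
    by (intro exI[of _ "pcompose Q [:0, - 1:]"] exI[of _ "pcompose P' [:0, - 1:]"]) (simp add: PQ(3) poly_pcompose)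
  show "((\<lambda>x. 1 / u (- x)) \<longlongrightarrow> 1) at_infinity"
  proof -
    have "filterlim uminus at_infinity (at_infinity :: complex filter)"
      using filterlim_norm_at_top by (simp add: filterlim_at_infinity_conv_norm_at_top)
    then have "((\<lambda>x. u (- x)) \<longlongrightarrow> 1) at_infinity" by (rule filterlim_compose[OF t])
    then have "((\<lambda>x. 1 / u (- x)) \<longlongrightarrow> 1 / 1) at_infinity" by (intro tendsto_divide tendsto_const) auto
    then show ?thesis by simp
  qed
  fix x assume x: "x \<noteq> 0 \<and> 1 / u (- x) \<noteq> 0"
  then have x0: "x \<noteq> 0" "u (- x) \<noteq> 0" by auto
  define S where "S = {z. u analytic_on {- z} \<and> u (- z) \<noteq> 0}"
  have an: "u analytic_on {z}" if "u z \<noteq> 0" for z using rational_function_analytic[OF r that] .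
  have oS: "open {z. u z \<noteq> 0}"
  proof -
    have "{z. u z \<noteq> 0} = {z. poly P' z \<noteq> 0} \<inter> {z. poly Q z \<noteq> 0}" by (auto simp: PQ(3))
    then show ?thesis using open_nonroots by auto
  qed
  define W where "W = uminus -` {z. u z \<noteq> 0}"
  have oW: "open W" unfolding W_def by (rule open_vimage[OF oS]) (intro continuous_intros)
  have xW: "x \<in> W" using x0 by (simp add: W_def)
  have d1: "((\<lambda>x. 1 / u (- x)) has_field_derivative deriv u (- z) / (u (- z))\<^sup>2) (at z)" if "z \<in> W" for z
  proof -
    have nz: "u (- z) \<noteq> 0" using that by (simp add: W_def)
    have "(u has_field_derivative deriv u (- z)) (at (- z))"
      using an[OF nz] analytic_on_imp_differentiable_at[of u "{- z}" "- z"] DERIV_deriv_iff_field_differentiable by blast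
    moreover have "((\<lambda>z::complex. - z) has_field_derivative - 1) (at z)" by (auto intro!: derivative_eq_intros)
    ultimately have "((\<lambda>z. u (- z)) has_field_derivative deriv u (- z) * - 1) (at z)" by (rule DERIV_chain2)
    from DERIV_divide[OF DERIV_const[of 1] this nz] show ?thesis by (simp add: power2_eq_square)
  qed
  define p where "p = u (- x)" define p1 where "p1 = deriv u (- x)" define p2 where "p2 = deriv (deriv u) (- x)"
  have nz: "p \<noteq> 0" using x0 by (simp add: p_def)
  have du: "((\<lambda>z. u (- z)) has_field_derivative - p1) (at x)"
  proof -
    have "(u has_field_derivative p1) (at (- x))" unfolding p1_def
      using an[OF x0(2)] analytic_on_imp_differentiable_at[of u "{- x}" "- x"] DERIV_deriv_iff_field_differentiable by blast
    moreover have "((\<lambda>z::complex. - z) has_field_derivative - 1) (at x)" by (auto intro!: derivative_eq_intros)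
    ultimately have "((\<lambda>z. u (- z)) has_field_derivative p1 * - 1) (at x)" by (rule DERIV_chain2)
    then show ?thesis by simp
  qed
  have ddu: "((\<lambda>z. deriv u (- z)) has_field_derivative - p2) (at x)"
  proof -
    have "(deriv u has_field_derivative p2) (at (- x))" unfolding p2_def
      using analytic_deriv[OF an[OF x0(2)]] analytic_on_imp_differentiable_at[of "deriv u" "{- x}" "- x"] DERIV_deriv_iff_field_differentiable by blast
    moreover have "((\<lambda>z::complex. - z) has_field_derivative - 1) (at x)" by (auto intro!: derivative_eq_intros)
    ultimately have "((\<lambda>z. deriv u (- z)) has_field_derivative p2 * - 1) (at x)" by (rule DERIV_chain2)
    then show ?thesis by simp
  qed
  have "((\<lambda>z. deriv u (- z) / (u (- z))\<^sup>2) has_field_derivative (- p2 * p\<^sup>2 - p1 * (2 * p * - p1)) / (p\<^sup>2 * p\<^sup>2)) (at x)"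
    by (rule derivative_eq_intros du ddu refl)+ (use nz in \<open>simp_all add: p_def p1_def\<close>)
  then have "(deriv (\<lambda>x. 1 / u (- x)) has_field_derivative (- p2 * p\<^sup>2 - p1 * (2 * p * - p1)) / (p\<^sup>2 * p\<^sup>2)) (at x)"
    by (rule has_field_derivative_transform_within_open[OF _ oW xW]) (use DERIV_imp_deriv[OF d1] in simp)
  then have D2: "deriv (deriv (\<lambda>x. 1 / u (- x))) x = (- p2 * p\<^sup>2 - p1 * (2 * p * - p1)) / (p\<^sup>2 * p\<^sup>2)" by (rule DERIV_imp_deriv)
  have D1: "deriv (\<lambda>x. 1 / u (- x)) x = p1 / p\<^sup>2" using DERIV_imp_deriv[OF d1[OF xW]] by (simp add: p1_def p_def)
  have "painleve_III (of_int n + m) (m - of_int n + 1) u (- x)" by (rule P) (use x0 in auto)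
  then have e: "p2 = p1\<^sup>2 / p - p1 / (- x) + (4 * (of_int n + m) * p\<^sup>2 + 4 * (1 - (m - of_int n + 1))) / (- x) + 4 * p ^ 3 - 4 / p"
    by (simp only: painleve_III_def p_def p1_def p2_def)
  have gen: "(- q * p\<^sup>2 - p1 * (2 * p * - p1)) * (i\<^sup>2 * i\<^sup>2) = (p1 * i\<^sup>2)\<^sup>2 * p - (p1 * i\<^sup>2) * s
      + (4 * (a - m) * i\<^sup>2 + 4 * (1 - (- m - a + 1))) * s + 4 * i ^ 3 - 4 * p"
    if "p * i = 1" "q = p1\<^sup>2 * i + p1 * s - (4 * (a + m) * p\<^sup>2 + 4 * (1 - (m - a + 1))) * s + 4 * p ^ 3 - 4 * i" for q i s a
    using that by algebra
  show "painleve_III (of_int n + - m) (- m - of_int n + 1) (\<lambda>x. 1 / u (- x)) x"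
    unfolding painleve_III_def D2 D1 p_def[symmetric]
    using gen[of "1 / p" p2 "1 / x" "of_int n"] nz e by (simp add: power_divide)
qed

theorem theorem4:
  fixes k :: nat and m :: complex and K :: "complex set"
  shows
    "(m = - (of_nat k + 1 / 2) \<and> K \<subseteq> - eyebrow_inf \<and> bounded_away K eyebrow_inf \<longrightarrow>
        (\<exists>C::real. \<exists>N::nat. \<forall>n\<ge>N. \<forall>y\<in>K.
           \<not> is_pole (\<lambda>x. 1 / u_rat (int n) m x) (of_nat n * y) \<and>
           norm (1 / u_rat (int n) m (of_nat n * y) - 1 / (\<i> * p_inf y)) \<le> C / real n)) \<and>
     (m = of_nat k + 1 / 2 \<and> K \<subseteq> - eyebrow_zero \<and> bounded_away K eyebrow_zero \<longrightarrow>
        (\<exists>C::real. \<exists>N::nat. \<forall>n\<ge>N. \<forall>y\<in>K.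
           \<not> is_pole (u_rat (int n) m) (of_nat n * y) \<and>
           norm (u_rat (int n) m (of_nat n * y) - \<i> * p_zero y) \<le> C / real n))"
proof -
  define M where "M = (of_nat k + 1 / 2 :: complex)"
  have key: "\<exists>C N. \<forall>n\<ge>N. \<exists>u. rational_solution (int n) M u \<and>
     (\<forall>y. (\<forall>z\<in>eyebrow_zero. d \<le> dist y z) \<longrightarrow> u analytic_on {of_nat n * y} \<and> norm (u (of_nat n * y) - w_lim y) \<le> C / real n)"
    if d: "d > 0" for d
  proof -
    define d' where "d' = min d (1/4)"
    have d': "0 < d'" "d' \<le> 1/4" "d' \<le> d" using d by (auto simp: d'_def)
    obtain C N where CN: "\<And>n. n \<ge> N \<Longrightarrow> \<exists>u. rational_solution (int n) M u \<and> u 0 = 0 \<and>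
     (\<forall>y\<in>away d'. u analytic_on {of_nat n * y} \<and> norm (u (of_nat n * y) - w_lim y) \<le> C / real n)"
      using asymptotics_at_half_integer[of k] d'(1,2) unfolding asymptotics_at_def M_def by blast
    have "y \<in> away d'" if "\<forall>z\<in>eyebrow_zero. d \<le> dist y z" for y using that d'(3) by (force simp: away_def)
    then show ?thesis using CN by (intro exI[of _ C] exI[of _ N]) blast
  qed
  have part2: "\<exists>C::real. \<exists>N::nat. \<forall>n\<ge>N. \<forall>y\<in>K.
           \<not> is_pole (u_rat (int n) m) (of_nat n * y) \<and>
           norm (u_rat (int n) m (of_nat n * y) - \<i> * p_zero y) \<le> C / real n"
    if m: "m = M" and K: "bounded_away K eyebrow_zero"
  proof -
    obtain d where d: "d > 0" "\<And>y z. y \<in> K \<Longrightarrow> z \<in> eyebrow_zero \<Longrightarrow> d \<le> dist y z" using K unfolding bounded_away_def by blast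
    obtain C N where CN: "\<And>n. n \<ge> N \<Longrightarrow> \<exists>u. rational_solution (int n) M u \<and>
     (\<forall>y. (\<forall>z\<in>eyebrow_zero. d \<le> dist y z) \<longrightarrow> u analytic_on {of_nat n * y} \<and> norm (u (of_nat n * y) - w_lim y) \<le> C / real n)"
      using key[OF d(1)] by blast
    show ?thesis
    proof (intro exI[of _ C] exI[of _ N] allI impI ballI)
      fix n y assume n: "n \<ge> N" and y: "y \<in> K"
      obtain u where u: "rational_solution (int n) M u"
        "\<And>y. (\<forall>z\<in>eyebrow_zero. d \<le> dist y z) \<Longrightarrow> u analytic_on {of_nat n * y} \<and> norm (u (of_nat n * y) - w_lim y) \<le> C / real n"
        using CN[OF n] by blast
      have "u analytic_on {of_nat n * y} \<and> norm (u (of_nat n * y) - w_lim y) \<le> C / real n" using u(2)[of y] d(2)[OF y] by blast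
      moreover have "u_rat (int n) m = u" unfolding m by (rule u_rat_eqI[OF u(1)])
      ultimately show "\<not> is_pole (u_rat (int n) m) (of_nat n * y) \<and>
           norm (u_rat (int n) m (of_nat n * y) - \<i> * p_zero y) \<le> C / real n"
        using analytic_not_pole[of u "of_nat n * y"] by (simp add: p_zero_eq)
    qed
  qed
  have part1: "\<exists>C::real. \<exists>N::nat. \<forall>n\<ge>N. \<forall>y\<in>K.
           \<not> is_pole (\<lambda>x. 1 / u_rat (int n) m x) (of_nat n * y) \<and>
           norm (1 / u_rat (int n) m (of_nat n * y) - 1 / (\<i> * p_inf y)) \<le> C / real n"
    if m: "m = - M" and K: "bounded_away K eyebrow_inf"
  proof -
    obtain d where d: "d > 0" "\<And>y z. y \<in> K \<Longrightarrow> z \<in> eyebrow_inf \<Longrightarrow> d \<le> dist y z" using K unfolding bounded_away_def by blast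
    obtain C N where CN: "\<And>n. n \<ge> N \<Longrightarrow> \<exists>u. rational_solution (int n) M u \<and>
     (\<forall>y. (\<forall>z\<in>eyebrow_zero. d \<le> dist y z) \<longrightarrow> u analytic_on {of_nat n * y} \<and> norm (u (of_nat n * y) - w_lim y) \<le> C / real n)"
      using key[OF d(1)] by blast
    show ?thesis
    proof (intro exI[of _ C] exI[of _ N] allI impI ballI)
      fix n y assume n: "n \<ge> N" and y: "y \<in> K"
      obtain u where u: "rational_solution (int n) M u"
        "\<And>y. (\<forall>z\<in>eyebrow_zero. d \<le> dist y z) \<Longrightarrow> u analytic_on {of_nat n * y} \<and> norm (u (of_nat n * y) - w_lim y) \<le> C / real n"
        using CN[OF n] by blast
      have "d \<le> dist (- y) z" if "z \<in> eyebrow_zero" for z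
      proof -
        have "- z \<in> eyebrow_inf" using that by (simp add: mem_eyebrow_inf)
        from d(2)[OF y this] show ?thesis using norm_minus_commute[of "- y" z] by (simp add: dist_norm add.commute)
      qed
      then have est: "u analytic_on {of_nat n * (- y)} \<and> norm (u (of_nat n * (- y)) - w_lim (- y)) \<le> C / real n" using u(2)[of "- y"] by blast
      have ueq: "u_rat (int n) m = (\<lambda>x. 1 / u (- x))" unfolding m by (rule u_rat_eqI[OF rational_solution_reflect[OF u(1)]])
      have "(\<lambda>x. u (- 1 * x)) analytic_on {of_nat n * y}" by (rule analytic_scaled) (use est in simp)
      then have "\<not> is_pole (\<lambda>x. 1 / u_rat (int n) m x) (of_nat n * y)"
        using analytic_not_pole by (simp add: ueq)
      moreover have "1 / (\<i> * p_inf y) = w_lim (- y)" by (simp add: p_inf_eq)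
      ultimately show "\<not> is_pole (\<lambda>x. 1 / u_rat (int n) m x) (of_nat n * y) \<and>
           norm (1 / u_rat (int n) m (of_nat n * y) - 1 / (\<i> * p_inf y)) \<le> C / real n"
        using est by (simp add: ueq)
    qed
  qed
  show ?thesis using part1 part2 unfolding M_def by blast
qed

end
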